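(* Let $\Gamma$ be a countable discrete group and $\Gamma\to\mathrm{Aut}(X)$ a nonelementary, essential and proper action on a finite dimensional CAT(0) cube complex $X$. Let $\mu$ be a generating probability measure on $\Gamma$ with finite entropy. If there is a base point $o\in X$ with $\sum_{\gamma\in\Gamma}\mu(\gamma)\log|\gamma|_o<\infty$, where $|\gamma|_o=d(\gamma o,o)$ (terms with $|\gamma|_o=0$ omitted), then there are probability measures $\lambda_-,\lambda_+$ on $\partial X$ such that $(\partial X,\lambda_-)$ and $(\partial X,\lambda_+)$ are the Furstenberg–Poisson boundaries of the $\check\mu$- and $\mu$-random walks on $\Gamma$ respectively, where $\check\mu(\gamma)=\mu(\gamma^{-1})$.
   Context: Conventions. $X$ is a finite-dimensional, second countable CAT(0) cube complex, identified with its vertex set and equipped with the combinatorial metric $d$. $\mathfrak H$ is the set of half-spaces (vertex sets of complementary components of hyperplanes), $h^*=X\setminus h$; $U_v=\{h:v\in h\}$; the Roller compactification $\overline X$ is the closure of $\{U_v:v\in X\}$ in $2^{\mathfrak H}$ and $\partial X=\overline X\setminus X$. The action is nonelementary if it has no finite orbit in $X$ nor in the visual boundary; a half-space $h$ is $\Gamma$-deep if for some (every) $x\in X$ the points of $\Gamma x\cap h$ are at unbounded distance from $h^*$; the action is essential if $h$ and $h^*$ are $\Gamma$-deep for all $h\in\mathfrak H$; it is proper if $\{\gamma:d(\gamma x,x)\le R\}$ is finite for all $x\in X$, $R\ge0$. $\mu$ generating means its support generates $\Gamma$ as a semigroup; finite entropy means $-\sum\mu(\gamma)\log\mu(\gamma)<\infty$.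 *)

theory Defs
  imports "HOL-Probability.Probability"
begin

text \<open>A CAT(0) cube complex is identified with its vertex set (the whole type 'x),
  with combinatorial metric given by the graph metric of its 1-skeleton, the
  adjacency relation E.  The 1-skeleta of CAT(0) cube complexes are exactly the
  median graphs (Chepoi, Roller), and the complex is the cube completion of it.\<close>

definition gdist :: "('x \<Rightarrow> 'x \<Rightarrow> bool) \<Rightarrow> 'x \<Rightarrow> 'x \<Rightarrow> nat" where
  "gdist E a b = (LEAST n. (E ^^ n) a b)"

definition ginterval :: "('x \<Rightarrow> 'x \<Rightarrow> bool) \<Rightarrow> 'x \<Rightarrow> 'x \<Rightarrow> 'x set" where
  "ginterval E a b = {m. gdist E a m + gdist E m b = gdist E a b}"

definition median_graph :: "('x \<Rightarrow> 'x \<Rightarrow> bool) \<Rightarrow> bool" where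
  "median_graph E \<longleftrightarrow> symp E \<and> irreflp E \<and> (\<forall>a b. \<exists>n. (E ^^ n) a b) \<and>
     (\<forall>a b c. \<exists>!m. m \<in> ginterval E a b \<inter> ginterval E b c \<inter> ginterval E a c)"

definition gconvex :: "('x \<Rightarrow> 'x \<Rightarrow> bool) \<Rightarrow> 'x set \<Rightarrow> bool" where
  "gconvex E A \<longleftrightarrow> (\<forall>a\<in>A. \<forall>b\<in>A. ginterval E a b \<subseteq> A)"

text \<open>Half-spaces: vertex sets of the complementary components of hyperplanes; in the
  1-skeleton these are exactly the nonempty proper convex sets with convex complement.\<close>
definition halfspaces :: "('x \<Rightarrow> 'x \<Rightarrow> bool) \<Rightarrow> 'x set set" where
  "halfspaces E = {h. h \<noteq> {} \<and> h \<noteq> UNIV \<and> gconvex E h \<and> gconvex E (- h)}"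

definition transverse :: "'x set \<Rightarrow> 'x set \<Rightarrow> bool" where
  "transverse h k \<longleftrightarrow> h \<inter> k \<noteq> {} \<and> h \<inter> - k \<noteq> {} \<and> - h \<inter> k \<noteq> {} \<and> - h \<inter> - k \<noteq> {}"

text \<open>A cube with corner v: a finite set S of pairwise transverse half-spaces not containing
  v, each separating v from a neighbour of v (the cube spanned at v by the dual hyperplanes).\<close>
definition cube :: "('x \<Rightarrow> 'x \<Rightarrow> bool) \<Rightarrow> 'x \<Rightarrow> 'x set set \<Rightarrow> bool" where
  "cube E v S \<longleftrightarrow> finite S \<and> S \<subseteq> halfspaces E \<and> (\<forall>k\<in>S. v \<notin> k \<and> (\<exists>w. E v w \<and> w \<in> k)) \<and>
     (\<forall>h\<in>S. \<forall>k\<in>S. h \<noteq> k \<longrightarrow> transverse h k)"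

definition finite_dim :: "('x \<Rightarrow> 'x \<Rightarrow> bool) \<Rightarrow> bool" where
  "finite_dim E \<longleftrightarrow> (\<exists>n. \<forall>v S. cube E v S \<longrightarrow> card S \<le> n)"

definition graph_aut :: "('x \<Rightarrow> 'x \<Rightarrow> bool) \<Rightarrow> ('x \<Rightarrow> 'x) \<Rightarrow> bool" where
  "graph_aut E f \<longleftrightarrow> bij f \<and> (\<forall>a b. E a b \<longleftrightarrow> E (f a) (f b))"

definition cc_action :: "('x \<Rightarrow> 'x \<Rightarrow> bool) \<Rightarrow> ('g::group_add \<Rightarrow> 'x \<Rightarrow> 'x) \<Rightarrow> bool" where
  "cc_action E act \<longleftrightarrow> (\<forall>g. graph_aut E (act g)) \<and> act 0 = id \<and> (\<forall>g h. act (g + h) = act g \<circ> act h)"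

definition proper_action :: "('x \<Rightarrow> 'x \<Rightarrow> bool) \<Rightarrow> ('g::group_add \<Rightarrow> 'x \<Rightarrow> 'x) \<Rightarrow> bool" where
  "proper_action E act \<longleftrightarrow> (\<forall>x (R::real). finite {g. real (gdist E (act g x) x) \<le> R})"

definition deep :: "('x \<Rightarrow> 'x \<Rightarrow> bool) \<Rightarrow> ('g::group_add \<Rightarrow> 'x \<Rightarrow> 'x) \<Rightarrow> 'x set \<Rightarrow> bool" where
  "deep E act h \<longleftrightarrow> (\<exists>x. \<forall>R::nat. \<exists>g. act g x \<in> h \<and> (\<forall>y\<in>- h. R < gdist E (act g x) y))"

definition essential :: "('x \<Rightarrow> 'x \<Rightarrow> bool) \<Rightarrow> ('g::group_add \<Rightarrow> 'x \<Rightarrow> 'x) \<Rightarrow> bool" where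
  "essential E act \<longleftrightarrow> (\<forall>h\<in>halfspaces E. deep E act h \<and> deep E act (- h))"

text \<open>A point of the realization is encoded by its coordinate function on half-spaces.\<close>
definition vtx :: "('x \<Rightarrow> 'x \<Rightarrow> bool) \<Rightarrow> 'x \<Rightarrow> 'x set \<Rightarrow> real" where
  "vtx E v = (\<lambda>h. if h \<in> halfspaces E \<and> v \<in> h then 1 else 0)"

definition cpt :: "('x \<Rightarrow> 'x \<Rightarrow> bool) \<Rightarrow> 'x \<Rightarrow> 'x set set \<Rightarrow> ('x set \<Rightarrow> real) \<Rightarrow> 'x set \<Rightarrow> real" where
  "cpt E v S t = (\<lambda>h. if h \<in> S then t h else if - h \<in> S then 1 - t (- h) else vtx E v h)"

definition unit_param :: "'x set set \<Rightarrow> ('x set \<Rightarrow> real) \<Rightarrow> bool" where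
  "unit_param S t \<longleftrightarrow> (\<forall>k\<in>S. 0 \<le> t k \<and> t k \<le> 1)"

definition realization :: "('x \<Rightarrow> 'x \<Rightarrow> bool) \<Rightarrow> ('x set \<Rightarrow> real) set" where
  "realization E = {cpt E v S t | v S t. cube E v S \<and> unit_param S t}"

definition cube_dist :: "'x set set \<Rightarrow> ('x set \<Rightarrow> real) \<Rightarrow> ('x set \<Rightarrow> real) \<Rightarrow> real" where
  "cube_dist S t t' = sqrt (\<Sum>k\<in>S. (t k - t' k)\<^sup>2)"

text \<open>The intrinsic length metric: infimum of lengths of strings of segments, each
  contained in a single Euclidean unit cube.\<close>
definition rdist :: "('x \<Rightarrow> 'x \<Rightarrow> bool) \<Rightarrow> ('x set \<Rightarrow> real) \<Rightarrow> ('x set \<Rightarrow> real) \<Rightarrow> real" where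
  "rdist E p q = Inf {(\<Sum>i<n. cube_dist (S i) (t i) (t' i)) | n v S t t'.
      (\<forall>i<n. cube E (v i) (S i) \<and> unit_param (S i) (t i) \<and> unit_param (S i) (t' i)) \<and>
      (\<forall>i. Suc i < n \<longrightarrow> cpt E (v i) (S i) (t' i) = cpt E (v (Suc i)) (S (Suc i)) (t (Suc i))) \<and>
      (n = 0 \<longrightarrow> p = q) \<and>
      (0 < n \<longrightarrow> cpt E (v 0) (S 0) (t 0) = p \<and> cpt E (v (n - 1)) (S (n - 1)) (t' (n - 1)) = q)}"

definition geodesic_ray :: "('x \<Rightarrow> 'x \<Rightarrow> bool) \<Rightarrow> (real \<Rightarrow> 'x set \<Rightarrow> real) \<Rightarrow> bool" where
  "geodesic_ray E r \<longleftrightarrow> (\<forall>t\<ge>0. r t \<in> realization E) \<and>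
     (\<forall>s\<ge>0. \<forall>t\<ge>0. rdist E (r s) (r t) = \<bar>s - t\<bar>)"

definition asymptotic :: "('x \<Rightarrow> 'x \<Rightarrow> bool) \<Rightarrow> (real \<Rightarrow> 'x set \<Rightarrow> real) \<Rightarrow> (real \<Rightarrow> 'x set \<Rightarrow> real) \<Rightarrow> bool" where
  "asymptotic E r r' \<longleftrightarrow> (\<exists>C. \<forall>t\<ge>0. rdist E (r t) (r' t) \<le> C)"

definition pact :: "('g::group_add \<Rightarrow> 'x \<Rightarrow> 'x) \<Rightarrow> 'g \<Rightarrow> ('x set \<Rightarrow> real) \<Rightarrow> 'x set \<Rightarrow> real" where
  "pact act g p = (\<lambda>h. p (act (- g) ` h))"

text \<open>Nonelementary: no finite orbit in X and no finite orbit in the visual boundary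
  (classes of geodesic rays up to asymptoticity).\<close>
definition nonelementary :: "('x \<Rightarrow> 'x \<Rightarrow> bool) \<Rightarrow> ('g::group_add \<Rightarrow> 'x \<Rightarrow> 'x) \<Rightarrow> bool" where
  "nonelementary E act \<longleftrightarrow> (\<forall>x. infinite (range (\<lambda>g. act g x))) \<and>
     \<not> (\<exists>r. geodesic_ray E r \<and> (\<exists>R. finite R \<and> (\<forall>r'\<in>R. geodesic_ray E r') \<and>
           (\<forall>g. \<exists>r'\<in>R. asymptotic E (\<lambda>t. pact act g (r t)) r')))"

definition roller_top :: "('x \<Rightarrow> 'x \<Rightarrow> bool) \<Rightarrow> ('x set \<Rightarrow> bool) topology" where
  "roller_top E = product_topology (\<lambda>_. discrete_topology UNIV) (halfspaces E)"

definition Uv :: "('x \<Rightarrow> 'x \<Rightarrow> bool) \<Rightarrow> 'x \<Rightarrow> 'x set \<Rightarrow> bool" where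
  "Uv E v = (\<lambda>h\<in>halfspaces E. v \<in> h)"

definition roller_boundary :: "('x \<Rightarrow> 'x \<Rightarrow> bool) \<Rightarrow> ('x set \<Rightarrow> bool) set" where
  "roller_boundary E = (roller_top E closure_of range (Uv E)) - range (Uv E)"

definition boundary_borel :: "('x \<Rightarrow> 'x \<Rightarrow> bool) \<Rightarrow> ('x set \<Rightarrow> bool) measure" where
  "boundary_borel E = sigma (roller_boundary E)
      {A. openin (subtopology (roller_top E) (roller_boundary E)) A}"

definition ract :: "('x \<Rightarrow> 'x \<Rightarrow> bool) \<Rightarrow> ('g::group_add \<Rightarrow> 'x \<Rightarrow> 'x) \<Rightarrow> 'g \<Rightarrow> ('x set \<Rightarrow> bool) \<Rightarrow> 'x set \<Rightarrow> bool" where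
  "ract E act g \<xi> = (\<lambda>h\<in>halfspaces E. \<xi> (act (- g) ` h))"

definition generating :: "'g::group_add pmf \<Rightarrow> bool" where
  "generating \<mu> \<longleftrightarrow> (\<forall>g. \<exists>xs. xs \<noteq> [] \<and> set xs \<subseteq> set_pmf \<mu> \<and> g = sum_list xs)"

definition finite_entropy :: "'g pmf \<Rightarrow> bool" where
  "finite_entropy \<mu> \<longleftrightarrow> (\<lambda>g. - pmf \<mu> g * ln (pmf \<mu> g)) summable_on UNIV"

definition reflect_pmf :: "'g::group_add pmf \<Rightarrow> 'g pmf" where
  "reflect_pmf \<mu> = map_pmf uminus \<mu>"

definition path_space :: "(nat \<Rightarrow> 'g) measure" where
  "path_space = PiM UNIV (\<lambda>_. count_space UNIV)"

definition rw_measure :: "'g::group_add pmf \<Rightarrow> (nat \<Rightarrow> 'g) measure" where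
  "rw_measure \<mu> = distr (PiM UNIV (\<lambda>_::nat. measure_pmf \<mu>)) path_space
      (\<lambda>\<omega> n. sum_list (map \<omega> [0..<n]))"

definition path_shift :: "(nat \<Rightarrow> 'g) \<Rightarrow> nat \<Rightarrow> 'g" where
  "path_shift Z = (\<lambda>n. Z (Suc n))"

text \<open>(B, lam) with the Gamma-action A is the Furstenberg--Poisson boundary of the
  mu-random walk: it is a Gamma-equivariant, shift-invariant measurable quotient
  of the path space whose sigma-algebra coincides mod 0 with the shift-invariant
  sigma-algebra of the path space.\<close>
definition poisson_boundary :: "'g::group_add pmf \<Rightarrow> ('g \<Rightarrow> 'b \<Rightarrow> 'b) \<Rightarrow> 'b measure \<Rightarrow> bool" where
  "poisson_boundary \<mu> A lam \<longleftrightarrow> prob_space lam \<and> (\<forall>g. A g \<in> lam \<rightarrow>\<^sub>M lam) \<and>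
     (\<exists>bnd \<in> path_space \<rightarrow>\<^sub>M lam.
        distr (rw_measure \<mu>) lam bnd = lam \<and>
        (AE Z in rw_measure \<mu>. bnd (path_shift Z) = bnd Z) \<and>
        (\<forall>g. AE Z in rw_measure \<mu>. bnd (\<lambda>n. g + Z n) = A g (bnd Z)) \<and>
        (\<forall>S\<in>sets path_space. path_shift -` S = S \<longrightarrow>
           (\<exists>B\<in>sets lam. emeasure (rw_measure \<mu>) ((S - bnd -` B) \<union> (bnd -` B - S)) = 0)))"

end

theory Submission
  imports Defs "HOL-Library.Ramsey" "HOL-Library.Diagonal_Subsequence"
begin

text \<open>
  If the translates of some half-space contained only boundedly many pairwise disjoint ones, a maximal end above a
  descending chain of them would have a finite orbit, and a geodesic ray along an axis of half-spaces
  converging to such an end would have a finite orbit in the visual boundary; so in a nonelementary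
  essential action every half-space has arbitrarily many pairwise disjoint translates.  A Cesaro limit
  of the hitting probabilities \<open>P (act (Z n) o \<in> h)\<close> is a stationary weight \<open>st\<close> on half-spaces.  Disjoint
  translates force \<open>st\<close> to be small on all but finitely many half-spaces missing the base point, so the bounded
  martingale \<open>st (act (- Z n) h)\<close> converges to \<open>0\<close> or \<open>1\<close>, and the half-spaces with limit \<open>1\<close> form the limit point of
  the walk in the Roller boundary.

  Two independent limit points of the forward and backward walks have only finitely many half-spaces
  missing the base point in common, which equivariantly selects a strip in the group.  Width considerations
  bound its growth polynomially, and by properness Kaimanovich's strip argument makes the conditional entropy
  of the walk given the limit point vanish.  A factor with zero conditional entropy is maximal:
  the densities of any larger factor agree with its own.
\<close>


section \<open>Median graphs\<close>

text \<open>Local finiteness is not assumed, so bounded sets need not be compact. The substitute is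
  finite dimension: by Helly's theorem pairwise transverse half-spaces span a cube, hence pairwise
  meeting, incomparable half-spaces missing a vertex number at most \<open>D\<close>, and Ramsey's
  theorem finds a disjoint or nested infinite subfamily in any infinite family missing a vertex. The
  half-spaces leading to the end of an axis form finitely many orbits under its translation;
  forgetting all other coordinates retracts the realization, without increasing lengths, onto a
  subcomplex whose bounded parts are finite, and there the ray is found. Convergence of the walk is
  read off along sparse times \<open>N j\<close> at which the second moments of \<open>st\<close>
  are nearly exhausted. The forward and backward walks live on two product spaces; stationarity
  under the two-sided shift is expressed by moving one increment from one space to the other. The
  entropy estimate is Gibbs' inequality with a competitor that is half spread over a ball of the
  strip and half the law of the walk.\<close>

locale median_cc =
  fixes E :: "'x \<Rightarrow> 'x \<Rightarrow> bool"
  assumes median: "median_graph E"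
begin

abbreviation d :: "'x \<Rightarrow> 'x \<Rightarrow> nat" where "d \<equiv> gdist E"
abbreviation I :: "'x \<Rightarrow> 'x \<Rightarrow> 'x set" where "I \<equiv> ginterval E"

lemma E_sym: "E a b \<Longrightarrow> E b a"
  using median unfolding median_graph_def symp_def by blast

lemma E_irrefl: "\<not> E a a"
  using median unfolding median_graph_def irreflp_def by blast

lemma connected: "\<exists>n. (E ^^ n) a b"
  using median unfolding median_graph_def by blast

lemma median_ex1: "\<exists>!m. m \<in> I a b \<inter> I b c \<inter> I a c"
  using median unfolding median_graph_def by blast

lemma d_walk: "(E ^^ d a b) a b"
  unfolding gdist_def using connected by (rule LeastI_ex)

lemma d_le: "(E ^^ n) a b \<Longrightarrow> d a b \<le> n"
  unfolding gdist_def by (rule Least_le)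

lemma d_eq_0 [simp]: "d a b = 0 \<longleftrightarrow> a = b"
proof
  assume "d a b = 0"
  then show "a = b" using d_walk[of a b] by simp
next
  assume "a = b"
  then have "(E ^^ 0) a b" by simp
  then show "d a b = 0" using d_le by fastforce
qed

lemma d_self [simp]: "d a a = 0" by simp

lemma walk_sym: "(E ^^ n) a b \<Longrightarrow> (E ^^ n) b a"
proof (induction n arbitrary: a b)
  case (Suc n)
  then obtain c where "(E ^^ n) a c" "E c b" by auto
  then have "E b c" "(E ^^ n) c a" using Suc.IH E_sym by auto
  then show ?case by (metis relpowp_Suc_I2)
qed auto

lemma d_sym: "d a b = d b a"
  by (meson d_le d_walk walk_sym le_antisym)

lemma d_tri: "d a c \<le> d a b + d b c"
proof -
  have "(E ^^ (d a b + d b c)) a c"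
    using d_walk[of a b] d_walk[of b c] by (auto simp: relpowp_add)
  then show ?thesis by (rule d_le)
qed

lemma d_1: "d a b = 1 \<longleftrightarrow> E a b"
proof
  assume "d a b = 1"
  then show "E a b" using d_walk[of a b] by (simp add: relcompp_apply eq_OO)
next
  assume "E a b"
  then have "(E ^^ 1) a b" by (simp add: eq_OO)
  then have "d a b \<le> 1" by (rule d_le)
  moreover have "d a b \<noteq> 0" using \<open>E a b\<close> E_irrefl by auto
  ultimately show "d a b = 1" by linarith
qed

lemma d_step:
  assumes "d a b = Suc n"
  obtains c where "E a c" "d c b = n"
proof -
  have "(E ^^ Suc n) a b" using d_walk[of a b] assms by simp
  then obtain c where c: "E a c" "(E ^^ n) c b" by (metis relpowp_Suc_E2)
  have "d c b \<le> n" using c d_le by blast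
  moreover have "Suc n \<le> d a c + d c b" using d_tri[where a = a and b = c and c = b] assms by simp
  moreover have "d a c = 1" using c d_1 by simp
  ultimately show ?thesis using that[of c] c by simp
qed

lemma I_iff: "x \<in> I a b \<longleftrightarrow> d a x + d x b = d a b"
  by (simp add: ginterval_def)

lemma I_ends [simp]: "a \<in> I a b" "b \<in> I a b"
  by (auto simp: I_iff)

lemma median_obtain:
  obtains m where "m \<in> I a b" "m \<in> I b c" "m \<in> I a c"
  using median_ex1[where a = a and b = b and c = c] by blast

lemma median_unique:
  assumes "m \<in> I a b" "m \<in> I b c" "m \<in> I a c" "n \<in> I a b" "n \<in> I b c" "n \<in> I a c"
  shows "m = n"
  using median_ex1[where a = a and b = b and c = c] assms by blast

lemma I_edge: "E u v \<Longrightarrow> x \<in> I u v \<Longrightarrow> x = u \<or> x = v"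
  using d_1[of u v] by (auto simp: I_iff) (metis add_is_1 d_eq_0)

text \<open>The median of \<open>u\<close>, \<open>v\<close>, \<open>x\<close> lies on the edge, so
  it is one of its ends, and \<open>x\<close> is one step farther from the other end.\<close>

lemma bipartite: "E u v \<Longrightarrow> d x v = Suc (d x u) \<or> d x u = Suc (d x v)"
proof -
  assume e: "E u v"
  then have 1: "d u v = 1" "d v u = 1" using d_1 E_sym by auto
  obtain m where m: "m \<in> I u v" "m \<in> I v x" "m \<in> I u x" by (rule median_obtain)
  from I_edge[OF e m(1)] show ?thesis
    using m 1 by (auto simp: I_iff d_sym)
qed

text \<open>The side of \<open>u\<close> for the hyperplane dual to the edge from \<open>u\<close>
  to \<open>v\<close>.\<close>

definition W :: "'x \<Rightarrow> 'x \<Rightarrow> 'x set" where "W u v = {x. d x u < d x v}"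

lemma W_iff: "E u v \<Longrightarrow> x \<in> W u v \<longleftrightarrow> d x v = Suc (d x u)"
  using bipartite[of u v x] by (auto simp: W_def)

lemma W_compl: "E u v \<Longrightarrow> - W u v = W v u"
  using bipartite[of u v] unfolding W_def by (auto simp: not_less) (metis less_Suc_eq_le nat_less_le)

text \<open>Two distinct neighbours of \<open>a\<close> have distance 2 because the graph is
  bipartite, so the median of \<open>p\<close>, \<open>q\<close>, \<open>y\<close> is adjacent to
  both and one step closer to \<open>y\<close>.\<close>

lemma quadrangle:
  assumes "E a p" "E a q" "p \<noteq> q" "d p y = k" "d q y = k" "d a y = Suc k"
  obtains z where "E p z" "E q z" "d z y < k" "Suc (d z y) = k"
proof -
  have npq: "\<not> E p q"
    using bipartite[of p q a] assms d_1[of a p] d_1[of a q] by auto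
  then have "d p q \<noteq> 1" "d p q \<noteq> 0" using d_1 assms by auto
  moreover have "d p q \<le> 2" using d_tri[where a=p and b=a and c=q] assms d_1[of a p] d_1[of a q] d_sym[of p a] by auto
  ultimately have dpq: "d p q = 2" by linarith
  obtain z where z: "z \<in> I p q" "z \<in> I q y" "z \<in> I p y" by (rule median_obtain)
  have *: "d p z + d z q = 2" "d q z + d z y = k" "d p z + d z y = k"
    using z dpq assms by (auto simp: I_iff)
  then have "d p z = d q z" by linarith
  then have "d p z = 1" "d q z = 1" using * d_sym[of z q] by auto
  then show ?thesis using that[of z] d_1 * by auto
qed

text \<open>A 4-cycle whose two diagonals were both level for \<open>y\<close> would be completed by a quadrangle
  to a copy of \<open>K\<^sub>2\<^sub>,\<^sub>3\<close>, which has two medians.\<close>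

lemma square_W:
  assumes "E p q" "E q r" "E r s" "E s p" "p \<noteq> r" "q \<noteq> s"
  shows "W p q \<subseteq> W s r"
proof
  fix y assume y: "y \<in> W p q"
  show "y \<in> W s r"
  proof (rule ccontr)
    assume "y \<notin> W s r"
    then have yr: "d y s = Suc (d y r)"
      using W_compl[of s r] W_iff[of r s] assms E_sym by blast
    have yq: "d y q = Suc (d y p)" using y W_iff assms by blast
    have eq: "d y p = d y r" using bipartite[OF assms(2), of y] bipartite[OF assms(4), of y] yr yq by arith
    obtain z where z: "E p z" "E r z" "Suc (d z y) = d p y"
      by (rule quadrangle[of q p r y "d p y"]) (use assms yq eq d_sym E_sym in auto)
    have nz: "z \<noteq> q" "z \<noteq> s" using z yq yr eq d_sym[of p y] d_sym[of q y] d_sym[of s y] by (metis Suc_n_not_le_n le_SucI le_refl)+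
    have two: "d u w = 2 \<and> v \<in> I u w" if "E u v" "E v w" "u \<noteq> w" for u v w
    proof -
      have 1: "d u v = 1" "d v w = 1" using that d_1 by auto
      have "d u w \<noteq> 0" using that by simp
      moreover have "\<not> E u w" using bipartite[of u w v] 1 d_sym by auto
      then have "d u w \<noteq> 1" using d_1 by auto
      moreover have "d u w \<le> 2" using d_tri[where a=u and b=v and c=w] 1 by simp
      ultimately have "d u w = 2" by linarith
      then show ?thesis using 1 by (simp add: I_iff)
    qed
    have es: "E q p" "E r q" "E s r" "E p s" "E z p" "E z r" using assms z E_sym by blast+
    have "p = r"
    proof (rule median_unique)
      show "p \<in> I q s" "r \<in> I q s" using two[of q p s] two[of q r s] assms es by blast+
      show "p \<in> I s z" "r \<in> I s z" using two[of s p z] two[of s r z] assms es z nz by blast+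
      show "p \<in> I q z" "r \<in> I q z" using two[of q p z] two[of q r z] assms es z nz by blast+
    qed
    then show False using assms by simp
  qed
qed

lemma square_W_eq:
  assumes "E p q" "E q r" "E r s" "E s p" "p \<noteq> r" "q \<noteq> s"
  shows "W p q = W s r"
proof
  show "W s r \<subseteq> W p q" by (rule square_W) (use assms E_sym in auto)
qed (rule square_W[OF assms])

text \<open>Induction on the distance from \<open>a\<close> to \<open>u\<close>: a first step
  \<open>a1\<close> towards \<open>u\<close> and a quadrangle relative to \<open>v\<close> give a
  square whose opposite edge \<open>a1 x1\<close> again crosses from \<open>W u v\<close> to
  \<open>W v u\<close>, and opposite edges of a square bound the same set by
  \<open>square_W_eq\<close>.\<close>

lemma parallel_W:
  assumes "E u v" "a \<in> W u v" "x \<in> W v u" "E a x"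
  shows "W a x = W u v"
  using assms(2-4)
proof (induction "d a u" arbitrary: a x)
  case 0
  then have "a = u" by simp
  moreover have "x = v"
    using 0 \<open>a = u\<close> W_iff[of v u x] assms E_sym d_1 by (metis One_nat_def Suc_inject d_eq_0 d_sym)
  ultimately show ?case by simp
next
  case (Suc k)
  have av: "d a v = Suc (Suc k)" using Suc W_iff assms by simp
  have xu: "d x u = Suc (d x v)" using Suc W_iff assms E_sym by blast
  have "d x v = Suc k"
    using bipartite[OF Suc(5), of u] bipartite[OF Suc(5), of v] Suc(2) av xu
      d_sym[of x u] d_sym[of x v] d_sym[of a u] d_sym[of a v] by arith
  obtain a1 where a1: "E a a1" "d a1 u = k" using d_step Suc(2) by metis
  have "d a1 v = Suc k"
    using bipartite[OF assms(1), of a1] bipartite[OF a1(1), of v] a1 av d_sym[of v a] d_sym[of v a1] by arith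
  then have a1W: "a1 \<in> W u v" using W_iff assms a1 by auto
  have ne: "a1 \<noteq> x" using a1 xu \<open>d x v = Suc k\<close> by auto
  obtain x1 where x1: "E a1 x1" "E x x1" "Suc (d x1 v) = Suc k"
    by (rule quadrangle[of a a1 x v "Suc k"]) (use a1 Suc ne \<open>d a1 v = Suc k\<close> \<open>d x v = Suc k\<close> av in auto)
  have "d x1 u = Suc k"
    using bipartite[OF assms(1), of x1] bipartite[OF x1(2), of u] x1 xu \<open>d x v = Suc k\<close> d_sym[of u x] d_sym[of u x1] by arith
  then have "x1 \<in> W v u" using W_iff[of v u x1] assms x1 E_sym by auto
  have "W a1 x1 = W u v" using Suc(1)[of a1 x1] a1 a1W x1 \<open>x1 \<in> W v u\<close> by blast
  moreover have "W a x = W a1 x1"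
  proof (rule square_W_eq)
    show "a \<noteq> x1" using W_compl[OF assms(1)] Suc(3) \<open>x1 \<in> W v u\<close> by blast
  qed (use Suc(5) a1(1) x1(1,2) ne E_sym in blast)+
  ultimately show ?case by simp
qed

lemma path_crossing:
  assumes "a \<in> A" "b \<notin> A"
  obtains u v where "E u v" "u \<in> A" "v \<notin> A" "u \<in> I a b" "v \<in> I a b" "d u b = Suc (d v b)"
  using assms
proof (induction "d a b" arbitrary: a thesis)
  case 0
  then show ?case by auto
next
  case (Suc n)
  obtain c where c: "E a c" "d c b = n" using d_step Suc(2) by metis
  have 1: "d a c = 1" using c d_1 by simp
  show ?case
  proof (cases "c \<in> A")
    case False
    show ?thesis
      by (rule Suc(3)[of a c]) (use c Suc False 1 in \<open>auto simp: I_iff\<close>)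
  next
    case True
    obtain u v where uv: "E u v" "u \<in> A" "v \<notin> A" "u \<in> I c b" "v \<in> I c b" "d u b = Suc (d v b)"
      using Suc(1)[of c] c True Suc by metis
    have sub: "x \<in> I a b" if "x \<in> I c b" for x
      using that c Suc(2) 1 d_tri[where a=a and b=c and c=x] d_tri[where a=a and b=x and c=b]
      by (auto simp: I_iff)
    show ?thesis by (rule Suc(3)[of u v]) (use uv sub in auto)
  qed
qed

text \<open>A geodesic from \<open>a\<close> to \<open>b\<close> that leaves \<open>W u v\<close>
  does so across an edge \<open>p q\<close> with \<open>W p q = W u v\<close>. This set contains
  \<open>b\<close>, so the step from \<open>p\<close> to \<open>q\<close> moves away from
  \<open>b\<close>, although \<open>p\<close> and \<open>q\<close> lie in this order on a geodesic
  to \<open>b\<close>.\<close>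

lemma W_convex:
  assumes "E u v"
  shows "gconvex E (W u v)"
  unfolding gconvex_def
proof (intro ballI subsetI, rule ccontr)
  fix a b x assume ab: "a \<in> W u v" "b \<in> W u v" "x \<in> I a b" "x \<notin> W u v"
  obtain p q where pq: "E p q" "p \<in> W u v" "q \<notin> W u v" "p \<in> I a x" "q \<in> I a x" "d p x = Suc (d q x)"
    by (rule path_crossing[of a "W u v" x]) (use ab in auto)
  have eq: "W p q = W u v" by (rule parallel_W) (use assms pq W_compl[of u v] in auto)
  have "b \<in> W p q" using ab eq by simp
  then have bq: "d b q = Suc (d b p)" using W_iff pq by blast
  have "d a p + d p x = d a x" "d a x + d x b = d a b" using pq ab by (auto simp: I_iff)
  moreover have "d p b \<le> d p q + d q b" "d q b \<le> d q x + d x b" "d a b \<le> d a p + d p b" using d_tri by auto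
  ultimately show False using pq(6) bq d_sym[of b] by auto
qed

section \<open>Half-spaces and separation\<close>

abbreviation H where "H \<equiv> halfspaces E"

lemma W_halfspace: "E u v \<Longrightarrow> W u v \<in> H"
proof -
  assume e: "E u v"
  have "u \<in> W u v" "v \<notin> W u v" using d_1[of u v] e by (auto simp: W_def)
  then show ?thesis
    unfolding halfspaces_def using W_convex[OF e] W_convex[OF E_sym[OF e]] W_compl[OF e] by auto
qed

lemma H_compl: "h \<in> H \<Longrightarrow> - h \<in> H"
  by (auto simp: halfspaces_def)

lemma H_convex: "h \<in> H \<Longrightarrow> gconvex E h"
  by (auto simp: halfspaces_def)

lemma H_ne: "h \<in> H \<Longrightarrow> h \<noteq> {}" "h \<in> H \<Longrightarrow> h \<noteq> UNIV" "h \<in> H \<Longrightarrow> - h \<noteq> {}"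
  by (auto simp: halfspaces_def)

lemma convexD: "gconvex E A \<Longrightarrow> a \<in> A \<Longrightarrow> b \<in> A \<Longrightarrow> x \<in> I a b \<Longrightarrow> x \<in> A"
  by (auto simp: gconvex_def)

lemma H_convexD: "h \<in> H \<Longrightarrow> a \<in> h \<Longrightarrow> b \<in> h \<Longrightarrow> x \<in> I a b \<Longrightarrow> x \<in> h"
  using H_convex convexD by blast

lemma H_cconvexD: "h \<in> H \<Longrightarrow> a \<notin> h \<Longrightarrow> b \<notin> h \<Longrightarrow> x \<in> I a b \<Longrightarrow> x \<notin> h"
  using H_convexD[of "- h" a b x] H_compl by auto

text \<open>A point of \<open>h\<close> nearer to \<open>v\<close> would put \<open>v\<close>
  between it and \<open>u\<close>, against convexity; likewise for the complement.\<close>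

lemma H_eq_W:
  assumes "h \<in> H" "E u v" "u \<in> h" "v \<notin> h"
  shows "h = W u v"
proof -
  have 1: "d u v = 1" "d v u = 1" using assms d_1 E_sym by auto
  have "x \<in> W u v" if "x \<in> h" for x
  proof (rule ccontr)
    assume "x \<notin> W u v"
    then have "d x u = Suc (d x v)" using W_compl W_iff assms E_sym by blast
    then have "v \<in> I x u" using 1 by (simp add: I_iff)
    then show False using H_convexD that assms by blast
  qed
  moreover have "x \<notin> W u v" if "x \<notin> h" for x
  proof
    assume "x \<in> W u v"
    then have "d x v = Suc (d x u)" using W_iff assms by blast
    then have "u \<in> I x v" using 1 by (simp add: I_iff)
    then show False using H_cconvexD that assms by blast
  qed
  ultimately show ?thesis by blast
qed

lemma H_edge:
  assumes "h \<in> H"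
  obtains u v where "E u v" "u \<in> h" "v \<notin> h" "h = W u v"
proof -
  obtain a b where "a \<in> h" "b \<notin> h" using H_ne[OF assms] by auto
  then obtain u v where "E u v" "u \<in> h" "v \<notin> h" using path_crossing by metis
  then show ?thesis using that H_eq_W assms by blast
qed

definition sep :: "'x \<Rightarrow> 'x \<Rightarrow> 'x set set" where "sep x y = {h \<in> H. x \<in> h \<and> y \<notin> h}"

text \<open>The first edge \<open>x z\<close> of a geodesic crosses only the hyperplane of
  \<open>W x z\<close>, and convexity of complements keeps a hyperplane from being crossed
  twice.\<close>

lemma sep_card: "finite (sep x y) \<and> card (sep x y) = d x y"
proof (induction "d x y" arbitrary: x)
  case 0
  then have "sep x y = {}" by (auto simp: sep_def)
  then show ?case using 0 by simp
next
  case (Suc n)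
  obtain z where z: "E x z" "d z y = n" using d_step Suc(2) by metis
  have 1: "d x z = 1" using z d_1 by simp
  have zI: "z \<in> I x y" using z 1 Suc by (simp add: I_iff)
  have yW: "y \<notin> W x z" using z Suc d_sym[of y] by (simp add: W_def)
  have "z \<notin> W x z" by (simp add: W_def)
  have "sep x y = insert (W x z) (sep z y)"
  proof (rule set_eqI)
    fix h
    have "h \<in> sep z y \<Longrightarrow> x \<in> h"
      using H_cconvexD[of h x y z] zI by (auto simp: sep_def)
    moreover have "h \<in> sep x y \<Longrightarrow> z \<notin> h \<Longrightarrow> h = W x z"
      using H_eq_W z by (auto simp: sep_def)
    moreover have "W x z \<in> sep x y"
      using W_halfspace[OF z(1)] yW 1 by (auto simp: sep_def W_def)
    ultimately show "h \<in> sep x y \<longleftrightarrow> h \<in> insert (W x z) (sep z y)" by (auto simp: sep_def)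
  qed
  moreover have "W x z \<notin> sep z y" using \<open>z \<notin> W x z\<close> by (auto simp: sep_def)
  moreover have "finite (sep z y)" "card (sep z y) = n" using Suc(1)[of z] z by auto
  ultimately show ?case using Suc(2) by simp
qed

lemma finite_sep: "finite (sep x y)" and card_sep: "card (sep x y) = d x y"
  using sep_card by auto

lemma H_separates:
  assumes "x \<noteq> y"
  obtains h where "h \<in> H" "x \<in> h" "y \<notin> h"
proof -
  have "sep x y \<noteq> {}" using assms card_sep[of x y] by auto
  then show ?thesis using that by (auto simp: sep_def)
qed

section \<open>Helly property, gates and cubes\<close>

lemma convex_Int: "gconvex E A \<Longrightarrow> gconvex E B \<Longrightarrow> gconvex E (A \<inter> B)"
  by (fastforce simp: gconvex_def)

lemma convex_Inter: "(\<And>A. A \<in> F \<Longrightarrow> gconvex E A) \<Longrightarrow> gconvex E (\<Inter> F)"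
  unfolding gconvex_def by blast

lemma helly3:
  assumes "gconvex E A" "gconvex E B" "gconvex E C" "A \<inter> B \<noteq> {}" "B \<inter> C \<noteq> {}" "A \<inter> C \<noteq> {}"
  shows "A \<inter> B \<inter> C \<noteq> {}"
proof -
  obtain p q r where pqr: "p \<in> A \<inter> B" "q \<in> B \<inter> C" "r \<in> A \<inter> C" using assms by blast
  obtain m where m: "m \<in> I p q" "m \<in> I q r" "m \<in> I p r" by (rule median_obtain)
  have "m \<in> A" "m \<in> B" "m \<in> C" using m pqr convexD[of _ p r m] convexD[of _ q r m] convexD[of _ p q m] assms by auto
  then show ?thesis by blast
qed

lemma helly:
  assumes "finite F" "\<And>A. A \<in> F \<Longrightarrow> gconvex E A" "\<And>A B. A \<in> F \<Longrightarrow> B \<in> F \<Longrightarrow> A \<inter> B \<noteq> {}"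
  shows "\<Inter> F \<noteq> {}"
proof -
  have "\<Inter> (f ` J) \<noteq> {}" if "finite J" "\<And>i. i \<in> J \<Longrightarrow> gconvex E (f i)" "\<And>i j. i \<in> J \<Longrightarrow> j \<in> J \<Longrightarrow> f i \<inter> f j \<noteq> {}"
    for J :: "'x set set" and f
    using that
  proof (induction J arbitrary: f rule: finite_induct)
    case (insert k J)
    show ?case
    proof (cases "J = {}")
      case True
      then show ?thesis using insert(5)[of k k] by simp
    next
      case False
      have "\<Inter> ((\<lambda>i. f i \<inter> f k) ` J) \<noteq> {}"
      proof (rule insert.IH)
        show "gconvex E (f i \<inter> f k)" if "i \<in> J" for i
          using that insert by (intro convex_Int) auto
        show "(f i \<inter> f k) \<inter> (f j \<inter> f k) \<noteq> {}" if "i \<in> J" "j \<in> J" for i j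
        proof -
          have "f i \<inter> f j \<inter> f k \<noteq> {}"
            using that insert by (intro helly3) auto
          then show ?thesis by blast
        qed
      qed
      then show ?thesis using False by auto
    qed
  qed auto
  from this[of F id] show ?thesis using assms by simp
qed

text \<open>A nearest point \<open>c\<close> works: the median of \<open>x\<close>,
  \<open>c\<close>, \<open>y\<close> lies in \<open>C\<close> by convexity and between
  \<open>x\<close> and \<open>c\<close>, so it equals \<open>c\<close>. The gate is the
  combinatorial nearest point projection.\<close>

lemma gate:
  assumes "gconvex E C" "C \<noteq> {}"
  obtains c where "c \<in> C" "\<And>y. y \<in> C \<Longrightarrow> c \<in> I x y"
proof -
  obtain c where c: "c \<in> C" "\<And>y. y \<in> C \<Longrightarrow> d x c \<le> d x y"
    using assms(2) ex_has_least_nat[of "\<lambda>y. y \<in> C" _ "d x"] by blast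
  have "c \<in> I x y" if y: "y \<in> C" for y
  proof -
    obtain m where m: "m \<in> I x c" "m \<in> I c y" "m \<in> I x y" by (rule median_obtain)
    have "m \<in> C" using convexD assms c y m by blast
    then have "d x c \<le> d x m" using c by blast
    moreover have "d x m + d m c = d x c" using m(1) by (simp add: I_iff del: d_eq_0)
    ultimately have "d m c = 0" by linarith
    then show ?thesis using m by simp
  qed
  then show ?thesis using that c by blast
qed

text \<open>The gate lies between \<open>x\<close> and each point of \<open>C\<close>, so a
  half-space entered on the way to the gate is never left again.\<close>

lemma gate_sep:
  assumes "c \<in> C" "\<And>y. y \<in> C \<Longrightarrow> c \<in> I x y" "h \<in> sep c x"
  shows "C \<subseteq> h"
proof
  fix y assume "y \<in> C"
  then have "c \<in> I x y" using assms by blast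
  then show "y \<in> h" using H_cconvexD[of h x y c] assms(3) by (auto simp: sep_def)
qed

text \<open>Otherwise \<open>- h\<close> meets every member of \<open>F\<close>, and Helly's theorem
  finds a point of the intersection outside \<open>h\<close>.\<close>

lemma Inter_subset_halfspace:
  assumes "finite F" "F \<subseteq> H" "\<And>a b. a \<in> F \<Longrightarrow> b \<in> F \<Longrightarrow> a \<inter> b \<noteq> {}" "h \<in> H" "\<Inter> F \<subseteq> h"
  shows "\<exists>k\<in>F. k \<subseteq> h"
proof (rule ccontr)
  assume n: "\<not> ?thesis"
  have "\<Inter> (insert (- h) F) \<noteq> {}"
  proof (rule helly)
    show "gconvex E A" if "A \<in> insert (- h) F" for A
      using that H_convex H_compl assms by blast
    have "- h \<inter> B \<noteq> {}" "B \<inter> - h \<noteq> {}" if "B \<in> F" for B using that n by blast+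
    then show "A \<inter> B \<noteq> {}" if "A \<in> insert (- h) F" "B \<in> insert (- h) F" for A B
      using that assms(3) H_ne(3)[OF assms(4)] by blast
  qed (use assms in auto)
  then show False using assms by auto
qed

lemma transverse_sym: "transverse h k \<longleftrightarrow> transverse k h"
  by (auto simp: transverse_def)

text \<open>The intersection of \<open>S\<close> and that of the complements are both nonempty by
  Helly's theorem. Projecting back and forth between them gives gates \<open>w\<close> and
  \<open>v\<close> separated by no half-space outside \<open>S\<close>, and \<open>v\<close> is then
  a corner of the cube.\<close>

lemma transverse_cube:
  assumes "finite S" "S \<subseteq> H" "\<And>h k. h \<in> S \<Longrightarrow> k \<in> S \<Longrightarrow> h \<noteq> k \<Longrightarrow> transverse h k"
  shows "\<exists>v. cube E v S"
proof -
  have trI: "h \<inter> k \<noteq> {} \<and> - h \<inter> - k \<noteq> {}" if "h \<in> S" "k \<in> S" for h k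
    using assms(3)[of h k] that H_ne[of h] assms(2) by (cases "h = k") (auto simp: transverse_def)
  have B: "\<Inter> S \<noteq> {}"
    by (rule helly) (use assms trI H_convex in auto)
  have C: "\<Inter> (uminus ` S) \<noteq> {}"
    by (rule helly) (use assms trI H_convex H_compl in auto)
  obtain v0 where v0: "v0 \<in> \<Inter> (uminus ` S)" using C by blast
  have cB: "gconvex E (\<Inter> S)" "gconvex E (\<Inter> (uminus ` S))"
    using assms(2) H_convex H_compl by (auto intro!: convex_Inter)
  obtain w where w: "w \<in> \<Inter> S" "\<And>y. y \<in> \<Inter> S \<Longrightarrow> w \<in> I v0 y" using gate[where x = v0, OF cB(1) B] by blast
  obtain v where v: "v \<in> \<Inter> (uminus ` S)" "\<And>y. y \<in> \<Inter> (uminus ` S) \<Longrightarrow> v \<in> I w y" using gate[where x = w, OF cB(2) C] by blast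
  have vS: "v \<notin> k" if "k \<in> S" for k using v(1) that by auto
  \<comment> \<open>Because \<open>v\<close> is a gate, \<open>h\<close> lies inside a member of
    \<open>S\<close>; because \<open>w\<close> is a gate, it contains one. Nested members of a
    transverse family coincide, so \<open>h\<close> is squeezed to a member of
    \<open>S\<close>.\<close>
  have sepS: "h \<in> S" if h: "h \<in> sep w v" for h
  proof -
    have hH: "h \<in> H" "w \<in> h" "v \<notin> h" using h by (auto simp: sep_def)
    have "- h \<in> sep v w" using hH H_compl by (auto simp: sep_def)
    then have "\<Inter> (uminus ` S) \<subseteq> - h" using gate_sep[OF v] by blast
    then have "\<exists>k\<in>uminus ` S. k \<subseteq> - h"
      using assms hH H_compl trI by (intro Inter_subset_halfspace) auto
    then obtain k where k: "k \<in> S" "h \<subseteq> k" by auto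
    have "v0 \<notin> h" using v0 k by auto
    then have "h \<in> sep w v0" using hH by (auto simp: sep_def)
    then have "\<Inter> S \<subseteq> h" using gate_sep[OF w] by blast
    then have "\<exists>k\<in>S. k \<subseteq> h"
      using assms hH trI by (intro Inter_subset_halfspace) auto
    then obtain k' where k': "k' \<in> S" "k' \<subseteq> h" by auto
    have "k = k'" using assms(3)[of k' k] k k' by (auto simp: transverse_def)
    then show ?thesis using k k' by auto
  qed
  have "\<exists>c. E v c \<and> c \<in> k" if k: "k \<in> S" for k
  proof -
    \<comment> \<open>The region on which only \<open>k\<close> is flipped; its gate from
      \<open>v\<close> turns out to be the neighbour of \<open>v\<close> across
      \<open>k\<close>.\<close>
    let ?F = "insert k (uminus ` (S - {k}))"
    have F: "finite ?F" "?F \<subseteq> H" using assms k H_compl by auto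
    have Fp: "a \<inter> b \<noteq> {}" if "a \<in> ?F" "b \<in> ?F" for a b
      using that trI k assms(3)[of k] assms(3)[of _ k] by (auto simp: transverse_def)
    have ne: "\<Inter> ?F \<noteq> {}" by (rule helly[OF F(1) _ Fp]) (use F H_convex in blast)+
    have cF: "gconvex E (\<Inter> ?F)" using F H_convex by (intro convex_Inter) blast
    obtain c where c: "c \<in> \<Inter> ?F" "\<And>y. y \<in> \<Inter> ?F \<Longrightarrow> c \<in> I v y" using gate[where x = v, OF cF ne] by blast
    have "sep c v \<subseteq> {k}"
    proof
      fix h assume h: "h \<in> sep c v"
      then have hH: "h \<in> H" "v \<notin> h" by (auto simp: sep_def)
      have "\<Inter> ?F \<subseteq> h" using gate_sep[OF c h] .
      then obtain a where a: "a \<in> ?F" "a \<subseteq> h" using Inter_subset_halfspace[OF F Fp hH(1)] by blast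
      have "a = k" using a hH vS by auto
      then have "k \<subseteq> h" using a by simp
      then have "h \<in> sep w v" using w k hH by (auto simp: sep_def)
      then have "h \<in> S" by (rule sepS)
      then show "h \<in> {k}" using assms(3)[of k h] k \<open>k \<subseteq> h\<close> by (auto simp: transverse_def)
    qed
    then have "card (sep c v) \<le> 1" by (metis card.empty card_insert_disjoint card_mono empty_iff finite.intros One_nat_def)
    then have "d v c \<le> 1" using card_sep[of c v] d_sym by simp
    moreover have "c \<in> k" using c by auto
    moreover then have "d v c \<noteq> 0" using vS k by auto
    ultimately have "E v c" using d_1[of v c] by linarith
    then show ?thesis using \<open>c \<in> k\<close> by blast
  qed
  then show ?thesis unfolding cube_def using assms vS by blast
qed

text \<open>An edge crossing the boundary of a half-space determines it, which makes the half-spaces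
  countable when the vertices are.\<close>

lemma H_inj_edges: "\<exists>f :: 'x set \<Rightarrow> 'x \<times> 'x. inj_on f H"
proof -
  have "\<forall>h\<in>H. \<exists>p. h = W (fst p) (snd p)" using H_edge by (metis fst_conv snd_conv)
  then obtain f where "\<forall>h\<in>H. h = W (fst (f h)) (snd (f h))" by metis
  then have "inj_on f H" by (metis inj_onI)
  then show ?thesis by blast
qed

end

lemma countable_halfspaces:
  fixes E :: "'x::countable \<Rightarrow> 'x \<Rightarrow> bool"
  assumes "median_graph E"
  shows "countable (halfspaces E)"
proof -
  interpret median_cc E by unfold_locales fact
  obtain f :: "'x set \<Rightarrow> 'x \<times> 'x" where "inj_on f H" using H_inj_edges by blast
  then show ?thesis by (metis countable_image_inj_on uncountable_def countableI_type countable_subset subset_UNIV)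
qed

section \<open>Half-spaces under a group action\<close>

locale cc_act = median_cc E for E :: "'x::countable \<Rightarrow> 'x \<Rightarrow> bool" +
  fixes act :: "'g::{group_add,countable} \<Rightarrow> 'x \<Rightarrow> 'x"
  assumes fdim: "finite_dim E" and action: "cc_action E act"
begin

abbreviation tr :: "'g \<Rightarrow> 'x set \<Rightarrow> 'x set" where "tr g h \<equiv> act g ` h"

lemma act_add: "act (g + h) x = act g (act h x)"
  using action by (simp add: cc_action_def)

lemma act_0 [simp]: "act 0 x = x"
  using action by (simp add: cc_action_def)

lemma act_minus [simp]: "act (- g) (act g x) = x" "act g (act (- g) x) = x"
  using act_add[of "- g" g x] act_add[of g "- g" x] by auto

lemma act_E: "E (act g a) (act g b) \<longleftrightarrow> E a b"
  using action by (auto simp: cc_action_def graph_aut_def)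

lemma act_eq [simp]: "act g a = act g b \<longleftrightarrow> a = b"
  by (metis act_minus(1))

lemma inj_act: "inj (act g)"
  by (rule injI) simp

lemma act_walk: "(E ^^ n) a b \<Longrightarrow> (E ^^ n) (act g a) (act g b)"
proof (induction n arbitrary: b)
  case (Suc n)
  then obtain c where c: "(E ^^ n) a c" "E c b" by auto
  then show ?case using Suc.IH[OF c(1)] act_E[of g c b] by auto
qed auto

lemma act_d [simp]: "d (act g a) (act g b) = d a b"
proof (rule antisym)
  show le: "d (act g a) (act g b) \<le> d a b" for g a b
    by (rule d_le, rule act_walk, rule d_walk)
  show "d a b \<le> d (act g a) (act g b)" using le[of "- g" "act g a" "act g b"] by simp
qed

lemma act_I: "act g x \<in> I (act g a) (act g b) \<longleftrightarrow> x \<in> I a b"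
  by (simp add: I_iff)

lemma tr_iff: "x \<in> tr g h \<longleftrightarrow> act (- g) x \<in> h"
  by (metis act_minus image_iff)

lemma act_tr_iff [simp]: "act g x \<in> tr g h \<longleftrightarrow> x \<in> h"
  by (simp add: tr_iff)

lemma tr_compl: "tr g (- h) = - tr g h"
  by (auto simp: tr_iff)

lemma tr_add: "tr g (tr k h) = tr (g + k) h"
  by (simp add: image_image act_add)

lemma tr_0 [simp]: "tr 0 h = h"
  by simp

lemma tr_minus [simp]: "tr (- g) (tr g h) = h" "tr g (tr (- g) h) = h"
  by (simp_all add: tr_add)

lemma tr_Int: "tr g (h \<inter> k) = tr g h \<inter> tr g k"
  by (simp add: image_Int inj_act)

lemma tr_subset [simp]: "tr g h \<subseteq> tr g k \<longleftrightarrow> h \<subseteq> k"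
  by (simp add: inj_image_subset_iff inj_act)

lemma tr_eq [simp]: "tr g h = tr g k \<longleftrightarrow> h = k"
  by (simp add: inj_image_eq_iff inj_act)

lemma tr_psubset [simp]: "tr g h \<subset> tr g k \<longleftrightarrow> h \<subset> k"
  unfolding psubset_eq by simp

lemma tr_empty_Int: "tr g h \<inter> tr g k = {} \<longleftrightarrow> h \<inter> k = {}"
  by (simp flip: tr_Int)

lemma tr_convex: "gconvex E h \<Longrightarrow> gconvex E (tr g h)"
proof -
  assume h: "gconvex E h"
  show ?thesis
    unfolding gconvex_def
  proof (intro ballI subsetI)
    fix a b x assume "a \<in> tr g h" "b \<in> tr g h" "x \<in> I a b"
    then have "act (- g) a \<in> h" "act (- g) b \<in> h" "act (- g) x \<in> I (act (- g) a) (act (- g) b)"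
      by (simp_all add: tr_iff act_I)
    then show "x \<in> tr g h" using convexD[OF h] tr_iff by blast
  qed
qed

lemma tr_H_I: "h \<in> H \<Longrightarrow> tr g h \<in> H"
proof -
  assume h: "h \<in> H"
  have "tr g h \<noteq> UNIV"
  proof
    assume "tr g h = UNIV"
    then have "x \<in> h" for x using act_tr_iff[of g x h] by blast
    then show False using H_ne[OF h] by blast
  qed
  moreover have "gconvex E (- tr g h)" using h tr_convex[of "- h" g] by (simp add: halfspaces_def tr_compl)
  ultimately show ?thesis using h tr_convex[of h g] by (auto simp: halfspaces_def)
qed

lemma tr_H [simp]: "tr g h \<in> H \<longleftrightarrow> h \<in> H"
  using tr_H_I[of h g] tr_H_I[of "tr g h" "- g"] by auto

lemma tr_inj: "inj (tr g)"
  by (rule injI) simp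

lemma countable_H: "countable H"
  using countable_halfspaces median by blast

definition D :: nat where "D = (SOME n. \<forall>v S. cube E v S \<longrightarrow> card S \<le> n)"

lemma cube_card: "cube E v S \<Longrightarrow> card S \<le> D"
proof -
  have "\<forall>v S. cube E v S \<longrightarrow> card S \<le> D"
    unfolding D_def by (rule someI_ex) (use fdim in \<open>simp add: finite_dim_def\<close>)
  then show "cube E v S \<Longrightarrow> card S \<le> D" by blast
qed

lemma transverse_card:
  assumes "S \<subseteq> H" "\<And>h k. h \<in> S \<Longrightarrow> k \<in> S \<Longrightarrow> h \<noteq> k \<Longrightarrow> transverse h k"
  shows "finite S \<and> card S \<le> D"
proof (rule ccontr)
  assume n: "\<not> ?thesis"
  obtain T where T: "T \<subseteq> S" "finite T" "card T = Suc D"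
  proof (cases "finite S")
    case True
    then show ?thesis using n that obtain_subset_with_card_n[of "Suc D" S] by (metis not_less_eq_eq)
  next
    case False
    then show ?thesis using that infinite_arbitrarily_large by blast
  qed
  then obtain v where "cube E v T" using transverse_cube[of T] assms by (meson subset_iff)
  then show False using cube_card T by fastforce
qed

text \<open>The halfspaces in a common ``side'' -- all missing \<open>x\<close>, any two of them meeting -- form a poset
  of width at most \<open>D\<close>.\<close>

definition sided :: "'x \<Rightarrow> 'x set set \<Rightarrow> bool" where
  "sided x U \<longleftrightarrow> U \<subseteq> H \<and> (\<forall>h\<in>U. x \<notin> h) \<and> (\<forall>h\<in>U. \<forall>k\<in>U. h \<inter> k \<noteq> {})"

lemma sided_mono: "sided x U \<Longrightarrow> V \<subseteq> U \<Longrightarrow> sided x V"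
  unfolding sided_def by blast

lemma sided_cases:
  assumes "sided x U" "h \<in> U" "k \<in> U"
  shows "h \<subseteq> k \<or> k \<subseteq> h \<or> transverse h k"
  using assms unfolding sided_def transverse_def by blast

lemma antichain_card:
  assumes "sided x U" "\<And>h k. h \<in> U \<Longrightarrow> k \<in> U \<Longrightarrow> h \<subseteq> k \<Longrightarrow> h = k"
  shows "finite U \<and> card U \<le> D"
proof (rule transverse_card)
  show "U \<subseteq> H" using assms by (simp add: sided_def)
  show "transverse h k" if "h \<in> U" "k \<in> U" "h \<noteq> k" for h k
    using sided_cases[OF assms(1) that(1,2)] assms(2) that by blast
qed

lemma finite_above:
  assumes "h \<in> H"
  shows "finite {k \<in> H. x \<notin> k \<and> h \<subseteq> k}"
proof -
  obtain y where "y \<in> h" using H_ne assms by blast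
  then have "{k \<in> H. x \<notin> k \<and> h \<subseteq> k} \<subseteq> sep y x" by (auto simp: sep_def)
  then show ?thesis using finite_sep finite_subset by blast
qed

definition maxels :: "'x set set \<Rightarrow> 'x set set" where
  "maxels U = {m \<in> U. \<forall>k\<in>U. m \<subseteq> k \<longrightarrow> k = m}"

lemma below_maxel:
  assumes "sided x U" "h \<in> U"
  obtains m where "m \<in> maxels U" "h \<subseteq> m"
proof -
  let ?A = "{k \<in> U. h \<subseteq> k}"
  have "?A \<subseteq> {k \<in> H. x \<notin> k \<and> h \<subseteq> k}" using assms by (auto simp: sided_def)
  then have "finite ?A" using finite_above[of h x] assms finite_subset by (auto simp: sided_def)
  moreover have "h \<in> ?A" using assms by simp
  ultimately obtain m where m: "m \<in> ?A" "\<And>k. k \<in> ?A \<Longrightarrow> m \<subseteq> k \<Longrightarrow> k = m"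
    using finite_has_maximal2[of ?A h] by metis
  then have "m \<in> maxels U" unfolding maxels_def by blast
  then show ?thesis using that m by blast
qed

lemma maxels_card:
  assumes "sided x U"
  shows "finite (maxels U) \<and> card (maxels U) \<le> D"
proof (rule antichain_card)
  show "sided x (maxels U)" by (rule sided_mono[OF assms]) (auto simp: maxels_def)
qed (auto simp: maxels_def)

definition desc :: "(nat \<Rightarrow> 'x set) \<Rightarrow> bool" where
  "desc c \<longleftrightarrow> (\<forall>n. c n \<in> H \<and> c (Suc n) \<subset> c n)"

lemma desc_H: "desc c \<Longrightarrow> c n \<in> H"
  by (simp add: desc_def)

lemma desc_less: "desc c \<Longrightarrow> m < n \<Longrightarrow> c n \<subset> c m"
proof (induction n)
  case (Suc n)
  then show ?case unfolding desc_def by (metis less_Suc_eq psubset_trans)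
qed simp

lemma desc_le: "desc c \<Longrightarrow> m \<le> n \<Longrightarrow> c n \<subseteq> c m"
  using desc_less[of c m n] by (cases "m = n") auto

lemma desc_inj: "desc c \<Longrightarrow> inj c"
  by (rule injI) (metis desc_less linorder_neqE_nat psubset_eq)

text \<open>If all \<open>c n\<close> contained \<open>x\<close>, infinitely many half-spaces would
  separate \<open>x\<close> from a vertex outside \<open>c 0\<close>.\<close>

lemma desc_escape:
  assumes "desc c"
  shows "\<exists>N. \<forall>n\<ge>N. x \<notin> c n"
proof -
  obtain y where y: "y \<notin> c 0" using H_ne(2)[OF desc_H[OF assms, of 0]] by auto
  have "\<exists>N. x \<notin> c N"
  proof (rule ccontr)
    assume "\<not> ?thesis"
    then have "range c \<subseteq> sep x y" using y desc_le[OF assms] desc_H[OF assms] by (auto simp: sep_def)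
    then show False using desc_inj[OF assms] finite_sep finite_subset range_inj_infinite by metis
  qed
  then show ?thesis using desc_le[OF assms] by blast
qed

lemma infinite_below:
  assumes "\<And>h. h \<in> U \<Longrightarrow> h \<in> H" "\<And>h. h \<in> U \<Longrightarrow> x \<notin> h" "infinite U" "\<And>h k. h \<in> U \<Longrightarrow> k \<in> U \<Longrightarrow> h \<subseteq> k \<or> k \<subseteq> h" "h \<in> U"
  shows "infinite {k \<in> U. k \<subset> h}"
proof
  assume f: "finite {k \<in> U. k \<subset> h}"
  have "U \<subseteq> {k \<in> U. k \<subset> h} \<union> {k \<in> H. x \<notin> k \<and> h \<subseteq> k}" using assms by blast
  then show False using f finite_above[of h x] assms finite_subset by blast
qed

lemma nested_desc:
  assumes "\<And>h. h \<in> U \<Longrightarrow> h \<in> H" "\<And>h. h \<in> U \<Longrightarrow> x \<notin> h" "infinite U" "\<And>h k. h \<in> U \<Longrightarrow> k \<in> U \<Longrightarrow> h \<subseteq> k \<or> k \<subseteq> h"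
  obtains c where "desc c" "range c \<subseteq> U"
proof -
  have "\<exists>c. \<forall>n. c n \<in> U \<and> c (Suc n) \<subset> c n"
  proof (rule dependent_nat_choice)
    show "\<exists>h. h \<in> U" using assms(3) by (metis ex_in_conv finite.emptyI)
    show "\<exists>k. k \<in> U \<and> k \<subset> h" if "h \<in> U" for h and n :: nat
    proof -
      have "infinite {k \<in> U. k \<subset> h}" using infinite_below[of U x h] assms that by blast
      then have "{k \<in> U. k \<subset> h} \<noteq> {}" by (metis finite.emptyI)
      then show ?thesis by blast
    qed
  qed
  then obtain c where c: "\<And>n. c n \<in> U \<and> c (Suc n) \<subset> c n" by blast
  have "desc c" unfolding desc_def using c assms(1) by blast
  then show ?thesis using that c by blast
qed

text \<open>Ramsey's theorem with three colours: disjoint, nested, and the rest. As all members miss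
  \<open>x\<close>, the remaining colour means transverse, and an infinite transverse family
  contradicts finite dimension.\<close>

lemma ramsey_halfspaces:
  assumes "U \<subseteq> H" "\<And>h. h \<in> U \<Longrightarrow> x \<notin> h" "infinite U"
  obtains (disjoint) V where "V \<subseteq> U" "infinite V" "\<And>h k. h \<in> V \<Longrightarrow> k \<in> V \<Longrightarrow> h \<noteq> k \<Longrightarrow> h \<inter> k = {}"
  | (nested) V where "V \<subseteq> U" "infinite V" "\<And>h k. h \<in> V \<Longrightarrow> k \<in> V \<Longrightarrow> h \<subseteq> k \<or> k \<subseteq> h"
proof -
  define col :: "'x set set \<Rightarrow> nat" where
    "col X = (if \<exists>h k. X = {h, k} \<and> h \<noteq> k \<and> h \<inter> k = {} then 0
              else if \<exists>h k. X = {h, k} \<and> h \<noteq> k \<and> h \<subseteq> k then 1 else 2)" for X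
  have "\<exists>Y t. Y \<subseteq> U \<and> infinite Y \<and> t < 3 \<and> (\<forall>h\<in>Y. \<forall>k\<in>Y. h \<noteq> k \<longrightarrow> col {h, k} = t)"
    by (rule Ramsey2[OF assms(3)]) (auto simp: col_def)
  then obtain V t where *: "V \<subseteq> U \<and> infinite V \<and> t < 3 \<and> (\<forall>h\<in>V. \<forall>k\<in>V. h \<noteq> k \<longrightarrow> col {h, k} = t)"
    by (elim exE)
  then have V: "V \<subseteq> U" "infinite V" "t < 3" and col: "\<And>h k. h \<in> V \<Longrightarrow> k \<in> V \<Longrightarrow> h \<noteq> k \<Longrightarrow> col {h, k} = t"
    by simp_all
  have c0: "h \<inter> k = {}" if "col {h, k} = 0" for h k
    using that by (auto simp: col_def doubleton_eq_iff split: if_splits)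
  have c1: "h \<subseteq> k \<or> k \<subseteq> h" if "col {h, k} = 1" for h k
    using that by (auto simp: col_def doubleton_eq_iff split: if_splits)
  have c2: "transverse h k" if "col {h, k} = 2" "h \<in> V" "k \<in> V" "h \<noteq> k" for h k
  proof -
    have "col {h, k} = 0" if "h \<inter> k = {}"
    proof -
      have "\<exists>a b. {h, k} = {a, b} \<and> a \<noteq> b \<and> a \<inter> b = {}" using that \<open>h \<noteq> k\<close> by blast
      then show ?thesis by (simp add: col_def)
    qed
    moreover have "col {h, k} \<noteq> 2" if "h \<subseteq> k \<or> k \<subseteq> h"
    proof -
      have "\<exists>a b. {h, k} = {a, b} \<and> a \<noteq> b \<and> a \<subseteq> b" using that \<open>h \<noteq> k\<close> by (metis insert_commute)
      then show ?thesis by (simp add: col_def)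
    qed
    ultimately have "h \<inter> k \<noteq> {}" "\<not> h \<subseteq> k" "\<not> k \<subseteq> h" using that(1) by auto
    moreover have "x \<notin> h" "x \<notin> k" using that V assms by auto
    ultimately show ?thesis unfolding transverse_def by blast
  qed
  have "t = 0 \<or> t = 1 \<or> t = 2" using V(3) by linarith
  then show ?thesis
  proof (elim disjE)
    assume "t = 0"
    show ?thesis
    proof (rule disjoint[OF V(1,2)])
      show "h \<inter> k = {}" if "h \<in> V" "k \<in> V" "h \<noteq> k" for h k
        using c0 col[OF that] \<open>t = 0\<close> by simp
    qed
  next
    assume "t = 1"
    show ?thesis
    proof (rule nested[OF V(1,2)])
      show "h \<subseteq> k \<or> k \<subseteq> h" if "h \<in> V" "k \<in> V" for h k
        using c1[of h k] col[OF that] \<open>t = 1\<close> by (cases "h = k") simp_all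
    qed
  next
    assume "t = 2"
    have "finite V \<and> card V \<le> D"
    proof (rule transverse_card)
      show "V \<subseteq> H" using V(1) assms(1) by (rule order_trans)
      show "transverse h k" if "h \<in> V" "k \<in> V" "h \<noteq> k" for h k
        using c2[OF _ that] col[OF that] \<open>t = 2\<close> by simp
    qed
    then show ?thesis using V by simp
  qed
qed

lemma sided_infinite_desc:
  assumes "sided x U" "infinite U"
  obtains c where "desc c" "range c \<subseteq> U"
proof -
  have U: "U \<subseteq> H" "\<And>h. h \<in> U \<Longrightarrow> x \<notin> h" using assms by (auto simp: sided_def)
  show ?thesis
  proof (rule ramsey_halfspaces[OF U assms(2)])
    fix V assume V: "V \<subseteq> U" "infinite V" "\<And>h k. h \<in> V \<Longrightarrow> k \<in> V \<Longrightarrow> h \<noteq> k \<Longrightarrow> h \<inter> k = {}"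
    obtain h where "h \<in> V" using V by (metis ex_in_conv finite.emptyI)
    have "k = h" if "k \<in> V" for k
      using V(3)[of k h] V(1) that \<open>h \<in> V\<close> assms(1) unfolding sided_def by (meson subsetD)
    then have "V \<subseteq> {h}" by blast
    then show thesis using V(2) finite_subset[of V "{h}"] by simp
  next
    fix V assume V: "V \<subseteq> U" "infinite V" "\<And>h k. h \<in> V \<Longrightarrow> k \<in> V \<Longrightarrow> h \<subseteq> k \<or> k \<subseteq> h"
    obtain c where "desc c" "range c \<subseteq> V"
    proof (rule nested_desc[of V x])
      show "h \<in> H" "x \<notin> h" if "h \<in> V" for h using that U V(1) by blast+
    qed (use V in auto)
    then show thesis using that V(1) by (meson order_trans)
  qed
qed

end

section \<open>Ends and axes\<close>

primrec gpow :: "'g::group_add \<Rightarrow> nat \<Rightarrow> 'g" where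
  "gpow g 0 = 0"
| "gpow g (Suc n) = g + gpow g n"

lemma gpow_add: "gpow g (m + n) = gpow g m + gpow g n"
  by (induction m) (simp_all add: add.assoc)

lemma gpow_Suc2: "gpow g (Suc n) = gpow g n + g"
  using gpow_add[of g n 1] by simp

context cc_act begin

text \<open>A strictly descending sequence of half-spaces shrinks to a convex subset of the Roller boundary;
  \<open>dom c c'\<close> says that the one of \<open>c\<close> contains the one of \<open>c'\<close>.\<close>

definition dom :: "(nat \<Rightarrow> 'x set) \<Rightarrow> (nat \<Rightarrow> 'x set) \<Rightarrow> bool" where
  "dom c c' \<longleftrightarrow> (\<forall>n. \<exists>m. c' m \<subseteq> c n)"

definition eqv :: "(nat \<Rightarrow> 'x set) \<Rightarrow> (nat \<Rightarrow> 'x set) \<Rightarrow> bool" where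
  "eqv c c' \<longleftrightarrow> dom c c' \<and> dom c' c"

definition edisj :: "(nat \<Rightarrow> 'x set) \<Rightarrow> (nat \<Rightarrow> 'x set) \<Rightarrow> bool" where
  "edisj c c' \<longleftrightarrow> (\<exists>n m. c n \<inter> c' m = {})"

abbreviation tre :: "'g \<Rightarrow> (nat \<Rightarrow> 'x set) \<Rightarrow> nat \<Rightarrow> 'x set" where
  "tre g c \<equiv> \<lambda>n. tr g (c n)"

lemma dom_refl [simp]: "dom c c"
  by (auto simp: dom_def)

lemma dom_trans: "dom a b \<Longrightarrow> dom b c \<Longrightarrow> dom a c"
  unfolding dom_def by (meson order_trans)

lemma dom_tre [simp]: "dom (tre g c) (tre g c') \<longleftrightarrow> dom c c'"
  by (simp add: dom_def)

lemma eqv_tre [simp]: "eqv (tre g c) (tre g c') \<longleftrightarrow> eqv c c'"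
  by (simp add: eqv_def)

lemma eqv_sym: "eqv a b \<Longrightarrow> eqv b a"
  by (simp add: eqv_def)

lemma eqv_refl [simp]: "eqv c c"
  by (simp add: eqv_def)

lemma eqv_trans: "eqv a b \<Longrightarrow> eqv b c \<Longrightarrow> eqv a c"
  unfolding eqv_def using dom_trans by blast

lemma desc_tre [simp]: "desc (tre g c) \<longleftrightarrow> desc c"
  by (simp add: desc_def)

lemma tre_tre: "tre g (tre k c) = tre (g + k) c"
  by (simp add: tr_add)

text \<open>Let \<open>c j\<close> be minimal for \<open>dom\<close>, so that for every other chain
  some level of \<open>c j\<close> contains none of its members. A level \<open>n\<close> is fixed
  that works for all of them; the other chains are then chosen recursively, so deep that they avoid
  a point \<open>p\<close> of \<open>c j n\<close> and the vertex \<open>x\<close>. The four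
  witnesses of transversality come from non-disjointness, \<open>p\<close>, the choice of
  \<open>n\<close>, and \<open>x\<close>.\<close>

lemma transverse_select:
  assumes "finite J" "\<And>j. j \<in> J \<Longrightarrow> desc (c j)"
    "\<And>i j. i \<in> J \<Longrightarrow> j \<in> J \<Longrightarrow> i \<noteq> j \<Longrightarrow> \<not> eqv (c i) (c j) \<and> \<not> edisj (c i) (c j)"
  shows "\<exists>f. (\<forall>j\<in>J. \<exists>n\<ge>N. f j = c j n) \<and> (\<forall>i\<in>J. \<forall>j\<in>J. i \<noteq> j \<longrightarrow> transverse (f i) (f j))"
  using assms
proof (induction "card J" arbitrary: J N)
  case 0
  then show ?case by auto
next
  case (Suc k)
  have "\<exists>j\<in>J. \<forall>i\<in>J. i \<noteq> j \<longrightarrow> \<not> (i \<noteq> j \<and> dom (c j) (c i))"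
  proof (rule Finite_Set.bex_min_element)
    show "asymp_on J (\<lambda>i j. i \<noteq> j \<and> dom (c j) (c i))"
      using Suc(5) by (auto simp: asymp_on_def eqv_def)
    show "transp_on J (\<lambda>i j. i \<noteq> j \<and> dom (c j) (c i))"
      using Suc(5) by (auto simp: transp_on_def eqv_def intro: dom_trans)
  qed (use Suc in auto)
  then obtain j where j: "j \<in> J" "\<And>i. i \<in> J - {j} \<Longrightarrow> \<not> dom (c j) (c i)" by auto
  have fin: "finite (J - {j})" using Suc by simp
  obtain x :: 'x where True by blast
  have ev: "\<forall>\<^sub>F n in sequentially. y \<notin> c i n" if "i \<in> J" for i y
    using desc_escape[OF Suc(4)[OF that], of y] by (auto simp: eventually_sequentially)
  have "\<forall>\<^sub>F n in sequentially. \<forall>i\<in>J. x \<notin> c i n"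
    using Suc(3) ev by (simp add: eventually_ball_finite)
  then obtain N' where N': "\<And>n i. n \<ge> N' \<Longrightarrow> i \<in> J \<Longrightarrow> x \<notin> c i n" by (auto simp: eventually_sequentially)
  have "\<forall>i\<in>J - {j}. \<exists>n. \<forall>m. \<not> c i m \<subseteq> c j n" using j by (auto simp: dom_def)
  then obtain nn where nn: "\<And>i m. i \<in> J - {j} \<Longrightarrow> \<not> c i m \<subseteq> c j (nn i)" by metis
  define n where "n = Max (insert N (insert N' (nn ` (J - {j}))))"
  have n: "n \<ge> N" "n \<ge> N'" "\<And>i. i \<in> J - {j} \<Longrightarrow> nn i \<le> n"
    unfolding n_def by (rule Max_ge; use fin in simp)+
  have nsub: "\<not> c i m \<subseteq> c j n" if "i \<in> J - {j}" for i m
    using nn[OF that, of m] desc_le[OF Suc(4)[OF j(1)] n(3)[OF that]] by blast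
  obtain p where p: "p \<in> c j n" using H_ne(1) desc_H Suc(4) j by blast
  have "\<forall>\<^sub>F m in sequentially. \<forall>i\<in>J - {j}. p \<notin> c i m"
    using fin ev by (simp add: eventually_ball_finite)
  then obtain N1 where N1: "\<And>m i. m \<ge> N1 \<Longrightarrow> i \<in> J - {j} \<Longrightarrow> p \<notin> c i m" by (auto simp: eventually_sequentially)
  have "\<exists>f. (\<forall>i\<in>J - {j}. \<exists>n\<ge>max N (max N' N1). f i = c i n) \<and> (\<forall>i\<in>J - {j}. \<forall>i'\<in>J - {j}. i \<noteq> i' \<longrightarrow> transverse (f i) (f i'))"
    by (rule Suc(1)) (use Suc j in auto)
  then obtain f where *: "\<forall>i\<in>J - {j}. \<exists>n\<ge>max N (max N' N1). f i = c i n"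
    "\<forall>i\<in>J - {j}. \<forall>i'\<in>J - {j}. i \<noteq> i' \<longrightarrow> transverse (f i) (f i')" by (elim exE conjE)
  have f: "\<exists>n\<ge>max N (max N' N1). f i = c i n" if "i \<in> J - {j}" for i using bspec[OF *(1) that] .
  have f2: "transverse (f i) (f i')" if "i \<in> J - {j}" "i' \<in> J - {j}" "i \<noteq> i'" for i i'
    using bspec[OF bspec[OF *(2) that(1)] that(2)] that(3) by (rule mp)
  have trj: "transverse (c j n) (f i)" if i: "i \<in> J - {j}" for i
  proof -
    obtain m where m: "m \<ge> N'" "m \<ge> N1" "f i = c i m" using f[OF i] by auto
    have "c j n \<inter> c i m \<noteq> {}" using Suc(5)[of i j] i j by (auto simp: edisj_def)
    moreover have "p \<in> c j n \<inter> - c i m" using p N1 m i by auto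
    moreover have "- c j n \<inter> c i m \<noteq> {}" using nsub[OF i, of m] by blast
    moreover have "x \<in> - c j n \<inter> - c i m" using N' n m i j by auto
    ultimately show ?thesis unfolding transverse_def m(3) by blast
  qed
  show ?case
  proof (rule exI[of _ "f(j := c j n)"], intro conjI ballI impI)
    show "\<exists>na\<ge>N. (f(j := c j n)) i = c i na" if "i \<in> J" for i
      using f[of i] that n(1) by (cases "i = j") auto
    show "transverse ((f(j := c j n)) i) ((f(j := c j n)) i')" if "i \<in> J" "i' \<in> J" "i \<noteq> i'" for i i'
      using f2[of i i'] trj[of i] trj[of i'] that transverse_sym by (cases "i = j"; cases "i' = j") auto
  qed
qed

lemma inequivalent_ends_card:
  assumes "finite J" "\<And>j. j \<in> J \<Longrightarrow> desc (c j)"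
    "\<And>i j. i \<in> J \<Longrightarrow> j \<in> J \<Longrightarrow> i \<noteq> j \<Longrightarrow> \<not> eqv (c i) (c j) \<and> \<not> edisj (c i) (c j)"
  shows "card J \<le> D"
proof -
  have "\<exists>f. (\<forall>j\<in>J. \<exists>n\<ge>0. f j = c j n) \<and> (\<forall>i\<in>J. \<forall>j\<in>J. i \<noteq> j \<longrightarrow> transverse (f i) (f j))"
    by (rule transverse_select[OF assms])
  then obtain f where *: "\<forall>j\<in>J. \<exists>n\<ge>0. f j = c j n" "\<forall>i\<in>J. \<forall>j\<in>J. i \<noteq> j \<longrightarrow> transverse (f i) (f j)"
    by (elim exE conjE)
  have f: "f j \<in> H" if "j \<in> J" for j using bspec[OF *(1) that] desc_H[OF assms(2)[OF that]] by auto
  have "inj_on f J" using *(2) by (auto simp: inj_on_def transverse_def)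
  moreover have "card (f ` J) \<le> D"
  proof -
    have "finite (f ` J) \<and> card (f ` J) \<le> D"
      by (rule transverse_card) (use f *(2) in auto)
    then show ?thesis by blast
  qed
  ultimately show ?thesis by (simp add: card_image)
qed

definition maxend :: "(nat \<Rightarrow> 'x set) \<Rightarrow> bool" where
  "maxend c \<longleftrightarrow> desc c \<and> (\<forall>e. desc e \<longrightarrow> dom e c \<longrightarrow> dom c e)"

lemma not_edisj_above:
  assumes "desc c" "dom e c" "dom e' c"
  shows "\<not> edisj e e'"
proof
  assume "edisj e e'"
  then obtain n m where "e n \<inter> e' m = {}" by (auto simp: edisj_def)
  moreover obtain i j where "c i \<subseteq> e n" "c j \<subseteq> e' m" using assms unfolding dom_def by meson
  moreover have "c (max i j) \<subseteq> c i" "c (max i j) \<subseteq> c j" using desc_le[OF assms(1)] by auto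
  ultimately show False using H_ne(1)[OF desc_H[OF assms(1), of "max i j"]] by blast
qed

lemma maxend_above:
  assumes "desc c"
  obtains e where "maxend e" "dom e c"
proof (rule ccontr)
  assume "\<not> thesis"
  then have no: "\<not> maxend e" if "dom e c" for e using that \<open>\<And>e. maxend e \<Longrightarrow> dom e c \<Longrightarrow> thesis\<close> by blast
  have "\<exists>f. \<forall>n. (desc (f n) \<and> dom (f n) c) \<and> dom (f (Suc n)) (f n) \<and> \<not> dom (f n) (f (Suc n))"
  proof (rule dependent_nat_choice)
    show "\<exists>f. desc f \<and> dom f c" using assms by auto
    show "\<exists>f'. (desc f' \<and> dom f' c) \<and> dom f' f \<and> \<not> dom f f'" if "desc f \<and> dom f c" for f and n :: nat
      using no[of f] that unfolding maxend_def by (meson dom_trans)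
  qed
  then obtain f where f: "\<And>n. desc (f n)" "\<And>n. dom (f n) c" "\<And>n. dom (f (Suc n)) (f n)" "\<And>n. \<not> dom (f n) (f (Suc n))"
    by blast
  have mono: "dom (f n) (f m)" if "m \<le> n" for m n
    using that by (induction rule: dec_induct) (use f(3) dom_trans in auto)
  have ne: "\<not> eqv (f m) (f n)" if "m < n" for m n
    using mono[of "Suc m" n] f(4)[of m] that dom_trans by (auto simp: eqv_def)
  have "card {..D} \<le> D"
  proof (rule inequivalent_ends_card[of _ f])
    show "\<not> eqv (f i) (f j) \<and> \<not> edisj (f i) (f j)" if "i \<noteq> j" for i j
      using ne[of i j] ne[of j i] that eqv_sym not_edisj_above[OF assms f(2) f(2)] by (cases i j rule: linorder_cases) auto
  qed (use f in auto)
  then show False by simp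
qed

section \<open>Disjoint translates and periodic ends\<close>

definition facing :: "'x set \<Rightarrow> nat \<Rightarrow> bool" where
  "facing h M \<longleftrightarrow> (\<exists>F. finite F \<and> card F = M \<and> (\<forall>g\<in>F. \<forall>g'\<in>F. g \<noteq> g' \<longrightarrow> tr g h \<inter> tr g' h = {}))"

text \<open>If only finitely many translates missed \<open>x\<close>, a point chosen in each would
  bound the distance from \<open>h\<close> of all orbit points of \<open>x\<close> outside
  \<open>h\<close>, against deepness of \<open>- h\<close>.\<close>

lemma deep_infinite:
  assumes "h \<in> H" "deep E act (- h)"
  shows "\<exists>x. infinite {tr (- g) h | g. x \<notin> tr (- g) h}"
proof -
  obtain x where x: "\<And>R::nat. \<exists>g. act g x \<in> - h \<and> (\<forall>y\<in>- (- h). R < d (act g x) y)"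
    using assms(2) unfolding deep_def by blast
  have "infinite {tr (- g) h | g. x \<notin> tr (- g) h}" (is "infinite ?W")
  proof
    assume fin: "finite ?W"
    have "\<forall>k\<in>?W. \<exists>y. y \<in> k" using H_ne(1)[OF assms(1)] by auto
    from bchoice[OF this] obtain y where "\<forall>k\<in>?W. y k \<in> k" ..
    then have y: "y k \<in> k" if "k \<in> ?W" for k using that by (rule bspec)
    define R where "R = Max ((\<lambda>k. d x (y k)) ` ?W)"
    obtain g where g: "act g x \<notin> h" "\<And>z. z \<in> h \<Longrightarrow> R < d (act g x) z" using x[of R] by auto
    have k: "tr (- g) h \<in> ?W" using g(1) by (auto simp: tr_iff)
    then have "d x (y (tr (- g) h)) \<le> R" unfolding R_def using fin by (intro Max_ge) auto
    moreover have "act g (y (tr (- g) h)) \<in> h" using y[OF k] by (simp add: tr_iff)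
    ultimately show False using g(2) act_d[of g x] by (metis leD)
  qed
  then show ?thesis by blast
qed

lemma facing_of_disjoint:
  assumes "infinite V" "\<And>k. k \<in> V \<Longrightarrow> \<exists>g. k = tr g h" "\<And>k k'. k \<in> V \<Longrightarrow> k' \<in> V \<Longrightarrow> k \<noteq> k' \<Longrightarrow> k \<inter> k' = {}"
  shows "facing h M"
proof -
  obtain V' where V': "V' \<subseteq> V" "finite V'" "card V' = M" using infinite_arbitrarily_large assms(1) by blast
  obtain g where g: "\<And>k. k \<in> V \<Longrightarrow> k = tr (g k) h" using assms(2) by metis
  have inj: "inj_on g V'" using g V' by (metis inj_onI subsetD)
  show ?thesis
    unfolding facing_def
  proof (intro exI[of _ "g ` V'"] conjI ballI impI)
    show "card (g ` V') = M" using inj V' by (simp add: card_image)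
    show "tr a h \<inter> tr b h = {}" if ab: "a \<in> g ` V'" "b \<in> g ` V'" "a \<noteq> b" for a b
    proof -
      obtain k k' where k: "k \<in> V'" "a = g k" "k' \<in> V'" "b = g k'" using ab by blast
      have "tr a h = k" "tr b h = k'" "k \<noteq> k'" using g k V' ab by auto
      then show ?thesis using assms(3)[of k k'] k V' by auto
    qed
  qed (use V' in auto)
qed

lemma orbit_desc:
  assumes "h \<in> H" "deep E act (- h)" "\<not> facing h M"
  obtains c where "desc c" "\<And>n. \<exists>g. c n = tr g h"
proof -
  obtain x where x: "infinite {tr (- g) h | g. x \<notin> tr (- g) h}" (is "infinite ?W")
    using deep_infinite assms by blast
  have W: "?W \<subseteq> H" "\<And>k. k \<in> ?W \<Longrightarrow> x \<notin> k" "\<And>k. k \<in> ?W \<Longrightarrow> \<exists>g. k = tr g h" using assms(1) by auto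
  show ?thesis
  proof (rule ramsey_halfspaces[OF W(1,2) x])
    fix V assume V: "V \<subseteq> ?W" "infinite V" "\<And>h k. h \<in> V \<Longrightarrow> k \<in> V \<Longrightarrow> h \<noteq> k \<Longrightarrow> h \<inter> k = {}"
    have "facing h M" by (rule facing_of_disjoint[OF V(2) _ V(3)]) (use V(1) W(3) in blast)+
    then show thesis using assms by blast
  next
    fix V assume V: "V \<subseteq> ?W" "infinite V" "\<And>h k. h \<in> V \<Longrightarrow> k \<in> V \<Longrightarrow> h \<subseteq> k \<or> k \<subseteq> h"
    obtain c where c: "desc c" "range c \<subseteq> V"
    proof (rule nested_desc[of V x])
      show "k \<in> H" "x \<notin> k" if "k \<in> V" for k
        using subsetD[OF V(1) that] W(1,2) by (meson subsetD)+
    qed (use V in auto)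
    then have "\<exists>g. c n = tr g h" for n using W(3)[of "c n"] V(1) by blast
    then show thesis using that c(1) by blast
  qed
qed

definition finorb :: "(nat \<Rightarrow> 'x set) \<Rightarrow> bool" where
  "finorb c \<longleftrightarrow> (\<exists>R. finite R \<and> (\<forall>g. \<exists>r\<in>R. eqv (tre g c) (tre r c)))"

text \<open>Infinitely many inequivalent translates of \<open>e\<close> contain, by Ramsey's
  theorem, an infinite subfamily that is pairwise disjoint or pairwise not. The second is excluded
  by dimension. In the first, deep members of \<open>M\<close> translates are disjoint, and each
  contains a translate of \<open>h\<close> because \<open>e\<close> lies above \<open>c\<close>; so
  \<open>h\<close> would have \<open>M\<close> disjoint translates.\<close>

lemma maxend_finorb:
  assumes "desc c" "dom e c" "desc e" "\<And>n. \<exists>g. c n = tr g h" "\<not> facing h M"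
  shows "finorb e"
proof (rule ccontr)
  assume nf: "\<not> finorb e"
  define cls where "cls g = {g'. eqv (tre g e) (tre g' e)}" for g
  have cls: "cls g = cls g' \<longleftrightarrow> eqv (tre g e) (tre g' e)" for g g'
    unfolding cls_def using eqv_trans eqv_sym eqv_refl by blast
  obtain T where T: "inj_on cls T" "range cls = cls ` T" using subset_image_inj[of "range cls" cls UNIV] by auto
  have infT: "infinite T"
  proof
    assume fin: "finite T"
    have "\<exists>r\<in>T. eqv (tre g e) (tre r e)" for g
    proof -
      have "cls g \<in> cls ` T" using T by blast
      then show ?thesis using cls by blast
    qed
    then show False using nf fin unfolding finorb_def by blast
  qed
  define col where "col X = (if \<exists>g g'. X = {g, g'} \<and> edisj (tre g e) (tre g' e) then 0 else 1::nat)" for X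
  have "\<exists>Y t. Y \<subseteq> T \<and> infinite Y \<and> t < 2 \<and> (\<forall>g\<in>Y. \<forall>g'\<in>Y. g \<noteq> g' \<longrightarrow> col {g, g'} = t)"
    by (rule Ramsey2[OF infT]) (auto simp: col_def)
  then obtain Y t where "Y \<subseteq> T \<and> infinite Y \<and> t < 2 \<and> (\<forall>g\<in>Y. \<forall>g'\<in>Y. g \<noteq> g' \<longrightarrow> col {g, g'} = t)" by (elim exE)
  then have Y: "Y \<subseteq> T" "infinite Y" "t < 2" "\<And>g g'. g \<in> Y \<Longrightarrow> g' \<in> Y \<Longrightarrow> g \<noteq> g' \<Longrightarrow> col {g, g'} = t" by simp_all
  have edisj_sym: "edisj a b \<longleftrightarrow> edisj b a" for a b unfolding edisj_def by (metis inf_commute)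
  have col0: "col {g, g'} = 0 \<longleftrightarrow> edisj (tre g e) (tre g' e)" for g g'
    unfolding col_def using edisj_sym by (auto simp: doubleton_eq_iff)
  show False
  proof (cases "t = 0")
    case False
    obtain J where J: "J \<subseteq> Y" "finite J" "card J = Suc D" using infinite_arbitrarily_large[OF Y(2)] by blast
    have "card J \<le> D"
    proof (rule inequivalent_ends_card[of J "\<lambda>g. tre g e"])
      show "\<not> eqv (tre i e) (tre j e) \<and> \<not> edisj (tre i e) (tre j e)" if "i \<in> J" "j \<in> J" "i \<noteq> j" for i j
      proof
        have ij: "i \<in> T" "j \<in> T" "i \<in> Y" "j \<in> Y" using that J Y by auto
        show "\<not> eqv (tre i e) (tre j e)" using ij T(1) that cls by (auto simp: inj_on_def)
        show "\<not> edisj (tre i e) (tre j e)" using ij Y(4) that False col0 by metis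
      qed
    qed (use J assms in auto)
    then show False using J by simp
  next
    case True
    obtain F where F: "F \<subseteq> Y" "finite F" "card F = M" using infinite_arbitrarily_large[OF Y(2)] by blast
    let ?P = "\<lambda>n p. fst p \<noteq> snd p \<longrightarrow> tr (fst p) (e n) \<inter> tr (snd p) (e n) = {}"
    have "\<forall>\<^sub>F n in sequentially. ?P n p" if "p \<in> F \<times> F" for p
    proof (cases "fst p = snd p")
      case False
      have "edisj (tre (fst p) e) (tre (snd p) e)"
        using col0[of "fst p" "snd p"] Y(4)[of "fst p" "snd p"] True False that subsetD[OF F(1)]
        by (simp add: mem_Times_iff)
      then obtain n m where nm: "tr (fst p) (e n) \<inter> tr (snd p) (e m) = {}" by (auto simp: edisj_def)
      have "tr (fst p) (e i) \<inter> tr (snd p) (e i) = {}" if "i \<ge> max n m" for i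
      proof -
        have "tr (fst p) (e i) \<subseteq> tr (fst p) (e n)" "tr (snd p) (e i) \<subseteq> tr (snd p) (e m)"
          unfolding tr_subset using desc_le[OF assms(3)] that by auto
        then show ?thesis using nm by blast
      qed
      then show ?thesis unfolding eventually_sequentially by blast
    qed simp
    then have "\<forall>\<^sub>F n in sequentially. \<forall>p\<in>F \<times> F. ?P n p" using F by (intro eventually_ball_finite) auto
    then obtain n where n: "\<And>g g'. g \<in> F \<Longrightarrow> g' \<in> F \<Longrightarrow> g \<noteq> g' \<Longrightarrow> tr g (e n) \<inter> tr g' (e n) = {}"
      unfolding eventually_sequentially by fastforce
    obtain m where "c m \<subseteq> e n" using assms(2) by (auto simp: dom_def)
    then obtain k where k: "tr k h \<subseteq> e n" using assms(4)[of m] by auto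
    have "facing h M"
      unfolding facing_def
    proof (intro exI[of _ "(\<lambda>g. g + k) ` F"] conjI ballI impI)
      show "card ((\<lambda>g. g + k) ` F) = M" using F by (simp add: card_image inj_on_def)
      show "tr a h \<inter> tr b h = {}" if ab: "a \<in> (\<lambda>g. g + k) ` F" "b \<in> (\<lambda>g. g + k) ` F" "a \<noteq> b" for a b
      proof -
        obtain g g' where g: "g \<in> F" "a = g + k" "g' \<in> F" "b = g' + k" using ab by blast
        have "tr a h \<subseteq> tr g (e n)" "tr b h \<subseteq> tr g' (e n)" using k g by (simp_all flip: tr_add)
        moreover have "g \<noteq> g'" using g ab by auto
        ultimately show ?thesis using n[of g g'] g by blast
      qed
    qed (use F in auto)
    then show False using assms by blast
  qed
qed

lemma finorb_tre: "finorb e \<Longrightarrow> finorb (tre k e)"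
proof -
  assume "finorb e"
  then obtain R where R: "finite R" "\<And>g. \<exists>r\<in>R. eqv (tre g e) (tre r e)" by (auto simp: finorb_def)
  have "\<exists>r\<in>(\<lambda>r. r - k) ` R. eqv (tre g (tre k e)) (tre r (tre k e))" for g
    using R(2)[of "g + k"] by (auto simp: tre_tre)
  then show ?thesis unfolding finorb_def using R(1) by (metis finite_imageI)
qed

lemma maxend_tre: "maxend e \<Longrightarrow> maxend (tre k e)"
proof -
  assume e: "maxend e"
  have "dom (tre k e) c" if "desc c" "dom c (tre k e)" for c
  proof -
    have "dom (tre (- k) c) (tre (- k) (tre k e))" using that by (simp del: tr_minus)
    then have "dom e (tre (- k) c)" using e that by (simp add: maxend_def)
    then have "dom (tre k e) (tre k (tre (- k) c))" by (simp del: tr_minus)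
    then show ?thesis by simp
  qed
  then show ?thesis using e by (simp add: maxend_def)
qed

text \<open>Infinitely many translates of \<open>b\<close> miss a vertex \<open>x\<close>, and by
  the pigeonhole principle infinitely many of them contain the same translated end
  \<open>e'\<close>. Among these, width at most \<open>D\<close> forces two nested ones,
  \<open>h\<close> inside \<open>k\<close>; the element carrying \<open>k\<close> to
  \<open>h\<close> preserves \<open>e'\<close>, and the end of its axis lies above
  \<open>e'\<close>, hence is equivalent to it by maximality.\<close>

lemma axis_exists:
  assumes "maxend e" "finorb e" "essential E act"
  obtains g a where "a \<in> H" "tr g a \<subset> a" "maxend (\<lambda>n. tr (gpow g n) a)" "finorb (\<lambda>n. tr (gpow g n) a)"
proof -
  have de: "desc e" using assms by (simp add: maxend_def)
  define b where "b = e 0"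
  have bH: "b \<in> H" using desc_H[OF de] by (simp add: b_def)
  then have "deep E act (- b)" using assms(3) by (auto simp: essential_def)
  then obtain x where x: "infinite {tr (- g) b | g. x \<notin> tr (- g) b}" using deep_infinite bH by blast
  obtain R where R: "finite R" "\<And>g. \<exists>r\<in>R. eqv (tre g e) (tre r e)" using assms(2) by (auto simp: finorb_def)
  have "{tr (- g) b | g. x \<notin> tr (- g) b} \<subseteq> (\<Union>r\<in>R. {tr (- g) b | g. x \<notin> tr (- g) b \<and> eqv (tre (- g) e) (tre r e)})"
    using R(2) by blast
  then have "infinite (\<Union>r\<in>R. {tr (- g) b | g. x \<notin> tr (- g) b \<and> eqv (tre (- g) e) (tre r e)})"
    using x finite_subset by blast
  then obtain r where "infinite {tr (- g) b | g. x \<notin> tr (- g) b \<and> eqv (tre (- g) e) (tre r e)}" (is "infinite ?V")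
    using R(1) by blast
  define e' where "e' = tre r e"
  have e': "maxend e'" "finorb e'" "desc e'" unfolding e'_def using maxend_tre finorb_tre assms de by auto
  have above: "\<exists>m. e' m \<subseteq> k" if k: "k \<in> ?V" for k
  proof -
    obtain g where g: "k = tr (- g) b" "eqv (tre (- g) e) e'" using k by (auto simp: e'_def)
    then show ?thesis by (auto simp: eqv_def dom_def b_def)
  qed
  have sd: "sided x ?V"
    unfolding sided_def
  proof (intro conjI ballI)
    fix k k' assume "k \<in> ?V" "k' \<in> ?V"
    then obtain m m' where "e' m \<subseteq> k" "e' m' \<subseteq> k'" using above by meson
    moreover have "e' (max m m') \<subseteq> e' m" "e' (max m m') \<subseteq> e' m'" using desc_le e' by auto
    moreover have "e' (max m m') \<noteq> {}" using H_ne(1) desc_H e' by blast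
    ultimately show "k \<inter> k' \<noteq> {}" by blast
  qed (use bH in auto)
  have "\<not> (\<forall>h\<in>?V. \<forall>k\<in>?V. h \<subseteq> k \<longrightarrow> h = k)"
    using antichain_card[OF sd] \<open>infinite ?V\<close> by blast
  then obtain h k where hk: "h \<in> ?V" "k \<in> ?V" "h \<subset> k" by blast
  obtain g1 g2 where g: "k = tr (- g1) b" "h = tr (- g2) b" "eqv (tre (- g1) e) e'" "eqv (tre (- g2) e) e'"
    using hk unfolding e'_def by blast
  define g where "g = - g2 + g1"
  have ga: "tr g k = h" using g by (simp add: g_def tr_add add.assoc)
  have ge: "eqv (tre g e') e'"
  proof -
    have "eqv (tre g1 (tre (- g1) e)) (tre g1 e')" using g(3) by (simp del: tr_minus)
    then have 1: "eqv e (tre g1 e')" by simp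
    then have "eqv (tre (- g2) e) (tre (- g2) (tre g1 e'))" by simp
    then have "eqv (tre (- g2) e) (tre g e')" by (simp add: g_def tr_add)
    then show ?thesis using g(4) eqv_trans eqv_sym by blast
  qed
  have gn: "eqv (tre (gpow g n) e') e'" for n
  proof (induction n)
    case (Suc n)
    then have "eqv (tre g (tre (gpow g n) e')) (tre g e')" by simp
    then have "eqv (tre (gpow g (Suc n)) e') (tre g e')" by (simp add: tr_add)
    then show ?case using ge eqv_trans by blast
  qed simp
  define f where "f = (\<lambda>n. tr (gpow g n) k)"
  have kH: "k \<in> H" using hk(2) bH by auto
  have df: "desc f"
    unfolding desc_def f_def
  proof
    fix n
    have "tr (gpow g (Suc n)) k = tr (gpow g n) (tr g k)" by (simp add: tr_add gpow_Suc2 del: gpow.simps)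
    then show "tr (gpow g n) k \<in> H \<and> tr (gpow g (Suc n)) k \<subset> tr (gpow g n) k" using kH hk(3) ga by simp
  qed
  have "dom f e'"
    unfolding dom_def
  proof
    fix n
    obtain m where "e' m \<subseteq> k" using above hk(2) by blast
    then have "tr (gpow g n) (e' m) \<subseteq> f n" by (simp add: f_def)
    moreover obtain m' where "e' m' \<subseteq> tr (gpow g n) (e' m)" using gn[of n] unfolding eqv_def dom_def by blast
    ultimately show "\<exists>m. e' m \<subseteq> f n" by blast
  qed
  then have eq: "eqv f e'" using e'(1) df by (auto simp: maxend_def eqv_def)
  have "maxend f"
    using e'(1) df eq unfolding maxend_def eqv_def by (meson dom_trans)
  moreover have "finorb f"
  proof -
    obtain R where R: "finite R" "\<And>g. \<exists>r\<in>R. eqv (tre g e') (tre r e')" using e' by (auto simp: finorb_def)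
    have "\<exists>r\<in>R. eqv (tre g f) (tre r f)" for g
      using R(2)[of g] eq eqv_trans eqv_sym eqv_tre by meson
    then show ?thesis using R(1) by (auto simp: finorb_def)
  qed
  ultimately show ?thesis using that[of k g] kH ga hk(3) by (simp add: f_def)
qed

lemma not_facing_axis:
  assumes "essential E act" "h \<in> H" "\<not> facing h M"
  obtains g a where "a \<in> H" "tr g a \<subset> a" "maxend (\<lambda>n. tr (gpow g n) a)" "finorb (\<lambda>n. tr (gpow g n) a)"
proof -
  have "deep E act (- h)" using assms by (auto simp: essential_def)
  then obtain c where c: "desc c" "\<And>n. \<exists>g. c n = tr g h" using orbit_desc assms by metis
  obtain e where e: "maxend e" "dom e c" using maxend_above c by blast
  have "desc e" using e by (simp add: maxend_def)
  then have "finorb e" using maxend_finorb[OF c(1) e(2) _ c(2) assms(3)] by blast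
  then show ?thesis using axis_exists[OF e(1) _ assms(1)] that by metis
qed

end

section \<open>The length metric on the realization\<close>

lemma cube_dist_ge0: "0 \<le> cube_dist S t t'"
  by (simp add: cube_dist_def sum_nonneg)

lemma cube_dist_sym: "cube_dist S t t' = cube_dist S t' t"
  by (simp add: cube_dist_def power2_commute)

lemma cube_dist_L1: "cube_dist S t t' \<le> (\<Sum>k\<in>S. \<bar>t k - t' k\<bar>)"
  unfolding cube_dist_def by (rule order_trans[OF _ L2_set_le_sum_abs]) (simp add: L2_set_def)

lemma cube_dist_coord: "finite S \<Longrightarrow> k \<in> S \<Longrightarrow> \<bar>t k - t' k\<bar> \<le> cube_dist S t t'"
  unfolding cube_dist_def by (rule real_le_rsqrt) (auto intro: member_le_sum)

lemma cube_dist_scale: "cube_dist S (\<lambda>h. t h + u * (t' h - t h)) (\<lambda>h. t h + u' * (t' h - t h)) = \<bar>u - u'\<bar> * cube_dist S t t'"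
proof -
  have "(t k + u * (t' k - t k) - (t k + u' * (t' k - t k)))\<^sup>2 = (u - u')\<^sup>2 * (t k - t' k)\<^sup>2" for k
    by (simp add: power2_eq_square algebra_simps)
  then show ?thesis
    unfolding cube_dist_def by (simp add: real_sqrt_mult flip: sum_distrib_left)
qed

context median_cc begin

text \<open>The strings of \<open>rdist\<close>, built by appending one segment at the far end; the
  real argument is the total length.\<close>

inductive reach :: "('x set \<Rightarrow> real) \<Rightarrow> ('x set \<Rightarrow> real) \<Rightarrow> real \<Rightarrow> bool" where
  reach_refl: "reach p p 0"
| reach_step: "reach p (cpt E v S t) l \<Longrightarrow> cube E v S \<Longrightarrow> unit_param S t \<Longrightarrow> unit_param S t' \<Longrightarrow>
    reach p (cpt E v S t') (l + cube_dist S t t')"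

abbreviation R :: "('x set \<Rightarrow> real) set" where "R \<equiv> realization E"
abbreviation rd where "rd \<equiv> rdist E"

lemma reach_of_string:
  assumes "\<forall>i<n. cube E (v i) (S i) \<and> unit_param (S i) (t i) \<and> unit_param (S i) (t' i)"
    "\<forall>i. Suc i < n \<longrightarrow> cpt E (v i) (S i) (t' i) = cpt E (v (Suc i)) (S (Suc i)) (t (Suc i))"
    "n = 0 \<longrightarrow> p = q" "0 < n \<longrightarrow> cpt E (v 0) (S 0) (t 0) = p \<and> cpt E (v (n - 1)) (S (n - 1)) (t' (n - 1)) = q"
  shows "reach p q (\<Sum>i<n. cube_dist (S i) (t i) (t' i))"
  using assms
proof (induction n arbitrary: q)
  case 0
  then show ?case by (simp add: reach_refl)
next
  case (Suc n)
  have q: "q = cpt E (v n) (S n) (t' n)" using Suc.prems(4) by simp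
  have "reach p (cpt E (v n) (S n) (t n)) (\<Sum>i<n. cube_dist (S i) (t i) (t' i))"
  proof (cases "n = 0")
    case True
    then show ?thesis using Suc.prems(4) by (simp add: reach_refl)
  next
    case False
    then obtain m where m: "n = Suc m" by (cases n) auto
    show ?thesis
      by (rule Suc.IH) (use Suc.prems m in auto)
  qed
  from reach_step[OF this] show ?case using Suc.prems(1) by (simp add: q)
qed

lemma string_of_reach:
  assumes "reach p q l"
  shows "\<exists>n v S t t'. l = (\<Sum>i<n. cube_dist (S i) (t i) (t' i)) \<and>
      (\<forall>i<n. cube E (v i) (S i) \<and> unit_param (S i) (t i) \<and> unit_param (S i) (t' i)) \<and>
      (\<forall>i. Suc i < n \<longrightarrow> cpt E (v i) (S i) (t' i) = cpt E (v (Suc i)) (S (Suc i)) (t (Suc i))) \<and>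
      (n = 0 \<longrightarrow> p = q) \<and>
      (0 < n \<longrightarrow> cpt E (v 0) (S 0) (t 0) = p \<and> cpt E (v (n - 1)) (S (n - 1)) (t' (n - 1)) = q)"
  using assms
proof induction
  case (reach_refl p)
  show ?case by (rule exI[of _ 0]) simp
next
  case (reach_step p v0 S0 t0 l t0')
  then obtain n v S t t' where *: "l = (\<Sum>i<n. cube_dist (S i) (t i) (t' i))"
      "\<forall>i<n. cube E (v i) (S i) \<and> unit_param (S i) (t i) \<and> unit_param (S i) (t' i)"
      "\<forall>i. Suc i < n \<longrightarrow> cpt E (v i) (S i) (t' i) = cpt E (v (Suc i)) (S (Suc i)) (t (Suc i))"
      "n = 0 \<longrightarrow> p = cpt E v0 S0 t0"
      "0 < n \<longrightarrow> cpt E (v 0) (S 0) (t 0) = p \<and> cpt E (v (n - 1)) (S (n - 1)) (t' (n - 1)) = cpt E v0 S0 t0"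
    by blast
  show ?case
  proof (rule exI[of _ "Suc n"], rule exI[of _ "v(n := v0)"], rule exI[of _ "S(n := S0)"],
      rule exI[of _ "t(n := t0)"], rule exI[of _ "t'(n := t0')"], intro conjI)
    show "\<forall>i. Suc i < Suc n \<longrightarrow> cpt E ((v(n := v0)) i) ((S(n := S0)) i) ((t'(n := t0')) i) =
        cpt E ((v(n := v0)) (Suc i)) ((S(n := S0)) (Suc i)) ((t(n := t0)) (Suc i))"
    proof (intro allI impI)
      fix i assume i: "Suc i < Suc n"
      show "cpt E ((v(n := v0)) i) ((S(n := S0)) i) ((t'(n := t0')) i) =
        cpt E ((v(n := v0)) (Suc i)) ((S(n := S0)) (Suc i)) ((t(n := t0)) (Suc i))"
      proof (cases "Suc i = n")
        case True
        then have "n - 1 = i" by simp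
        then show ?thesis using *(5) True by auto
      next
        case False
        then show ?thesis using *(3) i by auto
      qed
    qed
    show "0 < Suc n \<longrightarrow> cpt E ((v(n := v0)) 0) ((S(n := S0)) 0) ((t(n := t0)) 0) = p \<and>
      cpt E ((v(n := v0)) (Suc n - 1)) ((S(n := S0)) (Suc n - 1)) ((t'(n := t0')) (Suc n - 1)) = cpt E v0 S0 t0'"
      using *(4,5) by (cases "n = 0") auto
  qed (use * reach_step in \<open>auto simp: less_Suc_eq\<close>)
qed

lemma rdist_eq: "rd p q = Inf {l. reach p q l}"
  unfolding rdist_def
proof (rule arg_cong[where f = Inf], rule set_eqI, unfold mem_Collect_eq)
  fix l :: real
  show "(\<exists>n v S t t'. l = (\<Sum>i<n. cube_dist (S i) (t i) (t' i)) \<and>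
      (\<forall>i<n. cube E (v i) (S i) \<and> unit_param (S i) (t i) \<and> unit_param (S i) (t' i)) \<and>
      (\<forall>i. Suc i < n \<longrightarrow> cpt E (v i) (S i) (t' i) = cpt E (v (Suc i)) (S (Suc i)) (t (Suc i))) \<and>
      (n = 0 \<longrightarrow> p = q) \<and>
      (0 < n \<longrightarrow> cpt E (v 0) (S 0) (t 0) = p \<and> cpt E (v (n - 1)) (S (n - 1)) (t' (n - 1)) = q)) \<longleftrightarrow> reach p q l"
    (is "?L \<longleftrightarrow> _")
  proof
    assume ?L
    then obtain n v S t t' where l: "l = (\<Sum>i<n. cube_dist (S i) (t i) (t' i))" and
      "\<forall>i<n. cube E (v i) (S i) \<and> unit_param (S i) (t i) \<and> unit_param (S i) (t' i)"
      "\<forall>i. Suc i < n \<longrightarrow> cpt E (v i) (S i) (t' i) = cpt E (v (Suc i)) (S (Suc i)) (t (Suc i))"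
      "n = 0 \<longrightarrow> p = q" "0 < n \<longrightarrow> cpt E (v 0) (S 0) (t 0) = p \<and> cpt E (v (n - 1)) (S (n - 1)) (t' (n - 1)) = q"
      by (elim exE conjE)
    then show "reach p q l" unfolding l by (intro reach_of_string)
  qed (rule string_of_reach)
qed

lemma reach_ge0: "reach p q l \<Longrightarrow> 0 \<le> l"
  by (induction rule: reach.induct) (auto simp: cube_dist_ge0)

lemma reach_trans: "reach q r l' \<Longrightarrow> reach p q l \<Longrightarrow> reach p r (l + l')"
proof (induction rule: reach.induct)
  case (reach_step q v S t l' t')
  then show ?case using reach.reach_step[of p v S t "l + l'" t'] by (simp add: add.assoc)
qed simp

lemma reach_cube:
  "cube E v S \<Longrightarrow> unit_param S t \<Longrightarrow> unit_param S t' \<Longrightarrow> reach (cpt E v S t) (cpt E v S t') (cube_dist S t t')"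
  using reach_step[OF reach_refl] by force

lemma reach_sym: "reach p q l \<Longrightarrow> reach q p l"
proof (induction rule: reach.induct)
  case (reach_step p v S t l t')
  then have "reach (cpt E v S t') (cpt E v S t) (cube_dist S t t')" using reach_cube cube_dist_sym by metis
  then show ?case using reach_trans[OF reach_step.IH] by (metis add.commute)
qed (rule reach_refl)

lemma cube_0: "cube E v {}"
  by (simp add: cube_def)

lemma cpt_0: "cube E v S \<Longrightarrow> cpt E v S (\<lambda>_. 0) = vtx E v"
  by (rule ext) (auto simp: cpt_def vtx_def cube_def halfspaces_def)

lemma vtx_R: "vtx E v \<in> R"
  unfolding realization_def using cpt_0[OF cube_0] cube_0 by (auto simp: unit_param_def intro!: exI[of _ v] exI[of _ "{}"] exI[of _ "\<lambda>_. 0"])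

lemma cpt_R: "cube E v S \<Longrightarrow> unit_param S t \<Longrightarrow> cpt E v S t \<in> R"
  unfolding realization_def by blast

lemma R_cases:
  assumes "p \<in> R"
  obtains v S t where "p = cpt E v S t" "cube E v S" "unit_param S t"
  using assms unfolding realization_def by blast

lemma cpt_in_S: "k \<in> S \<Longrightarrow> cpt E v S t k = t k"
  by (simp add: cpt_def)

lemma cpt_cong: "(\<And>k. k \<in> S \<Longrightarrow> t k = t' k) \<Longrightarrow> cpt E v S t = cpt E v S t'"
  by (rule ext) (auto simp: cpt_def)

lemma cpt_self: "cpt E v S (cpt E v S t) = cpt E v S t"
  by (rule cpt_cong) (simp add: cpt_in_S)

lemma reach_edge:
  assumes "E u w"
  shows "reach (vtx E u) (vtx E w) 1"
proof -
  let ?h = "W w u"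
  have h: "?h \<in> H" "w \<in> ?h" "u \<notin> ?h"
    using W_halfspace[OF E_sym[OF assms]] assms d_1[of w u] E_sym by (auto simp: W_def)
  have c: "cube E u {?h}" using h assms by (auto simp: cube_def)
  have "cpt E u {?h} (\<lambda>_. 1) = vtx E w"
  proof
    fix k
    have "u \<in> k \<longleftrightarrow> w \<in> k" if k: "k \<in> H" "k \<noteq> ?h" "- k \<noteq> ?h"
    proof (rule ccontr)
      assume "\<not> ?thesis"
      then consider "w \<in> k" "u \<notin> k" | "w \<in> - k" "u \<notin> - k" by auto
      then show False using H_eq_W[of k w u] H_eq_W[of "- k" w u] k H_compl assms E_sym by cases auto
    qed
    moreover have "- ?h \<in> H" using h H_compl by blast
    ultimately show "cpt E u {?h} (\<lambda>_. 1) k = vtx E w k"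
      using h by (auto simp: cpt_def vtx_def)
  qed
  moreover have "cube_dist {?h} (\<lambda>_. 0) (\<lambda>_. 1) = 1" by (simp add: cube_dist_def)
  ultimately show ?thesis
    using reach_cube[OF c, of "\<lambda>_. 0" "\<lambda>_. 1"] cpt_0[OF c] by (simp add: unit_param_def)
qed

lemma reach_vtx: "reach (vtx E u) (vtx E w) (real (d u w))"
proof (induction "d u w" arbitrary: u)
  case 0
  then show ?case using reach_refl by simp
next
  case (Suc n)
  obtain z where z: "E u z" "d z w = n" using d_step Suc(2) by metis
  have "reach (vtx E u) (vtx E w) (1 + real (d z w))"
    by (rule reach_trans[OF Suc(1) reach_edge]) (use z in auto)
  moreover have "real (d u w) = 1 + real (d z w)" using z(2) Suc(2) by (metis of_nat_Suc)
  ultimately show ?case by simp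
qed

lemma cube_vtx_dist:
  assumes "cube E v S" "unit_param S t"
  shows "cube_dist S t (\<lambda>_. 0) \<le> real (card S)"
proof -
  have "(\<Sum>k\<in>S. \<bar>t k - 0\<bar>) \<le> (\<Sum>k\<in>S. 1)"
    using assms(2) by (intro sum_mono) (auto simp: unit_param_def)
  then show ?thesis using cube_dist_L1[of S t "\<lambda>_. 0"] by simp
qed

lemma unit_0: "unit_param S (\<lambda>_. 0)"
  by (simp add: unit_param_def)

lemma R_reach: "p \<in> R \<Longrightarrow> q \<in> R \<Longrightarrow> \<exists>l. reach p q l"
proof -
  have v: "\<exists>v l. reach (vtx E v) p l" if "p \<in> R" for p
    using R_cases[OF that] reach_cube[OF _ unit_0] cpt_0 by metis
  assume "p \<in> R" "q \<in> R"
  then obtain v l v' l' where "reach (vtx E v) p l" "reach (vtx E v') q l'" using v by blast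
  then show ?thesis using reach_sym reach_trans reach_vtx by blast
qed

lemma bdd_reach: "bdd_below {l. reach p q l}"
  using reach_ge0 by (auto intro!: bdd_belowI[of _ 0])

lemma rd_le: "reach p q l \<Longrightarrow> rd p q \<le> l"
  unfolding rdist_eq by (rule cInf_lower) (use bdd_reach in auto)

lemma rd_approx:
  assumes "p \<in> R" "q \<in> R" "\<epsilon> > 0"
  obtains l where "reach p q l" "l < rd p q + \<epsilon>"
proof -
  have "{l. reach p q l} \<noteq> {}" using R_reach assms by blast
  moreover have "Inf {l. reach p q l} < rd p q + \<epsilon>" using assms by (simp add: rdist_eq)
  ultimately have "\<exists>l\<in>{l. reach p q l}. l < rd p q + \<epsilon>"
    using cInf_less_iff[OF _ bdd_reach] by blast
  then show ?thesis using that by blast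
qed

lemma rd_ge:
  assumes "p \<in> R" "q \<in> R" "\<And>l. reach p q l \<Longrightarrow> c \<le> l"
  shows "c \<le> rd p q"
  unfolding rdist_eq by (rule cInf_greatest) (use R_reach assms in auto)

lemma rd_ge0: "p \<in> R \<Longrightarrow> q \<in> R \<Longrightarrow> 0 \<le> rd p q"
  by (rule rd_ge) (auto simp: reach_ge0)

lemma rd_self: "p \<in> R \<Longrightarrow> rd p p = 0"
  using rd_le[OF reach_refl, of p] rd_ge0[of p p] by simp

lemma rd_sym: "rd p q = rd q p"
proof -
  have "{l. reach p q l} = {l. reach q p l}" using reach_sym by blast
  then show ?thesis by (simp add: rdist_eq)
qed

lemma rd_tri:
  assumes "p \<in> R" "q \<in> R" "r \<in> R"
  shows "rd p r \<le> rd p q + rd q r"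
proof (rule field_le_epsilon)
  fix \<epsilon> :: real assume "\<epsilon> > 0"
  then obtain l l' where "reach p q l" "l < rd p q + \<epsilon>/2" "reach q r l'" "l' < rd q r + \<epsilon>/2"
    using rd_approx[OF assms(1,2), of "\<epsilon>/2"] rd_approx[OF assms(2,3), of "\<epsilon>/2"] by (metis half_gt_zero)
  moreover then have "rd p r \<le> l + l'" using rd_le reach_trans by blast
  ultimately show "rd p r \<le> rd p q + rd q r + \<epsilon>" by linarith
qed

lemma rd_vtx: "rd (vtx E u) (vtx E w) \<le> real (d u w)"
  using rd_le reach_vtx by blast

lemma rd_cpt: "cube E v S \<Longrightarrow> unit_param S t \<Longrightarrow> unit_param S t' \<Longrightarrow> rd (cpt E v S t) (cpt E v S t') \<le> cube_dist S t t'"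
  using rd_le reach_cube by blast

text \<open>Lower bounds for the length metric are obtained by testing: a function that is
  1-Lipschitz on each single cube is 1-Lipschitz along every string.\<close>

lemma reach_lipschitz:
  assumes "reach p q l" "\<And>v S t t'. cube E v S \<Longrightarrow> unit_param S t \<Longrightarrow> unit_param S t' \<Longrightarrow>
    \<bar>F (cpt E v S t) - F (cpt E v S t')\<bar> \<le> cube_dist S t t'"
  shows "\<bar>F p - F q :: real\<bar> \<le> l"
  using assms(1)
proof induction
  case (reach_step p v S t l t')
  then show ?case using assms(2)[of v S t t'] by linarith
qed simp

lemma rd_lipschitz:
  assumes "p \<in> R" "q \<in> R" "\<And>v S t t'. cube E v S \<Longrightarrow> unit_param S t \<Longrightarrow> unit_param S t' \<Longrightarrow>
    \<bar>F (cpt E v S t) - F (cpt E v S t')\<bar> \<le> cube_dist S t t'"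
  shows "\<bar>F p - F q :: real\<bar> \<le> rd p q"
  by (rule rd_ge[OF assms(1,2)]) (rule reach_lipschitz[OF _ assms(3)])

lemma cpt_diff_coord:
  assumes "cube E v S"
  shows "\<bar>cpt E v S t k - cpt E v S t' k\<bar> \<le> cube_dist S t t'"
  using assms cube_dist_coord[of S k t t'] cube_dist_coord[of S "- k" t t'] cube_dist_ge0[of S t t']
  by (auto simp: cpt_def cube_def abs_minus_commute)

lemma coord_lipschitz: "p \<in> R \<Longrightarrow> q \<in> R \<Longrightarrow> \<bar>p k - q k\<bar> \<le> rd p q"
  by (rule rd_lipschitz[where F = "\<lambda>p. p k"]) (auto intro: cpt_diff_coord)

lemma coord_bounds: "p \<in> R \<Longrightarrow> 0 \<le> p k \<and> p k \<le> 1"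
  by (erule R_cases) (auto simp: cpt_def vtx_def unit_param_def)

text \<open>The half-spaces of a cube are pairwise transverse, so at most one member of a nested
  chain is, up to complement, a direction of it. On one cube the sum therefore changes by a single
  coordinate.\<close>

lemma chain_lipschitz:
  assumes "finite N" "inj_on c N" "\<And>i. i \<in> N \<Longrightarrow> c i \<in> H" "\<And>i j. i \<in> N \<Longrightarrow> j \<in> N \<Longrightarrow> c i \<subseteq> c j \<or> c j \<subseteq> c i"
    "p \<in> R" "q \<in> R"
  shows "\<bar>(\<Sum>i\<in>N. p (c i)) - (\<Sum>i\<in>N. q (c i))\<bar> \<le> rd p q"
proof (rule rd_lipschitz[where F = "\<lambda>p. \<Sum>i\<in>N. p (c i)", OF assms(5,6)])
  fix v S t t' assume c: "cube E v S" "unit_param S t" "unit_param S t'"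
  let ?C = "\<lambda>i. c i \<in> S \<or> - c i \<in> S"
  have one: "i = j" if "i \<in> N" "j \<in> N" "?C i" "?C j" for i j
  proof (rule ccontr)
    assume "i \<noteq> j"
    then have ne: "c i \<noteq> c j" using assms(2) that by (auto simp: inj_on_def)
    have nt: "\<not> transverse (c i) (c j)" "\<not> transverse (c i) (- c j)" "\<not> transverse (- c i) (c j)" "\<not> transverse (- c i) (- c j)"
      using assms(4)[OF that(1,2)] by (auto simp: transverse_def)
    have "c i \<noteq> - c j" using assms(4)[OF that(1,2)] assms(3)[OF that(1)] assms(3)[OF that(2)] H_ne[of "c i"] H_ne[of "c j"] by auto
    moreover have "transverse h k" if "h \<in> S" "k \<in> S" "h \<noteq> k" for h k using c(1) that unfolding cube_def by blast
    moreover have "c i \<noteq> - c j" "- c i \<noteq> c j" "- c i \<noteq> - c j" using \<open>c i \<noteq> - c j\<close> ne by auto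
    ultimately show False using that(3,4) nt ne by meson
  qed
  have zero: "cpt E v S t (c i) = cpt E v S t' (c i)" if "\<not> ?C i" for i using that by (simp add: cpt_def)
  show "\<bar>(\<Sum>i\<in>N. cpt E v S t (c i)) - (\<Sum>i\<in>N. cpt E v S t' (c i))\<bar> \<le> cube_dist S t t'"
  proof (cases "\<exists>i\<in>N. ?C i")
    case True
    then obtain i where i: "i \<in> N" "?C i" by blast
    have "(\<Sum>j\<in>N. cpt E v S t (c j) - cpt E v S t' (c j)) = cpt E v S t (c i) - cpt E v S t' (c i)"
    proof (subst sum.remove[OF assms(1) i(1)])
      have "(\<Sum>j\<in>N - {i}. cpt E v S t (c j) - cpt E v S t' (c j)) = 0"
      proof (rule sum.neutral, rule ballI)
        fix j assume j: "j \<in> N - {i}"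
        then have "\<not> ?C j" using one[of j i] i by blast
        then show "cpt E v S t (c j) - cpt E v S t' (c j) = 0" using zero by simp
      qed
      then show "cpt E v S t (c i) - cpt E v S t' (c i) + (\<Sum>j\<in>N - {i}. cpt E v S t (c j) - cpt E v S t' (c j)) =
        cpt E v S t (c i) - cpt E v S t' (c i)" by simp
    qed
    then show ?thesis using cpt_diff_coord[OF c(1)] by (simp add: sum_subtractf)
  next
    case False
    then have "(\<Sum>i\<in>N. cpt E v S t (c i)) = (\<Sum>i\<in>N. cpt E v S t' (c i))" using zero by (intro sum.cong) auto
    then show ?thesis using cube_dist_ge0 by simp
  qed
qed

lemma unit_convex:
  assumes "unit_param S t" "unit_param S t'" "0 \<le> u" "u \<le> 1"
  shows "unit_param S (\<lambda>h. t h + u * (t' h - t h))"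
  unfolding unit_param_def
proof (intro ballI conjI)
  fix k assume "k \<in> S"
  then have b: "0 \<le> t k" "t k \<le> 1" "0 \<le> t' k" "t' k \<le> 1" using assms by (auto simp: unit_param_def)
  have e: "t k + u * (t' k - t k) = (1 - u) * t k + u * t' k" by (simp add: algebra_simps)
  show "0 \<le> t k + u * (t' k - t k)" unfolding e using b assms by simp
  have "(1 - u) * t k + u * t' k \<le> (1 - u) * 1 + u * 1" using b assms by (intro add_mono mult_left_mono) auto
  then show "t k + u * (t' k - t k) \<le> 1" unfolding e by simp
qed

text \<open>A string is traversed at unit speed, each segment linearly in its cube.\<close>

lemma reach_path:
  assumes "reach p q l" "p \<in> R"
  shows "\<exists>f. f 0 = p \<and> f l = q \<and> (\<forall>s. 0 \<le> s \<longrightarrow> s \<le> l \<longrightarrow> f s \<in> R) \<and>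
    (\<forall>s s'. 0 \<le> s \<longrightarrow> s \<le> s' \<longrightarrow> s' \<le> l \<longrightarrow> rd (f s) (f s') \<le> s' - s)"
  using assms
proof induction
  case (reach_refl p)
  then show ?case by (intro exI[of _ "\<lambda>_. p"]) (auto simp: rd_self)
next
  case (reach_step p v S t l t')
  then obtain f where f: "f 0 = p" "f l = cpt E v S t" "\<And>s. 0 \<le> s \<Longrightarrow> s \<le> l \<Longrightarrow> f s \<in> R"
    "\<And>s s'. 0 \<le> s \<Longrightarrow> s \<le> s' \<Longrightarrow> s' \<le> l \<Longrightarrow> rd (f s) (f s') \<le> s' - s" by blast
  let ?c = "cube_dist S t t'"
  have l0: "0 \<le> l" using reach_ge0 reach_step by blast
  have fin: "finite S" using reach_step by (simp add: cube_def)
  show ?case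
  \<comment> \<open>A segment of length zero cannot be parametrised by its length, but its two ends
    coincide.\<close>
  proof (cases "?c = 0")
    case True
    then have "t k = t' k" if "k \<in> S" for k using cube_dist_coord[OF fin that, of t t'] by simp
    then have "cpt E v S t = cpt E v S t'" by (rule cpt_cong)
    then show ?thesis using f True by (intro exI[of _ f]) auto
  next
    case False
    then have c0: "?c > 0" using cube_dist_ge0[of S t t'] by simp
    define m where "m s = cpt E v S (\<lambda>h. t h + ((s - l) / ?c) * (t' h - t h))" for s
    have mu: "unit_param S (\<lambda>h. t h + ((s - l) / ?c) * (t' h - t h))" if "l \<le> s" "s \<le> l + ?c" for s
      by (rule unit_convex) (use that c0 reach_step in \<open>auto simp: divide_simps\<close>)
    have mR: "m s \<in> R" if "l \<le> s" "s \<le> l + ?c" for s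
      unfolding m_def by (rule cpt_R) (use mu that reach_step in auto)
    have md: "rd (m s) (m s') \<le> s' - s" if "l \<le> s" "s \<le> s'" "s' \<le> l + ?c" for s s'
    proof -
      have "rd (m s) (m s') \<le> \<bar>(s - l) / ?c - (s' - l) / ?c\<bar> * ?c"
        unfolding m_def cube_dist_scale[symmetric] by (rule rd_cpt[OF reach_step(2) mu[of s] mu[of s']]) (use that in auto)
      also have "\<dots> = s' - s" using c0 that by (simp add: field_simps flip: diff_divide_distrib abs_mult_pos)
      finally show ?thesis .
    qed
    have ml: "m l = f l" by (simp add: m_def f)
    have me: "m (l + ?c) = cpt E v S t'" using c0 by (simp add: m_def)
    let ?f = "\<lambda>s. if s \<le> l then f s else m s"
    have fR: "?f s \<in> R" if "0 \<le> s" "s \<le> l + ?c" for s using f(3) mR that by auto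
    have "rd (?f s) (?f s') \<le> s' - s" if s: "0 \<le> s" "s \<le> s'" "s' \<le> l + ?c" for s s'
    proof -
      consider "s' \<le> l" | "s \<le> l" "l < s'" | "l < s" by linarith
      then show ?thesis
      proof cases
        case 2
        have "rd (f s) (m s') \<le> rd (f s) (f l) + rd (m l) (m s')"
          unfolding ml by (rule rd_tri) (use f(3) mR[of s'] 2 s l0 in auto)
        also have "\<dots> \<le> (l - s) + (s' - l)" using f(4)[of s l] md[of l s'] 2 s by (intro add_mono) auto
        finally show ?thesis using 2 by simp
      qed (use f(4) md s in auto)
    qed
    then show ?thesis using f(1) fR me l0 c0 by (intro exI[of _ ?f]) auto
  qed
qed

end

section \<open>Isometric action on the realization\<close>

context cc_act begin

lemma pact_vtx: "pact act g (vtx E v) = vtx E (act g v)"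
  by (rule ext) (auto simp: pact_def vtx_def tr_iff)

lemma pact_cpt: "pact act g (cpt E v S t) = cpt E (act g v) (tr g ` S) (\<lambda>k. t (tr (- g) k))"
proof
  fix h
  have *: "h \<in> tr g ` S \<longleftrightarrow> tr (- g) h \<in> S" for h
  proof
    assume "tr (- g) h \<in> S"
    then have "tr g (tr (- g) h) \<in> tr g ` S" by (rule imageI)
    then show "h \<in> tr g ` S" by simp
  qed auto
  show "pact act g (cpt E v S t) h = cpt E (act g v) (tr g ` S) (\<lambda>k. t (tr (- g) k)) h"
    using *[of h] *[of "- h"] fun_cong[OF pact_vtx[of g v], of h] by (simp add: pact_def cpt_def tr_compl)
qed

lemma cube_tr: "cube E v S \<Longrightarrow> cube E (act g v) (tr g ` S)"
  unfolding cube_def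
proof (elim conjE, intro conjI ballI impI)
  assume c: "finite S" "S \<subseteq> H" "\<forall>k\<in>S. v \<notin> k \<and> (\<exists>w. E v w \<and> w \<in> k)" "\<forall>h\<in>S. \<forall>k\<in>S. h \<noteq> k \<longrightarrow> transverse h k"
  show "\<exists>w. E (act g v) w \<and> w \<in> k" if k: "k \<in> tr g ` S" for k
  proof -
    obtain k0 where k0: "k0 \<in> S" "k = tr g k0" using k by blast
    then obtain w where "E v w" "w \<in> k0" using bspec[OF c(3) k0(1)] by blast
    then show ?thesis using k0 act_E by (intro exI[of _ "act g w"]) auto
  qed
  show "transverse h k" if hk: "h \<in> tr g ` S" "k \<in> tr g ` S" "h \<noteq> k" for h k
  proof -
    obtain h0 k0 where 0: "h0 \<in> S" "h = tr g h0" "k0 \<in> S" "k = tr g k0" using hk by blast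
    then have "transverse h0 k0" using c(4) hk by auto
    then show ?thesis unfolding transverse_def 0 tr_compl[symmetric] by (simp add: tr_empty_Int)
  qed
qed auto

lemma cube_dist_tr: "cube_dist (tr g ` S) (\<lambda>k. t (tr (- g) k)) (\<lambda>k. t' (tr (- g) k)) = cube_dist S t t'"
  unfolding cube_dist_def by (subst sum.reindex) (auto simp: inj_on_def)

lemma unit_tr: "unit_param S t \<Longrightarrow> unit_param (tr g ` S) (\<lambda>k. t (tr (- g) k))"
  by (auto simp: unit_param_def)

lemma reach_pact: "reach p q l \<Longrightarrow> reach (pact act g p) (pact act g q) l"
proof (induction rule: reach.induct)
  case (reach_step p v S t l t')
  have "reach (pact act g p) (cpt E (act g v) (tr g ` S) (\<lambda>k. t' (tr (- g) k)))
    (l + cube_dist (tr g ` S) (\<lambda>k. t (tr (- g) k)) (\<lambda>k. t' (tr (- g) k)))"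
    by (rule reach.reach_step) (use reach_step in \<open>auto simp: cube_tr unit_tr simp flip: pact_cpt\<close>)
  then show ?case by (simp add: cube_dist_tr pact_cpt)
qed (rule reach_refl)

lemma pact_minus: "p \<in> R \<Longrightarrow> pact act (- g) (pact act g p) = p"
  by (rule ext) (simp add: pact_def image_image)

lemma pact_R: "p \<in> R \<Longrightarrow> pact act g p \<in> R"
  by (erule R_cases) (simp add: pact_cpt cpt_R cube_tr unit_tr)

lemma rd_pact: "p \<in> R \<Longrightarrow> q \<in> R \<Longrightarrow> rd (pact act g p) (pact act g q) = rd p q"
proof (rule antisym)
  have le: "rd (pact act g p) (pact act g q) \<le> rd p q" if "p \<in> R" "q \<in> R" for g p q
    by (rule rd_ge) (use that reach_pact rd_le in auto)
  assume "p \<in> R" "q \<in> R"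
  then show "rd (pact act g p) (pact act g q) \<le> rd p q" "rd p q \<le> rd (pact act g p) (pact act g q)"
    using le[of p q g] le[of "pact act g p" "pact act g q" "- g"] pact_R pact_minus by auto
qed

lemma rd_cube_vertex:
  assumes "cube E v S" "unit_param S t"
  shows "rd (cpt E v S t) (vtx E v) \<le> D"
proof -
  have "rd (cpt E v S t) (cpt E v S (\<lambda>_. 0)) \<le> cube_dist S t (\<lambda>_. 0)" by (rule rd_cpt[OF assms unit_0])
  also have "\<dots> \<le> real (card S)" by (rule cube_vtx_dist[OF assms])
  also have "\<dots> \<le> D" using cube_card[OF assms(1)] by simp
  finally show ?thesis using cpt_0[OF assms(1)] by simp
qed

end

section \<open>A geodesic ray along an axis\<close>

lemma common_convergent_subsequence:
  fixes X :: "nat \<Rightarrow> 'i \<Rightarrow> real"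
  assumes I: "countable I" and bd: "\<And>n i. i \<in> I \<Longrightarrow> \<bar>X n i\<bar> \<le> C"
  obtains \<phi> where "strict_mono \<phi>" "\<And>i. i \<in> I \<Longrightarrow> convergent (\<lambda>n. X (\<phi> n) i)"
proof (cases "I = {}")
  case True
  then show ?thesis using that[of id] by (simp add: strict_mono_id)
next
  case False
  let ?r = "from_nat_into I"
  have r: "?r n \<in> I" for n using False by (rule from_nat_into)
  let ?P = "\<lambda>n s. convergent (\<lambda>k. X (s k) (?r n))"
  interpret nat: subseqs ?P
  proof
    fix n :: nat and s :: "nat \<Rightarrow> nat" assume s: "strict_mono s"
    have "X (s k) (?r n) \<in> {-C..C}" for k using bd[OF r, of "s k" n] by (simp add: abs_le_iff)
    then obtain l s' where "strict_mono s'" "((\<lambda>k. X (s k) (?r n)) \<circ> s') \<longlonglongrightarrow> l"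
      using compact_Icc compact_imp_seq_compact seq_compactE by metis
    then show "\<exists>r'. strict_mono r' \<and> convergent (\<lambda>k. X ((s \<circ> r') k) (?r n))"
      by (auto simp: comp_def convergent_def)
  qed
  have "?P n nat.diagseq" for n
  proof -
    have "?P n (nat.seqseq (Suc n))" by (rule nat.seqseq_holds)
    then have "convergent ((\<lambda>k. X (nat.seqseq (Suc n) k) (?r n)) \<circ> (\<lambda>k. nat.fold_reduce (Suc n) k (Suc n + k)))"
      by (rule convergent_subseq_convergent) (rule nat.subseq_diagonal_rest)
    moreover have "(\<lambda>k. X (nat.seqseq (Suc n) k) (?r n)) \<circ> (\<lambda>k. nat.fold_reduce (Suc n) k (Suc n + k)) =
        (\<lambda>k. X ((nat.diagseq \<circ> ((+) (Suc n))) k) (?r n))"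
      unfolding nat.diagseq_seqseq by auto
    ultimately obtain L where "(\<lambda>k. X (nat.diagseq (k + Suc n)) (?r n)) \<longlonglongrightarrow> L"
      by (auto simp: add.commute dest: convergentD)
    then have "(\<lambda>k. X (nat.diagseq k) (?r n)) \<longlonglongrightarrow> L" by (rule LIMSEQ_offset)
    then show ?thesis by (rule convergentI)
  qed
  then have "convergent (\<lambda>n. X (nat.diagseq n) i)" if "i \<in> I" for i
    using that from_nat_into_surj[OF I] by metis
  then show ?thesis using that[of nat.diagseq] nat.subseq_diagseq by blast
qed

text \<open>The vertex \<open>b\<close> lies in \<open>tr (- g) a\<close> but outside
  \<open>a\<close>: it is the origin of the ray, and \<open>g\<close> carries it across the first
  wall of the axis.\<close>

locale cc_axis = cc_act E act for E :: "'x::countable \<Rightarrow> 'x \<Rightarrow> bool" and act :: "'g::{group_add,countable} \<Rightarrow> 'x \<Rightarrow> 'x" +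
  fixes g :: 'g and a :: "'x set" and b :: 'x
  assumes aH: "a \<in> H" and ga: "tr g a \<subset> a" and me': "maxend (\<lambda>n. tr (gpow g n) a)"
    and b: "b \<notin> a" "act g b \<in> a"
begin

definition e where "e = (\<lambda>n. tr (gpow g n) a)"

lemma me: "maxend e"
  using me' by (simp add: e_def)

lemma de: "desc e"
  using me by (simp add: maxend_def)

lemma e_0: "e 0 = a"
  by (simp add: e_def)

lemma tr_e: "tr g (e n) = e (Suc n)"
  by (simp add: e_def tr_add)

lemma e_le: "m \<le> n \<Longrightarrow> e n \<subseteq> e m"
  by (rule desc_le[OF de])

lemma b_e: "b \<notin> e n"
  using e_le[of 0 n] b by (auto simp: e_0)

lemma e_H: "e n \<in> H"
  by (rule desc_H[OF de])

text \<open>The half-spaces separating \<open>b\<close> from the end of the axis. They and their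
  complements are the coordinates kept by \<open>ret\<close>.\<close>

definition U where "U = {k \<in> H. b \<notin> k \<and> (\<exists>m. e m \<subseteq> k)}"

lemma e_U: "e n \<in> U"
  unfolding U_def using e_H b_e by blast

lemma U_up: "k \<in> U \<Longrightarrow> k \<subseteq> h \<Longrightarrow> h \<in> H \<Longrightarrow> b \<notin> h \<Longrightarrow> h \<in> U"
  unfolding U_def by blast

lemma U_H: "k \<in> U \<Longrightarrow> k \<in> H" and U_b: "k \<in> U \<Longrightarrow> b \<notin> k"
  by (auto simp: U_def)

lemma sided_U: "sided b U"
  unfolding sided_def
proof (intro conjI ballI)
  fix h k assume "h \<in> U" "k \<in> U"
  then obtain m n where "e m \<subseteq> h" "e n \<subseteq> k" by (auto simp: U_def)
  moreover have "e (max m n) \<subseteq> e m" "e (max m n) \<subseteq> e n" using e_le by auto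
  ultimately show "h \<inter> k \<noteq> {}" using H_ne(1)[OF e_H, of "max m n"] by blast
qed (auto simp: U_def)

text \<open>Infinitely many exceptions would contain a descending chain \<open>c\<close> whose end
  lies above that of \<open>e\<close>. By maximality of \<open>e\<close> the two ends are
  equivalent, so \<open>c\<close> eventually enters \<open>k\<close>.\<close>

lemma cofinite_below:
  assumes "k \<in> U"
  shows "finite {k' \<in> U. \<not> k' \<subseteq> k}"
proof (rule ccontr)
  assume inf: "infinite {k' \<in> U. \<not> k' \<subseteq> k}"
  have "sided b {k' \<in> U. \<not> k' \<subseteq> k}" by (rule sided_mono[OF sided_U]) auto
  then obtain c where c: "desc c" "range c \<subseteq> {k' \<in> U. \<not> k' \<subseteq> k}" using sided_infinite_desc inf by blast
  then have cU: "c n \<in> U" "\<not> c n \<subseteq> k" for n by auto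
  have "dom c e" unfolding dom_def using cU(1) by (simp add: U_def)
  then have "dom e c" using me c by (auto simp: maxend_def)
  moreover obtain m where "e m \<subseteq> k" using assms by (auto simp: U_def)
  ultimately obtain m' where "c m' \<subseteq> k" unfolding dom_def by (meson order_trans)
  then show False using cU by blast
qed

definition pidx :: "'x set \<Rightarrow> nat" where "pidx k = (LEAST m. e m \<subseteq> k)"

lemma e_pidx: "k \<in> U \<Longrightarrow> e (pidx k) \<subseteq> k"
  unfolding pidx_def U_def by (rule LeastI_ex) auto

definition F0 where "F0 = {k \<in> U. act g b \<in> k}"

lemma finite_F0: "finite F0"
proof (rule finite_subset)
  show "F0 \<subseteq> sep (act g b) b" using U_b by (auto simp: F0_def sep_def U_H)
qed (rule finite_sep)

text \<open>Translating by \<open>- g\<close> lowers \<open>pidx\<close> by one and stays in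
  \<open>U\<close> as long as \<open>k\<close> does not contain \<open>act g b\<close>. So
  \<open>U\<close> consists of forward translates of the finitely many members of
  \<open>F0\<close>.\<close>

lemma decomp:
  assumes "k \<in> U"
  shows "\<exists>r. \<exists>k0\<in>F0. k = tr (gpow g r) k0 \<and> pidx k = pidx k0 + r"
  using assms
proof (induction "pidx k" arbitrary: k rule: less_induct)
  case less
  show ?case
  proof (cases "act g b \<in> k")
    case True
    then show ?thesis using less by (intro exI[of _ 0] bexI[of _ k]) (auto simp: F0_def)
  next
    case False
    define k' where "k' = tr (- g) k"
    have k: "k = tr g k'" by (simp add: k'_def)
    have bk': "b \<notin> k'" using False by (simp add: k)
    have iff: "e (Suc m) \<subseteq> k \<longleftrightarrow> e m \<subseteq> k'" for m by (simp add: k flip: tr_e)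
    have n0: "\<not> e 0 \<subseteq> k" using False b by (auto simp: e_0)
    have p: "pidx k = Suc (pidx k')"
      unfolding pidx_def
      using Least_Suc[of "\<lambda>m. e m \<subseteq> k", OF e_pidx[OF less.prems] n0] by (simp add: iff)
    have k'U: "k' \<in> U"
    proof -
      have "e (pidx k') \<subseteq> k'" using e_pidx[OF less.prems] by (simp add: p iff)
      then show ?thesis using bk' U_H[OF less.prems] by (auto simp: U_def k)
    qed
    obtain r k0 where "k0 \<in> F0" "k' = tr (gpow g r) k0" "pidx k' = pidx k0 + r"
      using less.hyps[of k'] k'U p by auto
    then show ?thesis using p by (intro exI[of _ "Suc r"] bexI[of _ k0]) (auto simp: k tr_add)
  qed
qed

definition B where "B = card F0"

text \<open>By \<open>decomp\<close> the level and the representative in \<open>F0\<close> determine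
  the power of \<open>g\<close>, hence the half-space.\<close>

lemma level_card: "finite {k \<in> U. pidx k = n} \<and> card {k \<in> U. pidx k = n} \<le> B"
proof -
  have "{k \<in> U. pidx k = n} \<subseteq> (\<lambda>k0. tr (gpow g (n - pidx k0)) k0) ` F0"
    using decomp by force
  then show ?thesis unfolding B_def
    using finite_F0 by (meson card_image_le card_mono finite_imageI finite_subset order_trans)
qed

lemma finite_levels: "finite {k \<in> U. pidx k \<le> n}"
proof -
  have "{k \<in> U. pidx k \<le> n} = (\<Union>i\<le>n. {k \<in> U. pidx k = i})" by auto
  then show ?thesis using level_card by auto
qed

text \<open>For one orbit of half-spaces: if some translate of \<open>k0\<close> lies in
  \<open>a\<close>, later translates lie correspondingly deep in the axis; if none does,
  \<open>cofinite_below\<close> leaves only finitely many of them in \<open>U\<close>. The bounds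
  are uniform because \<open>F0\<close> is finite.\<close>

lemma width_ex: "\<exists>W. \<forall>k\<in>U. pidx k \<le> W \<or> k \<subseteq> e (pidx k - W)"
proof -
  have ex: "\<exists>w. \<forall>k\<in>U. \<forall>r. k = tr (gpow g r) k0 \<longrightarrow> pidx k = pidx k0 + r \<longrightarrow> pidx k \<le> w \<or> k \<subseteq> e (pidx k - w)" for k0
  proof (cases "\<exists>r0. tr (gpow g r0) k0 \<subseteq> a")
    case True
    then obtain r0 where r0: "tr (gpow g r0) k0 \<subseteq> a" by blast
    show ?thesis
    proof (intro exI[of _ "pidx k0 + r0"] ballI allI impI)
      fix k r assume k: "k \<in> U" "k = tr (gpow g r) k0" "pidx k = pidx k0 + r"
      show "pidx k \<le> pidx k0 + r0 \<or> k \<subseteq> e (pidx k - (pidx k0 + r0))"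
      proof (cases "r \<le> r0")
        case False
        then have r: "r = (r - r0) + r0" by simp
        have "k = tr (gpow g (r - r0)) (tr (gpow g r0) k0)" using k(2) r by (metis gpow_add tr_add)
        also have "\<dots> \<subseteq> tr (gpow g (r - r0)) a" using r0 by simp
        finally show ?thesis using k(3) by (simp add: e_def)
      qed (use k in simp)
    qed
  next
    case False
    have fin: "finite {k \<in> U. \<not> k \<subseteq> a}" using cofinite_below[OF e_U[of 0]] by (simp add: e_0)
    show ?thesis
    proof (intro exI[of _ "Max (pidx ` {k \<in> U. \<not> k \<subseteq> a})"] ballI allI impI)
      fix k r assume k: "k \<in> U" "k = tr (gpow g r) k0"
      then have "pidx k \<in> pidx ` {k \<in> U. \<not> k \<subseteq> a}" using False by auto
      then show "pidx k \<le> Max (pidx ` {k \<in> U. \<not> k \<subseteq> a}) \<or> k \<subseteq> e (pidx k - Max (pidx ` {k \<in> U. \<not> k \<subseteq> a}))"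
        using fin by (intro disjI1 Max_ge) auto
    qed
  qed
  from choice[OF allI[OF ex]] obtain w where
    "\<forall>k0. \<forall>k\<in>U. \<forall>r. k = tr (gpow g r) k0 \<longrightarrow> pidx k = pidx k0 + r \<longrightarrow> pidx k \<le> w k0 \<or> k \<subseteq> e (pidx k - w k0)" ..
  then have w: "pidx k \<le> w k0 \<or> k \<subseteq> e (pidx k - w k0)"
    if "k \<in> U" "k = tr (gpow g r) k0" "pidx k = pidx k0 + r" for k0 k r using that by blast
  show ?thesis
  proof (intro exI[of _ "Max (w ` F0)"] ballI)
    fix k assume k: "k \<in> U"
    obtain r k0 where 0: "k0 \<in> F0" "k = tr (gpow g r) k0" "pidx k = pidx k0 + r" using decomp[OF k] by blast
    have le: "w k0 \<le> Max (w ` F0)" using 0 finite_F0 by simp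
    then have "e (pidx k - w k0) \<subseteq> e (pidx k - Max (w ` F0))" by (intro e_le) simp
    then show "pidx k \<le> Max (w ` F0) \<or> k \<subseteq> e (pidx k - Max (w ` F0))"
      using w[OF k 0(2,3)] le by auto
  qed
qed

definition Wd where "Wd = (SOME W. \<forall>k\<in>U. pidx k \<le> W \<or> k \<subseteq> e (pidx k - W))"

lemma width: "k \<in> U \<Longrightarrow> pidx k \<le> Wd \<or> k \<subseteq> e (pidx k - Wd)"
  using someI_ex[OF width_ex] unfolding Wd_def by blast

definition fl :: "'x \<Rightarrow> nat" where "fl y = card {n. y \<in> e n}"

lemma fl_iff: "y \<in> e n \<longleftrightarrow> n < fl y"
proof -
  obtain N where N: "y \<notin> e N" using desc_escape[OF de, of y] by blast
  define M where "M = (LEAST n. y \<notin> e n)"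
  have M: "y \<notin> e M" unfolding M_def using N by (rule LeastI)
  have lt: "y \<in> e n" if "n < M" for n using not_less_Least[of n "\<lambda>n. y \<notin> e n"] that by (auto simp: M_def)
  have iff: "y \<in> e n \<longleftrightarrow> n < M" for n using lt M by (meson e_le not_le subsetD)
  then show ?thesis by (simp add: fl_def)
qed

lemma pidx_le_fl: "k \<in> U \<Longrightarrow> y \<in> k \<Longrightarrow> pidx k \<le> fl y + Wd"
  using width[of k] fl_iff[of y "pidx k - Wd"] by auto

lemma fl_le_pidx: "k \<in> U \<Longrightarrow> y \<notin> k \<Longrightarrow> fl y \<le> pidx k"
  using e_pidx[of k] fl_iff[of y "pidx k"] by (auto simp: not_less)

text \<open>Keeps the position of \<open>y\<close> with respect to the hyperplanes of
  \<open>U\<close> and takes the side of \<open>b\<close> for all others. Such a vertex exists: the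
  gate of \<open>b\<close> in the intersection of the members of \<open>U\<close> containing
  \<open>y\<close>.\<close>

definition rho :: "'x \<Rightarrow> 'x" where
  "rho y = (SOME z. \<forall>k\<in>H. b \<notin> k \<longrightarrow> (z \<in> k \<longleftrightarrow> k \<in> U \<and> y \<in> k))"

lemma rho_iff: "k \<in> H \<Longrightarrow> b \<notin> k \<Longrightarrow> rho y \<in> k \<longleftrightarrow> k \<in> U \<and> y \<in> k"
proof -
  define \<Phi> where "\<Phi> = {k \<in> U. y \<in> k}"
  have fin: "finite \<Phi>"
    by (rule finite_subset[OF _ finite_sep[of y b]]) (auto simp: \<Phi>_def sep_def U_def)
  have \<Phi>H: "\<Phi> \<subseteq> H" by (auto simp: \<Phi>_def U_def)
  have "gconvex E (\<Inter> \<Phi>)" using \<Phi>H H_convex by (intro convex_Inter) blast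
  moreover have "\<Inter> \<Phi> \<noteq> {}" by (auto simp: \<Phi>_def)
  ultimately obtain c where c: "c \<in> \<Inter> \<Phi>" "\<And>y. y \<in> \<Inter> \<Phi> \<Longrightarrow> c \<in> I b y" using gate[where x = b] by blast
  have "\<exists>z. \<forall>k\<in>H. b \<notin> k \<longrightarrow> (z \<in> k \<longleftrightarrow> k \<in> U \<and> y \<in> k)"
  proof (intro exI[of _ c] ballI impI iffI)
    fix k assume k: "k \<in> H" "b \<notin> k" "c \<in> k"
    then have "\<Inter> \<Phi> \<subseteq> k" using gate_sep[OF c] by (auto simp: sep_def)
    then obtain k1 where k1: "k1 \<in> \<Phi>" "k1 \<subseteq> k"
      using Inter_subset_halfspace[OF fin \<Phi>H _ k(1)] by (auto simp: \<Phi>_def)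
    then show "k \<in> U \<and> y \<in> k" using U_up[of k1 k] k by (auto simp: \<Phi>_def)
  next
    fix k assume "k \<in> U \<and> y \<in> k"
    then show "c \<in> k" using c(1) by (auto simp: \<Phi>_def)
  qed
  then have "\<forall>k\<in>H. b \<notin> k \<longrightarrow> (rho y \<in> k \<longleftrightarrow> k \<in> U \<and> y \<in> k)" unfolding rho_def by (rule someI_ex)
  then show "k \<in> H \<Longrightarrow> b \<notin> k \<Longrightarrow> rho y \<in> k \<longleftrightarrow> k \<in> U \<and> y \<in> k" by blast
qed

lemma rho_in: "k \<in> U \<or> - k \<in> U \<Longrightarrow> rho y \<in> k \<longleftrightarrow> y \<in> k"
  using rho_iff[of k y] rho_iff[of "- k" y] by (auto simp: U_def)

lemma rho_out: "k \<in> H \<Longrightarrow> k \<notin> U \<Longrightarrow> - k \<notin> U \<Longrightarrow> rho y \<in> k \<longleftrightarrow> b \<in> k"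
  using rho_iff[of k y] rho_iff[of "- k" y] H_compl[of k] by auto

lemma rho_b: "rho b = b"
proof (rule ccontr)
  assume "rho b \<noteq> b"
  then obtain h where "h \<in> H" "rho b \<in> h" "b \<notin> h" using H_separates by blast
  then show False using rho_iff by blast
qed

lemma fl_rho: "fl (rho y) = fl y"
  using rho_in[of _ y] e_U by (simp add: fl_def)

text \<open>A half-space of \<open>U\<close> containing \<open>y\<close> but not \<open>y'\<close>
  has index between \<open>fl y'\<close> and \<open>fl y + Wd\<close>, and each index occurs at most
  \<open>B\<close> times; the factor 2 counts both directions.\<close>

lemma d_rho:
  assumes "fl y \<le> fl y' + c" "fl y' \<le> fl y + c"
  shows "d (rho y) (rho y') \<le> 2 * (B * (c + Wd + 1))"
proof -
  have one: "finite {k \<in> U. y \<in> k \<and> y' \<notin> k} \<and> card {k \<in> U. y \<in> k \<and> y' \<notin> k} \<le> B * (c + Wd + 1)"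
    if "fl y \<le> fl y' + c" for y y'
  proof -
    let ?J = "{fl y'..fl y' + c + Wd}"
    have sub: "{k \<in> U. y \<in> k \<and> y' \<notin> k} \<subseteq> (\<Union>n\<in>?J. {k \<in> U. pidx k = n})"
      using pidx_le_fl[of _ y] fl_le_pidx[of _ y'] that by fastforce
    have fin: "finite (\<Union>n\<in>?J. {k \<in> U. pidx k = n})" using level_card by auto
    have "card (\<Union>n\<in>?J. {k \<in> U. pidx k = n}) \<le> (\<Sum>n\<in>?J. card {k \<in> U. pidx k = n})" by (rule card_UN_le) simp
    also have "\<dots> \<le> (\<Sum>n\<in>?J. B)" by (rule sum_mono) (use level_card in auto)
    also have "\<dots> = B * (c + Wd + 1)" by simp
    finally show ?thesis using card_mono[OF fin sub] finite_subset[OF sub fin] by linarith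
  qed
  let ?A = "{k \<in> U. y \<in> k \<and> y' \<notin> k}" and ?B = "{k \<in> U. y' \<in> k \<and> y \<notin> k}"
  have sub: "sep (rho y) (rho y') \<subseteq> ?A \<union> uminus ` ?B"
  proof
    fix k assume "k \<in> sep (rho y) (rho y')"
    then have k: "k \<in> H" "rho y \<in> k" "rho y' \<notin> k" by (auto simp: sep_def)
    then consider "k \<in> U" | "- k \<in> U" using rho_out by blast
    then show "k \<in> ?A \<union> uminus ` ?B"
    proof cases
      case 2
      then have "- k \<in> ?B" using rho_in[of k] k by auto
      then have "- (- k) \<in> uminus ` ?B" by (rule imageI)
      then show ?thesis by simp
    qed (use rho_in[of k] k in auto)
  qed
  have "card (sep (rho y) (rho y')) \<le> card (?A \<union> uminus ` ?B)"
    using sub one[OF assms(1)] one[OF assms(2)] by (intro card_mono) auto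
  also have "\<dots> \<le> card ?A + card (uminus ` ?B)" by (rule card_Un_le)
  also have "card (uminus ` ?B) = card ?B" by (rule card_image) (auto simp: inj_on_def)
  finally show ?thesis using card_sep one[OF assms(1)] one[OF assms(2)] by auto
qed

text \<open>\<open>rho y\<close> is determined by the members of \<open>U\<close> containing it, all
  of index at most \<open>c + Wd\<close>.\<close>

lemma finite_rho: "finite {rho y | y. fl y \<le> c}"
proof (rule finite_imageD)
  show "inj_on (\<lambda>z. {k \<in> U. z \<in> k}) {rho y | y. fl y \<le> c}"
  proof (rule inj_onI)
    fix z z' assume z: "z \<in> {rho y | y. fl y \<le> c}" "z' \<in> {rho y | y. fl y \<le> c}" "{k \<in> U. z \<in> k} = {k \<in> U. z' \<in> k}"
    then obtain y y' where y: "z = rho y" "z' = rho y'" by blast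
    have eq: "z \<in> k \<longleftrightarrow> z' \<in> k" if "k \<in> U" for k using z(3) that by blast
    show "z = z'"
    proof (rule ccontr)
      assume "z \<noteq> z'"
      then obtain h where h: "h \<in> H" "z \<in> h" "z' \<notin> h" using H_separates by blast
      then show False using eq[of h] eq[of "- h"] rho_out[of h] y by auto
    qed
  qed
  have "(\<lambda>z. {k \<in> U. z \<in> k}) ` {rho y | y. fl y \<le> c} \<subseteq> Pow {k \<in> U. pidx k \<le> c + Wd}"
    using pidx_le_fl rho_in by fastforce
  then show "finite ((\<lambda>z. {k \<in> U. z \<in> k}) ` {rho y | y. fl y \<le> c})"
    using finite_levels finite_subset by blast
qed

text \<open>Extends \<open>rho\<close> to the realization by freezing all other coordinates at
  \<open>b\<close>. A cube with directions \<open>S\<close> is projected to one with directions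
  \<open>rS S\<close>, so lengths of strings do not grow.\<close>

definition ret :: "('x set \<Rightarrow> real) \<Rightarrow> 'x set \<Rightarrow> real" where
  "ret p = (\<lambda>h. if h \<in> U \<or> - h \<in> U then p h else vtx E b h)"

abbreviation rS where "rS S \<equiv> {k \<in> S. k \<in> U \<or> - k \<in> U}"

lemma rho_edge:
  assumes "E v w" "k \<in> H" "w \<in> k" "v \<notin> k" "k \<in> U \<or> - k \<in> U"
  shows "E (rho v) (rho w)"
proof -
  have "sep (rho w) (rho v) = {k}"
  proof (intro equalityI subsetI)
    fix h assume "h \<in> sep (rho w) (rho v)"
    then have h: "h \<in> H" "rho w \<in> h" "rho v \<notin> h" by (auto simp: sep_def)
    then have "h \<in> U \<or> - h \<in> U" using rho_out by blast
    then have "w \<in> h" "v \<notin> h" using h rho_in by auto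
    then have "h = W w v" "k = W w v"
      using H_eq_W[OF h(1) E_sym[OF assms(1)]] H_eq_W[OF assms(2) E_sym[OF assms(1)] assms(3,4)] by blast+
    then show "h \<in> {k}" by simp
  qed (use assms rho_in[OF assms(5)] in \<open>auto simp: sep_def\<close>)
  then have "d (rho w) (rho v) = 1" using card_sep[of "rho w" "rho v"] by simp
  then show ?thesis using d_1 E_sym by blast
qed

lemma rho_cube: "cube E v S \<Longrightarrow> cube E (rho v) (rS S)"
  unfolding cube_def
proof (elim conjE, intro conjI ballI)
  assume c: "finite S" "S \<subseteq> H" "\<forall>k\<in>S. v \<notin> k \<and> (\<exists>w. E v w \<and> w \<in> k)" "\<forall>h\<in>S. \<forall>k\<in>S. h \<noteq> k \<longrightarrow> transverse h k"
  fix k assume k: "k \<in> rS S"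
  then have kS: "k \<in> S" "k \<in> U \<or> - k \<in> U" "k \<in> H" using c(2) by auto
  obtain w where w: "v \<notin> k" "E v w" "w \<in> k" using bspec[OF c(3) kS(1)] by blast
  show "rho v \<notin> k" using rho_in[OF kS(2)] w by simp
  show "\<exists>w. E (rho v) w \<and> w \<in> k"
    using rho_edge[OF w(2) kS(3) w(3,1) kS(2)] rho_in[OF kS(2)] w by blast
qed auto

lemma ret_cpt:
  assumes "cube E v S"
  shows "ret (cpt E v S t) = cpt E (rho v) (rS S) t"
proof
  fix h
  have "vtx E v h = vtx E (rho v) h" if "h \<in> U \<or> - h \<in> U" using rho_in[OF that] by (simp add: vtx_def)
  moreover have "vtx E b h = vtx E (rho v) h" if "\<not> (h \<in> U \<or> - h \<in> U)"
    using rho_out[of h v] that by (auto simp: vtx_def)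
  ultimately show "ret (cpt E v S t) h = cpt E (rho v) (rS S) t h"
    by (auto simp: ret_def cpt_def)
qed

lemma unit_sub: "unit_param S t \<Longrightarrow> unit_param (rS S) t"
  by (auto simp: unit_param_def)

lemma ret_R: "p \<in> R \<Longrightarrow> ret p \<in> R"
  by (erule R_cases) (simp add: ret_cpt cpt_R rho_cube unit_sub)

lemma cube_dist_sub: "finite S \<Longrightarrow> T \<subseteq> S \<Longrightarrow> cube_dist T t t' \<le> cube_dist S t t'"
  unfolding cube_dist_def by (intro real_sqrt_le_mono sum_mono2) auto

lemma reach_ret: "reach p q l \<Longrightarrow> \<exists>l'\<le>l. reach (ret p) (ret q) l'"
proof (induction rule: reach.induct)
  case (reach_step p v S t l t')
  then obtain l' where l': "l' \<le> l" "reach (ret p) (cpt E (rho v) (rS S) t) l'" by (auto simp: ret_cpt)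
  have "reach (ret p) (cpt E (rho v) (rS S) t') (l' + cube_dist (rS S) t t')"
    by (rule reach.reach_step[OF l'(2)]) (use reach_step rho_cube unit_sub in auto)
  moreover have "cube_dist (rS S) t t' \<le> cube_dist S t t'"
    using reach_step by (intro cube_dist_sub) (auto simp: cube_def)
  ultimately show ?case using l' reach_step by (intro exI[of _ "l' + cube_dist (rS S) t t'"]) (auto simp: ret_cpt)
qed (auto intro: reach_refl)

lemma rd_ret: "p \<in> R \<Longrightarrow> q \<in> R \<Longrightarrow> rd (ret p) (ret q) \<le> rd p q"
  by (rule rd_ge) (use reach_ret rd_le in \<open>force intro: order_trans\<close>)+

lemma ret_ret [simp]: "ret (ret p) = ret p"
  by (auto simp: ret_def)

lemma ret_vtx: "ret (vtx E y) = vtx E (rho y)"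
  using ret_cpt[OF cube_0, of y "\<lambda>_. 0"] cpt_0[OF cube_0] by simp

lemma sum_vtx_e: "(\<Sum>i<N. vtx E y (e i)) = real (min (fl y) N)"
proof -
  have "(\<Sum>i<N. vtx E y (e i)) = (\<Sum>i<N. if i < fl y then 1 else 0)"
    by (rule sum.cong) (auto simp: vtx_def e_H fl_iff)
  also have "\<dots> = real (card ({..<N} \<inter> {i. i < fl y}))" by (simp add: sum.If_cases)
  also have "{..<N} \<inter> {i. i < fl y} = {..<min (fl y) N}" by auto
  finally show ?thesis by simp
qed

lemma sum_e_lipschitz:
  "p \<in> R \<Longrightarrow> q \<in> R \<Longrightarrow> \<bar>(\<Sum>i<N. p (e i)) - (\<Sum>i<N. q (e i))\<bar> \<le> rd p q"
proof (rule chain_lipschitz)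
  show "inj_on e {..<N}" using desc_inj[OF de] by (rule inj_on_subset) simp
  show "e i \<subseteq> e j \<or> e j \<subseteq> e i" for i j using e_le[of i j] e_le[of j i] by (cases "i \<le> j") auto
qed (auto simp: e_H)

lemma fl_b: "fl b = 0"
  using fl_iff[of b] b_e by auto

lemma fl_le_rd: "real (fl y) \<le> rd (vtx E b) (vtx E y)"
  using sum_e_lipschitz[OF vtx_R[of b] vtx_R[of y], where N = "fl y"] by (simp add: sum_vtx_e fl_b)

end

section \<open>Compactness of the retract and the geodesic ray\<close>

context cc_axis begin

lemma rd_vtx_b_vertex:
  assumes "p \<in> R" "ret p = p"
  obtains y S where "cube E (rho y) S" "p = cpt E (rho y) S p" "S \<subseteq> {k. k \<in> U \<or> - k \<in> U}" "unit_param S p"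
    "rd p (vtx E (rho y)) \<le> D"
proof -
  obtain v S t where vS: "p = cpt E v S t" "cube E v S" "unit_param S t" using R_cases[OF assms(1)] by blast
  have p: "p = cpt E (rho v) (rS S) t" using ret_cpt[OF vS(2), of t] assms(2) vS(1) by simp
  have c: "cube E (rho v) (rS S)" "unit_param (rS S) t" using rho_cube unit_sub vS by auto
  have "cpt E (rho v) (rS S) p = p" using cpt_self[of "rho v" "rS S" t] by (simp flip: p)
  then have p2: "p = cpt E (rho v) (rS S) p" by (rule sym)
  have "unit_param (rS S) p" using coord_bounds[OF assms(1)] by (auto simp: unit_param_def)
  moreover have "rd p (vtx E (rho v)) \<le> D" using rd_cube_vertex[OF c] p by simp
  ultimately show ?thesis using that[of v "rS S"] c p2 by blast
qed

text \<open>Bounded parts of the retract are finite complexes, hence compact.\<close>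

lemma retract_limit:
  assumes p: "\<And>n. p n \<in> R" "\<And>n. ret (p n) = p n" "\<And>n. rd (vtx E b) (p n) \<le> C"
    and P: "\<And>k. (\<lambda>n. p n k) \<longlonglongrightarrow> P k"
  shows "P \<in> R" "ret P = P" "(\<lambda>n. rd (p n) P) \<longlonglongrightarrow> 0"
proof -
  \<comment> \<open>The chosen corner of a cube containing \<open>p n\<close> is within
    \<open>C + D\<close> of \<open>b\<close>; the extra 1 is for the neighbours of that corner
    across the directions of the cube.\<close>
  define c where "c = nat \<lceil>C + D\<rceil> + 1"
  define V where "V = {rho y | y. fl y \<le> c}"
  define Q where "Q = {k \<in> U. pidx k \<le> c + Wd}"
  define QQ where "QQ = Q \<union> uminus ` Q"
  have finV: "finite V" unfolding V_def by (rule finite_rho)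
  have finQQ: "finite QQ" unfolding QQ_def Q_def using finite_levels by simp
  have ex: "\<exists>z S. z \<in> V \<and> S \<subseteq> QQ \<and> cube E z S \<and> p n = cpt E z S (p n)" for n
  proof -
    obtain y S where y: "cube E (rho y) S" "p n = cpt E (rho y) S (p n)" "S \<subseteq> {k. k \<in> U \<or> - k \<in> U}"
      "rd (p n) (vtx E (rho y)) \<le> D" by (rule rd_vtx_b_vertex[OF p(1)[of n] p(2)[of n]]) (rule that)
    have "rd (vtx E b) (vtx E (rho y)) \<le> C + D"
      using rd_tri[OF vtx_R[of b] p(1)[of n] vtx_R[of "rho y"]] p(3)[of n] y(4) by linarith
    moreover have fl1: "real (fl y) \<le> rd (vtx E b) (vtx E (rho y))" using fl_le_rd[of "rho y"] by (simp add: fl_rho)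
    ultimately have fy: "real (fl y) \<le> C + D" by linarith
    then have "fl y + 1 \<le> c" unfolding c_def by linarith
    then have "rho y \<in> V" unfolding V_def by auto
    moreover have "S \<subseteq> QQ"
    proof
      fix k assume k: "k \<in> S"
      then have "rho y \<notin> k \<and> (\<exists>w. E (rho y) w \<and> w \<in> k)" using y(1) by (simp add: cube_def)
      then obtain w where w: "E (rho y) w" "w \<in> k" "rho y \<notin> k" by blast
      have "rd (vtx E b) (vtx E w) \<le> rd (vtx E b) (vtx E (rho y)) + rd (vtx E (rho y)) (vtx E w)"
        by (rule rd_tri) (rule vtx_R)+
      also have "rd (vtx E (rho y)) (vtx E w) \<le> 1" using rd_vtx[of "rho y" w] w(1) d_1[of "rho y" w] by simp
      finally have "real (fl w) \<le> C + D + 1" using fl_le_rd[of w] \<open>rd (vtx E b) (vtx E (rho y)) \<le> C + D\<close> by linarith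
      then have fw: "fl w \<le> c" unfolding c_def by linarith
      consider "k \<in> U" | "- k \<in> U" using y(3) k by blast
      then show "k \<in> QQ"
      proof cases
        case 1
        then have "k \<in> Q" using pidx_le_fl[OF 1 w(2)] fw by (simp add: Q_def)
        then show ?thesis by (simp add: QQ_def)
      next
        case 2
        then have "- k \<in> Q" using pidx_le_fl[OF 2, of "rho y"] w(3) fl_rho \<open>fl y + 1 \<le> c\<close> by (simp add: Q_def)
        then have "- (- k) \<in> uminus ` Q" by (rule imageI)
        then show ?thesis by (simp add: QQ_def)
      qed
    qed
    ultimately show ?thesis using y(1,2) by blast
  qed
  define K where "K = V \<times> Pow QQ"
  \<comment> \<open>The times at which the sequence sits in a given cube. Finitely many cubes occur,
    and one visited infinitely often contains the limit, because each coordinate of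
    \<open>cpt\<close> depends continuously on the parameters.\<close>
  define A where "A z S = {n. cube E z S \<and> p n = cpt E z S (p n)}" for z S
  have finK: "finite K" unfolding K_def using finV finQQ by simp
  have cover: "\<exists>(z, S)\<in>K. n \<in> A z S" for n using ex[of n] by (auto simp: K_def A_def)
  have Pb: "0 \<le> P k \<and> P k \<le> 1" for k
    using LIMSEQ_le_const[OF P[of k], of 0] LIMSEQ_le_const2[OF P[of k], of 1] coord_bounds[OF p(1)] by blast
  have inf: "cube E z S \<and> P = cpt E z S P" if "infinite (A z S)" for z S
  proof -
    have c: "cube E z S" using that by (auto simp: A_def)
    have "P h = cpt E z S P h" for h
    proof -
      have "(\<lambda>n. cpt E z S (p n) h) \<longlonglongrightarrow> cpt E z S P h"
        unfolding cpt_def by (auto intro!: tendsto_intros P)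
      then have "(\<lambda>n. p n h - cpt E z S (p n) h) \<longlonglongrightarrow> P h - cpt E z S P h" by (intro tendsto_diff P)
      then have "((\<lambda>n. p n h - cpt E z S (p n) h) \<circ> enumerate (A z S)) \<longlonglongrightarrow> P h - cpt E z S P h"
        by (rule LIMSEQ_subseq_LIMSEQ) (rule strict_mono_enumerate[OF that])
      moreover have "(\<lambda>n. p n h - cpt E z S (p n) h) \<circ> enumerate (A z S) = (\<lambda>_. 0)"
      proof
        fix n
        have AD: "p m = cpt E z S (p m)" if "m \<in> A z S" for m using that unfolding A_def by blast
        have "p (enumerate (A z S) n) = cpt E z S (p (enumerate (A z S) n))"
          by (rule AD) (rule enumerate_in_set[OF that])
        from fun_cong[OF this, of h] show "((\<lambda>n. p n h - cpt E z S (p n) h) \<circ> enumerate (A z S)) n = 0" by simp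
      qed
      ultimately have "(\<lambda>_. 0) \<longlonglongrightarrow> P h - cpt E z S P h" by simp
      then show ?thesis using LIMSEQ_unique tendsto_const by fastforce
    qed
    then show ?thesis using c by blast
  qed
  have unitP: "unit_param S P" for S using Pb by (auto simp: unit_param_def)
  have "\<exists>(z, S)\<in>K. infinite (A z S)"
  proof (rule ccontr)
    assume "\<not> ?thesis"
    then have "finite (\<Union>(z, S)\<in>K. A z S)" using finK by auto
    moreover have "(\<Union>(z, S)\<in>K. A z S) = UNIV" using cover by blast
    ultimately show False by simp
  qed
  then obtain z S where zS: "infinite (A z S)" by blast
  then have "cube E z S" "P = cpt E z S P" using inf by auto
  then show PR: "P \<in> R" using cpt_R[OF _ unitP] by metis
  have "ret P h = P h" for h
  proof (cases "h \<in> U \<or> - h \<in> U")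
    case False
    then have "p n h = vtx E b h" for n using fun_cong[OF p(2)[of n], of h] by (simp add: ret_def)
    then have "(\<lambda>_. vtx E b h) \<longlonglongrightarrow> P h" using P[of h] by simp
    then have "P h = vtx E b h" using LIMSEQ_unique tendsto_const by blast
    then show ?thesis using False by (simp add: ret_def)
  qed (simp add: ret_def)
  then show "ret P = P" by blast
  \<comment> \<open>After the last visit to the cubes visited only finitely often,
    \<open>p n\<close> and \<open>P\<close> lie in a common cube, where \<open>rd\<close> is at most
    the sum of the coordinate differences.\<close>
  have ev: "\<forall>\<^sub>F n in sequentially. rd (p n) P \<le> (\<Sum>k\<in>QQ. \<bar>p n k - P k\<bar>)"
  proof -
    let ?bad = "\<Union>(z, S)\<in>{(z, S)\<in>K. finite (A z S)}. A z S"
    have "finite {(z, S) \<in> K. finite (A z S)}" using finK by (rule rev_finite_subset) auto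
    then have "finite ?bad" by auto
    from this[THEN iffD1[OF finite_nat_set_iff_bounded]] obtain N where "\<forall>n\<in>?bad. n < N" ..
    then have N: "n < N" if "n \<in> ?bad" for n using that by (rule bspec)
    have "rd (p n) P \<le> (\<Sum>k\<in>QQ. \<bar>p n k - P k\<bar>)" if "n \<ge> N" for n
    proof -
      obtain z S where zS: "(z, S) \<in> K" "n \<in> A z S" using cover[of n] by (elim bexE) (simp split: prod.splits)
      have "infinite (A z S)"
      proof
        assume "finite (A z S)"
        then have "n \<in> ?bad" using zS by blast
        then show False using N[of n] that by simp
      qed
      then have P: "cube E z S" "P = cpt E z S P" using inf by auto
      have pn: "p n = cpt E z S (p n)" using zS by (simp add: A_def)
      have up: "unit_param S (p n)" using coord_bounds[OF p(1)] by (auto simp: unit_param_def)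
      have "rd (p n) P \<le> cube_dist S (p n) P" using rd_cpt[OF P(1) up unitP] P(2) pn by metis
      also have "\<dots> \<le> (\<Sum>k\<in>S. \<bar>p n k - P k\<bar>)" by (rule cube_dist_L1)
      also have "\<dots> \<le> (\<Sum>k\<in>QQ. \<bar>p n k - P k\<bar>)" using zS finQQ by (intro sum_mono2) (auto simp: K_def)
      finally show ?thesis .
    qed
    then show ?thesis unfolding eventually_sequentially by blast
  qed
  have "(\<lambda>n. \<Sum>k\<in>QQ. \<bar>p n k - P k\<bar>) \<longlonglongrightarrow> (\<Sum>k\<in>QQ. \<bar>P k - P k\<bar>)"
    by (intro tendsto_intros P)
  then show "(\<lambda>n. rd (p n) P) \<longlonglongrightarrow> 0"
    by (intro tendsto_sandwich[OF _ ev tendsto_const]) (use rd_ge0[OF p(1) PR] in auto)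
qed

text \<open>The retract of an almost shortest string from \<open>b\<close> to
  \<open>rho (act (gpow g N) b)\<close>. It crosses at least \<open>N\<close> members of the nested
  chain \<open>e\<close>, so it is at least \<open>N\<close> long, and since its total length
  exceeds the distance of its ends by less than \<open>1 / (N + 1)\<close>, the same defect bounds
  any two of its points.\<close>

lemma near_geodesic:
  "\<exists>f. f 0 = vtx E b \<and> (\<forall>s. 0 \<le> s \<longrightarrow> s \<le> real N \<longrightarrow> f s \<in> R \<and> ret (f s) = f s) \<and>
    (\<forall>s s'. 0 \<le> s \<longrightarrow> s \<le> s' \<longrightarrow> s' \<le> real N \<longrightarrow>
      rd (f s) (f s') \<le> s' - s \<and> s' - s - 1 / (real N + 1) \<le> rd (f s) (f s'))"
proof -
  define x where "x = rho (act (gpow g N) b)"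
  have "N \<le> fl x"
  proof (cases N)
    case (Suc M)
    have "act (gpow g N) b = act (gpow g M) (act g b)" unfolding Suc gpow_Suc2 by (rule act_add)
    then have "act (gpow g N) b \<in> e M" using b by (simp add: e_def)
    then show ?thesis using fl_iff[of _ M] Suc by (simp add: x_def fl_rho Suc_le_eq)
  qed simp
  then have NL: "real N \<le> rd (vtx E b) (vtx E x)" using fl_le_rd[of x] by linarith
  have "1 / (real N + 1) > 0" by simp
  then obtain l where l: "reach (vtx E b) (vtx E x) l" "l < rd (vtx E b) (vtx E x) + 1 / (real N + 1)"
    using rd_approx[OF vtx_R vtx_R] by metis
  have lL: "rd (vtx E b) (vtx E x) \<le> l" using l rd_le by blast
  obtain f0 where f0: "f0 0 = vtx E b" "f0 l = vtx E x" "\<And>s. 0 \<le> s \<Longrightarrow> s \<le> l \<Longrightarrow> f0 s \<in> R"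
    "\<And>s s'. 0 \<le> s \<Longrightarrow> s \<le> s' \<Longrightarrow> s' \<le> l \<Longrightarrow> rd (f0 s) (f0 s') \<le> s' - s"
    using reach_path[OF l(1) vtx_R] by blast
  define f where "f s = ret (f0 s)" for s
  have fR: "f s \<in> R" if "0 \<le> s" "s \<le> l" for s using that f0(3) ret_R by (simp add: f_def)
  have f0': "f 0 = vtx E b" by (simp add: f_def f0 ret_vtx rho_b)
  have rr: "rho (rho y) = rho y" for y
  proof (rule ccontr)
    assume "rho (rho y) \<noteq> rho y"
    then obtain h where h: "h \<in> H" "rho (rho y) \<in> h" "rho y \<notin> h" using H_separates by blast
    then show False using rho_in[of h "rho y"] rho_in[of h y] rho_out[of h y] rho_out[of h "rho y"] by blast
  qed
  have fl': "f l = vtx E x" by (simp add: f_def f0 ret_vtx x_def rr)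
  have up: "rd (f s) (f s') \<le> s' - s" if "0 \<le> s" "s \<le> s'" "s' \<le> l" for s s'
    using rd_ret[OF f0(3)[of s] f0(3)[of s']] f0(4)[of s s'] that by (simp add: f_def)
  have "s' - s - 1 / (real N + 1) \<le> rd (f s) (f s')" if s: "0 \<le> s" "s \<le> s'" "s' \<le> real N" for s s'
  proof -
    have sl: "s' \<le> l" using s NL lL by linarith
    have "rd (f 0) (f l) \<le> rd (f 0) (f s) + rd (f s) (f l)" by (rule rd_tri) (use fR s sl in auto)
    moreover have "rd (f s) (f l) \<le> rd (f s) (f s') + rd (f s') (f l)" by (rule rd_tri) (use fR s sl in auto)
    moreover have "rd (f 0) (f s) \<le> s - 0" "rd (f s') (f l) \<le> l - s'" using up[of 0 s] up[of s' l] s sl by auto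
    ultimately show ?thesis using l(2) f0' fl' by simp
  qed
  then show ?thesis using f0' fR up NL lL by (intro exI[of _ f]) (auto simp: f_def)
qed

text \<open>Arzela-Ascoli for the paths of \<open>near_geodesic\<close>: a diagonal subsequence
  makes all coordinates converge at rational times, the Lipschitz bound extends this to all times,
  and \<open>retract_limit\<close> turns it into convergence for \<open>rd\<close>.\<close>

lemma ray_exists: "\<exists>r. geodesic_ray E r \<and> r 0 = vtx E b \<and> (\<forall>s\<ge>0. ret (r s) = r s)"
proof -
  from choice[OF allI[OF near_geodesic]] obtain f where "\<forall>N. f N 0 = vtx E b \<and>
    (\<forall>s. 0 \<le> s \<longrightarrow> s \<le> real N \<longrightarrow> f N s \<in> R \<and> ret (f N s) = f N s) \<and>
    (\<forall>s s'. 0 \<le> s \<longrightarrow> s \<le> s' \<longrightarrow> s' \<le> real N \<longrightarrow>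
      rd (f N s) (f N s') \<le> s' - s \<and> s' - s - 1 / (real N + 1) \<le> rd (f N s) (f N s'))" ..
  then have f: "f N 0 = vtx E b" "0 \<le> s \<Longrightarrow> s \<le> real N \<Longrightarrow> f N s \<in> R" "0 \<le> s \<Longrightarrow> s \<le> real N \<Longrightarrow> ret (f N s) = f N s"
    "0 \<le> s \<Longrightarrow> s \<le> s' \<Longrightarrow> s' \<le> real N \<Longrightarrow> rd (f N s) (f N s') \<le> s' - s"
    "0 \<le> s \<Longrightarrow> s \<le> s' \<Longrightarrow> s' \<le> real N \<Longrightarrow> s' - s - 1 / (real N + 1) \<le> rd (f N s) (f N s')" for N s s' by blast+
  \<comment> \<open>Paths are stopped at time \<open>N\<close>, so that all of them are defined on
    the whole half-line.\<close>
  define F where "F N s = f N (min s (real N))" for N s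
  have FR: "F N s \<in> R" "ret (F N s) = F N s" if "0 \<le> s" for N s using f(2,3) that by (auto simp: F_def)
  have Flip: "rd (F N s) (F N s') \<le> s' - s" if "0 \<le> s" "s \<le> s'" for N s s'
  proof -
    have "rd (F N s) (F N s') \<le> min s' (real N) - min s (real N)"
      unfolding F_def by (rule f(4)) (use that in auto)
    then show ?thesis using that by linarith
  qed
  have F0: "F N 0 = vtx E b" for N by (simp add: F_def f)
  let ?I = "(\<rat> \<inter> {0..}) \<times> H :: (real \<times> 'x set) set"
  have cI: "countable ?I" using countable_H by (intro countable_SIGMA countable_Int1 countable_rat)
  have bI: "\<bar>F n (fst i) (snd i)\<bar> \<le> 1" if "i \<in> ?I" for n i
    using coord_bounds[OF FR(1), of "fst i" n "snd i"] that by auto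
  obtain \<phi> where \<phi>: "strict_mono \<phi>" "\<And>i. i \<in> ?I \<Longrightarrow> convergent (\<lambda>n. F (\<phi> n) (fst i) (snd i))"
    by (rule common_convergent_subsequence[OF cI, of "\<lambda>n i. F n (fst i) (snd i)" 1, OF bI]) (assumption | rule that)+
  have conv: "convergent (\<lambda>n. F (\<phi> n) s k)" if s: "0 \<le> s" for s k
  proof (cases "k \<in> H")
    case False
    have "p k = 0" if pR: "p \<in> R" for p
    proof -
      obtain v S t where p: "p = cpt E v S t" "cube E v S" by (rule R_cases[OF pR]) (rule that)
      have "k \<notin> S" "- k \<notin> S" using p(2) False H_compl[of "- k"] by (auto simp: cube_def)
      then show ?thesis using p(1) False by (simp add: cpt_def vtx_def)
    qed
    then have "F (\<phi> n) s k = 0" for n using FR(1)[OF s] by blast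
    then show ?thesis by (simp add: convergent_const)
  next
    case True
    have "Cauchy (\<lambda>n. F (\<phi> n) s k)"
    proof (rule metric_CauchyI)
      fix \<epsilon> :: real assume "\<epsilon> > 0"
      then obtain q where q: "q \<in> \<rat>" "s < q" "q < s + \<epsilon>/3" using Rats_dense_in_real[of s "s + \<epsilon>/3"] by auto
      have "Cauchy (\<lambda>n. F (\<phi> n) q k)"
        using \<phi>(2)[of "(q, k)"] q s True by (intro convergent_Cauchy) auto
      then obtain M where M: "\<And>m n. m \<ge> M \<Longrightarrow> n \<ge> M \<Longrightarrow> dist (F (\<phi> m) q k) (F (\<phi> n) q k) < \<epsilon>/3"
        using metric_CauchyD[of _ "\<epsilon>/3"] \<open>\<epsilon> > 0\<close> by (metis divide_pos_pos zero_less_numeral)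
      have close: "\<bar>F N s k - F N q k\<bar> \<le> \<epsilon>/3" for N
        using coord_lipschitz[OF FR(1)[of s N] FR(1)[of q N], of k] Flip[of s q N] q s by linarith
      have "dist (F (\<phi> m) s k) (F (\<phi> n) s k) < \<epsilon>" if "m \<ge> M" "n \<ge> M" for m n
        using M[OF that] close[of "\<phi> m"] close[of "\<phi> n"] unfolding dist_real_def by linarith
      then show "\<exists>M. \<forall>m\<ge>M. \<forall>n\<ge>M. dist (F (\<phi> m) s k) (F (\<phi> n) s k) < \<epsilon>" by blast
    qed
    then show ?thesis by (rule Cauchy_convergent)
  qed
  define r where "r s k = lim (\<lambda>n. F (\<phi> n) s k)" for s k
  have lim: "(\<lambda>n. F (\<phi> n) s k) \<longlonglongrightarrow> r s k" if "0 \<le> s" for s k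
    using conv[OF that] by (simp add: r_def convergent_LIMSEQ_iff)
  have bd: "rd (vtx E b) (F N s) \<le> s" if "0 \<le> s" for s N using Flip[of 0 s N] F0 that by simp
  note L = retract_limit[OF FR(1) FR(2) bd lim]
  have rR: "r s \<in> R" "ret (r s) = r s" "(\<lambda>n. rd (F (\<phi> n) s) (r s)) \<longlonglongrightarrow> 0" if "0 \<le> s" for s
    using L[OF that that that that] by auto
  have dist: "rd (r s) (r s') = s' - s" if s: "0 \<le> s" "s \<le> s'" for s s'
  proof -
    have s': "0 \<le> s'" using s by simp
    have 1: "(\<lambda>n. rd (F (\<phi> n) s) (F (\<phi> n) s')) \<longlonglongrightarrow> s' - s"
    proof (rule tendsto_sandwich)
      have ge: "N \<le> \<phi> N" for N using \<phi>(1) by (rule strict_mono_imp_increasing)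
      have "s' - s - 1 / (real (\<phi> n) + 1) \<le> rd (F (\<phi> n) s) (F (\<phi> n) s')" if "n \<ge> nat \<lceil>s'\<rceil>" for n
      proof -
        have "s' \<le> real n" using that by linarith
        also have "\<dots> \<le> real (\<phi> n)" using ge[of n] by simp
        finally show ?thesis using f(5)[of s s' "\<phi> n"] s by (simp add: F_def)
      qed
      then show "\<forall>\<^sub>F n in sequentially. s' - s - 1 / (real (\<phi> n) + 1) \<le> rd (F (\<phi> n) s) (F (\<phi> n) s')"
        unfolding eventually_sequentially by blast
      have "(\<lambda>n. 1 / (real n + 1)) \<longlonglongrightarrow> 0" using LIMSEQ_inverse_real_of_nat by (simp add: inverse_eq_divide add.commute)
      then have "((\<lambda>n. 1 / (real n + 1)) \<circ> \<phi>) \<longlonglongrightarrow> 0" by (rule LIMSEQ_subseq_LIMSEQ[OF _ \<phi>(1)])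
      then have "(\<lambda>n. 1 / (real (\<phi> n) + 1)) \<longlonglongrightarrow> 0" by (simp add: comp_def)
      then have "(\<lambda>n. s' - s - 1 / (real (\<phi> n) + 1)) \<longlonglongrightarrow> s' - s - 0" by (intro tendsto_intros)
      then show "(\<lambda>n. s' - s - 1 / (real (\<phi> n) + 1)) \<longlonglongrightarrow> s' - s" by simp
      show "\<forall>\<^sub>F n in sequentially. rd (F (\<phi> n) s) (F (\<phi> n) s') \<le> s' - s" using Flip s by simp
    qed simp
    have "(\<lambda>n. rd (F (\<phi> n) s) (F (\<phi> n) s') - rd (r s) (r s')) \<longlonglongrightarrow> 0"
    proof (rule Lim_null_comparison)
      show "(\<lambda>n. rd (F (\<phi> n) s) (r s) + rd (F (\<phi> n) s') (r s')) \<longlonglongrightarrow> 0"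
        using tendsto_add[OF rR(3)[OF s(1)] rR(3)[OF s']] by simp
      have "norm (rd (F n s) (F n s') - rd (r s) (r s')) \<le> rd (F n s) (r s) + rd (F n s') (r s')" for n
        using rd_tri[of "F n s" "r s" "F n s'"] rd_tri[of "r s" "r s'" "F n s'"] rd_tri[of "r s" "F n s" "r s'"]
          rd_tri[of "F n s" "F n s'" "r s'"] FR(1)[OF s(1)] FR(1)[OF s'] rR(1)[OF s(1)] rR(1)[OF s']
          rd_sym[of "r s" "F n s"] rd_sym[of "r s'" "F n s'"] by simp
      then show "\<forall>\<^sub>F n in sequentially. norm (rd (F (\<phi> n) s) (F (\<phi> n) s') - rd (r s) (r s'))
        \<le> rd (F (\<phi> n) s) (r s) + rd (F (\<phi> n) s') (r s')" by simp
    qed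
    then have "(\<lambda>n. rd (F (\<phi> n) s) (F (\<phi> n) s')) \<longlonglongrightarrow> rd (r s) (r s')" by (simp add: LIM_zero_iff)
    then show ?thesis using 1 LIMSEQ_unique by blast
  qed
  have "rd (r s) (r s') = \<bar>s - s'\<bar>" if "0 \<le> s" "0 \<le> s'" for s s'
    using dist[of s s'] dist[of s' s] rd_sym[of "r s" "r s'"] that by (cases "s \<le> s'") auto
  moreover have "r 0 = vtx E b" by (rule ext) (simp add: r_def F0)
  ultimately show ?thesis using rR(1,2) unfolding geodesic_ray_def by (intro exI[of _ r]) auto
qed

text \<open>A point of the translated ray is near a vertex \<open>w\<close>, and \<open>w\<close> is
  near \<open>rho w\<close>, since the two are separated only by half-spaces that also separate
  \<open>act \<gamma> b\<close> from \<open>b\<close>. The ray passes near every level of the axis,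
  hence near \<open>rho w\<close> by \<open>d_rho\<close>. Both rays have unit speed and nearby
  origins, so the times of the two close points differ boundedly.\<close>

lemma ray_asymptotic:
  assumes "eqv (tre \<gamma> e) e" and ray: "geodesic_ray E r" "r 0 = vtx E b" "\<And>s. s \<ge> 0 \<Longrightarrow> ret (r s) = r s"
  shows "asymptotic E (\<lambda>t. pact act \<gamma> (r t)) r"
proof -
  have rR: "r s \<in> R" if "s \<ge> 0" for s using ray that by (auto simp: geodesic_ray_def)
  have rd_r: "rd (r s) (r t) = \<bar>s - t\<bar>" if "s \<ge> 0" "t \<ge> 0" for s t using ray that by (auto simp: geodesic_ray_def)
  have near: "\<exists>y. rd (r s) (vtx E (rho y)) \<le> D" if "s \<ge> 0" for s
    using rd_vtx_b_vertex[OF rR[OF that] ray(3)[OF that]] by metis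
  have level: "\<exists>s\<ge>0. \<exists>y. rd (r s) (vtx E (rho y)) \<le> D \<and> fl y \<le> j + D \<and> j \<le> fl y + D" for j
  proof -
    let ?N = "j + D + 1"
    define G where "G s = (\<Sum>i<?N. r s (e i))" for s
    have Glip: "\<bar>G s - G t\<bar> \<le> \<bar>s - t\<bar>" if "s \<ge> 0" "t \<ge> 0" for s t
      using sum_e_lipschitz[OF rR[OF that(1)] rR[OF that(2)], of ?N] rd_r[OF that] by (simp add: G_def)
    have Gv: "\<bar>G s - real (min (fl y) ?N)\<bar> \<le> D" if "s \<ge> 0" "rd (r s) (vtx E (rho y)) \<le> D" for s y
    proof -
      have "\<bar>(\<Sum>i<?N. r s (e i)) - (\<Sum>i<?N. vtx E (rho y) (e i))\<bar> \<le> D"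
        using sum_e_lipschitz[OF rR[OF that(1)] vtx_R[of "rho y"], of ?N] that by linarith
      then show ?thesis by (simp only: sum_vtx_e fl_rho G_def)
    qed
    have G0: "G 0 = 0" unfolding G_def ray(2) sum_vtx_e fl_b by simp
    \<comment> \<open>By \<open>d_rho\<close>, a vertex \<open>rho y\<close> with
      \<open>fl y\<close> at most \<open>?N\<close> is within \<open>T - D - 1\<close> of
      \<open>b\<close>; so at time \<open>T\<close> the ray has passed level \<open>?N\<close>, and
      the intermediate value theorem finds a time at which \<open>G\<close> equals
      \<open>j\<close>.\<close>
    define T where "T = real (2 * (B * (?N + Wd + 1))) + D + 1"
    have T0: "T \<ge> 0" by (simp add: T_def)
    obtain y where y: "rd (r T) (vtx E (rho y)) \<le> D" using near T0 by blast
    have "fl y > ?N"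
    proof (rule ccontr)
      assume "\<not> ?thesis"
      then have "d (rho b) (rho y) \<le> 2 * (B * (?N + Wd + 1))" by (intro d_rho) (auto simp: fl_b)
      then have "rd (vtx E b) (vtx E (rho y)) \<le> real (2 * (B * (?N + Wd + 1)))"
        using rd_vtx[of b "rho y"] rho_b by (metis of_nat_mono order_trans)
      moreover have "rd (r 0) (r T) \<le> rd (r 0) (vtx E (rho y)) + rd (vtx E (rho y)) (r T)"
        by (rule rd_tri) (use rR T0 vtx_R in auto)
      moreover have "rd (r 0) (r T) = T" using rd_r[of 0 T] T0 by simp
      ultimately show False using y ray(2) rd_sym[of "r T"] by (simp add: T_def)
    qed
    then have GT: "G T \<ge> j" using Gv[OF T0 y] by auto
    have cont: "continuous_on {0..T} G"
    proof (rule continuous_onI)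
      fix s \<epsilon> :: real assume "s \<in> {0..T}" "\<epsilon> > 0"
      then show "\<exists>\<delta>>0. \<forall>s'\<in>{0..T}. dist s' s < \<delta> \<longrightarrow> dist (G s') (G s) \<le> \<epsilon>"
        using Glip by (intro exI[of _ \<epsilon>]) (force simp: dist_real_def)
    qed
    obtain s where s: "0 \<le> s" "s \<le> T" "G s = real j"
      using IVT'[of G 0 "real j" T] G0 GT T0 cont by auto
    obtain z where z: "rd (r s) (vtx E (rho z)) \<le> D" using near s by blast
    have *: "\<bar>real j - real (min (fl z) ?N)\<bar> \<le> D" using Gv[OF s(1) z] s(3) by simp
    have lt: "fl z < ?N"
    proof (rule ccontr)
      assume "\<not> fl z < ?N"
      then have "min (fl z) ?N = ?N" by simp
      then have "\<bar>real j - (real j + real D + 1)\<bar> \<le> real D" using * by simp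
      then show False by simp
    qed
    then have "\<bar>real j - real (fl z)\<bar> \<le> D" using * by simp
    then have "fl z \<le> j + D \<and> j \<le> fl z + D" by linarith
    then show ?thesis using s z by blast
  qed
  define C1 where "C1 = real (d (act \<gamma> b) b)"
  define C2 where "C2 = real (2 * (B * (D + Wd + 1)))"
  define C where "C = D + C1 + C2 + D"
  have "rd (pact act \<gamma> (r t)) (r t) \<le> C + (C + C1)" if t: "t \<ge> 0" for t
  proof -
    obtain y where y: "rd (r t) (vtx E (rho y)) \<le> D" using near t by blast
    define v where "v = rho y"
    define w where "w = act \<gamma> v"
    have pR: "pact act \<gamma> (r t) \<in> R" using pact_R rR t by blast
    have 1: "rd (pact act \<gamma> (r t)) (vtx E w) \<le> D"
      using rd_pact[OF rR[OF t] vtx_R[of v], of \<gamma>] y by (simp add: pact_vtx w_def v_def)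
    \<comment> \<open>If \<open>k\<close> is forgotten by \<open>rho\<close>, contains
      \<open>w\<close> and misses \<open>b\<close> and \<open>act \<gamma> b\<close>, then its
      pullback contains \<open>rho y\<close> and misses \<open>b\<close>, so it belongs to
      \<open>U\<close>; as \<open>\<gamma>\<close> preserves the end, \<open>k\<close> would belong
      to \<open>U\<close> too.\<close>
    have "sep w (rho w) \<subseteq> sep (act \<gamma> b) b"
    proof
      fix k assume "k \<in> sep w (rho w)"
      then have k: "k \<in> H" "w \<in> k" "rho w \<notin> k" by (auto simp: sep_def)
      have kU: "k \<notin> U" "- k \<notin> U" using rho_in[of k w] k by auto
      then have bk: "b \<notin> k" using rho_out[OF k(1)] k by blast
      have "act \<gamma> b \<in> k"
      proof (rule ccontr)
        assume n: "act \<gamma> b \<notin> k"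
        let ?k = "tr (- \<gamma>) k"
        have "?k \<in> H" "b \<notin> ?k" "v \<in> ?k" using k n by (auto simp: tr_iff w_def)
        then have "?k \<in> U" using rho_iff[of ?k y] by (simp add: v_def)
        then obtain m where "e m \<subseteq> ?k" by (auto simp: U_def)
        then have "tr \<gamma> (e m) \<subseteq> tr \<gamma> ?k" by (simp del: tr_minus)
        then have "tr \<gamma> (e m) \<subseteq> k" by simp
        moreover obtain m' where "e m' \<subseteq> tr \<gamma> (e m)" using assms(1) unfolding eqv_def dom_def by blast
        ultimately have "k \<in> U" using k bk unfolding U_def by blast
        then show False using kU by blast
      qed
      then show "k \<in> sep (act \<gamma> b) b" using k bk by (auto simp: sep_def)
    qed
    then have "d w (rho w) \<le> d (act \<gamma> b) b" using card_mono[OF finite_sep] card_sep by metis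
    then have 2: "rd (vtx E w) (vtx E (rho w)) \<le> C1" using rd_vtx[of w "rho w"] by (simp add: C1_def)
    obtain s z where s: "s \<ge> 0" "rd (r s) (vtx E (rho z)) \<le> D" "fl z \<le> fl w + D" "fl w \<le> fl z + D"
      using level by blast
    have "d (rho w) (rho z) \<le> 2 * (B * (D + Wd + 1))" by (rule d_rho) (use s in auto)
    then have 3: "rd (vtx E (rho w)) (vtx E (rho z)) \<le> C2"
      using rd_vtx[of "rho w" "rho z"] unfolding C2_def by (meson of_nat_mono order_trans)
    have "rd (pact act \<gamma> (r t)) (vtx E (rho w)) \<le> rd (pact act \<gamma> (r t)) (vtx E w) + rd (vtx E w) (vtx E (rho w))"
      by (rule rd_tri) (use pR vtx_R in auto)
    moreover have "rd (pact act \<gamma> (r t)) (vtx E (rho z)) \<le> rd (pact act \<gamma> (r t)) (vtx E (rho w)) + rd (vtx E (rho w)) (vtx E (rho z))"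
      by (rule rd_tri) (use pR vtx_R in auto)
    moreover have "rd (pact act \<gamma> (r t)) (r s) \<le> rd (pact act \<gamma> (r t)) (vtx E (rho z)) + rd (vtx E (rho z)) (r s)"
      by (rule rd_tri) (use pR vtx_R rR s in auto)
    ultimately have ps: "rd (pact act \<gamma> (r t)) (r s) \<le> C"
      using 1 2 3 s(2) rd_sym[of "r s" "vtx E (rho z)"] by (simp add: C_def)
    have g0: "pact act \<gamma> (r 0) = vtx E (act \<gamma> b)" by (simp add: ray(2) pact_vtx)
    have gt: "rd (pact act \<gamma> (r 0)) (pact act \<gamma> (r t)) = t" using rd_pact[OF rR[of 0] rR[OF t]] rd_r[of 0 t] t by simp
    have g00: "rd (pact act \<gamma> (r 0)) (r 0) \<le> C1" using rd_vtx[of "act \<gamma> b" b] by (simp add: pact_vtx ray(2) C1_def)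
    have rs: "rd (r 0) (r s) = s" using rd_r[of 0 s] s by simp
    have p0R: "pact act \<gamma> (r 0) \<in> R" using pact_R rR by blast
    have "s \<le> C1 + t + C"
      using rd_tri[OF rR[of 0] p0R rR[OF s(1)]] rd_tri[OF p0R pR rR[OF s(1)]] gt g00 rs ps rd_sym[of "r 0" "pact act \<gamma> (r 0)"] by simp
    moreover have "t \<le> C1 + s + C"
      using rd_tri[OF p0R rR[of 0] pR] rd_tri[OF rR[of 0] rR[OF s(1)] pR] gt g00 rs ps rd_sym[of "r s" "pact act \<gamma> (r t)"] by simp
    ultimately have "rd (r s) (r t) \<le> C1 + C" using rd_r[OF s(1) t] by simp
    moreover have "rd (pact act \<gamma> (r t)) (r t) \<le> rd (pact act \<gamma> (r t)) (r s) + rd (r s) (r t)"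
      by (rule rd_tri) (use pR rR s t in auto)
    ultimately show ?thesis using ps by simp
  qed
  then show ?thesis unfolding asymptotic_def by blast
qed

text \<open>If \<open>\<gamma>\<close> and \<open>q\<close> move the end to equivalent ends, then
  \<open>- q + \<gamma>\<close> preserves it, and \<open>ray_asymptotic\<close> applies to that
  element.\<close>

lemma finite_visual_orbit:
  assumes "finorb e"
  shows "\<exists>r. geodesic_ray E r \<and> (\<exists>R. finite R \<and> (\<forall>r'\<in>R. geodesic_ray E r') \<and>
           (\<forall>g. \<exists>r'\<in>R. asymptotic E (\<lambda>t. pact act g (r t)) r'))"
proof -
  obtain r where r: "geodesic_ray E r" "r 0 = vtx E b" "\<And>s. s \<ge> 0 \<Longrightarrow> ret (r s) = r s" using ray_exists by blast
  obtain Q where Q: "finite Q" "\<And>g. \<exists>q\<in>Q. eqv (tre g e) (tre q e)" using assms by (auto simp: finorb_def)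
  have rR: "r s \<in> R" if "s \<ge> 0" for s using r that by (auto simp: geodesic_ray_def)
  show ?thesis
  proof (intro exI[of _ r] conjI r(1) exI[of _ "(\<lambda>q t. pact act q (r t)) ` Q"] ballI allI)
    show "geodesic_ray E r'" if "r' \<in> (\<lambda>q t. pact act q (r t)) ` Q" for r'
      using that r(1) rd_pact pact_R by (auto simp: geodesic_ray_def)
    fix \<gamma>
    obtain q where q: "q \<in> Q" "eqv (tre \<gamma> e) (tre q e)" using Q by blast
    then have "eqv (tre (- q) (tre \<gamma> e)) (tre (- q) (tre q e))" by (simp del: tr_minus)
    then have "eqv (tre (- q + \<gamma>) e) e" by (simp add: tr_add)
    then have "asymptotic E (\<lambda>t. pact act (- q + \<gamma>) (r t)) r" using ray_asymptotic r by blast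
    then obtain C where C: "\<And>t. t \<ge> 0 \<Longrightarrow> rd (pact act (- q + \<gamma>) (r t)) (r t) \<le> C" by (auto simp: asymptotic_def)
    have "rd (pact act \<gamma> (r t)) (pact act q (r t)) \<le> C" if t: "t \<ge> 0" for t
    proof -
      have "pact act q (pact act (- q + \<gamma>) p) = pact act \<gamma> p" for p
        unfolding pact_def by (simp add: tr_add minus_add add.assoc)
      then have "rd (pact act \<gamma> (r t)) (pact act q (r t)) = rd (pact act (- q + \<gamma>) (r t)) (r t)"
        using rd_pact[of "pact act (- q + \<gamma>) (r t)" "r t" q] pact_R[OF rR[OF t]] rR[OF t] by simp
      then show ?thesis using C t by simp
    qed
    then have "asymptotic E (\<lambda>t. pact act \<gamma> (r t)) (\<lambda>t. pact act q (r t))" by (auto simp: asymptotic_def)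
    then show "\<exists>r'\<in>(\<lambda>q t. pact act q (r t)) ` Q. asymptotic E (\<lambda>t. pact act \<gamma> (r t)) r'" using q by blast
  qed (use Q in auto)
qed

end

context cc_act begin

theorem facing_translates:
  assumes "nonelementary E act" "essential E act" "h \<in> H"
  shows "facing h M"
proof (rule ccontr)
  assume "\<not> facing h M"
  then obtain g a where a: "a \<in> H" "tr g a \<subset> a" "maxend (\<lambda>n. tr (gpow g n) a)" "finorb (\<lambda>n. tr (gpow g n) a)"
    using not_facing_axis assms by metis
  have "tr (- g) (tr g a) \<subset> tr (- g) a" using a(2) by (simp del: tr_minus)
  then obtain b where "b \<in> tr (- g) a" "b \<notin> a" by auto
  then interpret cc_axis E act g a b by unfold_locales (use a in \<open>auto simp: tr_iff\<close>)
  show False using finite_visual_orbit a(4) assms(1) unfolding e_def[symmetric] nonelementary_def by blast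
qed

end

section \<open>Random walks and their factors\<close>

text \<open>Tested on the set where \<open>f\<close> exceeds 1, the bound leaves no room for the
  excess.\<close>

lemma (in finite_measure) AE_le_1:
  fixes f :: "'a \<Rightarrow> ennreal"
  assumes [measurable]: "f \<in> borel_measurable M"
    and le: "\<And>B. B \<in> sets M \<Longrightarrow> (\<integral>\<^sup>+x. f x * indicator B x \<partial>M) \<le> emeasure M B"
  shows "AE x in M. f x \<le> 1"
proof -
  let ?B = "{x \<in> space M. 1 < f x}"
  have [measurable]: "?B \<in> sets M" by measurable
  have "emeasure M ?B + (\<integral>\<^sup>+x. (f x - 1) * indicator ?B x \<partial>M) =
      (\<integral>\<^sup>+x. indicator ?B x + (f x - 1) * indicator ?B x \<partial>M)"
    by (subst nn_integral_add) auto
  also have "\<dots> = (\<integral>\<^sup>+x. f x * indicator ?B x \<partial>M)"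
    by (rule nn_integral_cong) (auto simp: indicator_def add_diff_inverse_ennreal less_imp_le)
  also have "\<dots> \<le> emeasure M ?B + 0" using le[of ?B] by simp
  finally have "(\<integral>\<^sup>+x. (f x - 1) * indicator ?B x \<partial>M) = 0"
    using emeasure_finite[of ?B] by (subst (asm) ennreal_add_left_cancel_le) auto
  then have "AE x in M. (f x - 1) * indicator ?B x = 0" by (subst (asm) nn_integral_0_iff_AE) auto
  with AE_space show ?thesis
  proof eventually_elim
    case (elim x)
    show ?case
    proof (rule ccontr)
      assume n: "\<not> f x \<le> 1"
      then have "f x - 1 = 0" using elim by (simp add: not_le)
      then show False using n diff_gt_0_iff_gt_ennreal[of "f x" 1] by (simp add: not_le)
    qed
  qed
qed

locale rw = fixes \<mu> :: "'g::{group_add,countable} pmf"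
begin

sublocale seq: sequence_space "measure_pmf \<mu>"
  by unfold_locales

abbreviation \<Omega> :: "(nat \<Rightarrow> 'g) measure" where "\<Omega> \<equiv> PiM UNIV (\<lambda>_::nat. measure_pmf \<mu>)"

definition Z :: "nat \<Rightarrow> (nat \<Rightarrow> 'g) \<Rightarrow> 'g" where "Z n \<omega> = sum_list (map \<omega> [0..<n])"

definition shift :: "(nat \<Rightarrow> 'g) \<Rightarrow> nat \<Rightarrow> 'g" where "shift \<omega> = (\<lambda>n. \<omega> (Suc n))"

lemma prob_\<Omega>: "prob_space \<Omega>"
  by (rule prob_space_PiM) (rule prob_space_measure_pmf)

lemma Z_0 [simp]: "Z 0 \<omega> = 0"
  by (simp add: Z_def)

text \<open>Splits off the first increment. The inductions below condition on
  \<open>\<omega> 0\<close> and apply the hypothesis to the shifted sequence, which matches the left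
  action on the boundary.\<close>

lemma Z_Suc: "Z (Suc n) \<omega> = \<omega> 0 + Z n (shift \<omega>)"
proof -
  have "[0..<Suc n] = 0 # map Suc [0..<n]" by (simp add: upt_conv_Cons map_Suc_upt del: upt_Suc)
  then show ?thesis by (simp add: Z_def shift_def comp_def del: upt_Suc)
qed

lemma shift_case [simp]: "shift (case_nat x \<omega>) = \<omega>"
  by (simp add: shift_def)

lemma meas_comp [measurable]: "(\<lambda>\<omega>. \<omega> i) \<in> \<Omega> \<rightarrow>\<^sub>M count_space UNIV"
  using measurable_component_singleton[of i UNIV "\<lambda>_. measure_pmf \<mu>"]
  by (simp cong: measurable_cong_sets)

lemma meas_shift [measurable]: "shift \<in> \<Omega> \<rightarrow>\<^sub>M \<Omega>"
  unfolding shift_def by (rule measurable_abs_UNIV) (rule measurable_component_singleton, simp)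

lemma meas_plus:
  assumes "f \<in> M \<rightarrow>\<^sub>M count_space UNIV" "h \<in> M \<rightarrow>\<^sub>M count_space UNIV"
  shows "(\<lambda>x. f x + h x :: 'g) \<in> M \<rightarrow>\<^sub>M count_space UNIV"
  by (rule measurable_compose_countable[OF _ assms(1)], rule measurable_compose[OF assms(2)]) simp

lemma meas_Z [measurable]: "Z n \<in> \<Omega> \<rightarrow>\<^sub>M count_space UNIV"
proof (induction n)
  case (Suc n)
  have "(\<lambda>\<omega>. \<omega> 0 + Z n (shift \<omega>)) \<in> \<Omega> \<rightarrow>\<^sub>M count_space UNIV"
    by (rule meas_plus[OF meas_comp measurable_compose[OF meas_shift Suc]])
  then show ?case by (simp add: Z_Suc[abs_def])
qed (simp add: Z_def[abs_def])

lemma nn_iter: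
  assumes [measurable]: "f \<in> borel_measurable \<Omega>"
  shows "(\<integral>\<^sup>+\<omega>. f \<omega> \<partial>\<Omega>) = (\<integral>\<^sup>+x. \<integral>\<^sup>+\<omega>. f (case_nat x \<omega>) \<partial>\<Omega> \<partial>\<mu>)"
proof -
  have "(\<integral>\<^sup>+\<omega>. f \<omega> \<partial>\<Omega>) = (\<integral>\<^sup>+p. f (case p of (x, \<omega>) \<Rightarrow> case_nat x \<omega>) \<partial>(measure_pmf \<mu> \<Otimes>\<^sub>M \<Omega>))"
    by (subst seq.PiM_iter[symmetric], subst nn_integral_distr) auto
  also have "\<dots> = (\<integral>\<^sup>+x. \<integral>\<^sup>+\<omega>. f (case_nat x \<omega>) \<partial>\<Omega> \<partial>\<mu>)"
    by (subst seq.P.nn_integral_fst[symmetric]) auto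
  finally show ?thesis .
qed

lemma AE_iter:
  assumes "AE \<omega> in \<Omega>. P \<omega>"
  shows "AE x in \<mu>. AE \<omega> in \<Omega>. P (case_nat x \<omega>)"
proof -
  have "AE \<omega> in distr (measure_pmf \<mu> \<Otimes>\<^sub>M \<Omega>) \<Omega> (\<lambda>(x, \<omega>). case_nat x \<omega>). P \<omega>"
    using assms by (subst seq.PiM_iter)
  then have "AE p in measure_pmf \<mu> \<Otimes>\<^sub>M \<Omega>. P (case p of (x, \<omega>) \<Rightarrow> case_nat x \<omega>)"
    by (rule AE_distrD[rotated]) measurable
  then have "AE p in measure_pmf \<mu> \<Otimes>\<^sub>M \<Omega>. P (case_nat (fst p) (snd p))"
    by (simp add: case_prod_beta)
  interpret pair_sigma_finite "measure_pmf \<mu>" \<Omega>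
    by (intro pair_sigma_finite.intro prob_space_imp_sigma_finite prob_space_measure_pmf prob_\<Omega>)
  from AE_pair[OF \<open>AE p in _ \<Otimes>\<^sub>M _. P (case_nat (fst p) (snd p))\<close>] show ?thesis by simp
qed

lemma distr_shift: "distr \<Omega> \<Omega> shift = \<Omega>"
proof (rule measure_eqI)
  fix A assume "A \<in> sets (distr \<Omega> \<Omega> shift)"
  then have [measurable]: "A \<in> sets \<Omega>" by simp
  have "emeasure (distr \<Omega> \<Omega> shift) A = (\<integral>\<^sup>+\<omega>. indicator A (shift \<omega>) \<partial>\<Omega>)"
    using nn_integral_indicator[of A "distr \<Omega> \<Omega> shift"] nn_integral_distr[OF meas_shift, of "indicator A"] by simp
  also have "\<dots> = emeasure \<Omega> A" by (subst nn_iter) (simp_all add: measure_pmf.emeasure_space_1[simplified])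
  finally show "emeasure (distr \<Omega> \<Omega> shift) A = emeasure \<Omega> A" .
qed simp

lemma AE_shift: "AE \<omega> in \<Omega>. P \<omega> \<Longrightarrow> AE \<omega> in \<Omega>. P (shift \<omega>)"
proof -
  assume "AE \<omega> in \<Omega>. P \<omega>"
  then have "AE \<omega> in distr \<Omega> \<Omega> shift. P \<omega>" by (subst distr_shift)
  then show ?thesis by (rule AE_distrD[OF meas_shift])
qed

lemma integral_shift:
  fixes f :: "(nat \<Rightarrow> 'g) \<Rightarrow> real"
  assumes "f \<in> borel_measurable \<Omega>"
  shows "(\<integral>\<omega>. f (shift \<omega>) \<partial>\<Omega>) = (\<integral>\<omega>. f \<omega> \<partial>\<Omega>)"
  using integral_distr[OF meas_shift, of f] assms by (simp add: distr_shift)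

lemma integrable_shift:
  fixes f :: "(nat \<Rightarrow> 'g) \<Rightarrow> real"
  assumes "f \<in> borel_measurable \<Omega>"
  shows "integrable \<Omega> (\<lambda>\<omega>. f (shift \<omega>)) \<longleftrightarrow> integrable \<Omega> f"
  using integrable_distr_eq[OF meas_shift, of f] assms by (simp add: distr_shift)

text \<open>The \<open>n\<close>-fold convolution power of \<open>\<mu>\<close>, that is, the law of
  \<open>Z n\<close>.\<close>

primrec m :: "nat \<Rightarrow> 'g pmf" where
  "m 0 = return_pmf 0"
| "m (Suc n) = bind_pmf \<mu> (\<lambda>x. map_pmf ((+) x) (m n))"

lemma sum_list_in_m: "set xs \<subseteq> set_pmf \<mu> \<Longrightarrow> sum_list xs \<in> set_pmf (m (length xs))"
  by (induction xs) auto

lemma AE_Z_m: "AE \<omega> in \<Omega>. Z n \<omega> \<in> set_pmf (m n)"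
proof (induction n)
  case (Suc n)
  have "AE \<omega> in \<Omega>. \<omega> 0 \<in> set_pmf \<mu>"
  proof (rule AE_distrD[of "\<lambda>\<omega>. \<omega> 0" \<Omega> "measure_pmf \<mu>"])
    have "distr \<Omega> (measure_pmf \<mu>) (\<lambda>\<omega>. \<omega> 0) = measure_pmf \<mu>" by (rule seq.PiM_component) simp
    then show "AE x in distr \<Omega> (measure_pmf \<mu>) (\<lambda>\<omega>. \<omega> 0). x \<in> set_pmf \<mu>"
      by (simp only: AE_measure_pmf)
  qed simp
  with AE_shift[OF Suc] show ?case by eventually_elim (auto simp: Z_Suc)
qed simp

end

text \<open>An equivariant factor of the path space, written in increments: the single relation
  \<open>equivar\<close> says that the boundary point is unchanged when the path is shifted and
  moves along with the starting point.\<close>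

locale rw_factor = rw \<mu> for \<mu> :: "'g::{group_add,countable} pmf" +
  fixes N :: "'b measure" and A :: "'g \<Rightarrow> 'b \<Rightarrow> 'b" and \<beta> :: "(nat \<Rightarrow> 'g) \<Rightarrow> 'b"
  assumes generating: "generating \<mu>"
    and meas_A [measurable]: "\<And>z. A z \<in> N \<rightarrow>\<^sub>M N"
    and A_add: "\<And>z w y. y \<in> space N \<Longrightarrow> A (z + w) y = A z (A w y)"
    and A_0: "\<And>y. y \<in> space N \<Longrightarrow> A 0 y = y"
    and meas_\<beta> [measurable]: "\<beta> \<in> \<Omega> \<rightarrow>\<^sub>M N"
    and equivar: "AE \<omega> in \<Omega>. \<beta> \<omega> = A (\<omega> 0) (\<beta> (shift \<omega>))"
begin

definition lam :: "'b measure" where "lam = distr \<Omega> N \<beta>"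

lemma sets_lam [simp, measurable_cong]: "sets lam = sets N"
  by (simp add: lam_def)

lemma space_lam [simp]: "space lam = space N"
  by (simp add: lam_def)

sublocale L: prob_space lam
  unfolding lam_def by (rule seq.P.prob_space_distr) (rule meas_\<beta>)

lemma \<beta>_space: "\<beta> \<omega> \<in> space N"
  by (rule measurable_space[OF meas_\<beta>]) (simp add: space_PiM)

lemma A_space: "y \<in> space N \<Longrightarrow> A z y \<in> space N"
  by (rule measurable_space[OF meas_A])

lemma A_minus: "y \<in> space N \<Longrightarrow> A (- z) (A z y) = y"
  using A_add[of y "- z" z] A_0 by simp

lemma equivar_case: "AE x in \<mu>. AE \<omega> in \<Omega>. \<beta> (case_nat x \<omega>) = A x (\<beta> \<omega>)"
  using AE_iter[OF equivar] by simp

lemma meas_pair: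
  assumes "F \<in> borel_measurable (count_space UNIV \<Otimes>\<^sub>M N)"
  shows "(\<lambda>y. F (z :: 'g, y)) \<in> borel_measurable N"
  by (rule measurable_compose[OF _ assms]) measurable

lemma meas_from_countable:
  "(\<And>z. (\<lambda>y. F z y) \<in> borel_measurable N) \<Longrightarrow> (\<lambda>(z :: 'g, y). F z y) \<in> borel_measurable (count_space UNIV \<Otimes>\<^sub>M N)"
  by (rule measurable_pair_measure_countable1) auto

text \<open>Iterating \<open>equivar\<close>, the boundary point is \<open>A (Z n)\<close> applied
  to the boundary point of the increments after time \<open>n\<close>, which is independent of
  \<open>Z n\<close> and has law \<open>lam\<close>.\<close>

lemma joint_law:
  assumes F: "F \<in> borel_measurable (count_space UNIV \<Otimes>\<^sub>M N)"
  shows "(\<integral>\<^sup>+\<omega>. F (Z n \<omega>, \<beta> \<omega>) \<partial>\<Omega>) = (\<integral>\<^sup>+z. \<integral>\<^sup>+y. F (z, A z y) \<partial>lam \<partial>m n)"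
  using F
proof (induction n arbitrary: F)
  case 0
  note [measurable] = 0
  have "(\<integral>\<^sup>+\<omega>. F (0, \<beta> \<omega>) \<partial>\<Omega>) = (\<integral>\<^sup>+y. F (0, y) \<partial>lam)"
    unfolding lam_def using meas_pair[OF 0] by (subst nn_integral_distr) auto
  also have "\<dots> = (\<integral>\<^sup>+y. F (0, A 0 y) \<partial>lam)" by (rule nn_integral_cong) (simp add: A_0)
  finally show ?case by simp
next
  case (Suc n)
  note [measurable] = Suc.prems
  have F': "(\<lambda>(z, y). F (x + z, A x y)) \<in> borel_measurable (count_space UNIV \<Otimes>\<^sub>M N)" for x
    by (rule meas_from_countable) (rule measurable_compose[OF meas_A meas_pair[OF Suc.prems]])
  have Fm: "(\<lambda>\<omega>. F (Z (Suc n) \<omega>, \<beta> \<omega>)) \<in> borel_measurable \<Omega>"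
    by (rule measurable_compose[OF _ Suc.prems]) measurable
  have "(\<integral>\<^sup>+\<omega>. F (Z (Suc n) \<omega>, \<beta> \<omega>) \<partial>\<Omega>) = (\<integral>\<^sup>+x. \<integral>\<^sup>+\<omega>. F (x + Z n \<omega>, \<beta> (case_nat x \<omega>)) \<partial>\<Omega> \<partial>\<mu>)"
    using nn_iter[OF Fm] by (simp add: Z_Suc)
  also have "\<dots> = (\<integral>\<^sup>+x. \<integral>\<^sup>+\<omega>. F (x + Z n \<omega>, A x (\<beta> \<omega>)) \<partial>\<Omega> \<partial>\<mu>)"
    by (intro nn_integral_cong_AE, use equivar_case in eventually_elim) (rule nn_integral_cong_AE, auto)
  also have "\<dots> = (\<integral>\<^sup>+x. \<integral>\<^sup>+z. \<integral>\<^sup>+y. F (x + z, A x (A z y)) \<partial>lam \<partial>m n \<partial>\<mu>)"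
    using Suc.IH[OF F'] by simp
  also have "\<dots> = (\<integral>\<^sup>+x. \<integral>\<^sup>+z. \<integral>\<^sup>+y. F (x + z, A (x + z) y) \<partial>lam \<partial>m n \<partial>\<mu>)"
    by (intro nn_integral_cong) (simp add: A_add)
  finally show ?case by simp
qed

lemma stationary:
  assumes "f \<in> borel_measurable N"
  shows "(\<integral>\<^sup>+y. f y \<partial>lam) = (\<integral>\<^sup>+x. \<integral>\<^sup>+y. f (A x y) \<partial>lam \<partial>m n)"
proof -
  have [measurable]: "(\<lambda>(z :: 'g, y). f y) \<in> borel_measurable (count_space UNIV \<Otimes>\<^sub>M N)"
    using assms by measurable
  show ?thesis
    using joint_law[of "\<lambda>(z, y). f y" n] assms by (simp add: lam_def nn_integral_distr)
qed

lemma m_exhaust: obtains n where "z \<in> set_pmf (m (Suc n))"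
proof -
  obtain xs where xs: "xs \<noteq> []" "set xs \<subseteq> set_pmf \<mu>" "z = sum_list xs"
    using generating unfolding generating_def by blast
  then obtain n where "length xs = Suc n" by (cases xs) auto
  then show ?thesis using sum_list_in_m[OF xs(2)] xs(3) that by metis
qed

text \<open>Some convolution power charges \<open>z\<close>, and by stationarity the translate by
  \<open>z\<close>, weighted by this mass, is at most \<open>lam\<close>.\<close>

lemma abs_cont: "absolutely_continuous lam (distr lam N (A z))"
  unfolding absolutely_continuous_def
proof
  fix B assume B: "B \<in> null_sets lam"
  then have [measurable]: "B \<in> sets N" by (auto simp: null_sets_def)
  obtain n where n: "z \<in> set_pmf (m (Suc n))" by (rule m_exhaust)
  have "(\<integral>\<^sup>+x. \<integral>\<^sup>+y. indicator B (A x y) \<partial>lam \<partial>m (Suc n)) = 0"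
    using stationary[of "indicator B" "Suc n"] B by (auto simp: null_sets_def simp del: m.simps)
  then have "AE x in m (Suc n). (\<integral>\<^sup>+y. indicator B (A x y) \<partial>lam) = 0"
    by (subst (asm) nn_integral_0_iff_AE) auto
  then have "(\<integral>\<^sup>+y. indicator B (A z y) \<partial>lam) = 0" using n by (auto simp: AE_measure_pmf_iff)
  moreover have "emeasure (distr lam N (A z)) B = (\<integral>\<^sup>+y. indicator B (A z y) \<partial>lam)"
    using nn_integral_indicator[of B "distr lam N (A z)"] nn_integral_distr[of "A z" lam N "indicator B"] by simp
  ultimately show "B \<in> null_sets (distr lam N (A z))" by (auto simp: null_sets_def)
qed

definition \<rho> :: "'g \<Rightarrow> 'b \<Rightarrow> ennreal" where "\<rho> z = RN_deriv lam (distr lam N (A z))"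

lemma meas_\<rho> [measurable]: "\<rho> z \<in> borel_measurable N"
  unfolding \<rho>_def using borel_measurable_RN_deriv by (simp cong: measurable_cong_sets)

lemma \<rho>_integral:
  assumes [measurable]: "f \<in> borel_measurable N"
  shows "(\<integral>\<^sup>+y. \<rho> z y * f y \<partial>lam) = (\<integral>\<^sup>+y. f (A z y) \<partial>lam)"
  using L.RN_deriv_nn_integral[OF abs_cont, of z f] by (simp add: \<rho>_def nn_integral_distr)

lemma \<rho>_unique:
  assumes [measurable]: "f \<in> borel_measurable N"
    and "\<And>B. B \<in> sets N \<Longrightarrow> (\<integral>\<^sup>+y. f y * indicator B y \<partial>lam) = (\<integral>\<^sup>+y. indicator B (A z y) \<partial>lam)"
  shows "AE y in lam. f y = \<rho> z y"
  by (rule L.density_unique_finite_measure) (use assms \<rho>_integral in auto)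

lemma cocycle: "AE y in lam. \<rho> z y * \<rho> w (A (- z) y) = \<rho> (z + w) y"
proof (rule \<rho>_unique)
  fix B assume [measurable]: "B \<in> sets N"
  have "(\<integral>\<^sup>+y. \<rho> z y * \<rho> w (A (- z) y) * indicator B y \<partial>lam) = (\<integral>\<^sup>+y. \<rho> z y * (\<rho> w (A (- z) y) * indicator B y) \<partial>lam)"
    by (simp add: mult.assoc)
  also have "\<dots> = (\<integral>\<^sup>+y. \<rho> w (A (- z) (A z y)) * indicator B (A z y) \<partial>lam)"
    by (rule \<rho>_integral) measurable
  also have "\<dots> = (\<integral>\<^sup>+y. \<rho> w y * indicator B (A z y) \<partial>lam)"
    by (rule nn_integral_cong) (simp add: A_minus)
  also have "\<dots> = (\<integral>\<^sup>+y. indicator B (A z (A w y)) \<partial>lam)"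
    by (rule \<rho>_integral) measurable
  also have "\<dots> = (\<integral>\<^sup>+y. indicator B (A (z + w) y) \<partial>lam)"
    by (rule nn_integral_cong) (simp add: A_add)
  finally show "(\<integral>\<^sup>+y. \<rho> z y * \<rho> w (A (- z) y) * indicator B y \<partial>lam) = (\<integral>\<^sup>+y. indicator B (A (z + w) y) \<partial>lam)" .
qed measurable

lemma \<rho>_total: "(\<integral>\<^sup>+y. \<rho> z y \<partial>lam) = 1"
  using \<rho>_integral[of "\<lambda>_. 1" z] L.emeasure_space_1 by simp

lemma joint_density:
  assumes F: "F \<in> borel_measurable (count_space UNIV \<Otimes>\<^sub>M N)"
  shows "(\<integral>\<^sup>+\<omega>. F (Z n \<omega>, \<beta> \<omega>) \<partial>\<Omega>) = (\<integral>\<^sup>+z. \<integral>\<^sup>+y. \<rho> z y * F (z, y) \<partial>lam \<partial>m n)"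
proof -
  have "(\<integral>\<^sup>+y. F (z, A z y) \<partial>lam) = (\<integral>\<^sup>+y. \<rho> z y * F (z, y) \<partial>lam)" for z
    using \<rho>_integral[OF meas_pair[OF F, of z], of z] by simp
  then show ?thesis by (simp add: joint_law[OF F])
qed

text \<open>By \<open>joint_density\<close> a pair at which \<open>\<rho>\<close> vanishes is almost
  surely not met, so \<open>Q\<close> matters only where the density is nonzero.\<close>

lemma AE_joint:
  assumes "\<And>z. z \<in> set_pmf (m n) \<Longrightarrow> AE y in lam. \<rho> z y \<noteq> 0 \<longrightarrow> Q z y"
    "\<And>z. Measurable.pred N (Q z)"
  shows "AE \<omega> in \<Omega>. Q (Z n \<omega>) (\<beta> \<omega>)"
proof -
  note [measurable] = assms(2)
  let ?F = "\<lambda>(z, y). if Q z y then 0 else 1 :: ennreal"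
  have F: "?F \<in> borel_measurable (count_space UNIV \<Otimes>\<^sub>M N)" by (rule meas_from_countable) measurable
  have Fm [measurable]: "(\<lambda>\<omega>. ?F (Z n \<omega>, \<beta> \<omega>)) \<in> borel_measurable \<Omega>" by (rule measurable_compose[OF _ F]) measurable
  have "(\<integral>\<^sup>+\<omega>. ?F (Z n \<omega>, \<beta> \<omega>) \<partial>\<Omega>) = (\<integral>\<^sup>+z. \<integral>\<^sup>+y. \<rho> z y * ?F (z, y) \<partial>lam \<partial>m n)"
    by (rule joint_density[OF F])
  also have "\<dots> = (\<integral>\<^sup>+z. 0 \<partial>m n)"
  proof (rule nn_integral_cong_AE, unfold AE_measure_pmf_iff, rule ballI)
    fix z assume z: "z \<in> set_pmf (m n)"
    have "(\<integral>\<^sup>+y. \<rho> z y * ?F (z, y) \<partial>lam) = (\<integral>\<^sup>+y. 0 \<partial>lam)"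
      by (rule nn_integral_cong_AE, use assms(1)[OF z] in eventually_elim) auto
    then show "(\<integral>\<^sup>+y. \<rho> z y * ?F (z, y) \<partial>lam) = 0" by simp
  qed
  finally have "AE \<omega> in \<Omega>. ?F (Z n \<omega>, \<beta> \<omega>) = 0" using nn_integral_0_iff_AE[OF Fm] by simp
  then show ?thesis by eventually_elim (auto split: if_splits)
qed

lemma \<rho>_finite: "AE y in lam. \<rho> z y \<noteq> \<infinity>"
  by (rule nn_integral_PInf_AE) (auto simp: \<rho>_total)

text \<open>\<open>r z y\<close> is the density of the translate of \<open>lam\<close> by \<open>z\<close>; \<open>pmf (m n) z * r z y\<close> is the
  conditional probability of \<open>Z n = z\<close> given the boundary point \<open>y\<close>.\<close>

definition r :: "'g \<Rightarrow> 'b \<Rightarrow> real" where "r z y = enn2real (\<rho> z y)"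

lemma meas_r [measurable]: "r z \<in> borel_measurable N"
  unfolding r_def[abs_def] by measurable

lemma \<rho>_r: "AE y in lam. \<rho> z y = ennreal (r z y)"
  using \<rho>_finite[of z] by eventually_elim (simp add: r_def less_top)

lemma r_pos: "AE \<omega> in \<Omega>. 0 < r (Z n \<omega>) (\<beta> \<omega>)"
  by (rule AE_joint, use \<rho>_finite in eventually_elim)
    (auto simp: r_def enn2real_positive_iff less_top[symmetric] zero_less_iff_neq_zero)

text \<open>In the stationarity identity for \<open>m n\<close> the single term of \<open>z\<close>
  is dominated by the whole.\<close>

lemma conditional_le_1: "AE y in lam. ennreal (pmf (m n) z) * \<rho> z y \<le> 1"
proof (rule L.AE_le_1)
  fix B assume "B \<in> sets lam"
  then have [measurable]: "B \<in> sets N" by simp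
  have "(\<integral>\<^sup>+y. ennreal (pmf (m n) z) * \<rho> z y * indicator B y \<partial>lam) = ennreal (pmf (m n) z) * (\<integral>\<^sup>+y. \<rho> z y * indicator B y \<partial>lam)"
    by (subst nn_integral_cmult[symmetric]) (auto simp: mult.assoc)
  also have "\<dots> = (\<integral>\<^sup>+y. indicator B (A z y) \<partial>lam) * emeasure (m n) {z}"
    by (subst \<rho>_integral) (auto simp: emeasure_pmf_single mult.commute)
  also have "\<dots> = (\<integral>\<^sup>+x. (\<integral>\<^sup>+y. indicator B (A x y) \<partial>lam) * indicator {z} x \<partial>m n)"
    by simp
  also have "\<dots> \<le> (\<integral>\<^sup>+x. (\<integral>\<^sup>+y. indicator B (A x y) \<partial>lam) \<partial>m n)"
    by (rule nn_integral_mono) (auto simp: indicator_def)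
  also have "\<dots> = (\<integral>\<^sup>+y. indicator B y \<partial>lam)" by (rule stationary[symmetric]) measurable
  finally show "(\<integral>\<^sup>+y. ennreal (pmf (m n) z) * \<rho> z y * indicator B y \<partial>lam) \<le> emeasure lam B" by simp
qed measurable

end

section \<open>Entropy\<close>

context rw begin

text \<open>Information of one increment; off the support it is 0, since
  \<open>ln 0 = 0\<close>.\<close>

definition v :: "'g \<Rightarrow> real" where "v x = - ln (pmf \<mu> x)"

lemma v_nonneg: "0 \<le> v x"
proof (cases "pmf \<mu> x = 0")
  case False
  then have "0 < pmf \<mu> x" using pmf_nonneg[of \<mu> x] by linarith
  then show ?thesis using pmf_le_1[of \<mu> x] by (simp add: v_def)
qed (simp add: v_def)

lemma nn_integral_comp: "(\<integral>\<^sup>+\<omega>. f (\<omega> i) \<partial>\<Omega>) = (\<integral>\<^sup>+x. f x \<partial>\<mu>)"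
proof -
  have "distr \<Omega> (measure_pmf \<mu>) (\<lambda>\<omega>. \<omega> i) = measure_pmf \<mu>" by (rule seq.PiM_component) simp
  then have "(\<integral>\<^sup>+x. f x \<partial>\<mu>) = (\<integral>\<^sup>+x. f x \<partial>distr \<Omega> (measure_pmf \<mu>) (\<lambda>\<omega>. \<omega> i))" by (simp only:)
  also have "\<dots> = (\<integral>\<^sup>+\<omega>. f (\<omega> i) \<partial>\<Omega>)" by (rule nn_integral_distr) simp_all
  finally show ?thesis by simp
qed

lemma pmf_m_Suc: "pmf \<mu> x * pmf (m n) z \<le> pmf (m (Suc n)) (x + z)"
proof -
  have "ennreal (pmf \<mu> x * pmf (m n) z) = (\<integral>\<^sup>+y. ennreal (pmf (m n) z) * indicator {x} y \<partial>\<mu>)"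
    by (subst nn_integral_indicator_singleton) (auto simp: emeasure_pmf_single ennreal_mult mult.commute)
  also have "\<dots> \<le> (\<integral>\<^sup>+y. ennreal (pmf (map_pmf ((+) y) (m n)) (x + z)) \<partial>\<mu>)"
  proof (rule nn_integral_mono)
    fix y
    have "pmf (map_pmf ((+) x) (m n)) (x + z) = pmf (m n) z" by (rule pmf_map_inj') (simp add: inj_def)
    then show "ennreal (pmf (m n) z) * indicator {x} y \<le> ennreal (pmf (map_pmf ((+) y) (m n)) (x + z))"
      by (auto simp: indicator_def)
  qed
  also have "\<dots> = ennreal (pmf (m (Suc n)) (x + z))" by (simp add: ennreal_pmf_bind)
  finally show ?thesis by (simp add: ennreal_le_iff)
qed

text \<open>One way to reach \<open>Z n\<close> is by the increments actually made, so its
  probability is at least the product of theirs.\<close>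

lemma ln_m_bound: "AE \<omega> in \<Omega>. - ln (pmf (m n) (Z n \<omega>)) \<le> (\<Sum>i<n. v (\<omega> i))"
proof (induction n)
  case (Suc n)
  have "AE \<omega> in \<Omega>. \<omega> 0 \<in> set_pmf \<mu>"
    using AE_Z_m[of 1] by eventually_elim (auto simp: Z_def)
  with AE_shift[OF Suc] AE_shift[OF AE_Z_m[of n]] show ?case
  proof eventually_elim
    case (elim \<omega>)
    let ?z = "Z n (shift \<omega>)"
    have pos: "0 < pmf \<mu> (\<omega> 0)" "0 < pmf (m n) ?z" using elim by (auto simp: pmf_positive)
    then have "ln (pmf \<mu> (\<omega> 0) * pmf (m n) ?z) \<le> ln (pmf (m (Suc n)) (\<omega> 0 + ?z))"
      using pmf_m_Suc[of "\<omega> 0" n ?z] by (subst ln_le_cancel_iff) (auto intro: less_le_trans[OF mult_pos_pos] simp del: m.simps)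
    then have "- ln (pmf (m (Suc n)) (Z (Suc n) \<omega>)) \<le> v (\<omega> 0) + - ln (pmf (m n) ?z)"
      using pos by (simp add: Z_Suc ln_mult v_def del: m.simps)
    also have "- ln (pmf (m n) ?z) \<le> (\<Sum>i<n. v (\<omega> (Suc i)))" using elim by (simp add: shift_def)
    finally show ?case by (simp only: sum.lessThan_Suc_shift)
  qed
qed simp

end

context rw_factor begin

definition cp :: "nat \<Rightarrow> (nat \<Rightarrow> 'g) \<Rightarrow> real" where
  "cp n \<omega> = pmf (m n) (Z n \<omega>) * r (Z n \<omega>) (\<beta> \<omega>)"

text \<open>Its integral is the conditional entropy of \<open>Z n\<close> given the boundary
  point.\<close>

definition u :: "nat \<Rightarrow> (nat \<Rightarrow> 'g) \<Rightarrow> real" where "u n \<omega> = - ln (cp n \<omega>)"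

lemma meas_Z_\<beta>:
  assumes "\<And>z. (\<lambda>y. F z y) \<in> borel_measurable N"
  shows "(\<lambda>\<omega>. F (Z n \<omega>) (\<beta> \<omega>)) \<in> borel_measurable \<Omega>"
  by (rule measurable_compose_countable[OF _ meas_Z]) (rule measurable_compose[OF meas_\<beta> assms])

lemma meas_rZ [measurable]: "(\<lambda>\<omega>. r (Z n \<omega>) (\<beta> \<omega>)) \<in> borel_measurable \<Omega>"
  by (rule meas_Z_\<beta>) (rule meas_r)

lemma meas_cp [measurable]: "cp n \<in> borel_measurable \<Omega>"
  unfolding cp_def[abs_def] by (rule meas_Z_\<beta>[of "\<lambda>z y. pmf (m n) z * r z y"]) measurable

lemma meas_u [measurable]: "u n \<in> borel_measurable \<Omega>"
  unfolding u_def[abs_def] by measurable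

lemma cp_pos: "AE \<omega> in \<Omega>. 0 < cp n \<omega>"
  using AE_Z_m[of n] r_pos[of n] by eventually_elim (simp add: cp_def pmf_positive)

lemma cp_le_1: "AE \<omega> in \<Omega>. cp n \<omega> \<le> 1"
  unfolding cp_def
proof (rule AE_joint)
  fix z
  show "AE y in lam. \<rho> z y \<noteq> 0 \<longrightarrow> pmf (m n) z * r z y \<le> 1"
    using conditional_le_1[of n z] \<rho>_r[of z]
  proof eventually_elim
    case (elim y)
    then have "ennreal (pmf (m n) z * r z y) \<le> 1" by (simp add: ennreal_mult')
    then show ?case by simp
  qed
qed measurable

lemma u_nonneg: "AE \<omega> in \<Omega>. 0 \<le> u n \<omega>"
  using cp_pos[of n] cp_le_1[of n] by eventually_elim (simp add: u_def)

text \<open>Gibbs' inequality for the conditional distribution of \<open>Z n\<close>: \<open>-ln p \<le> -ln q + (q / p - 1)\<close>,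
  and \<open>q / p\<close> has expectation at most 1.\<close>

lemma gibbs:
  assumes q0: "\<And>z y. 0 \<le> q z y" and q [measurable]: "\<And>z. (\<lambda>y. q z y) \<in> borel_measurable N"
    and q1: "\<And>y. y \<in> space N \<Longrightarrow> (\<integral>\<^sup>+z. ennreal (q z y) \<partial>count_space UNIV) \<le> 1"
    and qpos: "AE \<omega> in \<Omega>. 0 < q (Z n \<omega>) (\<beta> \<omega>)"
  shows "(\<integral>\<^sup>+\<omega>. ennreal (u n \<omega>) \<partial>\<Omega>) \<le> (\<integral>\<^sup>+\<omega>. ennreal (- ln (q (Z n \<omega>) (\<beta> \<omega>))) \<partial>\<Omega>)"
proof -
  have qle: "q z y \<le> 1" if "y \<in> space N" for z y
  proof -
    have "ennreal (q z y) = (\<integral>\<^sup>+x. ennreal (q x y) * indicator {z} x \<partial>count_space UNIV)" by simp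
    also have "\<dots> \<le> (\<integral>\<^sup>+x. ennreal (q x y) \<partial>count_space UNIV)" by (rule nn_integral_mono) (auto simp: indicator_def)
    also have "\<dots> \<le> 1" by (rule q1[OF that])
    finally show ?thesis by simp
  qed
  \<comment> \<open>The ratio \<open>q / p\<close>. Under the joint law the density \<open>r\<close>
    and the mass of \<open>m n\<close> cancel, which leaves the total mass of \<open>q\<close>, at
    most 1.\<close>
  define F where "F z y = ennreal (q z y / (pmf (m n) z * r z y))" for z y
  have Fm [measurable]: "(\<lambda>y. F z y) \<in> borel_measurable N" for z unfolding F_def by measurable
  have qm: "(\<lambda>(z, y). ennreal (q z y)) \<in> borel_measurable (count_space UNIV \<Otimes>\<^sub>M lam)"
  proof -
    have "(\<lambda>(z, y). ennreal (q z y)) \<in> borel_measurable (count_space UNIV \<Otimes>\<^sub>M N)"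
      by (rule meas_from_countable) measurable
    then show ?thesis by (simp cong: measurable_cong_sets sets_pair_measure_cong)
  qed
  have "(\<integral>\<^sup>+\<omega>. F (Z n \<omega>) (\<beta> \<omega>) \<partial>\<Omega>) = (\<integral>\<^sup>+z. \<integral>\<^sup>+y. \<rho> z y * F z y \<partial>lam \<partial>m n)"
    using joint_density[OF meas_from_countable[OF Fm], where n = n] by simp
  also have "\<dots> \<le> (\<integral>\<^sup>+z. \<integral>\<^sup>+y. ennreal (q z y / pmf (m n) z) \<partial>lam \<partial>m n)"
  proof (rule nn_integral_mono, rule nn_integral_mono_AE)
    fix z
    show "AE y in lam. \<rho> z y * F z y \<le> ennreal (q z y / pmf (m n) z)"
      using \<rho>_r[of z]
    proof eventually_elim
      case (elim y)
      have r0: "0 \<le> r z y" by (simp add: r_def)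
      have "\<rho> z y * F z y = ennreal (r z y) * ennreal (q z y / (pmf (m n) z * r z y))"
        by (simp add: elim F_def)
      also have "\<dots> = ennreal (r z y * (q z y / (pmf (m n) z * r z y)))"
        using r0 q0[of z y] by (intro ennreal_mult[symmetric]) auto
      also have "\<dots> \<le> ennreal (q z y / pmf (m n) z)"
      proof (rule ennreal_leI)
        show "r z y * (q z y / (pmf (m n) z * r z y)) \<le> q z y / pmf (m n) z"
          using q0[of z y] by (cases "r z y = 0") auto
      qed
      finally show ?case .
    qed
  qed
  also have "\<dots> = (\<integral>\<^sup>+z. ennreal (pmf (m n) z) * (\<integral>\<^sup>+y. ennreal (q z y / pmf (m n) z) \<partial>lam) \<partial>count_space UNIV)"
    by (rule nn_integral_measure_pmf)
  also have "\<dots> = (\<integral>\<^sup>+z. (\<integral>\<^sup>+y. ennreal (pmf (m n) z) * ennreal (q z y / pmf (m n) z) \<partial>lam) \<partial>count_space UNIV)"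
    by (intro nn_integral_cong nn_integral_cmult[symmetric]) (simp cong: measurable_cong_sets)
  also have "\<dots> \<le> (\<integral>\<^sup>+z. (\<integral>\<^sup>+y. ennreal (q z y) \<partial>lam) \<partial>count_space UNIV)"
    using q0 by (intro nn_integral_mono) (auto simp flip: ennreal_mult')
  also have "\<dots> = (\<integral>\<^sup>+y. (\<integral>\<^sup>+z. ennreal (q z y) \<partial>count_space UNIV) \<partial>lam)"
  proof -
    interpret pair_sigma_finite "count_space (UNIV :: 'g set)" lam
      by (intro pair_sigma_finite.intro sigma_finite_measure_count_space_countable L.sigma_finite_measure_axioms) simp
    show ?thesis using Fubini[OF qm] by simp
  qed
  also have "\<dots> \<le> (\<integral>\<^sup>+y. 1 \<partial>lam)" by (rule nn_integral_mono) (use q1 in simp)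
  also have "\<dots> = 1" using L.emeasure_space_1 by simp
  finally have FE: "(\<integral>\<^sup>+\<omega>. F (Z n \<omega>) (\<beta> \<omega>) \<partial>\<Omega>) \<le> 1" .
  have [measurable]: "(\<lambda>\<omega>. F (Z n \<omega>) (\<beta> \<omega>)) \<in> borel_measurable \<Omega>" by (rule meas_Z_\<beta>) (rule Fm)
  have [measurable]: "(\<lambda>\<omega>. q (Z n \<omega>) (\<beta> \<omega>)) \<in> borel_measurable \<Omega>" by (rule meas_Z_\<beta>) (rule q)
  have "(\<integral>\<^sup>+\<omega>. ennreal (u n \<omega>) \<partial>\<Omega>) + 1 = (\<integral>\<^sup>+\<omega>. ennreal (u n \<omega>) + 1 \<partial>\<Omega>)"
    using seq.P.emeasure_space_1 by (subst nn_integral_add) auto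
  also have "\<dots> \<le> (\<integral>\<^sup>+\<omega>. ennreal (- ln (q (Z n \<omega>) (\<beta> \<omega>))) + F (Z n \<omega>) (\<beta> \<omega>) \<partial>\<Omega>)"
  proof (rule nn_integral_mono_AE, use cp_pos[of n] cp_le_1[of n] qpos in eventually_elim)
    case (elim \<omega>)
    let ?q = "q (Z n \<omega>) (\<beta> \<omega>)" and ?p = "cp n \<omega>"
    have q1: "?q \<le> 1" using qle \<beta>_space by blast
    have "ln (?q / ?p) \<le> ?q / ?p - 1" using elim by (intro ln_le_minus_one) simp
    then have "- ln ?p + 1 \<le> - ln ?q + ?q / ?p" using elim by (simp add: ln_div)
    then have "ennreal (- ln ?p + 1) \<le> ennreal (- ln ?q + ?q / ?p)" by (rule ennreal_leI)
    moreover have nn: "0 \<le> - ln ?p" "0 \<le> - ln ?q" "0 \<le> ?q / ?p" using elim q1 by auto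
    moreover have "ennreal (- ln ?p + 1) = ennreal (- ln ?p) + ennreal 1" using nn by (intro ennreal_plus) auto
    moreover have "ennreal (- ln ?q + ?q / ?p) = ennreal (- ln ?q) + ennreal (?q / ?p)" using nn by (intro ennreal_plus) auto
    ultimately show ?case by (simp only: u_def F_def cp_def[symmetric] ennreal_1)
  qed
  also have "\<dots> = (\<integral>\<^sup>+\<omega>. ennreal (- ln (q (Z n \<omega>) (\<beta> \<omega>))) \<partial>\<Omega>) + (\<integral>\<^sup>+\<omega>. F (Z n \<omega>) (\<beta> \<omega>) \<partial>\<Omega>)"
    by (rule nn_integral_add) auto
  also have "\<dots> \<le> (\<integral>\<^sup>+\<omega>. ennreal (- ln (q (Z n \<omega>) (\<beta> \<omega>))) \<partial>\<Omega>) + 1" using FE by (rule add_left_mono)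
  finally show ?thesis by (simp add: add.commute[of _ 1] ennreal_add_left_cancel_le)
qed

text \<open>Gibbs' inequality with the unconditioned law as competitor: conditioning does not
  increase entropy, and that of \<open>Z n\<close> is at most \<open>n\<close> times the entropy of
  \<open>\<mu>\<close>.\<close>

lemma u_finite:
  assumes "(\<integral>\<^sup>+x. ennreal (v x) \<partial>\<mu>) < \<top>"
  shows "(\<integral>\<^sup>+\<omega>. ennreal (u n \<omega>) \<partial>\<Omega>) < \<top>"
proof -
  have "(\<integral>\<^sup>+\<omega>. ennreal (u n \<omega>) \<partial>\<Omega>) \<le> (\<integral>\<^sup>+\<omega>. ennreal (- ln (pmf (m n) (Z n \<omega>))) \<partial>\<Omega>)"
  proof (rule gibbs[where q = "\<lambda>z y. pmf (m n) z"])
    show "AE \<omega> in \<Omega>. 0 < pmf (m n) (Z n \<omega>)" using AE_Z_m[of n] by eventually_elim (simp add: pmf_positive)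
  qed (simp_all add: nn_integral_pmf measure_pmf.emeasure_space_1[simplified])
  also have "\<dots> \<le> (\<integral>\<^sup>+\<omega>. (\<Sum>i<n. ennreal (v (\<omega> i))) \<partial>\<Omega>)"
    by (rule nn_integral_mono_AE, use ln_m_bound[of n] in eventually_elim)
      (auto simp: v_nonneg sum_ennreal intro!: ennreal_leI)
  also have "\<dots> = (\<Sum>i<n. (\<integral>\<^sup>+\<omega>. ennreal (v (\<omega> i)) \<partial>\<Omega>))"
    by (rule nn_integral_sum) (rule measurable_compose[OF meas_comp], simp)
  also have "\<dots> = of_nat n * (\<integral>\<^sup>+x. ennreal (v x) \<partial>\<mu>)" by (simp add: nn_integral_comp[of "\<lambda>x. ennreal (v x)"])
  also have "\<dots> < \<top>" using assms by (simp add: ennreal_mult_less_top of_nat_less_top)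
  finally show ?thesis .
qed

lemma u_integrable:
  assumes "(\<integral>\<^sup>+x. ennreal (v x) \<partial>\<mu>) < \<top>"
  shows "integrable \<Omega> (u n)" "ennreal (\<integral>\<omega>. u n \<omega> \<partial>\<Omega>) = (\<integral>\<^sup>+\<omega>. ennreal (u n \<omega>) \<partial>\<Omega>)"
proof -
  show "integrable \<Omega> (u n)" by (rule integrableI_nonneg) (use u_nonneg u_finite[OF assms] in auto)
  then show "ennreal (\<integral>\<omega>. u n \<omega> \<partial>\<Omega>) = (\<integral>\<^sup>+\<omega>. ennreal (u n \<omega>) \<partial>\<Omega>)"
    using nn_integral_eq_integral u_nonneg by metis
qed

text \<open>Chain rule for densities along the walk. The identity \<open>cocycle\<close> fails on a
  null set depending on two group elements; countability of the group removes this dependence, so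
  that random elements can be inserted.\<close>

lemma r_cocycle: "AE \<omega> in \<Omega>. r (Z (Suc n) \<omega>) (\<beta> \<omega>) = r (Z 1 \<omega>) (\<beta> \<omega>) * r (Z n (shift \<omega>)) (\<beta> (shift \<omega>))"
proof -
  have "AE y in lam. \<forall>z w. \<rho> z y * \<rho> w (A (- z) y) = \<rho> (z + w) y"
    by (simp add: AE_all_countable cocycle)
  then have "AE y in distr \<Omega> N \<beta>. \<forall>z w. \<rho> z y * \<rho> w (A (- z) y) = \<rho> (z + w) y" unfolding lam_def .
  then have "AE \<omega> in \<Omega>. \<forall>z w. \<rho> z (\<beta> \<omega>) * \<rho> w (A (- z) (\<beta> \<omega>)) = \<rho> (z + w) (\<beta> \<omega>)"
    by (rule AE_distrD[OF meas_\<beta>])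
  with equivar show ?thesis
  proof eventually_elim
    case (elim \<omega>)
    have "A (- \<omega> 0) (\<beta> \<omega>) = \<beta> (shift \<omega>)" using elim A_minus \<beta>_space by simp
    then have "\<rho> (\<omega> 0 + Z n (shift \<omega>)) (\<beta> \<omega>) = \<rho> (\<omega> 0) (\<beta> \<omega>) * \<rho> (Z n (shift \<omega>)) (\<beta> (shift \<omega>))"
      using elim(2)[rule_format, of "\<omega> 0" "Z n (shift \<omega>)"] by simp
    moreover have "Z 1 \<omega> = \<omega> 0" by (simp add: Z_def)
    ultimately show ?case by (simp add: Z_Suc r_def enn2real_mult)
  qed
qed

end

section \<open>Maximality of a factor of zero conditional entropy\<close>

text \<open>The factor \<open>G\<close> refines \<open>F\<close> through \<open>\<pi>\<close>, and
  at suitable times the conditional entropy of \<open>F\<close> is arbitrarily small compared with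
  the time. The goal is that \<open>G\<close> carries no further event.\<close>

locale rw_factor_pair = F: rw_factor \<mu> N A \<beta> + G: rw_factor \<mu> N' A' \<beta>'
  for \<mu> :: "'g::{group_add,countable} pmf" and N :: "'b measure" and A :: "'g \<Rightarrow> 'b \<Rightarrow> 'b" and \<beta> :: "(nat \<Rightarrow> 'g) \<Rightarrow> 'b"
    and N' :: "'c measure" and A' :: "'g \<Rightarrow> 'c \<Rightarrow> 'c" and \<beta>' :: "(nat \<Rightarrow> 'g) \<Rightarrow> 'c" +
  fixes \<pi> :: "'c \<Rightarrow> 'b"
  assumes meas_\<pi> [measurable]: "\<pi> \<in> N' \<rightarrow>\<^sub>M N" and \<beta>_\<pi>: "\<And>\<omega>. \<beta> \<omega> = \<pi> (\<beta>' \<omega>)"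
    and ent: "(\<integral>\<^sup>+x. ennreal (F.v x) \<partial>\<mu>) < \<top>"
    and small: "\<And>\<epsilon>. \<epsilon> > 0 \<Longrightarrow> \<exists>n. (\<integral>\<^sup>+\<omega>. ennreal (F.u (Suc n) \<omega>) \<partial>F.\<Omega>) \<le> ennreal (\<epsilon> * real (Suc n))"
begin

text \<open>Excess of the log density of the finer factor; the mass of \<open>m n\<close> cancels,
  so by \<open>l_u\<close> it is the difference of the two conditional informations.\<close>

definition l :: "nat \<Rightarrow> (nat \<Rightarrow> 'g) \<Rightarrow> real" where
  "l n \<omega> = ln (G.r (F.Z n \<omega>) (\<beta>' \<omega>)) - ln (F.r (F.Z n \<omega>) (\<beta> \<omega>))"

lemma meas_l [measurable]: "l n \<in> borel_measurable F.\<Omega>"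
  unfolding l_def[abs_def] by measurable

lemma l_u: "AE \<omega> in F.\<Omega>. l n \<omega> = F.u n \<omega> - G.u n \<omega>"
  using F.AE_Z_m[of n] F.r_pos[of n] G.r_pos[of n]
proof eventually_elim
  case (elim \<omega>)
  then have "0 < pmf (F.m n) (F.Z n \<omega>)" by (simp add: pmf_positive)
  then show ?case using elim by (simp add: l_def F.u_def G.u_def F.cp_def G.cp_def ln_mult)
qed

lemma l_integrable: "integrable F.\<Omega> (l n)"
proof -
  have "integrable F.\<Omega> (\<lambda>\<omega>. F.u n \<omega> - G.u n \<omega>)" using F.u_integrable[OF ent] G.u_integrable[OF ent] by simp
  then show ?thesis using l_u[of n] by (subst integrable_cong_AE) auto
qed

lemma l_Suc: "AE \<omega> in F.\<Omega>. l (Suc n) \<omega> = l 1 \<omega> + l n (F.shift \<omega>)"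
  using F.r_cocycle[of n] G.r_cocycle[of n] F.r_pos[of 1] G.r_pos[of 1] F.AE_shift[OF F.r_pos[of n]] F.AE_shift[OF G.r_pos[of n]]
  by eventually_elim (simp add: l_def ln_mult)

lemma l_integral: "(\<integral>\<omega>. l (Suc n) \<omega> \<partial>F.\<Omega>) = real (Suc n) * (\<integral>\<omega>. l 1 \<omega> \<partial>F.\<Omega>)"
proof (induction n)
  case (Suc n)
  have "(\<integral>\<omega>. l (Suc (Suc n)) \<omega> \<partial>F.\<Omega>) = (\<integral>\<omega>. l 1 \<omega> + l (Suc n) (F.shift \<omega>) \<partial>F.\<Omega>)"
    by (rule integral_cong_AE) (use l_Suc[of "Suc n"] in auto)
  also have "\<dots> = (\<integral>\<omega>. l 1 \<omega> \<partial>F.\<Omega>) + (\<integral>\<omega>. l (Suc n) (F.shift \<omega>) \<partial>F.\<Omega>)"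
    by (rule Bochner_Integration.integral_add) (use l_integrable F.integrable_shift[OF meas_l] in auto)
  finally show ?case using Suc F.integral_shift[OF meas_l, of "Suc n"] by (simp add: algebra_simps)
qed simp

text \<open>The mean of \<open>l n\<close> is linear in \<open>n\<close> by the cocycle identity,
  but at most the conditional entropy of \<open>F\<close>, hence at most
  \<open>\<epsilon> * n\<close> for suitable \<open>n\<close>.\<close>

lemma l_1_le: "(\<integral>\<omega>. l 1 \<omega> \<partial>F.\<Omega>) \<le> 0"
proof (rule field_le_epsilon)
  fix \<epsilon> :: real assume "\<epsilon> > 0"
  then obtain n where n: "(\<integral>\<^sup>+\<omega>. ennreal (F.u (Suc n) \<omega>) \<partial>F.\<Omega>) \<le> ennreal (\<epsilon> * real (Suc n))" using small by blast
  have "real (Suc n) * (\<integral>\<omega>. l 1 \<omega> \<partial>F.\<Omega>) = (\<integral>\<omega>. F.u (Suc n) \<omega> - G.u (Suc n) \<omega> \<partial>F.\<Omega>)"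
    unfolding l_integral[symmetric] by (rule integral_cong_AE) (use l_u in auto)
  also have "\<dots> = (\<integral>\<omega>. F.u (Suc n) \<omega> \<partial>F.\<Omega>) - (\<integral>\<omega>. G.u (Suc n) \<omega> \<partial>F.\<Omega>)"
    by (rule Bochner_Integration.integral_diff) (use F.u_integrable[OF ent] G.u_integrable[OF ent] in auto)
  also have "\<dots> \<le> (\<integral>\<omega>. F.u (Suc n) \<omega> \<partial>F.\<Omega>)"
    using integral_nonneg_AE[OF G.u_nonneg] by simp
  also have "\<dots> \<le> \<epsilon> * real (Suc n)"
  proof -
    have "ennreal (\<integral>\<omega>. F.u (Suc n) \<omega> \<partial>F.\<Omega>) \<le> ennreal (\<epsilon> * real (Suc n))"
      using n F.u_integrable(2)[OF ent] by simp
    then show ?thesis using \<open>\<epsilon> > 0\<close> by (subst (asm) ennreal_le_iff) auto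
  qed
  finally show "(\<integral>\<omega>. l 1 \<omega> \<partial>F.\<Omega>) \<le> 0 + \<epsilon>" by (simp add: mult.commute[of \<epsilon>])
qed

definition w :: "(nat \<Rightarrow> 'g) \<Rightarrow> real" where
  "w \<omega> = F.r (F.Z 1 \<omega>) (\<beta> \<omega>) / G.r (F.Z 1 \<omega>) (\<beta>' \<omega>)"

lemma meas_w [measurable]: "w \<in> borel_measurable F.\<Omega>"
  unfolding w_def[abs_def] by measurable

lemma lam_\<pi>: "F.lam = distr G.lam N \<pi>"
  unfolding F.lam_def G.lam_def by (subst distr_distr) (auto simp: comp_def \<beta>_\<pi>[abs_def])

lemma nn_\<pi>: "f \<in> borel_measurable N \<Longrightarrow> (\<integral>\<^sup>+y. f (\<pi> y) \<partial>G.lam) = (\<integral>\<^sup>+y. f y \<partial>F.lam)"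
  unfolding lam_\<pi> by (subst nn_integral_distr) (auto cong: measurable_cong_sets)

lemma \<rho>_r_\<pi>: "AE y in G.lam. F.\<rho> z (\<pi> y) = ennreal (F.r z (\<pi> y))"
proof (rule AE_distrD[of \<pi> G.lam N])
  show "\<pi> \<in> G.lam \<rightarrow>\<^sub>M N" by (simp cong: measurable_cong_sets)
  show "AE y in distr G.lam N \<pi>. F.\<rho> z y = ennreal (F.r z y)" using F.\<rho>_r[of z] by (simp only: lam_\<pi>)
qed

lemma w_integral: "(\<integral>\<^sup>+\<omega>. ennreal (w \<omega>) \<partial>F.\<Omega>) \<le> 1"
proof -
  let ?W = "\<lambda>z y. ennreal (F.r z (\<pi> y) / G.r z y)"
  have m: "(\<lambda>(z, y). ?W z y) \<in> borel_measurable (count_space UNIV \<Otimes>\<^sub>M N')"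
    by (rule G.meas_from_countable) measurable
  have "(\<integral>\<^sup>+\<omega>. ennreal (w \<omega>) \<partial>F.\<Omega>) = (\<integral>\<^sup>+z. \<integral>\<^sup>+y. G.\<rho> z y * ?W z y \<partial>G.lam \<partial>F.m 1)"
    using G.joint_density[OF m, where n = 1] by (simp add: w_def \<beta>_\<pi>)
  also have "\<dots> \<le> (\<integral>\<^sup>+z. \<integral>\<^sup>+y. F.\<rho> z (\<pi> y) \<partial>G.lam \<partial>F.m 1)"
  proof (rule nn_integral_mono, rule nn_integral_mono_AE)
    fix z
    show "AE y in G.lam. G.\<rho> z y * ?W z y \<le> F.\<rho> z (\<pi> y)"
      using G.\<rho>_r[of z] \<rho>_r_\<pi>[of z]
    proof eventually_elim
      case (elim y)
      have n: "0 \<le> G.r z y" "0 \<le> F.r z (\<pi> y)" by (simp_all add: G.r_def F.r_def)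
      have "G.\<rho> z y * ?W z y = ennreal (G.r z y * (F.r z (\<pi> y) / G.r z y))"
        unfolding elim(1) using n by (intro ennreal_mult[symmetric]) auto
      also have "\<dots> \<le> ennreal (F.r z (\<pi> y))" using n by (intro ennreal_leI) (cases "G.r z y = 0", auto)
      finally show ?case by (simp add: elim)
    qed
  qed
  also have "\<dots> = 1" by (simp add: nn_\<pi> F.\<rho>_total measure_pmf.emeasure_space_1[simplified])
  finally show ?thesis .
qed

text \<open>Equality case of Jensen's inequality: \<open>l 1 = - ln w\<close> is pointwise at least
  \<open>1 - w\<close>, while the mean of \<open>l 1\<close> is at most 0 and that of
  \<open>w\<close> at most 1.\<close>

lemma w_eq_1: "AE \<omega> in F.\<Omega>. w \<omega> = 1"
proof -
  have pos: "AE \<omega> in F.\<Omega>. 0 < w \<omega> \<and> l 1 \<omega> = - ln (w \<omega>)"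
    using F.r_pos[of 1] G.r_pos[of 1] by eventually_elim (simp add: w_def l_def ln_div)
  have wi: "integrable F.\<Omega> w"
  proof (rule integrableI_nonneg)
    show "AE \<omega> in F.\<Omega>. 0 \<le> w \<omega>" using pos by eventually_elim simp
    show "(\<integral>\<^sup>+\<omega>. ennreal (w \<omega>) \<partial>F.\<Omega>) < \<infinity>" using w_integral by (simp add: order_le_less_trans[OF _ ennreal_one_less_top])
  qed simp
  have w1: "(\<integral>\<omega>. w \<omega> \<partial>F.\<Omega>) \<le> 1"
  proof -
    have "ennreal (\<integral>\<omega>. w \<omega> \<partial>F.\<Omega>) \<le> 1"
      using w_integral nn_integral_eq_integral[OF wi] pos by (simp add: eventually_mono)
    then show ?thesis by simp
  qed
  have i: "integrable F.\<Omega> (\<lambda>\<omega>. l 1 \<omega> - (1 - w \<omega>))"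
    by (intro Bochner_Integration.integrable_diff l_integrable wi) (rule F.seq.P.integrable_const)
  have nn: "AE \<omega> in F.\<Omega>. 0 \<le> l 1 \<omega> - (1 - w \<omega>)"
    using pos
  proof eventually_elim
    case (elim \<omega>)
    then show ?case using ln_le_minus_one[of "w \<omega>"] by simp
  qed
  have "(\<integral>\<omega>. l 1 \<omega> - (1 - w \<omega>) \<partial>F.\<Omega>) = (\<integral>\<omega>. l 1 \<omega> \<partial>F.\<Omega>) - (1 - (\<integral>\<omega>. w \<omega> \<partial>F.\<Omega>))"
    using l_integrable[of 1] wi F.seq.P.prob_space by (simp add: F.seq.P.integrable_const)
  then have "(\<integral>\<omega>. l 1 \<omega> - (1 - w \<omega>) \<partial>F.\<Omega>) \<le> 0" using l_1_le w1 by simp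
  then have "(\<integral>\<omega>. l 1 \<omega> - (1 - w \<omega>) \<partial>F.\<Omega>) = 0" using integral_nonneg_AE[OF nn] by linarith
  then have "AE \<omega> in F.\<Omega>. l 1 \<omega> - (1 - w \<omega>) = 0" using integral_nonneg_eq_0_iff_AE[OF i nn] by simp
  with pos show ?thesis
  proof eventually_elim
    case (elim \<omega>)
    then show ?case by (intro ln_eq_minus_one) auto
  qed
qed

lemma r_eq: "AE \<omega> in F.\<Omega>. G.r (F.Z (Suc n) \<omega>) (\<beta>' \<omega>) = F.r (F.Z (Suc n) \<omega>) (\<beta> \<omega>)"
proof (induction n)
  case 0
  show ?case using w_eq_1 F.r_pos[of 1] G.r_pos[of 1] by eventually_elim (simp add: w_def)
next
  case (Suc n)
  have "AE \<omega> in F.\<Omega>. G.r (F.Z 1 \<omega>) (\<beta>' \<omega>) = F.r (F.Z 1 \<omega>) (\<beta> \<omega>)"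
    using w_eq_1 F.r_pos[of 1] G.r_pos[of 1] by eventually_elim (simp add: w_def)
  with F.r_cocycle[of "Suc n"] G.r_cocycle[of "Suc n"] F.AE_shift[OF Suc] show ?case
    by eventually_elim simp
qed

text \<open>Equality along the walk holds wherever the density of the finer factor is nonzero, so
  this density is at most the other one; both have integral 1, which forces equality also where the
  first vanishes.\<close>

lemma \<rho>_eq: "AE y in G.lam. G.\<rho> z y = F.\<rho> z (\<pi> y)"
proof -
  obtain n where n: "z \<in> set_pmf (F.m (Suc n))" by (rule F.m_exhaust)
  let ?Q = "\<lambda>z y. if G.r z y = F.r z (\<pi> y) then 0 else 1 :: ennreal"
  have m: "(\<lambda>(z, y). ?Q z y) \<in> borel_measurable (count_space UNIV \<Otimes>\<^sub>M N')"
    by (rule G.meas_from_countable) measurable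
  have "0 = (\<integral>\<^sup>+\<omega>. ?Q (F.Z (Suc n) \<omega>) (\<beta>' \<omega>) \<partial>F.\<Omega>)"
  proof -
    have "(\<integral>\<^sup>+\<omega>. ?Q (F.Z (Suc n) \<omega>) (\<beta>' \<omega>) \<partial>F.\<Omega>) = (\<integral>\<^sup>+\<omega>. 0 \<partial>F.\<Omega>)"
      by (rule nn_integral_cong_AE, use r_eq[of n] in eventually_elim) (simp add: \<beta>_\<pi>)
    then show ?thesis by simp
  qed
  also have "\<dots> = (\<integral>\<^sup>+z. \<integral>\<^sup>+y. G.\<rho> z y * ?Q z y \<partial>G.lam \<partial>F.m (Suc n))"
    using G.joint_density[OF m, where n = "Suc n"] by simp
  finally have "AE z in F.m (Suc n). (\<integral>\<^sup>+y. G.\<rho> z y * ?Q z y \<partial>G.lam) = 0"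
    by (subst (asm) eq_commute, subst (asm) nn_integral_0_iff_AE) auto
  then have "(\<integral>\<^sup>+y. G.\<rho> z y * ?Q z y \<partial>G.lam) = 0" using n by (simp add: AE_measure_pmf_iff del: F.m.simps)
  then have "AE y in G.lam. G.\<rho> z y * ?Q z y = 0" by (subst (asm) nn_integral_0_iff_AE) (auto cong: measurable_cong_sets)
  then have le: "AE y in G.lam. G.\<rho> z y \<le> F.\<rho> z (\<pi> y)"
    using G.\<rho>_r[of z] \<rho>_r_\<pi>[of z] by eventually_elim (auto split: if_splits)
  have tot: "(\<integral>\<^sup>+y. F.\<rho> z (\<pi> y) \<partial>G.lam) = 1" by (simp add: nn_\<pi> F.\<rho>_total)
  have "(\<integral>\<^sup>+y. F.\<rho> z (\<pi> y) - G.\<rho> z y \<partial>G.lam) = (\<integral>\<^sup>+y. F.\<rho> z (\<pi> y) \<partial>G.lam) - (\<integral>\<^sup>+y. G.\<rho> z y \<partial>G.lam)"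
    by (rule nn_integral_diff) (use le G.\<rho>_total in \<open>auto cong: measurable_cong_sets\<close>)
  also have "\<dots> = 0" by (simp add: tot G.\<rho>_total)
  finally have "AE y in G.lam. F.\<rho> z (\<pi> y) - G.\<rho> z y = 0"
    by (subst (asm) nn_integral_0_iff_AE) (auto cong: measurable_cong_sets)
  with le G.\<rho>_finite[of z] show ?thesis
  proof eventually_elim
    case (elim y)
    then show ?case by (auto simp: diff_eq_0_iff_ennreal less_top intro: antisym)
  qed
qed

section \<open>Conditional expectation on the coarser factor\<close>

definition pre :: "nat \<Rightarrow> (nat \<Rightarrow> 'g) \<Rightarrow> 'g list" where "pre n \<omega> = map \<omega> [0..<n]"

lemma pre_Suc: "pre (Suc n) \<omega> = \<omega> 0 # pre n (F.shift \<omega>)"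
  by (simp add: pre_def F.shift_def map_upt_Suc comp_def del: upt_Suc)

lemma meas_pre [measurable]: "pre n \<in> F.\<Omega> \<rightarrow>\<^sub>M count_space UNIV"
proof (induction n)
  case (Suc n)
  have "(\<lambda>\<omega>. \<omega> 0 # pre n (F.shift \<omega>)) \<in> F.\<Omega> \<rightarrow>\<^sub>M count_space UNIV"
    by (rule measurable_compose_countable[OF _ F.meas_comp], rule measurable_compose[OF measurable_compose[OF F.meas_shift Suc]]) simp
  then show ?case by (simp add: pre_Suc[abs_def])
qed (simp add: pre_def[abs_def])

context
  fixes B' assumes B' [measurable]: "B' \<in> sets N'"
begin

text \<open>The conditional probability of \<open>B'\<close> given the coarser factor, as a
  Radon-Nikodym density.\<close>

definition \<psi> :: "'b \<Rightarrow> ennreal" where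
  "\<psi> = RN_deriv F.lam (distr (density G.lam (indicator B')) N \<pi>)"

lemma meas_\<psi> [measurable]: "\<psi> \<in> borel_measurable N"
  unfolding \<psi>_def using borel_measurable_RN_deriv by (simp cong: measurable_cong_sets)

lemma \<psi>_integral:
  assumes f [measurable]: "f \<in> borel_measurable N"
  shows "(\<integral>\<^sup>+y. \<psi> y * f y \<partial>F.lam) = (\<integral>\<^sup>+y. indicator B' y * f (\<pi> y) \<partial>G.lam)"
proof -
  have p: "\<pi> \<in> density G.lam (indicator B') \<rightarrow>\<^sub>M N" by (simp cong: measurable_cong_sets)
  have nu: "integral\<^sup>N (distr (density G.lam (indicator B')) N \<pi>) g = (\<integral>\<^sup>+y. indicator B' y * g (\<pi> y) \<partial>G.lam)"
    if g [measurable]: "g \<in> borel_measurable N" for g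
  proof -
    have "(\<lambda>y. g (\<pi> y)) \<in> borel_measurable G.lam" by (simp cong: measurable_cong_sets)
    then show ?thesis using p by (subst nn_integral_distr) (auto simp: nn_integral_density cong: measurable_cong_sets)
  qed
  have ac: "absolutely_continuous F.lam (distr (density G.lam (indicator B')) N \<pi>)"
    unfolding absolutely_continuous_def
  proof
    fix C assume C: "C \<in> null_sets F.lam"
    then have [measurable]: "C \<in> sets N" by (auto simp: null_sets_def)
    have "(\<integral>\<^sup>+y. indicator B' y * indicator C (\<pi> y) \<partial>G.lam) \<le> (\<integral>\<^sup>+y. indicator C (\<pi> y) \<partial>G.lam)"
      by (rule nn_integral_mono) (auto simp: indicator_def)
    also have "\<dots> = (\<integral>\<^sup>+y. indicator C y \<partial>F.lam)" by (rule nn_\<pi>) measurable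
    also have "\<dots> = 0" using C by (subst nn_integral_indicator) auto
    finally have "emeasure (distr (density G.lam (indicator B')) N \<pi>) C = 0"
      using nu[of "indicator C"] by simp
    then show "C \<in> null_sets (distr (density G.lam (indicator B')) N \<pi>)" by (auto simp: null_sets_def)
  qed
  have "f \<in> borel_measurable F.lam" by (simp cong: measurable_cong_sets)
  from F.L.RN_deriv_nn_integral[OF ac _ this] show ?thesis
    unfolding \<psi>_def using nu[OF f] by simp
qed

text \<open>By \<open>\<rho>_eq\<close> a translation changes \<open>G.lam\<close> by a density that
  factors through \<open>\<pi>\<close>, so \<open>\<psi>\<close> stays the conditional probability
  of \<open>B'\<close> under every translate.\<close>

lemma integral_translate: "(\<integral>\<^sup>+\<omega>. indicator B' (A' z (\<beta>' \<omega>)) \<partial>F.\<Omega>) = (\<integral>\<^sup>+\<omega>. \<psi> (A z (\<beta> \<omega>)) \<partial>F.\<Omega>)"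
proof -
  have "(\<integral>\<^sup>+\<omega>. indicator B' (A' z (\<beta>' \<omega>)) \<partial>F.\<Omega>) = (\<integral>\<^sup>+y. indicator B' (A' z y) \<partial>G.lam)"
    unfolding G.lam_def by (subst nn_integral_distr) auto
  also have "\<dots> = (\<integral>\<^sup>+y. G.\<rho> z y * indicator B' y \<partial>G.lam)" by (subst G.\<rho>_integral) auto
  also have "\<dots> = (\<integral>\<^sup>+y. indicator B' y * F.\<rho> z (\<pi> y) \<partial>G.lam)"
    by (rule nn_integral_cong_AE, use \<rho>_eq[of z] in eventually_elim) (simp add: mult.commute)
  also have "\<dots> = (\<integral>\<^sup>+y. F.\<rho> z y * \<psi> y \<partial>F.lam)" by (simp add: \<psi>_integral mult.commute flip: \<psi>_integral)
  also have "\<dots> = (\<integral>\<^sup>+y. \<psi> (A z y) \<partial>F.lam)" by (rule F.\<rho>_integral) measurable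
  also have "\<dots> = (\<integral>\<^sup>+\<omega>. \<psi> (A z (\<beta> \<omega>)) \<partial>F.\<Omega>)"
    unfolding F.lam_def by (subst nn_integral_distr) auto
  finally show ?thesis .
qed

text \<open>Fixing the first increments only translates the boundary points of the remaining
  sequence, so a cylinder reduces to \<open>integral_translate\<close>; the free \<open>z\<close>
  collects the increments removed.\<close>

lemma cylinder_eq:
  "(\<integral>\<^sup>+\<omega>. indicator {xs} (pre n \<omega>) * indicator B' (A' z (\<beta>' \<omega>)) \<partial>F.\<Omega>) =
   (\<integral>\<^sup>+\<omega>. indicator {xs} (pre n \<omega>) * \<psi> (A z (\<beta> \<omega>)) \<partial>F.\<Omega>)"
proof (induction n arbitrary: xs z)
  case 0
  show ?case using integral_translate[of z] by (cases "xs = []") (simp_all add: pre_def)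
next
  case (Suc n)
  have pm [measurable]: "(\<lambda>\<omega>. indicator {xs} (pre n \<omega>) :: ennreal) \<in> borel_measurable F.\<Omega>" for n xs
    by (rule measurable_compose[OF meas_pre]) simp
  show ?case
  proof (cases xs)
    case Nil
    then show ?thesis by (simp add: pre_Suc)
  next
    case (Cons x0 xs0)
    have i: "indicator {xs} (pre (Suc n) (case_nat x \<omega>)) = (indicator {x0} x * indicator {xs0} (pre n \<omega>) :: ennreal)" for x \<omega>
      by (simp add: pre_Suc Cons indicator_def)
    have "(\<integral>\<^sup>+\<omega>. indicator {xs} (pre (Suc n) \<omega>) * indicator B' (A' z (\<beta>' \<omega>)) \<partial>F.\<Omega>) =
      (\<integral>\<^sup>+x. \<integral>\<^sup>+\<omega>. indicator {x0} x * indicator {xs0} (pre n \<omega>) * indicator B' (A' z (\<beta>' (case_nat x \<omega>))) \<partial>F.\<Omega> \<partial>\<mu>)"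
      by (subst F.nn_iter) (measurable, simp add: i)
    also have "\<dots> = (\<integral>\<^sup>+x. \<integral>\<^sup>+\<omega>. indicator {x0} x * (indicator {xs0} (pre n \<omega>) * indicator B' (A' (z + x) (\<beta>' \<omega>))) \<partial>F.\<Omega> \<partial>\<mu>)"
      by (rule nn_integral_cong_AE, use G.equivar_case in eventually_elim, rule nn_integral_cong_AE, elim eventually_mono)
        (simp add: G.A_add G.\<beta>_space mult.assoc)
    also have "\<dots> = (\<integral>\<^sup>+x. indicator {x0} x * (\<integral>\<^sup>+\<omega>. indicator {xs0} (pre n \<omega>) * indicator B' (A' (z + x) (\<beta>' \<omega>)) \<partial>F.\<Omega>) \<partial>\<mu>)"
      by (intro nn_integral_cong nn_integral_cmult) measurable
    also have "\<dots> = (\<integral>\<^sup>+x. indicator {x0} x * (\<integral>\<^sup>+\<omega>. indicator {xs0} (pre n \<omega>) * \<psi> (A (z + x) (\<beta> \<omega>)) \<partial>F.\<Omega>) \<partial>\<mu>)"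
      by (simp add: Suc)
    also have "\<dots> = (\<integral>\<^sup>+x. \<integral>\<^sup>+\<omega>. indicator {x0} x * (indicator {xs0} (pre n \<omega>) * \<psi> (A (z + x) (\<beta> \<omega>))) \<partial>F.\<Omega> \<partial>\<mu>)"
      by (intro nn_integral_cong nn_integral_cmult[symmetric]) measurable
    also have "\<dots> = (\<integral>\<^sup>+x. \<integral>\<^sup>+\<omega>. indicator {x0} x * indicator {xs0} (pre n \<omega>) * \<psi> (A z (\<beta> (case_nat x \<omega>))) \<partial>F.\<Omega> \<partial>\<mu>)"
      by (rule nn_integral_cong_AE, use F.equivar_case in eventually_elim, rule nn_integral_cong_AE, elim eventually_mono)
        (simp add: F.A_add F.\<beta>_space mult.assoc)
    also have "\<dots> = (\<integral>\<^sup>+\<omega>. indicator {xs} (pre (Suc n) \<omega>) * \<psi> (A z (\<beta> \<omega>)) \<partial>F.\<Omega>)"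
      by (subst F.nn_iter[of "\<lambda>\<omega>. indicator {xs} (pre (Suc n) \<omega>) * \<psi> (A z (\<beta> \<omega>))"]) (measurable, simp add: i)
    finally show ?thesis .
  qed
qed

text \<open>Cylinders generate the path space, so two densities that agree on all cylinders agree
  almost everywhere. Thus the conditional probability is already an indicator.\<close>

lemma \<psi>_indicator: "AE \<omega> in F.\<Omega>. indicator B' (\<beta>' \<omega>) = \<psi> (\<beta> \<omega>)"
proof -
  let ?f = "\<lambda>\<omega>. indicator B' (\<beta>' \<omega>) :: ennreal" and ?g = "\<lambda>\<omega>. \<psi> (\<beta> \<omega>)"
  have cyl: "(\<integral>\<^sup>+\<omega>. indicator {xs} (pre n \<omega>) * ?f \<omega> \<partial>F.\<Omega>) = (\<integral>\<^sup>+\<omega>. indicator {xs} (pre n \<omega>) * ?g \<omega> \<partial>F.\<Omega>)" for xs n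
    using cylinder_eq[of xs n 0] by (simp add: F.A_0 F.\<beta>_space G.A_0 G.\<beta>_space)
  have dist: "distr (density F.\<Omega> ?f) (count_space UNIV) (pre n) = distr (density F.\<Omega> ?g) (count_space UNIV) (pre n)" for n
  proof (rule measure_eqI_countable[of _ UNIV])
    have e: "emeasure (distr (density F.\<Omega> h) (count_space UNIV) (pre n)) {xs} = (\<integral>\<^sup>+\<omega>. indicator {xs} (pre n \<omega>) * h \<omega> \<partial>F.\<Omega>)"
      if [measurable]: "h \<in> borel_measurable F.\<Omega>" for h xs
    proof -
      have [measurable]: "pre n -` {xs} \<inter> space F.\<Omega> \<in> sets F.\<Omega>" by (rule measurable_sets[OF meas_pre]) simp
      have "emeasure (distr (density F.\<Omega> h) (count_space UNIV) (pre n)) {xs} = emeasure (density F.\<Omega> h) (pre n -` {xs} \<inter> space F.\<Omega>)"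
        by (subst emeasure_distr) auto
      also have "\<dots> = (\<integral>\<^sup>+\<omega>. h \<omega> * indicator (pre n -` {xs} \<inter> space F.\<Omega>) \<omega> \<partial>F.\<Omega>)" by (rule emeasure_density) measurable
      also have "\<dots> = (\<integral>\<^sup>+\<omega>. indicator {xs} (pre n \<omega>) * h \<omega> \<partial>F.\<Omega>)"
        by (rule nn_integral_cong) (auto simp: indicator_def)
      finally show ?thesis .
    qed
    show "emeasure (distr (density F.\<Omega> ?f) (count_space UNIV) (pre n)) {xs} = emeasure (distr (density F.\<Omega> ?g) (count_space UNIV) (pre n)) {xs}" for xs
      using e[of ?f xs] e[of ?g xs] cyl by simp
  qed auto
  have "density F.\<Omega> ?f = density F.\<Omega> ?g"
  proof (rule measure_eqI_PiM_infinite[where I = UNIV and M = "\<lambda>_. measure_pmf \<mu>"])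
    show "finite_measure (density F.\<Omega> ?f)"
    proof (rule finite_measureI)
      have "emeasure (density F.\<Omega> ?f) (space F.\<Omega>) = (\<integral>\<^sup>+\<omega>. ?f \<omega> * indicator (space F.\<Omega>) \<omega> \<partial>F.\<Omega>)"
        by (rule emeasure_density) measurable
      also have "\<dots> \<le> (\<integral>\<^sup>+\<omega>. 1 \<partial>F.\<Omega>)" by (rule nn_integral_mono) (auto simp: indicator_def)
      finally show "emeasure (density F.\<Omega> ?f) (space (density F.\<Omega> ?f)) \<noteq> \<infinity>"
        using F.seq.P.emeasure_space_1 by (auto simp: top_unique)
    qed
    fix J :: "nat set" and C :: "nat \<Rightarrow> 'g set" assume J: "finite J"
    \<comment> \<open>Inserting 0 keeps \<open>Max\<close> defined when \<open>J\<close> is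
      empty.\<close>
    define n where "n = Suc (Max (insert 0 J))"
    have n: "j < n" if "j \<in> J" for j using that J by (simp add: n_def less_Suc_eq_le)
    let ?X = "{xs. \<forall>j\<in>J. xs ! j \<in> C j}"
    have emb: "prod_emb UNIV (\<lambda>_. measure_pmf \<mu>) J (Pi\<^sub>E J C) = pre n -` ?X \<inter> space F.\<Omega>"
      using n by (auto simp: prod_emb_def pre_def space_PiM PiE_iff restrict_def extensional_def)
    have d: "emeasure (density F.\<Omega> h) (pre n -` ?X \<inter> space F.\<Omega>) = emeasure (distr (density F.\<Omega> h) (count_space UNIV) (pre n)) ?X" for h
      by (subst emeasure_distr) auto
    show "emeasure (density F.\<Omega> ?f) (prod_emb UNIV (\<lambda>_. measure_pmf \<mu>) J (Pi\<^sub>E J C)) =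
      emeasure (density F.\<Omega> ?g) (prod_emb UNIV (\<lambda>_. measure_pmf \<mu>) J (Pi\<^sub>E J C))"
      unfolding emb d dist ..
  qed simp_all
  then show ?thesis by (subst (asm) F.seq.P.density_unique_iff) auto
qed

theorem factor_maximal: "\<exists>B\<in>sets N. emeasure F.\<Omega> ((\<beta>' -` B' - \<beta> -` B) \<union> (\<beta> -` B - \<beta>' -` B')) = 0"
proof (intro bexI[of _ "{y \<in> space N. \<psi> y = 1}"])
  let ?D = "(\<beta>' -` B' - \<beta> -` {y \<in> space N. \<psi> y = 1}) \<union> (\<beta> -` {y \<in> space N. \<psi> y = 1} - \<beta>' -` B')"
  have "AE \<omega> in F.\<Omega>. \<not> (\<beta>' \<omega> \<in> B' \<longleftrightarrow> \<psi> (\<beta> \<omega>) = 1) \<longrightarrow> False"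
    using \<psi>_indicator by eventually_elim (auto simp: indicator_def split: if_splits)
  then have "emeasure F.\<Omega> {\<omega> \<in> space F.\<Omega>. \<not> (\<beta>' \<omega> \<in> B' \<longleftrightarrow> \<psi> (\<beta> \<omega>) = 1)} = 0"
    by (subst (asm) AE_iff_measurable[OF _ refl]) auto
  moreover have "?D = {\<omega> \<in> space F.\<Omega>. \<not> (\<beta>' \<omega> \<in> B' \<longleftrightarrow> \<psi> (\<beta> \<omega>) = 1)}"
    using F.\<beta>_space by (auto simp: space_PiM)
  ultimately show "emeasure F.\<Omega> ?D = 0" by simp
qed measurable

end

end

section \<open>The strip criterion\<close>

lemma tail_integral:
  fixes f :: "'a \<Rightarrow> real"
  assumes [measurable]: "f \<in> borel_measurable M" and fin: "(\<integral>\<^sup>+x. ennreal (f x) \<partial>M) < \<top>"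
    and a: "filterlim a at_top sequentially"
  shows "(\<lambda>n. \<integral>\<^sup>+x. ennreal (f x) * indicator {x. a n < f x} x \<partial>M) \<longlonglongrightarrow> 0"
proof -
  have "(\<lambda>n. \<integral>\<^sup>+x. ennreal (f x) * indicator {x. a n < f x} x \<partial>M) \<longlonglongrightarrow> (\<integral>\<^sup>+x. 0 \<partial>M)"
  proof (rule nn_integral_dominated_convergence[where w = "\<lambda>x. ennreal (f x)"])
    show "(\<lambda>x. ennreal (f x) * indicator {x. a n < f x} x) \<in> borel_measurable M" for n by measurable
    show "AE x in M. (\<lambda>n. ennreal (f x) * indicator {x. a n < f x} x) \<longlonglongrightarrow> 0"
    proof (rule AE_I2, rule tendsto_eventually)
      fix x
      have "\<forall>\<^sub>F n in sequentially. f x \<le> a n" using a by (simp add: filterlim_at_top)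
      then show "\<forall>\<^sub>F n in sequentially. ennreal (f x) * indicator {x. a n < f x} x = 0"
        by eventually_elim simp
    qed
  qed (use fin in \<open>auto simp: indicator_def\<close>)
  then show ?thesis by simp
qed

lemma (in prob_space) nn_integral_affine:
  assumes [measurable]: "f \<in> borel_measurable M"
  shows "(\<integral>\<^sup>+x. a + c * (k * (f x + y) + t) \<partial>M) = a + c * (k * ((\<integral>\<^sup>+x. f x \<partial>M) + y) + t)"
  by (simp add: nn_integral_add nn_integral_cmult emeasure_space_1)

text \<open>\<open>\<beta>\<close> and \<open>\<beta>'\<close> are the boundary points of the
  forward and the backward walk, on two independent spaces; \<open>S R\<close> assigns to a pair of
  them an increasing family of strips in the group. Balls in a strip grow polynomially, and the
  logarithmic moment keeps the walk within \<open>n * exp (c * n)\<close> with probability near 1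
  for every \<open>c > 0\<close>, so a strip carries entropy of order at most
  \<open>c * n\<close>.\<close>

locale rw_strip = F: rw_factor \<mu> N A \<beta> + B: rw_factor "reflect_pmf \<mu>" N A \<beta>'
  for \<mu> :: "'g::{group_add,countable} pmf" and N :: "'b measure" and A :: "'g \<Rightarrow> 'b \<Rightarrow> 'b"
    and \<beta> :: "(nat \<Rightarrow> 'g) \<Rightarrow> 'b" and \<beta>' :: "(nat \<Rightarrow> 'g) \<Rightarrow> 'b" +
  fixes S :: "nat \<Rightarrow> 'b \<Rightarrow> 'b \<Rightarrow> 'g set" and len :: "'g \<Rightarrow> nat"
  assumes ent: "(\<integral>\<^sup>+x. ennreal (F.v x) \<partial>\<mu>) < \<top>"
    and logmom: "(\<integral>\<^sup>+x. ennreal (ln (real (len x))) \<partial>\<mu>) < \<top>"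
    and len_0: "len 0 = 0" and len_add: "\<And>x y. len (x + y) \<le> len x + len y"
    and S_meas: "\<And>R z. Measurable.pred (N \<Otimes>\<^sub>M N) (\<lambda>p. z \<in> S R (fst p) (snd p))"
    and S_equi: "\<And>R h z y y'. y \<in> space N \<Longrightarrow> y' \<in> space N \<Longrightarrow> h + z \<in> S R (A h y) (A h y') \<longleftrightarrow> z \<in> S R y y'"
    and S_mono: "\<And>R y y'. S R y y' \<subseteq> S (Suc R) y y'"
    and S_ex: "AE \<omega>' in B.\<Omega>. AE \<omega> in F.\<Omega>. \<exists>R. 0 \<in> S R (\<beta>' \<omega>') (\<beta> \<omega>)"
    and growth: "\<And>R. \<exists>C k. \<forall>L. \<forall>y\<in>space N. \<forall>y'\<in>space N.
      finite {z \<in> S R y y'. len z \<le> L} \<and> card {z \<in> S R y y'. len z \<le> L} \<le> C * (L + 1) ^ k"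
begin

lemma S_meas_pair:
  assumes [measurable]: "f \<in> M \<rightarrow>\<^sub>M N" "h \<in> M \<rightarrow>\<^sub>M N" "k \<in> M \<rightarrow>\<^sub>M count_space (UNIV :: 'g set)"
  shows "Measurable.pred M (\<lambda>x. k x \<in> S R (f x) (h x))"
proof (rule measurable_compose_countable[OF _ assms(3)])
  fix z
  have "(\<lambda>x. (f x, h x)) \<in> M \<rightarrow>\<^sub>M N \<Otimes>\<^sub>M N" by measurable
  from measurable_compose[OF this S_meas[of z R]] show "Measurable.pred M (\<lambda>x. z \<in> S R (f x) (h x))" by simp
qed

definition miss :: "nat \<Rightarrow> nat \<Rightarrow> ennreal" where
  "miss R n = (\<integral>\<^sup>+\<omega>'. \<integral>\<^sup>+\<omega>. (if F.Z n \<omega> \<in> S R (\<beta>' \<omega>') (\<beta> \<omega>) then 0 else 1) \<partial>F.\<Omega> \<partial>B.\<Omega>)"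

lemma meas_pair_in [measurable]:
  "Measurable.pred (B.\<Omega> \<Otimes>\<^sub>M F.\<Omega>) (\<lambda>p. F.Z n (snd p) \<in> S R (\<beta>' (fst p)) (\<beta> (snd p)))"
  by (rule S_meas_pair) measurable

text \<open>Stationarity under the two-sided shift: shifting one step replaces the pair of boundary points
  by its translate, which by equivariance turns \<open>Z (Suc n)\<close> into \<open>Z n\<close>.\<close>

lemma miss_Suc: "miss R (Suc n) = miss R n"
proof -
  define f where "f z y' y = (if z \<in> S R y' y then 0 else 1 :: ennreal)" for z y' y
  have fm [measurable]: "(\<lambda>x. f (c x) (a x) (b x)) \<in> borel_measurable M"
    if "a \<in> M \<rightarrow>\<^sub>M N" "b \<in> M \<rightarrow>\<^sub>M N" "c \<in> M \<rightarrow>\<^sub>M count_space UNIV" for M :: "'z measure" and a b c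
    unfolding f_def using S_meas_pair[OF that] by measurable
  define g where "g \<omega>' = (\<integral>\<^sup>+\<omega>. f (F.Z n \<omega>) (\<beta>' \<omega>') (\<beta> \<omega>) \<partial>F.\<Omega>)" for \<omega>'
  have [measurable]: "(\<lambda>p. f (F.Z n (snd p)) (\<beta>' (fst p)) (\<beta> (snd p))) \<in> borel_measurable (B.\<Omega> \<Otimes>\<^sub>M F.\<Omega>)"
    by (rule fm) measurable
  have gm [measurable]: "g \<in> borel_measurable B.\<Omega>"
    unfolding g_def by (rule F.seq.P.borel_measurable_nn_integral) (simp add: case_prod_beta)
  have "miss R (Suc n) = (\<integral>\<^sup>+\<omega>'. \<integral>\<^sup>+\<omega>. f (F.Z (Suc n) \<omega>) (\<beta>' \<omega>') (\<beta> \<omega>) \<partial>F.\<Omega> \<partial>B.\<Omega>)"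
    by (simp add: miss_def f_def)
  also have "\<dots> = (\<integral>\<^sup>+\<omega>'. \<integral>\<^sup>+x. \<integral>\<^sup>+\<omega>. f (x + F.Z n \<omega>) (\<beta>' \<omega>') (\<beta> (case_nat x \<omega>)) \<partial>F.\<Omega> \<partial>\<mu> \<partial>B.\<Omega>)"
  proof (rule nn_integral_cong)
    fix \<omega>'
    have "(\<lambda>\<omega>. f (F.Z (Suc n) \<omega>) (\<beta>' \<omega>') (\<beta> \<omega>)) \<in> borel_measurable F.\<Omega>"
      by (rule fm) (use B.\<beta>_space in measurable)
    from F.nn_iter[OF this] show "(\<integral>\<^sup>+\<omega>. f (F.Z (Suc n) \<omega>) (\<beta>' \<omega>') (\<beta> \<omega>) \<partial>F.\<Omega>) =
      (\<integral>\<^sup>+x. \<integral>\<^sup>+\<omega>. f (x + F.Z n \<omega>) (\<beta>' \<omega>') (\<beta> (case_nat x \<omega>)) \<partial>F.\<Omega> \<partial>\<mu>)" by (simp add: F.Z_Suc)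
  qed
  also have "\<dots> = (\<integral>\<^sup>+\<omega>'. \<integral>\<^sup>+x. \<integral>\<^sup>+\<omega>. f (F.Z n \<omega>) (A (- x) (\<beta>' \<omega>')) (\<beta> \<omega>) \<partial>F.\<Omega> \<partial>\<mu> \<partial>B.\<Omega>)"
  proof (rule nn_integral_cong, rule nn_integral_cong_AE, use F.equivar_case in eventually_elim, rule nn_integral_cong_AE, elim eventually_mono)
    fix \<omega>' x \<omega> assume eq: "\<beta> (case_nat x \<omega>) = A x (\<beta> \<omega>)"
    have "A x (A (- x) (\<beta>' \<omega>')) = \<beta>' \<omega>'" using F.A_minus[of "\<beta>' \<omega>'" "- x"] B.\<beta>_space by simp
    then have "x + F.Z n \<omega> \<in> S R (\<beta>' \<omega>') (A x (\<beta> \<omega>)) \<longleftrightarrow> F.Z n \<omega> \<in> S R (A (- x) (\<beta>' \<omega>')) (\<beta> \<omega>)"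
      using S_equi[of "A (- x) (\<beta>' \<omega>')" "\<beta> \<omega>" x "F.Z n \<omega>" R] B.\<beta>_space F.\<beta>_space F.A_space by simp
    then show "f (x + F.Z n \<omega>) (\<beta>' \<omega>') (\<beta> (case_nat x \<omega>)) = f (F.Z n \<omega>) (A (- x) (\<beta>' \<omega>')) (\<beta> \<omega>)"
      by (simp add: f_def eq)
  qed
  also have "\<dots> = (\<integral>\<^sup>+x. \<integral>\<^sup>+\<omega>'. \<integral>\<^sup>+\<omega>. f (F.Z n \<omega>) (A (- x) (\<beta>' \<omega>')) (\<beta> \<omega>) \<partial>F.\<Omega> \<partial>B.\<Omega> \<partial>\<mu>)"
  proof -
    interpret pair_sigma_finite "measure_pmf \<mu>" B.\<Omega>
      by (intro pair_sigma_finite.intro prob_space_imp_sigma_finite prob_space_measure_pmf B.prob_\<Omega>)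
    have "(\<lambda>\<omega>'. \<integral>\<^sup>+\<omega>. f (F.Z n \<omega>) (A (- x) (\<beta>' \<omega>')) (\<beta> \<omega>) \<partial>F.\<Omega>) \<in> borel_measurable B.\<Omega>" for x
    proof (rule F.seq.P.borel_measurable_nn_integral)
      have "(\<lambda>p. f (F.Z n (snd p)) (A (- x) (\<beta>' (fst p))) (\<beta> (snd p))) \<in> borel_measurable (B.\<Omega> \<Otimes>\<^sub>M F.\<Omega>)"
        by (rule fm) measurable
      then show "(\<lambda>(\<omega>', \<omega>). f (F.Z n \<omega>) (A (- x) (\<beta>' \<omega>')) (\<beta> \<omega>)) \<in> borel_measurable (B.\<Omega> \<Otimes>\<^sub>M F.\<Omega>)"
        by (simp add: case_prod_beta)
    qed
    then have "(\<lambda>(x, \<omega>'). \<integral>\<^sup>+\<omega>. f (F.Z n \<omega>) (A (- x) (\<beta>' \<omega>')) (\<beta> \<omega>) \<partial>F.\<Omega>) \<in> borel_measurable (count_space UNIV \<Otimes>\<^sub>M B.\<Omega>)"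
      by (intro measurable_pair_measure_countable1) auto
    then have "(\<lambda>(x, \<omega>'). \<integral>\<^sup>+\<omega>. f (F.Z n \<omega>) (A (- x) (\<beta>' \<omega>')) (\<beta> \<omega>) \<partial>F.\<Omega>) \<in> borel_measurable (measure_pmf \<mu> \<Otimes>\<^sub>M B.\<Omega>)"
      by (simp cong: measurable_cong_sets sets_pair_measure_cong)
    from Fubini[OF this] show ?thesis by simp
  qed
  also have "\<dots> = (\<integral>\<^sup>+x. \<integral>\<^sup>+\<omega>'. g (case_nat (- x) \<omega>') \<partial>B.\<Omega> \<partial>\<mu>)"
  proof (rule nn_integral_cong_AE, unfold AE_measure_pmf_iff, rule ballI)
    fix x assume "x \<in> set_pmf \<mu>"
    \<comment> \<open>Prepending \<open>- x\<close>, an increment of the backward walk, to the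
      backward path produces the translate by \<open>- x\<close>: the increment has moved from one
      half of the two-sided path to the other.\<close>
    then have "- x \<in> set_pmf (reflect_pmf \<mu>)" by (simp add: reflect_pmf_def)
    then have "AE \<omega>' in B.\<Omega>. \<beta>' (case_nat (- x) \<omega>') = A (- x) (\<beta>' \<omega>')"
      using B.equivar_case unfolding AE_measure_pmf_iff by blast
    then show "(\<integral>\<^sup>+\<omega>'. \<integral>\<^sup>+\<omega>. f (F.Z n \<omega>) (A (- x) (\<beta>' \<omega>')) (\<beta> \<omega>) \<partial>F.\<Omega> \<partial>B.\<Omega>) = (\<integral>\<^sup>+\<omega>'. g (case_nat (- x) \<omega>') \<partial>B.\<Omega>)"
      unfolding g_def by (intro nn_integral_cong_AE, elim eventually_mono) simp
  qed
  also have "\<dots> = (\<integral>\<^sup>+\<omega>'. g \<omega>' \<partial>B.\<Omega>)"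
    using B.nn_iter[OF gm] by (simp add: reflect_pmf_def)
  finally show ?thesis by (simp add: g_def f_def miss_def)
qed

lemma miss_eq: "miss R n = miss R 0"
  by (induction n) (simp_all add: miss_Suc)

lemma miss_tendsto: "(\<lambda>R. miss R 0) \<longlonglongrightarrow> 0"
proof -
  define h where "h R \<omega>' = (\<integral>\<^sup>+\<omega>. (if 0 \<in> S R (\<beta>' \<omega>') (\<beta> \<omega>) then 0 else 1 :: ennreal) \<partial>F.\<Omega>)" for R \<omega>'
  have S_mono': "S R y y' \<subseteq> S R' y y'" if "R \<le> R'" for R R' y y'
    using that by (induction rule: dec_induct) (use S_mono order_trans in blast)+
  have pm: "Measurable.pred (B.\<Omega> \<Otimes>\<^sub>M F.\<Omega>) (\<lambda>p. 0 \<in> S R (\<beta>' (fst p)) (\<beta> (snd p)))" for R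
    by (rule S_meas_pair) measurable
  have hm [measurable]: "h R \<in> borel_measurable B.\<Omega>" for R
    unfolding h_def
  proof (rule F.seq.P.borel_measurable_nn_integral)
    have "(\<lambda>p. if 0 \<in> S R (\<beta>' (fst p)) (\<beta> (snd p)) then 0 else 1 :: ennreal) \<in> borel_measurable (B.\<Omega> \<Otimes>\<^sub>M F.\<Omega>)"
      using pm by measurable
    then show "(\<lambda>(\<omega>', \<omega>). if 0 \<in> S R (\<beta>' \<omega>') (\<beta> \<omega>) then 0 else 1 :: ennreal) \<in> borel_measurable (B.\<Omega> \<Otimes>\<^sub>M F.\<Omega>)"
      by (simp add: case_prod_beta)
  qed
  have h1: "h R \<omega>' \<le> 1" for R \<omega>'
  proof -
    have "h R \<omega>' \<le> (\<integral>\<^sup>+\<omega>. 1 \<partial>F.\<Omega>)" unfolding h_def by (rule nn_integral_mono) auto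
    then show ?thesis using F.seq.P.emeasure_space_1 by simp
  qed
  have "(\<lambda>R. \<integral>\<^sup>+\<omega>'. h R \<omega>' \<partial>B.\<Omega>) \<longlonglongrightarrow> (\<integral>\<^sup>+\<omega>'. 0 \<partial>B.\<Omega>)"
  proof (rule nn_integral_dominated_convergence[where w = "\<lambda>_. 1"])
    show "AE \<omega>' in B.\<Omega>. (\<lambda>R. h R \<omega>') \<longlonglongrightarrow> 0"
      using S_ex
    proof eventually_elim
      case (elim \<omega>')
      have "(\<lambda>R. h R \<omega>') \<longlonglongrightarrow> (\<integral>\<^sup>+\<omega>. 0 \<partial>F.\<Omega>)"
        unfolding h_def
      proof (rule nn_integral_dominated_convergence[where w = "\<lambda>_. 1"])
        have "Measurable.pred F.\<Omega> (\<lambda>\<omega>. 0 \<in> S R (\<beta>' \<omega>') (\<beta> \<omega>))" for R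
          by (rule S_meas_pair) (use B.\<beta>_space in measurable)
        then show "(\<lambda>\<omega>. if 0 \<in> S R (\<beta>' \<omega>') (\<beta> \<omega>) then 0 else 1 :: ennreal) \<in> borel_measurable F.\<Omega>" for R by measurable
        show "AE \<omega> in F.\<Omega>. (\<lambda>R. if 0 \<in> S R (\<beta>' \<omega>') (\<beta> \<omega>) then 0 else 1 :: ennreal) \<longlonglongrightarrow> 0"
          using elim
        proof eventually_elim
          case (elim \<omega>)
          then obtain R0 where "0 \<in> S R0 (\<beta>' \<omega>') (\<beta> \<omega>)" by blast
          then have "0 \<in> S R (\<beta>' \<omega>') (\<beta> \<omega>)" if "R \<ge> R0" for R using S_mono'[OF that] by blast
          then show ?case by (intro tendsto_eventually) (auto simp: eventually_sequentially)
        qed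
      qed (use F.seq.P.emeasure_space_1 in auto)
      then show ?case by simp
    qed
  qed (use h1 B.seq.P.emeasure_space_1 in auto)
  then show ?thesis by (simp add: miss_def h_def)
qed

lemma len_Z: "len (F.Z n \<omega>) \<le> (\<Sum>i<n. len (\<omega> i))"
proof (induction n arbitrary: \<omega>)
  case (Suc n)
  have "len (F.Z (Suc n) \<omega>) \<le> len (\<omega> 0) + len (F.Z n (F.shift \<omega>))" unfolding F.Z_Suc by (rule len_add)
  also have "\<dots> \<le> len (\<omega> 0) + (\<Sum>i<n. len (\<omega> (Suc i)))" using Suc[of "F.shift \<omega>"] by (simp add: F.shift_def)
  finally show ?case by (simp only: sum.lessThan_Suc_shift)
qed (simp add: len_0)

definition far :: "nat \<Rightarrow> nat \<Rightarrow> ennreal" where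
  "far L n = (\<integral>\<^sup>+\<omega>. (if len (F.Z n \<omega>) \<le> L then 0 else 1) \<partial>F.\<Omega>)"

lemma meas_len [measurable]: "Measurable.pred F.\<Omega> (\<lambda>\<omega>. len (F.Z n \<omega>) \<le> L)"
  by (rule measurable_compose[OF F.meas_Z]) simp

text \<open>If every increment has \<open>ln len\<close> at most \<open>c * n\<close>, then
  \<open>len (Z n)\<close> is at most \<open>n * exp (c * n)\<close>. A union bound over the
  \<open>n\<close> increments and Markov's inequality give the right side, in which the factor
  \<open>n\<close> has cancelled.\<close>

lemma far_bound:
  assumes c: "c > 0"
  shows "far (nat \<lfloor>real n * exp (c * real n)\<rfloor>) n \<le>
    ennreal (1 / c) * (\<integral>\<^sup>+x. ennreal (ln (real (len x))) * indicator {x. c * real n < ln (real (len x))} x \<partial>\<mu>)"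
proof -
  let ?Y = "\<lambda>x. ln (real (len x))"
  let ?a = "c * real n"
  have "far (nat \<lfloor>real n * exp ?a\<rfloor>) n \<le> (\<integral>\<^sup>+\<omega>. (\<Sum>i<n. indicator {x. ?a < ?Y x} (\<omega> i)) \<partial>F.\<Omega>)"
    unfolding far_def
  proof (rule nn_integral_mono)
    fix \<omega>
    show "(if len (F.Z n \<omega>) \<le> nat \<lfloor>real n * exp ?a\<rfloor> then 0 else 1) \<le> (\<Sum>i<n. indicator {x. ?a < ?Y x} (\<omega> i) :: ennreal)"
    proof (cases "\<exists>i<n. ?a < ?Y (\<omega> i)")
      case True
      then obtain i where i: "i < n" "?a < ?Y (\<omega> i)" by blast
      have "(1 :: ennreal) = indicator {x. ?a < ?Y x} (\<omega> i)" using i by simp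
      also have "\<dots> \<le> (\<Sum>i<n. indicator {x. ?a < ?Y x} (\<omega> i))" using i by (intro member_le_sum) auto
      finally show ?thesis by simp
    next
      case False
      have "real (len (\<omega> i)) \<le> exp ?a" if "i < n" for i
      proof (cases "len (\<omega> i) = 0")
        case False
        have "?Y (\<omega> i) \<le> ?a" using \<open>\<not> (\<exists>i<n. ?a < ?Y (\<omega> i))\<close> that by (meson not_less)
        then have "exp (?Y (\<omega> i)) \<le> exp ?a" by simp
        then show ?thesis using False by simp
      qed simp
      then have "(\<Sum>i<n. real (len (\<omega> i))) \<le> (\<Sum>i<n. exp ?a)" by (intro sum_mono) auto
      then have "real (len (F.Z n \<omega>)) \<le> real n * exp ?a"
        using len_Z[of n \<omega>] by (simp flip: of_nat_sum)
      then have "len (F.Z n \<omega>) \<le> nat \<lfloor>real n * exp ?a\<rfloor>" by (simp add: le_nat_floor)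
      then show ?thesis by simp
    qed
  qed
  also have "\<dots> = (\<Sum>i<n. (\<integral>\<^sup>+\<omega>. indicator {x. ?a < ?Y x} (\<omega> i) \<partial>F.\<Omega>))"
    by (rule nn_integral_sum) (rule measurable_compose[OF F.meas_comp], simp)
  also have "\<dots> = ennreal (real n) * (\<integral>\<^sup>+x. indicator {x. ?a < ?Y x} x \<partial>\<mu>)"
    by (simp only: F.nn_integral_comp sum_constant card_lessThan ennreal_of_nat_eq_real_of_nat)
  also have "\<dots> = (\<integral>\<^sup>+x. ennreal (real n) * indicator {x. ?a < ?Y x} x \<partial>\<mu>)"
    by (rule nn_integral_cmult[symmetric]) simp
  also have "\<dots> \<le> (\<integral>\<^sup>+x. ennreal (1 / c) * (ennreal (?Y x) * indicator {x. ?a < ?Y x} x) \<partial>\<mu>)"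
  proof (rule nn_integral_mono)
    fix x
    show "ennreal (real n) * indicator {x. ?a < ?Y x} x \<le> ennreal (1 / c) * (ennreal (?Y x) * indicator {x. ?a < ?Y x} x)"
    proof (cases "?a < ?Y x")
      case True
      then have "real n \<le> (1 / c) * ?Y x" using c by (simp add: field_simps)
      then have "ennreal (real n) \<le> ennreal (1 / c) * ennreal (?Y x)" using c by (simp add: ennreal_leI flip: ennreal_mult')
      then show ?thesis using True by simp
    qed simp
  qed
  also have "\<dots> = ennreal (1 / c) * (\<integral>\<^sup>+x. ennreal (?Y x) * indicator {x. ?a < ?Y x} x \<partial>\<mu>)"
    by (rule nn_integral_cmult) simp
  finally show ?thesis .
qed

text \<open>Gibbs' inequality for a fixed backward boundary point, with a competitor split between
  the ball of the strip and the law of \<open>Z n\<close>. Inside the strip this costs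
  \<open>ln (2 * C)\<close>; otherwise at most \<open>ln 2\<close> plus the information of the
  increments, of which the part up to \<open>K\<close> is charged to the bad event and the rest to
  the tail of \<open>v\<close>. Averaging over the backward walk yields \<open>miss\<close>.\<close>

lemma u_bound:
  assumes C: "C \<ge> 1" "\<And>y y'. y \<in> space N \<Longrightarrow> y' \<in> space N \<Longrightarrow>
      finite {z \<in> S R y y'. len z \<le> L} \<and> card {z \<in> S R y y'. len z \<le> L} \<le> C"
    and K: "K \<ge> 0"
  shows "(\<integral>\<^sup>+\<omega>. ennreal (F.u n \<omega>) \<partial>F.\<Omega>) \<le> ennreal (ln 2 + ln (real C)) +
    ennreal (real n) * (ennreal K * (miss R 0 + far L n) + (\<integral>\<^sup>+x. ennreal (F.v x) * indicator {x. K < F.v x} x \<partial>\<mu>))"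
proof -
  define \<tau> where "\<tau> = (\<integral>\<^sup>+x. ennreal (F.v x) * indicator {x. K < F.v x} x \<partial>\<mu>)"
  define bad where "bad \<omega>' \<omega> = ((if F.Z n \<omega> \<in> S R (\<beta>' \<omega>') (\<beta> \<omega>) then 0 else 1) + (if len (F.Z n \<omega>) \<le> L then 0 else 1) :: ennreal)" for \<omega>' \<omega>
  define tl where "tl i \<omega> = ennreal (F.v (\<omega> i)) * indicator {x. K < F.v x} (\<omega> i)" for i :: nat and \<omega> :: "nat \<Rightarrow> 'g"
  have lnC: "0 \<le> ln (real C)" using C(1) by simp
  have inS: "Measurable.pred F.\<Omega> (\<lambda>\<omega>. F.Z n \<omega> \<in> S R (\<beta>' \<omega>') (\<beta> \<omega>))" for \<omega>'
    by (rule S_meas_pair) (use B.\<beta>_space in measurable)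
  have bm [measurable]: "bad \<omega>' \<in> borel_measurable F.\<Omega>" for \<omega>'
    unfolding bad_def[abs_def] using inS[of \<omega>'] by measurable
  have tm [measurable]: "tl i \<in> borel_measurable F.\<Omega>" for i
    unfolding tl_def[abs_def] by (rule measurable_compose[OF F.meas_comp]) simp
  have tli: "(\<integral>\<^sup>+\<omega>. tl i \<omega> \<partial>F.\<Omega>) = \<tau>" for i
    unfolding tl_def \<tau>_def by (rule F.nn_integral_comp)
  have one: "(\<integral>\<^sup>+\<omega>. ennreal (F.u n \<omega>) \<partial>F.\<Omega>) \<le> ennreal (ln 2 + ln (real C)) + ennreal (real n) * (ennreal K * (\<integral>\<^sup>+\<omega>. bad \<omega>' \<omega> \<partial>F.\<Omega>) + \<tau>)" for \<omega>'
  proof -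
    let ?G = "\<lambda>z y. z \<in> S R (\<beta>' \<omega>') y \<and> len z \<le> L"
    \<comment> \<open>Mass \<open>1 / (2 * C)\<close> at each of at most \<open>C\<close> points
      keeps the first part below one half; the second part keeps \<open>q\<close> positive along the
      walk.\<close>
    define q where "q z y = (if ?G z y then 1 / (2 * real C) else 0) + pmf (F.m n) z / 2" for z y
    have "(\<integral>\<^sup>+\<omega>. ennreal (F.u n \<omega>) \<partial>F.\<Omega>) \<le> (\<integral>\<^sup>+\<omega>. ennreal (- ln (q (F.Z n \<omega>) (\<beta> \<omega>))) \<partial>F.\<Omega>)"
    proof (rule F.gibbs)
      show "0 \<le> q z y" for z y by (simp add: q_def)
      show "(\<lambda>y. q z y) \<in> borel_measurable N" for z
      proof -
        have "Measurable.pred N (\<lambda>y. z \<in> S R (\<beta>' \<omega>') y)" by (rule S_meas_pair) (use B.\<beta>_space in measurable)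
        then show ?thesis unfolding q_def by measurable
      qed
      show "AE \<omega> in F.\<Omega>. 0 < q (F.Z n \<omega>) (\<beta> \<omega>)"
        using F.AE_Z_m[of n] by eventually_elim (simp add: q_def add_nonneg_pos pmf_positive)
      fix y assume y: "y \<in> space N"
      let ?T = "{z. ?G z y}"
      have T: "finite ?T" "card ?T \<le> C" using C(2)[OF B.\<beta>_space y] by auto
      have "(\<integral>\<^sup>+z. ennreal (q z y) \<partial>count_space UNIV) = (\<integral>\<^sup>+z. ennreal (1 / (2 * real C)) * indicator ?T z + ennreal (1/2) * ennreal (pmf (F.m n) z) \<partial>count_space UNIV)"
      proof (rule nn_integral_cong)
        fix z
        have h: "ennreal (pmf (F.m n) z / 2) = ennreal (1/2) * ennreal (pmf (F.m n) z)"
          by (subst ennreal_mult[symmetric]) auto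
        show "ennreal (q z y) = ennreal (1 / (2 * real C)) * indicator ?T z + ennreal (1/2) * ennreal (pmf (F.m n) z)"
          unfolding q_def h[symmetric] by (cases "?G z y") (auto simp: ennreal_plus)
      qed
      also have "\<dots> = ennreal (1 / (2 * real C)) * ennreal (real (card ?T)) + ennreal (1/2) * 1"
        using T(1) by (subst nn_integral_add) (auto simp: nn_integral_cmult nn_integral_pmf measure_pmf.emeasure_space_1[simplified]
          nn_integral_cmult_indicator ennreal_of_nat_eq_real_of_nat)
      also have "\<dots> = ennreal (1 / (2 * real C) * real (card ?T) + 1/2)" by (simp add: ennreal_plus flip: ennreal_mult')
      also have "\<dots> \<le> ennreal 1"
      proof (rule ennreal_leI)
        have "real (card ?T) \<le> real C" using T by simp
        then show "1 / (2 * real C) * real (card ?T) + 1/2 \<le> 1" using C(1) by (simp add: field_simps)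
      qed
      finally show "(\<integral>\<^sup>+z. ennreal (q z y) \<partial>count_space UNIV) \<le> 1" by simp
    qed
    also have "\<dots> \<le> (\<integral>\<^sup>+\<omega>. ennreal (ln 2 + ln (real C)) + (\<Sum>i<n. ennreal K * bad \<omega>' \<omega> + tl i \<omega>) \<partial>F.\<Omega>)"
    proof (rule nn_integral_mono_AE, use F.AE_Z_m[of n] F.ln_m_bound[of n] in eventually_elim)
      case (elim \<omega>)
      have mp: "0 < pmf (F.m n) (F.Z n \<omega>)" using elim by (simp add: pmf_positive)
      show ?case
      proof (cases "?G (F.Z n \<omega>) (\<beta> \<omega>)")
        case True
        have "1 / (2 * real C) \<le> q (F.Z n \<omega>) (\<beta> \<omega>)" using True by (simp add: q_def)
        then have "ln (1 / (2 * real C)) \<le> ln (q (F.Z n \<omega>) (\<beta> \<omega>))" by (rule ln_mono) (use C(1) in simp)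
        then have "- ln (q (F.Z n \<omega>) (\<beta> \<omega>)) \<le> ln 2 + ln (real C)" using C(1) by (simp add: ln_div ln_mult)
        then have "ennreal (- ln (q (F.Z n \<omega>) (\<beta> \<omega>))) \<le> ennreal (ln 2 + ln (real C))" by (rule ennreal_leI)
        then show ?thesis by (rule order_trans) simp
      next
        case False
        then have b: "1 \<le> bad \<omega>' \<omega>" by (auto simp: bad_def)
        have "pmf (F.m n) (F.Z n \<omega>) / 2 \<le> q (F.Z n \<omega>) (\<beta> \<omega>)" using C(1) by (simp add: q_def)
        then have "ln (pmf (F.m n) (F.Z n \<omega>) / 2) \<le> ln (q (F.Z n \<omega>) (\<beta> \<omega>))" using mp by (subst ln_le_cancel_iff) (auto intro: less_le_trans)
        then have "- ln (q (F.Z n \<omega>) (\<beta> \<omega>)) \<le> ln 2 + (\<Sum>i<n. F.v (\<omega> i))" using mp elim by (simp add: ln_div)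
        then have "ennreal (- ln (q (F.Z n \<omega>) (\<beta> \<omega>))) \<le> ennreal (ln 2 + ln (real C)) + (\<Sum>i<n. ennreal (F.v (\<omega> i)))"
          using lnC by (simp add: sum_ennreal F.v_nonneg sum_nonneg ennreal_leI flip: ennreal_plus)
        also have "(\<Sum>i<n. ennreal (F.v (\<omega> i))) \<le> (\<Sum>i<n. ennreal K * bad \<omega>' \<omega> + tl i \<omega>)"
        proof (rule sum_mono)
          fix i
          show "ennreal (F.v (\<omega> i)) \<le> ennreal K * bad \<omega>' \<omega> + tl i \<omega>"
          proof (cases "K < F.v (\<omega> i)")
            case False
            then have "ennreal (F.v (\<omega> i)) \<le> ennreal K * 1" by (simp add: ennreal_leI)
            also have "\<dots> \<le> ennreal K * bad \<omega>' \<omega>" using b by (rule mult_left_mono) simp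
            finally show ?thesis by (rule order_trans) simp
          qed (simp add: tl_def)
        qed
        finally show ?thesis by (simp add: add_left_mono)
      qed
    qed
    also have "\<dots> = ennreal (ln 2 + ln (real C)) + (\<Sum>i<n. ennreal K * (\<integral>\<^sup>+\<omega>. bad \<omega>' \<omega> \<partial>F.\<Omega>) + \<tau>)"
      using F.seq.P.emeasure_space_1 by (simp add: nn_integral_add nn_integral_sum nn_integral_cmult tli)
    finally show ?thesis by (simp add: ennreal_of_nat_eq_real_of_nat)
  qed
  have bI: "(\<lambda>\<omega>'. \<integral>\<^sup>+\<omega>. (if F.Z n \<omega> \<in> S R (\<beta>' \<omega>') (\<beta> \<omega>) then 0 else 1 :: ennreal) \<partial>F.\<Omega>) \<in> borel_measurable B.\<Omega>"
  proof (rule F.seq.P.borel_measurable_nn_integral)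
    have "(\<lambda>p. if F.Z n (snd p) \<in> S R (\<beta>' (fst p)) (\<beta> (snd p)) then 0 else 1 :: ennreal) \<in> borel_measurable (B.\<Omega> \<Otimes>\<^sub>M F.\<Omega>)"
      by measurable
    then show "(\<lambda>(\<omega>', \<omega>). if F.Z n \<omega> \<in> S R (\<beta>' \<omega>') (\<beta> \<omega>) then 0 else 1 :: ennreal) \<in> borel_measurable (B.\<Omega> \<Otimes>\<^sub>M F.\<Omega>)"
      by (simp add: case_prod_beta)
  qed
  have split: "(\<integral>\<^sup>+\<omega>. bad \<omega>' \<omega> \<partial>F.\<Omega>) = (\<integral>\<^sup>+\<omega>. (if F.Z n \<omega> \<in> S R (\<beta>' \<omega>') (\<beta> \<omega>) then 0 else 1) \<partial>F.\<Omega>) + far L n" for \<omega>'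
    unfolding bad_def far_def
  proof (rule nn_integral_add)
    show "(\<lambda>\<omega>. if F.Z n \<omega> \<in> S R (\<beta>' \<omega>') (\<beta> \<omega>) then 0 else 1 :: ennreal) \<in> borel_measurable F.\<Omega>"
      using inS[of \<omega>'] by measurable
    show "(\<lambda>\<omega>. if len (F.Z n \<omega>) \<le> L then 0 else 1 :: ennreal) \<in> borel_measurable F.\<Omega>"
      by measurable
  qed
  have "(\<integral>\<^sup>+\<omega>. ennreal (F.u n \<omega>) \<partial>F.\<Omega>) = (\<integral>\<^sup>+\<omega>'. (\<integral>\<^sup>+\<omega>. ennreal (F.u n \<omega>) \<partial>F.\<Omega>) \<partial>B.\<Omega>)"
    using B.seq.P.emeasure_space_1 by simp
  also have "\<dots> \<le> (\<integral>\<^sup>+\<omega>'. ennreal (ln 2 + ln (real C)) + ennreal (real n) * (ennreal K * (\<integral>\<^sup>+\<omega>. bad \<omega>' \<omega> \<partial>F.\<Omega>) + \<tau>) \<partial>B.\<Omega>)"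
    by (rule nn_integral_mono) (rule one)
  also have "\<dots> = ennreal (ln 2 + ln (real C)) + ennreal (real n) * (ennreal K * (miss R n + far L n) + \<tau>)"
    unfolding split miss_def
    using B.seq.P.nn_integral_affine[OF bI, of "ennreal (ln 2 + ln (real C))" "ennreal (real n)" "ennreal K" "far L n" \<tau>] .
  finally show ?thesis by (simp only: miss_eq[of R n] \<tau>_def)
qed

lemma entropy_small:
  assumes "\<epsilon> > 0"
  shows "\<exists>n. (\<integral>\<^sup>+\<omega>. ennreal (F.u (Suc n) \<omega>) \<partial>F.\<Omega>) \<le> ennreal (\<epsilon> * real (Suc n))"
proof -
  \<comment> \<open>Two shares of \<open>\<delta>\<close> pay for \<open>ln C\<close>, and one each
    for \<open>miss\<close>, \<open>far\<close> and the tail of \<open>v\<close>.\<close>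
  define \<delta> where "\<delta> = \<epsilon> / 5"
  have \<delta>: "\<delta> > 0" using assms by (simp add: \<delta>_def)
  have "(\<lambda>n. \<integral>\<^sup>+x. ennreal (F.v x) * indicator {x. real n < F.v x} x \<partial>\<mu>) \<longlonglongrightarrow> 0"
    by (rule tail_integral[OF _ ent]) (simp_all add: filterlim_real_sequentially)
  then have "\<forall>\<^sub>F n in sequentially. (\<integral>\<^sup>+x. ennreal (F.v x) * indicator {x. real n < F.v x} x \<partial>\<mu>) < ennreal \<delta>"
    by (rule order_tendstoD) (simp add: \<delta>)
  then obtain K0 where K0: "(\<integral>\<^sup>+x. ennreal (F.v x) * indicator {x. real K0 < F.v x} x \<partial>\<mu>) < ennreal \<delta>"
    by (auto simp: eventually_sequentially)
  \<comment> \<open>The order of choices matters: \<open>K\<close> by the tail of \<open>v\<close>,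
    then \<open>R\<close> by \<open>K * miss\<close>, then \<open>C0\<close>, \<open>k\<close> and
    \<open>c\<close> depending on \<open>R\<close>, and \<open>n\<close> last.\<close>
  define K where "K = real K0"
  have K: "K \<ge> 0" by (simp add: K_def)
  have "(\<lambda>R. ennreal K * miss R 0) \<longlonglongrightarrow> ennreal K * 0"
    by (rule tendsto_mult_ennreal) (use miss_tendsto in auto)
  then have "\<forall>\<^sub>F R in sequentially. ennreal K * miss R 0 < ennreal \<delta>" by (intro order_tendstoD(2)) (auto simp: \<delta>)
  then obtain R where R: "ennreal K * miss R 0 < ennreal \<delta>" by (auto simp: eventually_sequentially)
  obtain C0 k where C0: "\<And>L y y'. y \<in> space N \<Longrightarrow> y' \<in> space N \<Longrightarrow>
      finite {z \<in> S R y y'. len z \<le> L} \<and> card {z \<in> S R y y'. len z \<le> L} \<le> C0 * (L + 1) ^ k"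
    using growth[of R] by blast
  \<comment> \<open>The exponent \<open>k\<close> of the growth turns \<open>exp (c * n)\<close>
    into \<open>k * c * n\<close> inside \<open>ln C\<close>; the \<open>+ 1\<close> covers
    \<open>k = 0\<close>.\<close>
  define c where "c = \<delta> / (real k + 1)"
  have c: "c > 0" using \<delta> by (simp add: c_def)
  have kc: "real k * c \<le> \<delta>" using \<delta> by (simp add: c_def field_simps)
  define L where "L n = nat \<lfloor>real n * exp (c * real n)\<rfloor>" for n
  let ?tail = "\<lambda>n. (\<integral>\<^sup>+x. ennreal (ln (real (len x))) * indicator {x. c * real n < ln (real (len x))} x \<partial>\<mu>)"
  have t0: "?tail \<longlonglongrightarrow> 0"
  proof (rule tail_integral[OF _ logmom])
    show "filterlim (\<lambda>n. c * real n) at_top sequentially"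
      using c by (intro filterlim_tendsto_pos_mult_at_top[OF tendsto_const] filterlim_real_sequentially) auto
  qed simp
  have "(\<lambda>n. ennreal K * (ennreal (1 / c) * ?tail n)) \<longlonglongrightarrow> ennreal K * (ennreal (1 / c) * 0)"
    by (intro tendsto_mult_ennreal tendsto_const t0) auto
  then have ev1: "\<forall>\<^sub>F n in sequentially. ennreal K * (ennreal (1 / c) * ?tail n) < ennreal \<delta>" by (intro order_tendstoD(2)) (auto simp: \<delta>)
  have "(\<lambda>n. (ln 2 + ln (real C0 + 1) + real k * ln 2) * (1 / real n) + real k * (ln (real n) / real n)) \<longlonglongrightarrow>
      (ln 2 + ln (real C0 + 1) + real k * ln 2) * 0 + real k * 0"
    by (intro tendsto_intros lim_1_over_n lim_ln_over_n)
  then have ev2: "\<forall>\<^sub>F n in sequentially. (ln 2 + ln (real C0 + 1) + real k * ln 2) * (1 / real n) + real k * (ln (real n) / real n) < \<delta>"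
    by (intro order_tendstoD(2)) (auto simp: \<delta>)
  have "\<forall>\<^sub>F n in sequentially. ennreal K * (ennreal (1 / c) * ?tail n) < ennreal \<delta> \<and>
      (ln 2 + ln (real C0 + 1) + real k * ln 2) * (1 / real n) + real k * (ln (real n) / real n) < \<delta> \<and> 1 \<le> n"
    using ev1 ev2 eventually_ge_at_top[of 1] by eventually_elim auto
  then obtain n where n: "ennreal K * (ennreal (1 / c) * ?tail n) < ennreal \<delta>"
      "(ln 2 + ln (real C0 + 1) + real k * ln 2) * (1 / real n) + real k * (ln (real n) / real n) < \<delta>" "1 \<le> n"
    by (auto simp: eventually_sequentially)
  define C where "C = (C0 + 1) * (L n + 1) ^ k"
  have "1 * 1 \<le> (C0 + 1) * (L n + 1) ^ k" by (intro mult_le_mono one_le_power) simp_all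
  then have C1: "C \<ge> 1" by (simp only: C_def)
  have C2: "finite {z \<in> S R y y'. len z \<le> L n} \<and> card {z \<in> S R y y'. len z \<le> L n} \<le> C" if "y \<in> space N" "y' \<in> space N" for y y'
    using C0[OF that, of "L n"] by (auto simp: C_def intro: order_trans)
  have lnC: "ln 2 + ln (real C) \<le> 2 * \<delta> * real n"
  proof -
    have "real (L n) \<le> real n * exp (c * real n)" unfolding L_def by (simp add: of_nat_floor)
    moreover have "1 \<le> exp (c * real n)" using c by simp
    moreover have "(real n + 1) * exp (c * real n) = real n * exp (c * real n) + exp (c * real n)" by (simp add: algebra_simps)
    ultimately have "real (L n) + 1 \<le> (real n + 1) * exp (c * real n)" by linarith
    then have "ln (real (L n) + 1) \<le> ln ((real n + 1) * exp (c * real n))" by (subst ln_le_cancel_iff) auto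
    also have "\<dots> = ln (real n + 1) + c * real n" by (subst ln_mult) auto
    finally have "real k * ln (real (L n) + 1) \<le> real k * ln (real n + 1) + real k * c * real n"
      by (metis distrib_left mult.assoc mult_left_mono of_nat_0_le_iff)
    moreover have "ln (real C) = ln (real C0 + 1) + real k * ln (real (L n) + 1)"
    proof -
      have "real C = (real C0 + 1) * (real (L n) + 1) ^ k" by (simp add: C_def algebra_simps)
      also have "ln \<dots> = ln (real C0 + 1) + ln ((real (L n) + 1) ^ k)" by (rule ln_mult_pos) auto
      also have "ln ((real (L n) + 1) ^ k) = real k * ln (real (L n) + 1)" by (rule ln_realpow)
      finally show ?thesis .
    qed
    moreover have "real k * c * real n \<le> \<delta> * real n" using kc by (rule mult_right_mono) simp
    moreover have "ln 2 + ln (real C0 + 1) + real k * ln (real n + 1) \<le> \<delta> * real n"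
    proof -
      have "ln (real n + 1) \<le> ln (2 * real n)" using n(3) by (subst ln_le_cancel_iff) auto
      also have "\<dots> = ln 2 + ln (real n)" using n(3) by (subst ln_mult) auto
      finally have "real k * ln (real n + 1) \<le> real k * (ln 2 + ln (real n))" by (rule mult_left_mono) simp
      moreover have "(ln 2 + ln (real C0 + 1) + real k * ln 2) + real k * ln (real n) \<le> \<delta> * real n"
        using n(2,3) by (simp add: field_simps)
      ultimately show ?thesis by (simp add: distrib_left)
    qed
    ultimately show ?thesis by simp
  qed
  have far: "ennreal K * far (L n) n \<le> ennreal \<delta>"
  proof -
    have "ennreal K * far (L n) n \<le> ennreal K * (ennreal (1 / c) * ?tail n)"
      unfolding L_def by (rule mult_left_mono[OF far_bound[OF c]]) simp
    then show ?thesis using n(1) by simp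
  qed
  have "(\<integral>\<^sup>+\<omega>. ennreal (F.u n \<omega>) \<partial>F.\<Omega>) \<le> ennreal (ln 2 + ln (real C)) +
    ennreal (real n) * (ennreal K * (miss R 0 + far (L n) n) + (\<integral>\<^sup>+x. ennreal (F.v x) * indicator {x. K < F.v x} x \<partial>\<mu>))"
    by (rule u_bound[OF C1 C2 K])
  also have "\<dots> \<le> ennreal (2 * \<delta> * real n) + ennreal (real n) * ((ennreal \<delta> + ennreal \<delta>) + ennreal \<delta>)"
  proof (intro add_mono mult_left_mono)
    show "ennreal (ln 2 + ln (real C)) \<le> ennreal (2 * \<delta> * real n)" using lnC by (rule ennreal_leI)
    show "ennreal K * (miss R 0 + far (L n) n) \<le> ennreal \<delta> + ennreal \<delta>"
      unfolding distrib_left using R far by (intro add_mono) auto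
    show "(\<integral>\<^sup>+x. ennreal (F.v x) * indicator {x. K < F.v x} x \<partial>\<mu>) \<le> ennreal \<delta>" using K0 by (simp add: K_def)
  qed simp
  also have "\<dots> = ennreal (2 * \<delta> * real n + real n * (\<delta> + \<delta> + \<delta>))"
  proof -
    have "(ennreal \<delta> + ennreal \<delta>) + ennreal \<delta> = ennreal (\<delta> + \<delta> + \<delta>)" using \<delta> by (simp only: ennreal_plus)
    moreover have "ennreal (real n) * ennreal (\<delta> + \<delta> + \<delta>) = ennreal (real n * (\<delta> + \<delta> + \<delta>))"
      by (rule ennreal_mult[symmetric]) (use \<delta> in simp_all)
    moreover have "ennreal (2 * \<delta> * real n) + ennreal (real n * (\<delta> + \<delta> + \<delta>)) = ennreal (2 * \<delta> * real n + real n * (\<delta> + \<delta> + \<delta>))"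
      by (rule ennreal_plus[symmetric]) (use \<delta> in simp_all)
    ultimately show ?thesis by (simp only:)
  qed
  also have "2 * \<delta> * real n + real n * (\<delta> + \<delta> + \<delta>) = \<epsilon> * real n" by (simp add: \<delta>_def algebra_simps)
  finally have "(\<integral>\<^sup>+\<omega>. ennreal (F.u n \<omega>) \<partial>F.\<Omega>) \<le> ennreal (\<epsilon> * real n)" .
  moreover obtain n' where "n = Suc n'" using n(3) by (cases n) auto
  ultimately show ?thesis by blast
qed

end

section \<open>The boundary map\<close>

context rw begin

lemma integrable_unit: "(\<And>x. 0 \<le> f x \<and> f x \<le> (1::real)) \<Longrightarrow> integrable (measure_pmf p) f"
  by (rule measure_pmf.integrable_const_bound[where B = 1]) auto

lemma nn_unit: "(\<And>x. 0 \<le> f x \<and> f x \<le> (1::real)) \<Longrightarrow> (\<integral>\<^sup>+x. ennreal (f x) \<partial>measure_pmf p) = ennreal (\<integral>x. f x \<partial>measure_pmf p)"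
  by (rule nn_integral_eq_integral) (auto intro: integrable_unit)

lemma integral_unit: "(\<And>x. 0 \<le> f x \<and> f x \<le> (1::real)) \<Longrightarrow> 0 \<le> (\<integral>x. f x \<partial>measure_pmf p) \<and> (\<integral>x. f x \<partial>measure_pmf p) \<le> 1"
  by (auto intro!: integral_nonneg_AE measure_pmf.integral_le_const integrable_unit)

lemma nn_m_add: "(\<integral>\<^sup>+z. f z \<partial>m (n + k)) = (\<integral>\<^sup>+x. \<integral>\<^sup>+y. f (x + y) \<partial>m k \<partial>m n)"
  by (induction n arbitrary: f) (simp_all add: add.assoc)

lemma integral_m_add:
  assumes "\<And>z. 0 \<le> f z \<and> f z \<le> (1::real)"
  shows "(\<integral>z. f z \<partial>m (n + k)) = (\<integral>x. (\<integral>y. f (x + y) \<partial>m k) \<partial>m n)"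
proof -
  have "ennreal (\<integral>z. f z \<partial>m (n + k)) = (\<integral>\<^sup>+x. \<integral>\<^sup>+y. ennreal (f (x + y)) \<partial>m k \<partial>m n)"
    using nn_unit[of f "m (n + k)", OF assms] by (simp add: nn_m_add)
  also have "\<dots> = ennreal (\<integral>x. (\<integral>y. f (x + y) \<partial>m k) \<partial>m n)"
    using assms by (simp add: nn_unit integral_unit)
  finally show ?thesis using integral_unit[OF assms] integral_unit[of "\<lambda>x. (\<integral>y. f (x + y) \<partial>m k)"] integral_unit[of "\<lambda>y. f (_ + y)"] assms
    by (subst (asm) ennreal_inj) (auto simp: integral_unit)
qed

lemma m_1: "m 1 = \<mu>"
  by (simp add: map_return_pmf bind_return_pmf')

lemma nn_Z: "(\<integral>\<^sup>+\<omega>. f (Z n \<omega>) \<partial>\<Omega>) = (\<integral>\<^sup>+z. f z \<partial>m n)"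
proof (induction n arbitrary: f)
  case 0
  show ?case using seq.P.emeasure_space_1 by simp
next
  case (Suc n)
  have "(\<lambda>\<omega>. f (Z (Suc n) \<omega>)) \<in> borel_measurable \<Omega>" by (rule measurable_compose[OF meas_Z]) simp
  note I = nn_iter[OF this]
  have J: "(\<integral>\<^sup>+\<omega>. f (x + Z n \<omega>) \<partial>\<Omega>) = (\<integral>\<^sup>+z. f (x + z) \<partial>m n)" for x using Suc[of "\<lambda>z. f (x + z)"] .
  show ?case unfolding I by (simp add: Z_Suc J)
qed

lemma nn_Z2: "(\<integral>\<^sup>+\<omega>. f (Z n \<omega>) (Z (n + k) \<omega>) \<partial>\<Omega>) = (\<integral>\<^sup>+x. \<integral>\<^sup>+y. f x (x + y) \<partial>m k \<partial>m n)"
proof (induction n arbitrary: f)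
  case 0
  show ?case using nn_Z[of "f 0" k] by simp
next
  case (Suc n)
  have "(\<lambda>\<omega>. f (Z (Suc n) \<omega>) (Z (Suc n + k) \<omega>)) \<in> borel_measurable \<Omega>"
    by (rule measurable_compose_countable[OF _ meas_Z], rule measurable_compose[OF meas_Z]) simp
  note I = nn_iter[OF this]
  have J: "(\<integral>\<^sup>+\<omega>. f (z + Z n \<omega>) (z + Z (n + k) \<omega>) \<partial>\<Omega>) = (\<integral>\<^sup>+x. \<integral>\<^sup>+y. f (z + x) (z + (x + y)) \<partial>m k \<partial>m n)" for z
    using Suc[of "\<lambda>a b. f (z + a) (z + b)"] .
  show ?case unfolding I by (simp add: Z_Suc add.assoc J)
qed

end

locale cc_walk = cc_act E act + rw \<mu> for E :: "'x::countable \<Rightarrow> 'x \<Rightarrow> bool"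
    and act :: "'g::{group_add,countable} \<Rightarrow> 'x \<Rightarrow> 'x" and \<mu> :: "'g pmf" +
  fixes b :: 'x
  assumes gen: "generating \<mu>" and fac: "\<And>h M. h \<in> H \<Longrightarrow> facing h M"
    and inforb: "\<And>x. infinite (range (\<lambda>g. act g x))"
begin

text \<open>\<open>st h\<close> plays the role of the mass of \<open>h\<close> for a stationary
  measure on the Roller compactification. Only complements, stationarity and disjoint sums are
  recorded, properties that survive a limit taken half-space by half-space.\<close>

definition stationary_weight :: "('x set \<Rightarrow> real) \<Rightarrow> bool" where
  "stationary_weight st \<longleftrightarrow> (\<forall>h. 0 \<le> st h \<and> st h \<le> 1) \<and> (\<forall>h\<in>H. st h + st (- h) = 1) \<and>
    (\<forall>h\<in>H. st h = (\<integral>x. st (tr (- x) h) \<partial>\<mu>)) \<and>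
    (\<forall>F. finite F \<longrightarrow> F \<subseteq> H \<longrightarrow> (\<forall>h\<in>F. \<forall>k\<in>F. h \<noteq> k \<longrightarrow> h \<inter> k = {}) \<longrightarrow> sum st F \<le> 1)"

text \<open>A subsequential limit of the Cesaro averages of the laws of \<open>act (Z n) b\<close>.\<close>

lemma stationary_weight_exists: "\<exists>st. stationary_weight st"
proof -
  define p where "p n h = measure (m n) {g. act g b \<in> h}" for n h
  define av where "av N h = (\<Sum>n<Suc N. p n h) / real (Suc N)" for N h
  have p01: "0 \<le> p n h \<and> p n h \<le> 1" for n h by (simp add: p_def)
  have av01: "0 \<le> av N h \<and> av N h \<le> 1" for N h
  proof -
    have "(\<Sum>n<Suc N. p n h) \<le> (\<Sum>n<Suc N. 1)" by (rule sum_mono) (use p01 in auto)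
    then show ?thesis using p01 by (auto simp: av_def sum_nonneg divide_simps)
  qed
  have pS: "p (Suc n) h = (\<integral>x. p n (tr (- x) h) \<partial>\<mu>)" for n h
  proof -
    have "p (Suc n) h = (\<integral>g. indicator {g. act g b \<in> h} g \<partial>m (1 + n))" by (simp add: p_def)
    also have "\<dots> = (\<integral>x. (\<integral>z. indicator {g. act g b \<in> h} (x + z) \<partial>m n) \<partial>m 1)"
      by (rule integral_m_add) (simp add: indicator_def)
    also have "\<dots> = (\<integral>x. (\<integral>z. indicator {g. act g b \<in> tr (- x) h} z \<partial>m n) \<partial>\<mu>)"
      unfolding m_1 by (simp add: indicator_def tr_iff act_add)
    finally show ?thesis by (simp add: p_def)
  qed
  \<comment> \<open>The sum telescopes: one step of the walk changes the Cesaro mean by a boundary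
    term that vanishes like \<open>1 / N\<close>.\<close>
  have avS: "(\<integral>x. av N (tr (- x) h) \<partial>\<mu>) = av N h + (p (Suc N) h - p 0 h) / real (Suc N)" for N h
  proof -
    have "(\<integral>x. av N (tr (- x) h) \<partial>\<mu>) = (\<Sum>n<Suc N. (\<integral>x. p n (tr (- x) h) \<partial>\<mu>)) / real (Suc N)"
      unfolding av_def using p01 by (subst integral_divide_zero, subst Bochner_Integration.integral_sum) (auto intro: integrable_unit)
    also have "\<dots> = (\<Sum>n<Suc N. p (Suc n) h) / real (Suc N)" by (simp only: pS)
    also have "(\<Sum>n<Suc N. p (Suc n) h) = (\<Sum>n<Suc N. p n h) + (p (Suc N) h - p 0 h)"
      by (subst sum.lessThan_Suc_shift[of "\<lambda>n. p n h"]) (simp add: sum.lessThan_Suc)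
    finally show ?thesis by (simp add: av_def add_divide_distrib)
  qed
  obtain \<phi> where \<phi>: "strict_mono \<phi>" "\<And>h. h \<in> H \<Longrightarrow> convergent (\<lambda>n. av (\<phi> n) h)"
  proof (rule common_convergent_subsequence[OF countable_H, of av 1])
    show "\<bar>av n h\<bar> \<le> 1" for n h using av01[of n h] by simp
  next
    fix \<phi> assume "strict_mono \<phi>" "\<And>h. h \<in> H \<Longrightarrow> convergent (\<lambda>n. av (\<phi> n) h)"
    then show ?thesis by (rule that)
  qed
  define st where "st h = (if h \<in> H then lim (\<lambda>n. av (\<phi> n) h) else 0)" for h
  have lim: "(\<lambda>n. av (\<phi> n) h) \<longlonglongrightarrow> st h" if "h \<in> H" for h
    using \<phi>(2)[OF that] that by (simp add: st_def convergent_LIMSEQ_iff)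
  have st01: "0 \<le> st h \<and> st h \<le> 1" for h
  proof (cases "h \<in> H")
    case True
    then show ?thesis using LIMSEQ_le_const[OF lim[OF True], of 0] LIMSEQ_le_const2[OF lim[OF True], of 1] av01 by blast
  qed (simp add: st_def)
  have compl: "st h + st (- h) = 1" if h: "h \<in> H" for h
  proof -
    have "p n h + p n (- h) = 1" for n
    proof -
      have "{g. act g b \<in> - h} = space (m n) - {g. act g b \<in> h}" by auto
      then have "p n (- h) = 1 - p n h" unfolding p_def by (simp only: measure_pmf.prob_compl sets_measure_pmf UNIV_I)
      then show ?thesis by simp
    qed
    then have "av N h + av N (- h) = 1" for N
      unfolding av_def add_divide_distrib[symmetric] sum.distrib[symmetric] by (simp del: sum.lessThan_Suc of_nat_Suc)
    then have "(\<lambda>n. 1) \<longlonglongrightarrow> st h + st (- h)" using tendsto_add[OF lim[OF h] lim[OF H_compl[OF h]]] by simp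
    from LIMSEQ_unique[OF this tendsto_const] show ?thesis .
  qed
  have stat: "st h = (\<integral>x. st (tr (- x) h) \<partial>\<mu>)" if h: "h \<in> H" for h
  proof -
    have 1: "(\<lambda>n. \<integral>x. av (\<phi> n) (tr (- x) h) \<partial>\<mu>) \<longlonglongrightarrow> (\<integral>x. st (tr (- x) h) \<partial>\<mu>)"
      by (rule integral_dominated_convergence[where w = "\<lambda>_. 1"]) (use lim h av01 in \<open>auto simp: measure_pmf.integrable_const\<close>)
    have "(\<lambda>n. (p (Suc (\<phi> n)) h - p 0 h) / real (Suc (\<phi> n))) \<longlonglongrightarrow> 0"
    proof (rule Lim_null_comparison)
      show "\<forall>\<^sub>F n in sequentially. norm ((p (Suc (\<phi> n)) h - p 0 h) / real (Suc (\<phi> n))) \<le> inverse (real (Suc (\<phi> n)))"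
      proof (rule always_eventually, rule allI)
        fix n
        have "\<bar>p (Suc (\<phi> n)) h - p 0 h\<bar> \<le> 1" using p01[of "Suc (\<phi> n)" h] p01[of 0 h] by linarith
        then have "\<bar>p (Suc (\<phi> n)) h - p 0 h\<bar> / real (Suc (\<phi> n)) \<le> 1 / real (Suc (\<phi> n))" by (rule divide_right_mono) simp
        then show "norm ((p (Suc (\<phi> n)) h - p 0 h) / real (Suc (\<phi> n))) \<le> inverse (real (Suc (\<phi> n)))"
          by (simp add: inverse_eq_divide)
      qed
      show "(\<lambda>n. inverse (real (Suc (\<phi> n)))) \<longlonglongrightarrow> 0"
        using LIMSEQ_subseq_LIMSEQ[OF LIMSEQ_inverse_real_of_nat \<phi>(1)] by (simp add: comp_def)
    qed
    from tendsto_add[OF lim[OF h] this] have "(\<lambda>n. \<integral>x. av (\<phi> n) (tr (- x) h) \<partial>\<mu>) \<longlonglongrightarrow> st h"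
      by (simp add: avS)
    then show ?thesis using 1 LIMSEQ_unique by blast
  qed
  have disj: "sum st F \<le> 1" if F: "finite F" "F \<subseteq> H" "\<forall>h\<in>F. \<forall>k\<in>F. h \<noteq> k \<longrightarrow> h \<inter> k = {}" for F
  proof -
    have "(\<Sum>h\<in>F. p n h) \<le> 1" for n
    proof -
      have "(\<Sum>h\<in>F. p n h) = measure (m n) (\<Union>h\<in>F. {g. act g b \<in> h})"
        unfolding p_def by (rule measure_pmf.finite_measure_finite_Union[symmetric]) (use F in \<open>auto simp: disjoint_family_on_def\<close>)
      then show ?thesis by simp
    qed
    then have "(\<Sum>n<Suc N. (\<Sum>h\<in>F. p n h)) \<le> (\<Sum>n<Suc N. 1)" for N by (intro sum_mono) auto
    then have "(\<Sum>h\<in>F. av N h) \<le> 1" for N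
      unfolding av_def sum_divide_distrib[symmetric] by (subst sum.swap) (simp add: divide_simps del: sum.lessThan_Suc)
    moreover have "(\<lambda>n. \<Sum>h\<in>F. av (\<phi> n) h) \<longlonglongrightarrow> sum st F" by (intro tendsto_sum lim) (use F in auto)
    ultimately show ?thesis using LIMSEQ_le_const2 by blast
  qed
  show ?thesis unfolding stationary_weight_def
  proof (intro exI[of _ st] conjI)
    show "\<forall>h. 0 \<le> st h \<and> st h \<le> 1" by (rule allI) (rule st01)
    show "\<forall>h\<in>H. st h + st (- h) = 1" by (rule ballI) (rule compl)
    show "\<forall>h\<in>H. st h = (\<integral>x. st (tr (- x) h) \<partial>\<mu>)" by (rule ballI) (rule stat)
    show "\<forall>F. finite F \<longrightarrow> F \<subseteq> H \<longrightarrow> (\<forall>h\<in>F. \<forall>k\<in>F. h \<noteq> k \<longrightarrow> h \<inter> k = {}) \<longrightarrow> sum st F \<le> 1"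
      by (intro allI impI) (rule disj)
  qed
qed

end

locale cc_state = cc_walk +
  fixes st :: "'a set \<Rightarrow> real"
  assumes weight: "stationary_weight st"
begin

lemma st01: "0 \<le> st h \<and> st h \<le> 1" and st_compl: "h \<in> H \<Longrightarrow> st (- h) = 1 - st h"
  and st_disj: "finite F \<Longrightarrow> F \<subseteq> H \<Longrightarrow> (\<And>h k. h \<in> F \<Longrightarrow> k \<in> F \<Longrightarrow> h \<noteq> k \<Longrightarrow> h \<inter> k = {}) \<Longrightarrow> sum st F \<le> 1"
proof -
  show "0 \<le> st h \<and> st h \<le> 1" using weight unfolding stationary_weight_def by (elim conjE) (rule spec)
  have "\<forall>h\<in>H. st h + st (- h) = 1" using weight unfolding stationary_weight_def by (elim conjE)
  from bspec[OF this] show "h \<in> H \<Longrightarrow> st (- h) = 1 - st h" by fastforce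
  show "finite F \<Longrightarrow> F \<subseteq> H \<Longrightarrow> (\<And>h k. h \<in> F \<Longrightarrow> k \<in> F \<Longrightarrow> h \<noteq> k \<Longrightarrow> h \<inter> k = {}) \<Longrightarrow> sum st F \<le> 1"
  proof -
    assume F: "finite F" "F \<subseteq> H" "\<And>h k. h \<in> F \<Longrightarrow> k \<in> F \<Longrightarrow> h \<noteq> k \<Longrightarrow> h \<inter> k = {}"
    have w: "\<forall>F. finite F \<longrightarrow> F \<subseteq> H \<longrightarrow> (\<forall>h\<in>F. \<forall>k\<in>F. h \<noteq> k \<longrightarrow> h \<inter> k = {}) \<longrightarrow> sum st F \<le> 1"
      using weight unfolding stationary_weight_def by (elim conjE)
    have "\<forall>h\<in>F. \<forall>k\<in>F. h \<noteq> k \<longrightarrow> h \<inter> k = {}" by (intro ballI impI) (rule F(3))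
    from w[rule_format, OF F(1,2)] this show ?thesis by simp
  qed
qed

lemma st_disj2: "h \<in> H \<Longrightarrow> k \<in> H \<Longrightarrow> h \<inter> k = {} \<Longrightarrow> st h + st k \<le> 1"
proof -
  assume hk: "h \<in> H" "k \<in> H" "h \<inter> k = {}"
  then have "h \<noteq> k" using H_ne(1) by auto
  moreover have "sum st {h, k} \<le> 1" by (rule st_disj) (use hk in auto)
  ultimately show ?thesis by simp
qed

lemma st_stat_1: "h \<in> H \<Longrightarrow> st h = (\<integral>x. st (tr (- x) h) \<partial>\<mu>)"
  using weight unfolding stationary_weight_def by (elim conjE) (rule bspec)

lemma st_stat: "h \<in> H \<Longrightarrow> st h = (\<integral>x. st (tr (- x) h) \<partial>m n)"
proof (induction n arbitrary: h)
  case (Suc n)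
  have "(\<integral>x. st (tr (- x) h) \<partial>m (1 + n)) = (\<integral>x. (\<integral>y. st (tr (- (x + y)) h) \<partial>m n) \<partial>m 1)"
    by (rule integral_m_add) (rule st01)
  also have "\<dots> = (\<integral>x. (\<integral>y. st (tr (- y) (tr (- x) h)) \<partial>m n) \<partial>\<mu>)"
    unfolding m_1 by (simp only: tr_add minus_add)
  also have "\<dots> = (\<integral>x. st (tr (- x) h) \<partial>\<mu>)" 
    using Suc.prems by (intro Bochner_Integration.integral_cong refl Suc.IH[symmetric]) simp
  also have "\<dots> = st h" by (rule st_stat_1[OF Suc.prems, symmetric])
  finally show ?case by simp
qed simp

lemma m_exh: obtains n where "z \<in> set_pmf (m n)"
proof -
  obtain xs where "set xs \<subseteq> set_pmf \<mu>" "z = sum_list xs" using gen unfolding generating_def by blast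
  then show ?thesis using sum_list_in_m that by blast
qed

lemma st_translates:
  assumes h: "h \<in> H" and F: "finite F" "\<And>g g'. g \<in> F \<Longrightarrow> g' \<in> F \<Longrightarrow> g \<noteq> g' \<Longrightarrow> tr g h \<inter> tr g' h = {}"
  shows "(\<Sum>g\<in>F. st (tr g h)) \<le> 1"
proof -
  have inj: "inj_on (\<lambda>g. tr g h) F"
  proof (rule inj_onI)
    fix g g' assume g: "g \<in> F" "g' \<in> F" "tr g h = tr g' h"
    show "g = g'"
    proof (rule ccontr)
      assume "g \<noteq> g'"
      then have "tr g h = {}" using F(2)[OF g(1,2)] g(3) by simp
      then show False using H_ne(1)[OF h] by simp
    qed
  qed
  have "sum st ((\<lambda>g. tr g h) ` F) \<le> 1"
  proof (rule st_disj)
    fix a c assume "a \<in> (\<lambda>g. tr g h) ` F" "c \<in> (\<lambda>g. tr g h) ` F" "a \<noteq> c"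
    then obtain g g' where "g \<in> F" "g' \<in> F" "a = tr g h" "c = tr g' h" "g \<noteq> g'" by blast
    then show "a \<inter> c = {}" using F(2) by simp
  qed (use F(1) h in auto)
  then show ?thesis using inj by (simp add: sum.reindex comp_def)
qed

text \<open>The weights of \<open>M\<close> disjoint translates add up to at most 1, so one of them
  is below \<open>\<epsilon>\<close> once \<open>M * \<epsilon> > 1\<close>.\<close>

lemma facing_small:
  assumes "h \<in> H" "\<epsilon> > 0"
  obtains g where "st (tr g h) < \<epsilon>"
proof -
  obtain M :: nat where M: "real M * \<epsilon> > 1" using reals_Archimedean3[OF assms(2)] by blast
  obtain F where F: "finite F" "card F = M" "\<And>g g'. g \<in> F \<Longrightarrow> g' \<in> F \<Longrightarrow> g \<noteq> g' \<Longrightarrow> tr g h \<inter> tr g' h = {}"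
    using fac[OF assms(1), of M] unfolding facing_def by blast
  have "(\<Sum>g\<in>F. st (tr g h)) \<le> 1" by (rule st_translates[OF assms(1) F(1,3)])
  moreover have "(\<Sum>g\<in>F. st (tr g h)) \<ge> real M * \<epsilon>" if "\<And>g. g \<in> F \<Longrightarrow> st (tr g h) \<ge> \<epsilon>"
    using sum_mono[of F "\<lambda>_. \<epsilon>" "\<lambda>g. st (tr g h)"] that F by simp
  ultimately show ?thesis using that M by (meson leD leI less_le_trans)
qed

lemma finite_crossing: "finite {k \<in> H. y \<notin> k \<and> x \<in> k}"
  by (rule finite_subset[OF _ finite_sep[of x y]]) (auto simp: sep_def)

text \<open>Let \<open>s\<close> be the limsup of \<open>st\<close> at infinity among the half-spaces missing \<open>b\<close>, attained along
  \<open>kk\<close>.  By stationarity every translate of \<open>kk\<close> also has weights tending to \<open>s\<close>; after passing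
  to a chain below one half-space, disjoint translates of that half-space force \<open>s = 0\<close>.\<close>

lemma finite_heavy:
  assumes "\<epsilon> > 0"
  shows "finite {k \<in> H. b \<notin> k \<and> st k \<ge> \<epsilon>}"
proof (rule ccontr)
  define HV where "HV t = {k \<in> H. b \<notin> k \<and> st k \<ge> t}" for t
  assume "infinite {k \<in> H. b \<notin> k \<and> st k \<ge> \<epsilon>}"
  then have inf\<epsilon>: "infinite (HV \<epsilon>)" by (simp add: HV_def)
  define T where "T = {t. infinite (HV t)}"
  have bd: "t \<le> 1" if "t \<in> T" for t
  proof (rule ccontr)
    assume "\<not> t \<le> 1"
    then have "\<not> t \<le> st k" for k using st01[of k] by linarith
    then have "HV t = {}" by (simp add: HV_def)
    then show False using that by (simp add: T_def)
  qed
  have bddT: "bdd_above T" by (rule bdd_aboveI[of _ 1]) (rule bd)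
  define s where "s = Sup T"
  have s\<epsilon>: "s \<ge> \<epsilon>" unfolding s_def by (rule cSup_upper[OF _ bddT]) (simp add: T_def inf\<epsilon>)
  have s0: "s > 0" using s\<epsilon> assms by simp
  have HV_mono: "HV t \<subseteq> HV t'" if "t' \<le> t" for t t' using that by (auto simp: HV_def)
  have lo: "infinite (HV (s - \<delta>))" if "\<delta> > 0" for \<delta>
  proof -
    obtain t where "t \<in> T" "s - \<delta> < t"
    proof -
      have "T \<noteq> {}" using inf\<epsilon> by (auto simp: T_def)
      then have "\<exists>t\<in>T. s - \<delta> < t" using less_cSup_iff[of T "s - \<delta>"] bddT \<open>\<delta> > 0\<close> by (simp add: s_def)
      then show ?thesis using that by blast
    qed
    then show ?thesis using HV_mono[of "s - \<delta>" t] finite_subset by (auto simp: T_def)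
  qed
  have hi: "finite (HV (s + \<delta>))" if "\<delta> > 0" for \<delta>
  proof (rule ccontr)
    assume "infinite (HV (s + \<delta>))"
    then have "s + \<delta> \<le> s" unfolding s_def by (intro cSup_upper[OF _ bddT]) (simp add: T_def)
    then show False using that by simp
  qed
  \<comment> \<open>The allowed defect \<open>s / (2 * (j + 1))\<close> keeps all weights at least
    \<open>s / 2\<close> and tends to 0; an enumeration index of at least \<open>j\<close> makes the
    sequence leave every finite set.\<close>
  have "\<exists>k. k \<in> HV (s - s / (2 * (real j + 1))) \<and> j \<le> to_nat_on H k" for j
  proof (rule ccontr)
    let ?A = "HV (s - s / (2 * (real j + 1)))"
    assume "\<not> ?thesis"
    then have "to_nat_on H ` ?A \<subseteq> {..<j}" by (auto simp: not_le)
    then have "finite (to_nat_on H ` ?A)" using finite_subset by blast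
    moreover have "inj_on (to_nat_on H) ?A" by (rule inj_on_subset[OF inj_on_to_nat_on[OF countable_H]]) (auto simp: HV_def)
    ultimately have "finite ?A" using finite_imageD by blast
    then show False using lo[of "s / (2 * (real j + 1))"] s0 by simp
  qed
  then obtain kk where kk: "\<And>j. kk j \<in> HV (s - s / (2 * (real j + 1)))" "\<And>j. j \<le> to_nat_on H (kk j)" by metis
  have kH: "kk j \<in> H" "b \<notin> kk j" "st (kk j) \<ge> s - s / (2 * (real j + 1))" for j using kk(1)[of j] by (auto simp: HV_def)
  have out: "\<forall>\<^sub>F j in sequentially. kk j \<notin> F" if "finite F" for F
  proof -
    have "finite (to_nat_on H ` F)" using that by simp
    then have "\<exists>N. \<forall>i\<in>to_nat_on H ` F. i < N" by (simp only: finite_nat_set_iff_bounded)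
    then obtain N where N: "\<forall>i\<in>to_nat_on H ` F. i < N" by (elim exE)
    have "kk j \<notin> F" if "N \<le> j" for j
    proof
      assume "kk j \<in> F"
      then have "to_nat_on H (kk j) < N" using N by simp
      then show False using kk(2)[of j] that by simp
    qed
    then show ?thesis unfolding eventually_sequentially by (intro exI[of _ N]) simp
  qed
  \<comment> \<open>Only finitely many half-spaces missing \<open>b\<close> weigh
    \<open>s + \<delta>\<close> or more, and only finitely many translates can come to contain
    \<open>b\<close>; the sequence leaves both sets.\<close>
  have up: "\<forall>\<^sub>F j in sequentially. st (tr g (kk j)) < s + \<delta>" if "\<delta> > 0" for g \<delta>
  proof -
    have f1: "finite (tr (- g) ` HV (s + \<delta>))" using hi[OF that] by simp
    have f2: "finite {k \<in> H. b \<notin> k \<and> act (- g) b \<in> k}" by (rule finite_crossing)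
    show ?thesis using out[OF f1] out[OF f2]
    proof eventually_elim
      case (elim j)
      then have "b \<notin> tr g (kk j)" using kH by (simp add: tr_iff)
      moreover have "tr g (kk j) \<notin> HV (s + \<delta>)"
      proof
        assume "tr g (kk j) \<in> HV (s + \<delta>)"
        then have "tr (- g) (tr g (kk j)) \<in> tr (- g) ` HV (s + \<delta>)" by (rule imageI)
        then show False using elim by simp
      qed
      ultimately show ?case using kH by (auto simp: HV_def)
    qed
  qed
  \<comment> \<open>\<open>st (kk j)\<close> is the average of the weights of its translates, which
    exceed \<open>s\<close> by an amount vanishing in the mean. As the average is almost
    \<open>s\<close> or more, the translate by \<open>g\<close>, which has positive probability
    \<open>c\<close>, cannot stay at \<open>s / 2\<close> or below.\<close>
  have low: "\<forall>\<^sub>F j in sequentially. st (tr g (kk j)) > s / 2" for g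
  proof -
    obtain n where n: "- g \<in> set_pmf (m n)" using m_exh by blast
    define c where "c = pmf (m n) (- g)"
    have c0: "c > 0" using n by (simp add: c_def pmf_positive)
    define a where "a j x = max (st (tr (- x) (kk j)) - s) 0" for j x
    have a01: "0 \<le> a j x \<and> a j x \<le> 1" for j x using st01[of "tr (- x) (kk j)"] s0 by (auto simp: a_def)
    have "(\<lambda>j. \<integral>x. a j x \<partial>m n) \<longlonglongrightarrow> (\<integral>x. 0 \<partial>m n)"
    proof (rule integral_dominated_convergence[where w = "\<lambda>_. 1"])
      show "AE x in m n. (\<lambda>j. a j x) \<longlonglongrightarrow> 0"
      proof (rule AE_I2, rule order_tendstoI)
        fix x and t :: real assume "t < 0"
        then show "\<forall>\<^sub>F j in sequentially. t < a j x" using a01 by (intro always_eventually) (auto intro: less_le_trans)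
      next
        fix x and t :: real assume "0 < t"
        then show "\<forall>\<^sub>F j in sequentially. a j x < t" 
          by (intro eventually_mono[OF up[OF \<open>0 < t\<close>, of "- x"]]) (simp add: a_def)
      qed
    qed (use a01 in \<open>auto simp: measure_pmf.integrable_const\<close>)
    then have a0: "(\<lambda>j. \<integral>x. a j x \<partial>m n) \<longlonglongrightarrow> 0" by simp
    have ineq: "c * (s - st (tr g (kk j))) \<le> (\<integral>x. a j x \<partial>m n) + s / (2 * (real j + 1))" for j
    proof -
      let ?i = "indicator {- g} :: 'b \<Rightarrow> real"
      let ?e = "max (s - st (tr g (kk j))) 0"
      have ii: "integrable (m n) ?i" by (rule integrable_unit) (simp add: indicator_def)
      have "st (kk j) - s = (\<integral>x. st (tr (- x) (kk j)) \<partial>m n) - s" using st_stat[OF kH(1)] by metis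
      also have "\<dots> = (\<integral>x. st (tr (- x) (kk j)) - s \<partial>m n)"
        by (simp add: Bochner_Integration.integral_diff[OF integrable_unit[OF st01] measure_pmf.integrable_const])
      also have "\<dots> \<le> (\<integral>x. a j x - ?i x * ?e \<partial>m n)"
      proof (rule integral_mono)
        show "st (tr (- x) (kk j)) - s \<le> a j x - ?i x * ?e" for x by (auto simp: a_def indicator_def)
      qed (intro Bochner_Integration.integrable_diff integrable_unit st01 a01 integrable_mult_left measure_pmf.integrable_const ii)+
      also have "\<dots> = (\<integral>x. a j x \<partial>m n) - c * ?e"
        by (subst Bochner_Integration.integral_diff) (intro integrable_unit a01, simp_all add: ii c_def measure_pmf_single)
      finally have "c * ?e \<le> (\<integral>x. a j x \<partial>m n) + (s - st (kk j))" by simp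
      also have "s - st (kk j) \<le> s / (2 * (real j + 1))" using kH(3)[of j] by simp
      finally have "c * ?e \<le> (\<integral>x. a j x \<partial>m n) + s / (2 * (real j + 1))" by simp
      moreover have "c * (s - st (tr g (kk j))) \<le> c * ?e" using c0 by (intro mult_left_mono) auto
      ultimately show ?thesis by simp
    qed
    have "(\<lambda>j. (\<integral>x. a j x \<partial>m n) + s / 2 * inverse (real (Suc j))) \<longlonglongrightarrow> 0 + s / 2 * 0"
      by (intro tendsto_add a0 tendsto_mult tendsto_const LIMSEQ_inverse_real_of_nat)
    then have "\<forall>\<^sub>F j in sequentially. (\<integral>x. a j x \<partial>m n) + s / 2 * inverse (real (Suc j)) < c * (s / 2)"
      by (rule order_tendstoD) (use c0 s0 in simp)
    then show ?thesis
    proof eventually_elim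
      case (elim j)
      have "s / 2 * inverse (real (Suc j)) = s / (2 * (real j + 1))" by (simp add: field_simps)
      then have "c * (s - st (tr g (kk j))) < c * (s / 2)" using ineq[of j] elim by linarith
      then show ?case using c0 by simp
    qed
  qed
  obtain M :: nat where M: "real M * (s / 2) > 1" using reals_Archimedean3[OF half_gt_zero[OF s0]] by blast
  have big: "st (kk j) \<ge> s / 2" for j
  proof -
    have "s / (2 * (real j + 1)) \<le> s / 2" using s0 by (intro divide_left_mono) auto
    then show ?thesis using kH(3)[of j] by linarith
  qed
  have infr: "infinite (range kk)"
  proof
    assume "finite (range kk)"
    from out[OF this] show False by (auto simp: eventually_sequentially)
  qed
  have rH: "range kk \<subseteq> H" "\<And>h. h \<in> range kk \<Longrightarrow> b \<notin> h" using kH by auto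
  show False
  \<comment> \<open>\<open>M\<close> disjoint members of weight at least \<open>s / 2\<close>
    contradict total mass 1 directly. In a chain, \<open>M\<close> disjoint translates of one member
    \<open>h\<close> give disjoint translates of a later \<open>kk j\<close> inside
    \<open>h\<close>, all still heavy by \<open>low\<close>.\<close>
  proof (rule ramsey_halfspaces[OF rH infr])
    fix V assume V: "V \<subseteq> range kk" "infinite V" "\<And>h k. h \<in> V \<Longrightarrow> k \<in> V \<Longrightarrow> h \<noteq> k \<Longrightarrow> h \<inter> k = {}"
    obtain V' where V': "V' \<subseteq> V" "finite V'" "card V' = M" using infinite_arbitrarily_large[OF V(2)] by blast
    have "sum st V' \<le> 1" by (rule st_disj) (use V V' rH in auto)
    moreover have "real M * (s / 2) \<le> sum st V'"
      using sum_mono[of V' "\<lambda>_. s / 2" st] V V' big by force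
    ultimately show False using M by linarith
  next
    fix V assume V: "V \<subseteq> range kk" "infinite V" "\<And>h k. h \<in> V \<Longrightarrow> k \<in> V \<Longrightarrow> h \<subseteq> k \<or> k \<subseteq> h"
    obtain h where h: "h \<in> V" using V(2) by (metis ex_in_conv finite.emptyI)
    have VH: "k \<in> H" "b \<notin> k" if "k \<in> V" for k using that V(1) rH by auto
    have inf: "infinite {k \<in> V. k \<subset> h}" using infinite_below[of V b h] VH V h by blast
    obtain F where F: "finite F" "card F = M" "\<And>g g'. g \<in> F \<Longrightarrow> g' \<in> F \<Longrightarrow> g \<noteq> g' \<Longrightarrow> tr g h \<inter> tr g' h = {}"
      using fac[OF VH(1)[OF h], of M] unfolding facing_def by blast
    have "\<forall>\<^sub>F j in sequentially. \<forall>g\<in>F. st (tr g (kk j)) > s / 2"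
      using F(1) low by (simp add: eventually_ball_finite)
    then obtain N where N: "\<And>j g. j \<ge> N \<Longrightarrow> g \<in> F \<Longrightarrow> st (tr g (kk j)) > s / 2" by (auto simp: eventually_sequentially)
    have "\<exists>j\<ge>N. kk j \<subset> h"
    proof (rule ccontr)
      assume "\<not> ?thesis"
      then have "{k \<in> V. k \<subset> h} \<subseteq> kk ` {..<N}" using V(1) by (force simp: not_le)
      then show False using inf finite_subset by blast
    qed
    then obtain j where j: "j \<ge> N" "kk j \<subset> h" by blast
    have dis: "tr g (kk j) \<inter> tr g' (kk j) = {}" if "g \<in> F" "g' \<in> F" "g \<noteq> g'" for g g'
    proof -
      have "tr g (kk j) \<subseteq> tr g h" "tr g' (kk j) \<subseteq> tr g' h" unfolding tr_subset using j by auto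
      then show ?thesis using F(3)[OF that] by blast
    qed
    have "(\<Sum>g\<in>F. st (tr g (kk j))) \<le> 1" by (rule st_translates[OF kH(1) F(1) dis])
    moreover have "real M * (s / 2) \<le> (\<Sum>g\<in>F. st (tr g (kk j)))"
      using sum_mono[of F "\<lambda>_. s / 2" "\<lambda>g. st (tr g (kk j))"] N[OF j(1)] F(2) by (simp add: less_imp_le)
    ultimately show False using M by linarith
  qed
qed

lemma finite_undecided:
  assumes "\<epsilon> > 0"
  shows "finite {k \<in> H. \<epsilon> \<le> st k \<and> \<epsilon> \<le> 1 - st k}"
proof -
  let ?A = "{k \<in> H. b \<notin> k \<and> st k \<ge> \<epsilon>}"
  have "{k \<in> H. \<epsilon> \<le> st k \<and> \<epsilon> \<le> 1 - st k} \<subseteq> ?A \<union> uminus ` ?A"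
  proof
    fix k assume k: "k \<in> {k \<in> H. \<epsilon> \<le> st k \<and> \<epsilon> \<le> 1 - st k}"
    show "k \<in> ?A \<union> uminus ` ?A"
    proof (cases "b \<in> k")
      case True
      then have "- k \<in> ?A" using k st_compl H_compl by auto
      then have "- (- k) \<in> uminus ` ?A" by (rule imageI)
      then show ?thesis by simp
    qed (use k in auto)
  qed
  then show ?thesis using finite_heavy[OF assms] by (meson finite_UnI finite_imageI finite_subset)
qed

end

section \<open>The Roller boundary\<close>

context median_cc begin

lemma topspace_roller: "topspace (roller_top E) = extensional H"
  by (auto simp: roller_top_def PiE_def)

lemma openin_cylinder:
  assumes "finite J" "J \<subseteq> H"
  shows "openin (roller_top E) {f \<in> extensional H. \<forall>h\<in>J. f h = \<xi> h}"
  using assms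
proof (induction J)
  case empty
  show ?case using openin_topspace[of "roller_top E"] by (simp add: topspace_roller)
next
  case (insert h J)
  have "openin (roller_top E) {f \<in> topspace (roller_top E). f h \<in> {\<xi> h}}"
    unfolding roller_top_def
    by (rule openin_continuous_map_preimage[OF continuous_map_product_projection]) (use insert in auto)
  then have "openin (roller_top E) ({f \<in> topspace (roller_top E). f h \<in> {\<xi> h}} \<inter> {f \<in> extensional H. \<forall>h\<in>J. f h = \<xi> h})"
    using insert by (intro openin_Int) auto
  moreover have "{f \<in> topspace (roller_top E). f h \<in> {\<xi> h}} \<inter> {f \<in> extensional H. \<forall>h\<in>J. f h = \<xi> h} =
      {f \<in> extensional H. \<forall>h\<in>insert h J. f h = \<xi> h}"
    by (auto simp: topspace_roller)
  ultimately show ?case by simp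
qed

lemma open_contains_cylinder:
  assumes "openin (roller_top E) T" "\<xi> \<in> T"
  obtains J where "finite J" "J \<subseteq> H" "\<And>f. f \<in> extensional H \<Longrightarrow> (\<And>h. h \<in> J \<Longrightarrow> f h = \<xi> h) \<Longrightarrow> f \<in> T"
proof -
  obtain U where U: "finite {i \<in> H. U i \<noteq> UNIV}" "\<xi> \<in> Pi\<^sub>E H U" "Pi\<^sub>E H U \<subseteq> T"
    using assms unfolding roller_top_def openin_product_topology_alt by auto
  show ?thesis
  proof (rule that[OF U(1)])
    fix f assume f: "f \<in> extensional H" "\<And>h. h \<in> {i \<in> H. U i \<noteq> UNIV} \<Longrightarrow> f h = \<xi> h"
    have "f h \<in> U h" if "h \<in> H" for h
    proof (cases "U h = UNIV")
      case False
      then have "f h = \<xi> h" using f(2) that by simp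
      then show ?thesis using U(2) that by auto
    qed simp
    then show "f \<in> T" using f(1) U(3) by (auto simp: PiE_def)
  qed auto
qed

lemma ultrafilter_finite:
  assumes \<xi>: "\<And>h. h \<in> H \<Longrightarrow> \<xi> (- h) \<longleftrightarrow> \<not> \<xi> h" "\<And>h k. h \<in> H \<Longrightarrow> k \<in> H \<Longrightarrow> \<xi> h \<Longrightarrow> \<xi> k \<Longrightarrow> h \<inter> k \<noteq> {}"
    and J: "finite J" "J \<subseteq> H"
  obtains v where "\<And>h. h \<in> J \<Longrightarrow> \<xi> h \<longleftrightarrow> v \<in> h"
proof -
  define F where "F = {h \<in> J. \<xi> h} \<union> uminus ` {h \<in> J. \<not> \<xi> h}"
  have FH: "h \<in> H \<and> \<xi> h" if "h \<in> F" for h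
    using that J(2) \<xi>(1) H_compl unfolding F_def by blast
  have "\<Inter> F \<noteq> {}"
  proof (rule helly)
    show "finite F" using J(1) by (simp add: F_def)
    show "gconvex E A" if "A \<in> F" for A using FH[OF that] H_convex by blast
    show "A \<inter> B \<noteq> {}" if "A \<in> F" "B \<in> F" for A B using FH[OF that(1)] FH[OF that(2)] \<xi>(2) by blast
  qed
  then obtain v where v: "\<And>A. A \<in> F \<Longrightarrow> v \<in> A" by blast
  show ?thesis
  proof (rule that)
    fix h assume h: "h \<in> J"
    show "\<xi> h \<longleftrightarrow> v \<in> h"
    proof
      assume "\<xi> h"
      then show "v \<in> h" using v[of h] h by (simp add: F_def)
    next
      assume vh: "v \<in> h"
      show "\<xi> h"
      proof (rule ccontr)
        assume "\<not> \<xi> h"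
        then have "v \<in> - h" using v[of "- h"] h by (simp add: F_def)
        then show False using vh by simp
      qed
    qed
  qed
qed

text \<open>Points of the compactification are the consistent orientations of all hyperplanes. On
  finitely many half-spaces such an orientation is realised by a vertex, by Helly's theorem, and
  cylinders over finite sets form a basis of the topology.\<close>

lemma roller_closure_iff:
  "\<xi> \<in> roller_top E closure_of range (Uv E) \<longleftrightarrow> \<xi> \<in> extensional H \<and> (\<forall>h\<in>H. \<xi> (- h) \<longleftrightarrow> \<not> \<xi> h) \<and>
    (\<forall>h\<in>H. \<forall>k\<in>H. \<xi> h \<longrightarrow> \<xi> k \<longrightarrow> h \<inter> k \<noteq> {})" (is "_ \<longleftrightarrow> ?R")
proof
  assume c: "\<xi> \<in> roller_top E closure_of range (Uv E)"
  have ext: "\<xi> \<in> extensional H" using c by (auto simp: in_closure_of topspace_roller)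
  have "\<exists>v. \<forall>h\<in>J. \<xi> h \<longleftrightarrow> v \<in> h" if J: "finite J" "J \<subseteq> H" for J
  proof -
    have self: "\<xi> \<in> {f \<in> extensional H. \<forall>h\<in>J. f h = \<xi> h}" using ext by simp
    have "\<exists>y. y \<in> range (Uv E) \<and> y \<in> {f \<in> extensional H. \<forall>h\<in>J. f h = \<xi> h}"
      by (rule conjunct2[OF c[unfolded in_closure_of], rule_format]) (intro conjI self openin_cylinder J)
    then obtain v where "\<forall>h\<in>J. Uv E v h = \<xi> h" by blast
    moreover have "Uv E v h \<longleftrightarrow> v \<in> h" if "h \<in> J" for h using that J(2) by (auto simp: Uv_def)
    ultimately have "\<forall>h\<in>J. \<xi> h \<longleftrightarrow> v \<in> h" by simp
    then show ?thesis ..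
  qed note * = this
  have 1: "\<xi> (- h) \<longleftrightarrow> \<not> \<xi> h" if "h \<in> H" for h
  proof -
    have "\<exists>v. \<forall>k\<in>{h, - h}. \<xi> k \<longleftrightarrow> v \<in> k" by (rule *) (use that H_compl in auto)
    then show ?thesis by auto
  qed
  have 2: "h \<inter> k \<noteq> {}" if "h \<in> H" "k \<in> H" "\<xi> h" "\<xi> k" for h k
  proof -
    have "\<exists>v. \<forall>l\<in>{h, k}. \<xi> l \<longleftrightarrow> v \<in> l" by (rule *) (use that in auto)
    then show ?thesis using that(3,4) by auto
  qed
  show ?R by (intro conjI ballI impI ext 1 2)
next
  assume R: ?R
  show "\<xi> \<in> roller_top E closure_of range (Uv E)"
    unfolding in_closure_of
  proof (intro conjI allI impI)
    show "\<xi> \<in> topspace (roller_top E)" using R by (simp add: topspace_roller)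
    fix T assume "\<xi> \<in> T \<and> openin (roller_top E) T"
    then obtain J where J: "finite J" "J \<subseteq> H" "\<And>f. f \<in> extensional H \<Longrightarrow> (\<And>h. h \<in> J \<Longrightarrow> f h = \<xi> h) \<Longrightarrow> f \<in> T"
      using open_contains_cylinder by blast
    obtain v where v: "\<And>h. h \<in> J \<Longrightarrow> \<xi> h \<longleftrightarrow> v \<in> h"
      by (rule ultrafilter_finite[of \<xi> J]) (use R J in auto)
    have "Uv E v \<in> T" by (rule J(3)) (use v J(2) in \<open>auto simp: Uv_def\<close>)
    then show "\<exists>y. y \<in> range (Uv E) \<and> y \<in> T" by blast
  qed
qed

lemma boundaryD:
  assumes "\<xi> \<in> roller_boundary E"
  shows "\<xi> \<in> extensional H" "h \<in> H \<Longrightarrow> \<xi> (- h) \<longleftrightarrow> \<not> \<xi> h" "h \<in> H \<Longrightarrow> k \<in> H \<Longrightarrow> \<xi> h \<Longrightarrow> \<xi> k \<Longrightarrow> h \<inter> k \<noteq> {}"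
    "\<xi> \<noteq> Uv E v"
proof -
  have c: "\<xi> \<in> roller_top E closure_of range (Uv E)" "\<xi> \<notin> range (Uv E)" using assms by (auto simp: roller_boundary_def)
  then show "\<xi> \<noteq> Uv E v" by blast
  note R = c(1)[unfolded roller_closure_iff]
  show "\<xi> \<in> extensional H" using R by (elim conjE)
  show "h \<in> H \<Longrightarrow> \<xi> (- h) \<longleftrightarrow> \<not> \<xi> h" using R by simp
  show "h \<in> H \<Longrightarrow> k \<in> H \<Longrightarrow> \<xi> h \<Longrightarrow> \<xi> k \<Longrightarrow> h \<inter> k \<noteq> {}" using R by simp
qed

lemma space_boundary: "space (boundary_borel E) = roller_boundary E"
  unfolding boundary_borel_def by (rule space_measure_of) (auto dest: openin_imp_subset)

lemma boundary_coordinate: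
  assumes "h \<in> H"
  shows "Measurable.pred (boundary_borel E) (\<lambda>\<xi>. \<xi> h)"
proof -
  let ?C = "{f \<in> extensional H. \<forall>k\<in>{h}. f k = True} \<inter> roller_boundary E"
  have "openin (subtopology (roller_top E) (roller_boundary E)) ?C"
    using openin_cylinder[of "{h}" "\<lambda>_. True"] assms unfolding openin_subtopology by blast
  then have "?C \<in> sets (boundary_borel E)"
    unfolding boundary_borel_def by (intro in_measure_of) (auto dest: openin_imp_subset)
  moreover have "{\<xi> \<in> space (boundary_borel E). \<xi> h} = ?C" by (auto simp: space_boundary dest: boundaryD(1))
  ultimately show ?thesis by (simp add: pred_def)
qed

text \<open>With countably many half-spaces there are only countably many cylinders, so the preimage
  of an open set is a countable union of preimages of cylinders, and measurable coordinates
  suffice.\<close>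

lemma measurable_boundary:
  assumes cH: "countable H" and f: "\<And>\<omega>. \<omega> \<in> space N \<Longrightarrow> f \<omega> \<in> roller_boundary E"
    and m: "\<And>h. h \<in> H \<Longrightarrow> Measurable.pred N (\<lambda>\<omega>. f \<omega> h)"
  shows "f \<in> N \<rightarrow>\<^sub>M boundary_borel E"
  unfolding boundary_borel_def
proof (rule measurable_measure_of)
  fix A assume "A \<in> {A. openin (subtopology (roller_top E) (roller_boundary E)) A}"
  then obtain T where T: "openin (roller_top E) T" "A = T \<inter> roller_boundary E" by (auto simp: openin_subtopology)
  let ?Fin = "{J. finite J \<and> J \<subseteq> H}"
  define cyl where "cyl P Q = {\<omega> \<in> space N. (\<forall>h\<in>P. f \<omega> h) \<and> (\<forall>h\<in>Q. \<not> f \<omega> h)}" for P Q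
  have cyl: "cyl P Q \<in> sets N" if "P \<in> ?Fin" "Q \<in> ?Fin" for P Q
  proof -
    have "{\<omega> \<in> space N. \<forall>h\<in>P. f \<omega> h} \<in> sets N" "{\<omega> \<in> space N. \<forall>h\<in>Q. \<not> f \<omega> h} \<in> sets N"
      using that m by (auto intro!: sets.sets_Collect_finite_All simp: pred_def)
    moreover have "cyl P Q = {\<omega> \<in> space N. \<forall>h\<in>P. f \<omega> h} \<inter> {\<omega> \<in> space N. \<forall>h\<in>Q. \<not> f \<omega> h}" by (auto simp: cyl_def)
    ultimately show ?thesis by simp
  qed
  define PQ where "PQ = {(P, Q) \<in> ?Fin \<times> ?Fin. cyl P Q \<subseteq> f -` A}"
  have "countable ?Fin" using countable_Collect_finite_subset[OF cH] by simp
  then have "countable PQ" unfolding PQ_def by (intro countable_subset[OF _ countable_SIGMA[of ?Fin "\<lambda>_. ?Fin"]]) auto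
  then have "(\<Union>p\<in>PQ. cyl (fst p) (snd p)) \<in> sets N"
    by (intro sets.countable_UN'') (auto simp: PQ_def intro: cyl)
  moreover have "f -` A \<inter> space N = (\<Union>p\<in>PQ. cyl (fst p) (snd p))"
  proof
    show "(\<Union>p\<in>PQ. cyl (fst p) (snd p)) \<subseteq> f -` A \<inter> space N" by (auto simp: PQ_def cyl_def)
    show "f -` A \<inter> space N \<subseteq> (\<Union>p\<in>PQ. cyl (fst p) (snd p))"
    proof
      fix \<omega> assume w: "\<omega> \<in> f -` A \<inter> space N"
      then have "f \<omega> \<in> T" using T by simp
      then obtain J where J: "finite J" "J \<subseteq> H" "\<And>g. g \<in> extensional H \<Longrightarrow> (\<And>h. h \<in> J \<Longrightarrow> g h = f \<omega> h) \<Longrightarrow> g \<in> T"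
        using open_contains_cylinder[OF T(1)] by blast
      let ?P = "{h \<in> J. f \<omega> h}" and ?Q = "{h \<in> J. \<not> f \<omega> h}"
      have "cyl ?P ?Q \<subseteq> f -` A"
      proof
        fix \<omega>' assume "\<omega>' \<in> cyl ?P ?Q"
        then have w': "\<omega>' \<in> space N" "\<And>h. h \<in> J \<Longrightarrow> f \<omega>' h = f \<omega> h" by (auto simp: cyl_def)
        then have "f \<omega>' \<in> T" using J(3)[of "f \<omega>'"] boundaryD(1)[OF f] by blast
        then show "\<omega>' \<in> f -` A" using T(2) f w'(1) by simp
      qed
      then have "(?P, ?Q) \<in> PQ" using J by (auto simp: PQ_def)
      moreover have "\<omega> \<in> cyl ?P ?Q" using w by (auto simp: cyl_def)
      ultimately show "\<omega> \<in> (\<Union>p\<in>PQ. cyl (fst p) (snd p))" by force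
    qed
  qed
  ultimately show "f -` A \<inter> space N \<in> sets N" by simp
qed (use f in \<open>auto dest: openin_imp_subset\<close>)

end

context cc_act begin

abbreviation ra where "ra \<equiv> ract E act"

lemma ra_apply: "h \<in> H \<Longrightarrow> ra g \<xi> h = \<xi> (tr (- g) h)"
  by (simp add: ract_def)

lemma ra_ext: "ra g \<xi> \<in> extensional H"
  by (simp add: ract_def)

lemma ra_add: "ra (g + k) \<xi> = ra g (ra k \<xi>)"
  by (rule extensionalityI[of _ H]) (simp_all add: ra_apply ra_ext tr_add minus_add)

lemma ra_0: "\<xi> \<in> extensional H \<Longrightarrow> ra 0 \<xi> = \<xi>"
  by (rule extensionalityI[of _ H]) (simp_all add: ra_apply ra_ext)

lemma ra_Uv: "ra g (Uv E v) = Uv E (act g v)"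
  by (rule extensionalityI[of _ H]) (simp_all add: ra_apply ra_ext Uv_def tr_iff)

lemma ra_boundary:
  assumes "\<xi> \<in> roller_boundary E"
  shows "ra g \<xi> \<in> roller_boundary E"
proof -
  note b = boundaryD[OF assms]
  have "ra g \<xi> \<in> roller_top E closure_of range (Uv E)"
    unfolding roller_closure_iff
  proof (intro conjI ballI impI)
    show "ra g \<xi> (- h) \<longleftrightarrow> \<not> ra g \<xi> h" if "h \<in> H" for h
      using b(2)[of "tr (- g) h"] that by (simp add: ra_apply H_compl tr_compl)
    show "h \<inter> k \<noteq> {}" if "h \<in> H" "k \<in> H" "ra g \<xi> h" "ra g \<xi> k" for h k
      using b(3)[of "tr (- g) h" "tr (- g) k"] that by (simp add: ra_apply tr_empty_Int)
  qed (rule ra_ext)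
  moreover have "ra g \<xi> \<noteq> Uv E v" for v
  proof
    assume "ra g \<xi> = Uv E v"
    then have "ra (- g + g) \<xi> = Uv E (act (- g) v)" by (simp only: ra_add ra_Uv)
    then show False using b(4) ra_0[OF b(1)] by simp
  qed
  ultimately show ?thesis by (auto simp: roller_boundary_def)
qed

lemma ra_measurable: "ra g \<in> boundary_borel E \<rightarrow>\<^sub>M boundary_borel E"
proof (rule measurable_boundary[OF countable_H])
  show "ra g \<xi> \<in> roller_boundary E" if "\<xi> \<in> space (boundary_borel E)" for \<xi>
    using that by (simp add: space_boundary ra_boundary)
  show "Measurable.pred (boundary_borel E) (\<lambda>\<xi>. ra g \<xi> h)" if "h \<in> H" for h
    using boundary_coordinate[of "tr (- g) h"] that by (simp add: ra_apply)
qed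

end

text \<open>\<open>a j * (1 - a j) < 3 / 16\<close> means that \<open>a j\<close> avoids the
  interval from 1/4 to 3/4, and steps shorter than 1/2 cannot jump over it.\<close>

lemma zero_one_dichotomy:
  fixes a :: "nat \<Rightarrow> real"
  assumes a: "\<And>j. 0 \<le> a j \<and> a j \<le> 1" and v: "(\<lambda>j. a j * (1 - a j)) \<longlonglongrightarrow> 0"
    and d: "(\<lambda>j. (a (Suc j) - a j)\<^sup>2) \<longlonglongrightarrow> 0"
  shows "(\<forall>\<^sub>F j in sequentially. a j > 1 / 2) \<and> a \<longlonglongrightarrow> 1 \<or> (\<forall>\<^sub>F j in sequentially. a j < 1 / 2) \<and> a \<longlonglongrightarrow> 0"
proof -
  have "\<forall>\<^sub>F j in sequentially. a j * (1 - a j) < 3 / 16 \<and> (a (Suc j) - a j)\<^sup>2 < (1 / 2)\<^sup>2"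
    using order_tendstoD(2)[OF v, of "3/16"] order_tendstoD(2)[OF d, of "(1/2)\<^sup>2"] by (simp add: eventually_conj)
  then obtain J where J: "\<And>j. j \<ge> J \<Longrightarrow> a j * (1 - a j) < 3 / 16" "\<And>j. j \<ge> J \<Longrightarrow> (a (Suc j) - a j)\<^sup>2 < (1 / 2)\<^sup>2"
    by (auto simp: eventually_sequentially)
  have gap: "a j < 1 / 4 \<or> a j > 3 / 4" if "j \<ge> J" for j
  proof (rule ccontr)
    assume "\<not> ?thesis"
    then have "0 \<le> (a j - 1 / 4) * (3 / 4 - a j)" by simp
    also have "\<dots> = a j * (1 - a j) - 3 / 16" by (simp add: algebra_simps)
    finally show False using J(1)[OF that] by simp
  qed
  have step: "\<bar>a (Suc j) - a j\<bar> < 1 / 2" if "j \<ge> J" for j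
    using abs_less_iff J(2)[OF that] by (metis abs_le_square_iff abs_of_nonneg half_gt_zero_iff less_eq_real_def not_le zero_less_one)
  show ?thesis
  proof (cases "a J > 3 / 4")
    case True
    have up: "a j > 3 / 4" if "j \<ge> J" for j using that
    proof (induction j rule: dec_induct)
      case (step n)
      then show ?case using gap[of "Suc n"] \<open>\<And>j. j \<ge> J \<Longrightarrow> \<bar>a (Suc j) - a j\<bar> < 1 / 2\<close>[of n] by (auto simp: abs_less_iff)
    qed (rule True)
    have "(\<lambda>j. 1 - a j) \<longlonglongrightarrow> 0"
    proof (rule Lim_null_comparison)
      show "\<forall>\<^sub>F j in sequentially. norm (1 - a j) \<le> 2 * (a j * (1 - a j))"
        unfolding eventually_sequentially
      proof (intro exI[of _ J] allI impI)
        fix j assume "J \<le> j"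
        then have "1 * (1 - a j) \<le> (2 * a j) * (1 - a j)" using up[of j] a[of j] by (intro mult_right_mono) auto
        then show "norm (1 - a j) \<le> 2 * (a j * (1 - a j))" using a[of j] by (simp add: mult.assoc)
      qed
      show "(\<lambda>j. 2 * (a j * (1 - a j))) \<longlonglongrightarrow> 0" using tendsto_mult_left[OF v, of 2] by simp
    qed
    from tendsto_diff[OF tendsto_const this, of 1] have "a \<longlonglongrightarrow> 1" by simp
    moreover have "\<forall>\<^sub>F j in sequentially. a j > 1 / 2"
      unfolding eventually_sequentially using up by (intro exI[of _ J]) force
    ultimately show ?thesis by blast
  next
    case False
    have dn: "a j < 1 / 4" if "j \<ge> J" for j using that
    proof (induction j rule: dec_induct)
      case base
      show ?case using gap[of J] False by auto
    next
      case (step n)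
      then show ?case using gap[of "Suc n"] \<open>\<And>j. j \<ge> J \<Longrightarrow> \<bar>a (Suc j) - a j\<bar> < 1 / 2\<close>[of n] by (auto simp: abs_less_iff)
    qed
    have "a \<longlonglongrightarrow> 0"
    proof (rule Lim_null_comparison)
      show "\<forall>\<^sub>F j in sequentially. norm (a j) \<le> 2 * (a j * (1 - a j))"
        unfolding eventually_sequentially
      proof (intro exI[of _ J] allI impI)
        fix j assume "J \<le> j"
        then have "a j * 1 \<le> a j * (2 * (1 - a j))" using dn[of j] a[of j] by (intro mult_left_mono) auto
        then show "norm (a j) \<le> 2 * (a j * (1 - a j))" using a[of j] by (simp add: mult.left_commute)
      qed
      show "(\<lambda>j. 2 * (a j * (1 - a j))) \<longlonglongrightarrow> 0" using tendsto_mult_left[OF v, of 2] by simp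
    qed
    moreover have "\<forall>\<^sub>F j in sequentially. a j < 1 / 2"
      unfolding eventually_sequentially using dn by (intro exI[of _ J]) force
    ultimately show ?thesis by blast
  qed
qed

text \<open>The integrals are summable from \<open>i\<close> on, so almost surely the values are
  summable too.\<close>

lemma AE_tendsto_0:
  fixes f :: "nat \<Rightarrow> 'a \<Rightarrow> real"
  assumes [measurable]: "\<And>j. f j \<in> borel_measurable M" and pos: "\<And>j x. 0 \<le> f j x"
    and le: "\<And>j. j \<ge> i \<Longrightarrow> (\<integral>\<^sup>+x. ennreal (f j x) \<partial>M) \<le> ennreal ((1 / 2) ^ j)"
  shows "AE x in M. (\<lambda>j. f j x) \<longlonglongrightarrow> 0"
proof -
  have "(\<integral>\<^sup>+x. (\<Sum>j. ennreal (f (j + i) x)) \<partial>M) = (\<Sum>j. \<integral>\<^sup>+x. ennreal (f (j + i) x) \<partial>M)"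
    by (rule nn_integral_suminf) simp
  also have "\<dots> \<le> (\<Sum>j. ennreal ((1 / 2) ^ (j + i)))" by (intro suminf_le le summableI) simp
  also have "\<dots> < \<infinity>"
    by (subst suminf_ennreal2) (auto intro!: summable_ignore_initial_segment summable_geometric)
  finally have "AE x in M. (\<Sum>j. ennreal (f (j + i) x)) \<noteq> \<infinity>" by (intro nn_integral_noteq_infinite) auto
  then show ?thesis
  proof eventually_elim
    case (elim x)
    have "summable (\<lambda>j. f (j + i) x)" using elim pos by (intro summable_suminf_not_top) auto
    then have "(\<lambda>j. f (j + i) x) \<longlonglongrightarrow> 0" by (rule summable_LIMSEQ_zero)
    then show ?case by (rule LIMSEQ_offset)
  qed
qed

section \<open>Second moments of the weight along the walk\<close>

context cc_state begin

definition V :: "nat \<Rightarrow> 'a set \<Rightarrow> real" where "V n h = (\<integral>x. (st (tr (- x) h))\<^sup>2 \<partial>m n)"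

lemma sq01: "0 \<le> (st h)\<^sup>2 \<and> (st h)\<^sup>2 \<le> 1"
  using st01[of h] by (simp add: power_le_one)

lemma dsq01: "0 \<le> (st h - st k)\<^sup>2 \<and> (st h - st k)\<^sup>2 \<le> 1"
proof -
  have "\<bar>st h - st k\<bar> \<le> 1" using st01[of h] st01[of k] by linarith
  then show ?thesis by (simp add: abs_square_le_1)
qed

lemma V01: "0 \<le> V n h \<and> V n h \<le> 1"
  unfolding V_def by (rule integral_unit) (rule sq01)

lemma variance:
  assumes "h \<in> H"
  shows "(\<integral>y. (st (tr (- y) h) - st h)\<^sup>2 \<partial>m k) = V k h - (st h)\<^sup>2"
proof -
  have "(\<integral>y. (st (tr (- y) h) - st h)\<^sup>2 \<partial>m k) = (\<integral>y. (st (tr (- y) h))\<^sup>2 - 2 * st h * st (tr (- y) h) + (st h)\<^sup>2 \<partial>m k)"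
    by (simp add: power2_diff algebra_simps)
  also have "\<dots> = V k h - 2 * st h * (\<integral>y. st (tr (- y) h) \<partial>m k) + (st h)\<^sup>2"
  proof -
    have i1: "integrable (m k) (\<lambda>y. (st (tr (- y) h))\<^sup>2)" by (rule integrable_unit) (rule sq01)
    have i2: "integrable (m k) (\<lambda>y. 2 * st h * st (tr (- y) h))" by (intro integrable_mult_right integrable_unit st01)
    show ?thesis using i1 i2 by (simp add: V_def)
  qed
  also have "(\<integral>y. st (tr (- y) h) \<partial>m k) = st h" by (rule st_stat[OF assms, symmetric])
  finally show ?thesis by (simp add: power2_eq_square)
qed

text \<open>Orthogonality of martingale increments: given the first \<open>n\<close> steps, the mean
  of the weight after \<open>k\<close> more steps is its present value, so the mean squared
  increment is a difference of second moments.\<close>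

lemma V_incr:
  assumes h: "h \<in> H"
  shows "(\<integral>x. (\<integral>y. (st (tr (- (x + y)) h) - st (tr (- x) h))\<^sup>2 \<partial>m k) \<partial>m n) = V (n + k) h - V n h"
proof -
  have "(\<integral>x. (\<integral>y. (st (tr (- (x + y)) h) - st (tr (- x) h))\<^sup>2 \<partial>m k) \<partial>m n) =
      (\<integral>x. V k (tr (- x) h) - (st (tr (- x) h))\<^sup>2 \<partial>m n)"
  proof (rule Bochner_Integration.integral_cong[OF refl])
    fix x
    have "(\<integral>y. (st (tr (- (x + y)) h) - st (tr (- x) h))\<^sup>2 \<partial>m k) = (\<integral>y. (st (tr (- y) (tr (- x) h)) - st (tr (- x) h))\<^sup>2 \<partial>m k)"
      by (simp only: tr_add minus_add)
    also have "\<dots> = V k (tr (- x) h) - (st (tr (- x) h))\<^sup>2" by (rule variance) (simp add: h)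
    finally show "(\<integral>y. (st (tr (- (x + y)) h) - st (tr (- x) h))\<^sup>2 \<partial>m k) = V k (tr (- x) h) - (st (tr (- x) h))\<^sup>2" .
  qed
  also have "\<dots> = (\<integral>x. V k (tr (- x) h) \<partial>m n) - V n h"
    unfolding V_def[of n] by (rule Bochner_Integration.integral_diff) (intro integrable_unit V01 sq01)+
  also have "(\<integral>x. V k (tr (- x) h) \<partial>m n) = V (n + k) h"
  proof -
    have "V (n + k) h = (\<integral>x. (\<integral>y. (st (tr (- (x + y)) h))\<^sup>2 \<partial>m k) \<partial>m n)"
      unfolding V_def[of "n + k"] by (rule integral_m_add) (rule sq01)
    also have "\<dots> = (\<integral>x. V k (tr (- x) h) \<partial>m n)" unfolding V_def[of k] by (simp only: tr_add minus_add)
    finally show ?thesis ..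
  qed
  finally show ?thesis .
qed

lemma V_mono:
  assumes h: "h \<in> H" and "n \<le> n'"
  shows "V n h \<le> V n' h"
proof -
  have "0 \<le> (\<integral>x. (\<integral>y. (st (tr (- (x + y)) h) - st (tr (- x) h))\<^sup>2 \<partial>m (n' - n)) \<partial>m n)"
    by (intro Bochner_Integration.integral_nonneg) simp
  then show ?thesis using V_incr[OF h, of n "n' - n"] assms(2) by simp
qed

lemma V_incr_0:
  assumes h: "h \<in> H"
  shows "(\<lambda>n. V (n + k) h - V n h) \<longlonglongrightarrow> 0"
proof -
  have "incseq (\<lambda>n. V n h)" unfolding incseq_def using V_mono[OF h] by blast
  then have "convergent (\<lambda>n. V n h)" using incseq_convergent[of "\<lambda>n. V n h" 1] V01 by (metis convergentI)
  then obtain L where L: "(\<lambda>n. V n h) \<longlonglongrightarrow> L" by (auto simp: convergent_def)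
  from tendsto_diff[OF LIMSEQ_ignore_initial_segment[OF this] this] show ?thesis by simp
qed

text \<open>From \<open>k\<close>, the walk reaches in \<open>j\<close> more steps, with fixed
  positive probability, the translate \<open>tr g k\<close> of smaller weight. A visit to
  \<open>k\<close> thus contributes at least its probability times \<open>c\<close> to the increment
  of \<open>V\<close>, and these increments tend to 0.\<close>

lemma visits_0:
  assumes h: "h \<in> H" and k: "k \<in> H" "0 < st k"
  shows "(\<lambda>n. measure (m n) {x. tr (- x) h = k}) \<longlonglongrightarrow> 0"
proof -
  obtain g where g: "st (tr g k) < st k" by (rule facing_small[OF k])
  obtain j where j: "- g \<in> set_pmf (m j)" by (rule m_exh)
  define c where "c = pmf (m j) (- g) * (st (tr g k) - st k)\<^sup>2"
  have c0: "0 < c" using g pmf_positive[OF j] by (simp add: c_def)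
  have le: "measure (m n) {x. tr (- x) h = k} * c \<le> V (n + j) h - V n h" for n
  proof -
    have inner: "(\<integral>y. (st (tr (- (x + y)) h) - st (tr (- x) h))\<^sup>2 \<partial>m j) \<ge> c" if "tr (- x) h = k" for x
    proof -
      have "c = (\<integral>y. indicator {- g} y * (st (tr g k) - st k)\<^sup>2 \<partial>m j)" by (simp add: c_def measure_pmf_single)
      also have "\<dots> \<le> (\<integral>y. (st (tr (- y) k) - st k)\<^sup>2 \<partial>m j)"
      proof (rule integral_mono)
        show "integrable (m j) (\<lambda>y. indicator {- g} y * (st (tr g k) - st k)\<^sup>2)"
          by (rule integrable_unit) (use dsq01 in \<open>auto simp: indicator_def\<close>)
        show "integrable (m j) (\<lambda>y. (st (tr (- y) k) - st k)\<^sup>2)" by (intro integrable_unit dsq01)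
      qed (simp add: indicator_def)
      also have "\<dots> = (\<integral>y. (st (tr (- (x + y)) h) - st (tr (- x) h))\<^sup>2 \<partial>m j)"
        by (simp only: minus_add tr_add[symmetric] that)
      finally show ?thesis .
    qed
    have "measure (m n) {x. tr (- x) h = k} * c = (\<integral>x. indicator {x. tr (- x) h = k} x * c \<partial>m n)" by simp
    also have "\<dots> \<le> (\<integral>x. (\<integral>y. (st (tr (- (x + y)) h) - st (tr (- x) h))\<^sup>2 \<partial>m j) \<partial>m n)"
    proof (rule integral_mono)
      have "integrable (m n) (indicator {x. tr (- x) h = k} :: 'b \<Rightarrow> real)" by (rule integrable_unit) (simp add: indicator_def)
      then show "integrable (m n) (\<lambda>x. indicator {x. tr (- x) h = k} x * c)" by (rule integrable_mult_left)
      show "integrable (m n) (\<lambda>x. \<integral>y. (st (tr (- (x + y)) h) - st (tr (- x) h))\<^sup>2 \<partial>m j)"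
        by (intro integrable_unit integral_unit dsq01)
      show "indicator {x. tr (- x) h = k} x * c \<le> (\<integral>y. (st (tr (- (x + y)) h) - st (tr (- x) h))\<^sup>2 \<partial>m j)" for x
        using inner[of x] by (simp add: indicator_def Bochner_Integration.integral_nonneg)
    qed
    also have "\<dots> = V (n + j) h - V n h" by (rule V_incr[OF h])
    finally show ?thesis .
  qed
  show ?thesis
  proof (rule Lim_null_comparison)
    show "\<forall>\<^sub>F n in sequentially. norm (measure (m n) {x. tr (- x) h = k}) \<le> (V (n + j) h - V n h) / c"
      using le c0 by (intro always_eventually) (simp add: pos_le_divide_eq)
    show "(\<lambda>n. (V (n + j) h - V n h) / c) \<longlonglongrightarrow> 0"
      using tendsto_divide[OF V_incr_0[OF h] tendsto_const, of c] c0 by simp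
  qed
qed

lemma defect:
  assumes h: "h \<in> H"
  shows "st h - V n h = (\<integral>x. st (tr (- x) h) * (1 - st (tr (- x) h)) \<partial>m n)"
proof -
  have "st h - V n h = (\<integral>x. st (tr (- x) h) \<partial>m n) - V n h" by (simp only: st_stat[OF h, symmetric])
  also have "\<dots> = (\<integral>x. st (tr (- x) h) - (st (tr (- x) h))\<^sup>2 \<partial>m n)"
    unfolding V_def by (rule Bochner_Integration.integral_diff[symmetric]) (intro integrable_unit st01 sq01)+
  finally show ?thesis by (simp add: power2_eq_square right_diff_distrib)
qed

text \<open>\<open>st * (1 - st)\<close> is at most \<open>\<epsilon>\<close> off the finite set
  \<open>K\<close> of half-spaces undecided at level \<open>\<epsilon>\<close>, and the walk meets
  \<open>K\<close> with vanishing probability.\<close>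

lemma decided:
  assumes h: "h \<in> H"
  shows "(\<lambda>n. st h - V n h) \<longlonglongrightarrow> 0"
proof -
  have v01: "0 \<le> st k * (1 - st k) \<and> st k * (1 - st k) \<le> 1" for k using st01[of k] by (simp add: mult_le_one)
  show ?thesis
  proof (rule order_tendstoI)
  fix t :: real assume t: "t < 0"
  have "0 \<le> st h - V n h" for n unfolding defect[OF h] using v01 by (intro Bochner_Integration.integral_nonneg) blast
  then show "\<forall>\<^sub>F n in sequentially. t < st h - V n h" using t by (intro always_eventually allI) (rule less_le_trans)
  next
  fix t :: real assume t: "0 < t"
  define \<epsilon> where "\<epsilon> = t / 2"
  have \<epsilon>: "\<epsilon> > 0" using t by (simp add: \<epsilon>_def)
  define K where "K = {k \<in> H. \<epsilon> \<le> st k \<and> \<epsilon> \<le> 1 - st k}"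
  have K: "finite K" using finite_undecided[OF \<epsilon>] by (simp add: K_def)
  let ?q = "\<lambda>n k. measure (m n) {x. tr (- x) h = k}"
  have "(\<lambda>n. \<Sum>k\<in>K. ?q n k) \<longlonglongrightarrow> (\<Sum>k\<in>K. 0)"
    by (intro tendsto_sum visits_0[OF h]) (use \<epsilon> in \<open>auto simp: K_def\<close>)
  then have ev: "\<forall>\<^sub>F n in sequentially. (\<Sum>k\<in>K. ?q n k) < \<epsilon>" using \<epsilon> by (intro order_tendstoD) auto
  have bound: "st h - V n h \<le> \<epsilon> + (\<Sum>k\<in>K. ?q n k)" for n
  proof -
    let ?S = "\<lambda>x. \<Sum>k\<in>K. indicator {x. tr (- x) h = k} x :: real"
    have iS: "integrable (m n) (indicator {x. tr (- x) h = k} :: 'b \<Rightarrow> real)" for k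
      by (rule integrable_unit) (simp add: indicator_def)
    have iK: "integrable (m n) ?S" by (intro Bochner_Integration.integrable_sum iS)
    have "st h - V n h \<le> (\<integral>x. \<epsilon> + ?S x \<partial>m n)"
      unfolding defect[OF h]
    proof (rule integral_mono)
      show "integrable (m n) (\<lambda>x. st (tr (- x) h) * (1 - st (tr (- x) h)))" by (intro integrable_unit v01)
      show "integrable (m n) (\<lambda>x. \<epsilon> + ?S x)" using iK by (intro Bochner_Integration.integrable_add) simp_all
      fix x
      let ?k = "tr (- x) h"
      show "st ?k * (1 - st ?k) \<le> \<epsilon> + ?S x"
      proof (cases "?k \<in> K")
        case True
        have "1 = indicator {x. tr (- x) h = ?k} x" by simp
        also have "\<dots> \<le> ?S x" by (rule member_le_sum[OF True _ K]) simp
        finally show ?thesis using v01[of ?k] \<epsilon> by linarith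
      next
        case False
        have "st ?k * (1 - st ?k) \<le> \<epsilon>"
        proof (cases "st ?k < \<epsilon>")
          case True
          have "st ?k * (1 - st ?k) \<le> st ?k * 1" using st01[of ?k] by (intro mult_left_mono) auto
          then show ?thesis using True by simp
        next
          case n: False
          then have "1 - st ?k < \<epsilon>" using False h by (simp add: K_def)
          moreover have "st ?k * (1 - st ?k) \<le> 1 * (1 - st ?k)" using st01[of ?k] by (intro mult_right_mono) auto
          ultimately show ?thesis by simp
        qed
        moreover have "0 \<le> ?S x" by (intro sum_nonneg) simp
        ultimately show ?thesis by linarith
      qed
    qed
    also have "\<dots> = \<epsilon> + (\<Sum>k\<in>K. ?q n k)" using iK iS by simp
    finally show ?thesis .
  qed
  show "\<forall>\<^sub>F n in sequentially. st h - V n h < t"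
  proof (rule eventually_mono[OF ev])
    fix n assume "(\<Sum>k\<in>K. ?q n k) < \<epsilon>"
    then show "st h - V n h < t" using bound[of n] by (simp add: \<epsilon>_def)
  qed
  qed
qed

text \<open>At time \<open>N j\<close> the half-spaces up to index \<open>j\<close> of an
  enumeration are decided up to \<open>(1 / 2) ^ j\<close>; for each fixed \<open>h\<close> these
  errors are summable from its index on. The bound persists at later times because \<open>V\<close>
  is monotone.\<close>

lemma decision_times:
  obtains N where "\<And>h. h \<in> H \<Longrightarrow> \<exists>i. \<forall>j\<ge>i. \<forall>n\<ge>N j. st h - V n h \<le> (1 / 2) ^ j" "mono N"
proof (cases "H = {}")
  case True
  then show ?thesis using that[of "\<lambda>_. 0"] by (simp add: mono_def)
next
  case False
  define e where "e = from_nat_into H"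
  have eH: "e i \<in> H" for i by (simp add: e_def from_nat_into[OF False])
  have sur: "\<exists>i. h = e i" if "h \<in> H" for h
    using from_nat_into_surj[OF countable_H that] by (auto simp: e_def)
  define P where "P j n \<longleftrightarrow> (\<forall>i\<le>j. st (e i) - V n (e i) \<le> (1 / 2) ^ j)" for j n
  have ex: "\<exists>n. P j n" for j
  proof -
    have "\<forall>\<^sub>F n in sequentially. \<forall>i\<in>{..j}. st (e i) - V n (e i) < (1 / 2) ^ j"
      unfolding eventually_ball_finite_distrib[OF finite_atMost]
      by (intro ballI order_tendstoD(2)[OF decided[OF eH]]) simp
    then show ?thesis unfolding P_def eventually_sequentially by (meson atMost_iff less_imp_le order_refl)
  qed
  define N where "N j = (LEAST n. P j n)" for j
  have PN: "P j (N j)" for j unfolding N_def using ex[of j] by (rule LeastI_ex)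
  have P_mono: "P j n" if "P j' n" "j \<le> j'" for j j' n
  proof -
    have "(1 / 2) ^ j' \<le> (1 / 2 :: real) ^ j" using that(2) by (intro power_decreasing) auto
    then show ?thesis using that unfolding P_def by (meson order_trans)
  qed
  have "mono N"
  proof (rule monoI)
    fix j j' :: nat assume "j \<le> j'"
    then show "N j \<le> N j'" unfolding N_def[of j] by (intro Least_le P_mono[OF PN])
  qed
  moreover have "\<exists>i. \<forall>j\<ge>i. \<forall>n\<ge>N j. st h - V n h \<le> (1 / 2) ^ j" if h: "h \<in> H" for h
  proof -
    obtain i where i: "h = e i" using sur[OF h] by blast
    show ?thesis
    proof (intro exI[of _ i] allI impI)
      fix j n assume "i \<le> j" "N j \<le> n"
      then have "st h - V (N j) h \<le> (1 / 2) ^ j" using PN[of j] i by (simp add: P_def)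
      then show "st h - V n h \<le> (1 / 2) ^ j" using V_mono[OF h \<open>N j \<le> n\<close>] by linarith
    qed
  qed
  ultimately show ?thesis using that by blast
qed

end

lemma eventually_half_iff:
  fixes a :: "nat \<Rightarrow> real"
  assumes "a \<longlonglongrightarrow> (if P then 1 else 0)"
  shows "(\<exists>J. \<forall>j\<ge>J. 1 / 2 < a j) \<longleftrightarrow> P"
proof (cases P)
  case True
  then show ?thesis using order_tendstoD(1)[OF assms, of "1/2"] by (simp add: eventually_sequentially)
next
  case False
  then have "\<forall>\<^sub>F j in sequentially. a j < 1 / 2" using order_tendstoD(2)[OF assms, of "1/2"] by simp
  then obtain J where J: "\<And>j. j \<ge> J \<Longrightarrow> a j < 1 / 2" by (auto simp: eventually_sequentially)
  have "\<not> (\<exists>J. \<forall>j\<ge>J. 1 / 2 < a j)"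
  proof
    assume "\<exists>J. \<forall>j\<ge>J. 1 / 2 < a j"
    then obtain J' where "\<forall>j\<ge>J'. 1 / 2 < a j" ..
    then have "1 / 2 < a (max J J')" by simp
    then show False using J[of "max J J'"] by simp
  qed
  then show ?thesis using False by simp
qed

context rw begin

definition walk :: "(nat \<Rightarrow> 'g) \<Rightarrow> nat \<Rightarrow> 'g" where "walk \<omega> = (\<lambda>n. Z n \<omega>)"

lemma meas_walk [measurable]: "walk \<in> \<Omega> \<rightarrow>\<^sub>M path_space"
  unfolding walk_def path_space_def by (rule measurable_abs_UNIV) (rule meas_Z)

lemma rw_measure_eq: "rw_measure \<mu> = distr \<Omega> path_space walk"
  unfolding rw_measure_def walk_def Z_def ..

lemma meas_path [measurable]: "(\<lambda>p :: nat \<Rightarrow> 'g. p n) \<in> path_space \<rightarrow>\<^sub>M count_space UNIV"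
  unfolding path_space_def by (rule measurable_component_singleton) simp

lemma path_shift_walk: "path_shift (walk \<omega>) = (\<lambda>n. \<omega> 0 + walk (shift \<omega>) n)"
  by (simp add: path_shift_def walk_def Z_Suc)

end

section \<open>The limit point of the walk\<close>

locale cc_bnd = cc_state +
  fixes N :: "nat \<Rightarrow> nat"
  assumes decision: "\<And>h. h \<in> H \<Longrightarrow> \<exists>i. \<forall>j\<ge>i. \<forall>n\<ge>N j. st h - V n h \<le> (1 / 2) ^ j" and monoN: "mono N"
begin

text \<open>Defined for every path by a threshold, so that translation equivariance holds exactly
  and not just almost surely; where \<open>good\<close> holds it is the 0-1 limit of the
  weights.\<close>

definition prebnd :: "(nat \<Rightarrow> 'b) \<Rightarrow> 'a set \<Rightarrow> bool" where
  "prebnd p = (\<lambda>h\<in>H. \<exists>J. \<forall>j\<ge>J. 1 / 2 < st (tr (- p (N j)) h))"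

text \<open>The first two conditions feed \<open>zero_one_dichotomy\<close>; the third compares the
  times \<open>N j\<close> and \<open>N j + 1\<close> and yields invariance under the path
  shift.\<close>

definition good :: "(nat \<Rightarrow> 'b) \<Rightarrow> 'a set \<Rightarrow> bool" where
  "good \<omega> h \<longleftrightarrow> (\<lambda>j. st (tr (- Z (N j) \<omega>) h) * (1 - st (tr (- Z (N j) \<omega>) h))) \<longlonglongrightarrow> 0 \<and>
    (\<lambda>j. (st (tr (- Z (N (Suc j)) \<omega>) h) - st (tr (- Z (N j) \<omega>) h))\<^sup>2) \<longlonglongrightarrow> 0 \<and>
    (\<lambda>j. (st (tr (- Z (N j + 1) \<omega>) h) - st (tr (- Z (N j) \<omega>) h))\<^sup>2) \<longlonglongrightarrow> 0"

lemma prebnd_ext: "prebnd p \<in> extensional H"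
  by (simp add: prebnd_def)

lemma prebnd_translate: "prebnd (\<lambda>n. g + p n) = ra g (prebnd p)"
  by (rule extensionalityI[of _ H]) (simp_all add: prebnd_ext ra_ext ra_apply prebnd_def tr_add minus_add)

lemma nn_incr:
  assumes h: "h \<in> H"
  shows "(\<integral>\<^sup>+\<omega>. ennreal ((st (tr (- Z (n + k) \<omega>) h) - st (tr (- Z n \<omega>) h))\<^sup>2) \<partial>\<Omega>) = ennreal (V (n + k) h - V n h)"
proof -
  have "(\<integral>\<^sup>+\<omega>. ennreal ((st (tr (- Z (n + k) \<omega>) h) - st (tr (- Z n \<omega>) h))\<^sup>2) \<partial>\<Omega>) =
      (\<integral>\<^sup>+x. \<integral>\<^sup>+y. ennreal ((st (tr (- (x + y)) h) - st (tr (- x) h))\<^sup>2) \<partial>m k \<partial>m n)"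
    by (rule nn_Z2[of "\<lambda>a c. ennreal ((st (tr (- c) h) - st (tr (- a) h))\<^sup>2)"])
  also have "\<dots> = (\<integral>\<^sup>+x. ennreal (\<integral>y. (st (tr (- (x + y)) h) - st (tr (- x) h))\<^sup>2 \<partial>m k) \<partial>m n)"
    by (intro nn_integral_cong nn_unit dsq01)
  also have "\<dots> = ennreal (\<integral>x. (\<integral>y. (st (tr (- (x + y)) h) - st (tr (- x) h))\<^sup>2 \<partial>m k) \<partial>m n)"
    by (intro nn_unit integral_unit dsq01)
  also have "\<dots> = ennreal (V (n + k) h - V n h)" by (simp only: V_incr[OF h])
  finally show ?thesis .
qed

lemma v01: "0 \<le> st k * (1 - st k) \<and> st k * (1 - st k) \<le> 1"
  using st01[of k] by (simp add: mult_le_one)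

lemma V_le_st: "h \<in> H \<Longrightarrow> V n h \<le> st h"
proof -
  assume h: "h \<in> H"
  have "0 \<le> st h - V n h" unfolding defect[OF h] using v01 by (intro Bochner_Integration.integral_nonneg) blast
  then show ?thesis by simp
qed

lemma meas_st_Z [measurable]: "(\<lambda>\<omega>. st (tr (- Z n \<omega>) h)) \<in> borel_measurable \<Omega>"
  by (rule measurable_compose[OF meas_Z]) simp

lemma AE_good: "AE \<omega> in \<Omega>. \<forall>h\<in>H. good \<omega> h"
proof (rule AE_ball_countable'[OF _ countable_H])
  fix h assume h: "h \<in> H"
  obtain i where i: "\<And>j n. j \<ge> i \<Longrightarrow> n \<ge> N j \<Longrightarrow> st h - V n h \<le> (1 / 2) ^ j" using decision[OF h] by blast
  have inc: "(\<integral>\<^sup>+\<omega>. ennreal ((st (tr (- Z n' \<omega>) h) - st (tr (- Z (N j) \<omega>) h))\<^sup>2) \<partial>\<Omega>) \<le> ennreal ((1 / 2) ^ j)"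
    if "j \<ge> i" "n' \<ge> N j" for j n'
  proof -
    have "V n' h - V (N j) h \<le> (1 / 2) ^ j" using V_le_st[OF h, of n'] i[OF that(1) order_refl] by linarith
    then show ?thesis using nn_incr[OF h, of "N j" "n' - N j"] that(2) by (simp add: ennreal_leI)
  qed
  have "AE \<omega> in \<Omega>. (\<lambda>j. st (tr (- Z (N j) \<omega>) h) * (1 - st (tr (- Z (N j) \<omega>) h))) \<longlonglongrightarrow> 0"
  proof (rule AE_tendsto_0[where i = i])
    fix j assume "i \<le> j"
    have "(\<integral>\<^sup>+\<omega>. ennreal (st (tr (- Z (N j) \<omega>) h) * (1 - st (tr (- Z (N j) \<omega>) h))) \<partial>\<Omega>) =
        (\<integral>\<^sup>+z. ennreal (st (tr (- z) h) * (1 - st (tr (- z) h))) \<partial>m (N j))"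
      by (rule nn_Z[of "\<lambda>z. ennreal (st (tr (- z) h) * (1 - st (tr (- z) h)))"])
    also have "\<dots> = ennreal (st h - V (N j) h)" unfolding defect[OF h] by (intro nn_unit v01)
    also have "\<dots> \<le> ennreal ((1 / 2) ^ j)" using i[OF \<open>i \<le> j\<close> order_refl] by (rule ennreal_leI)
    finally show "(\<integral>\<^sup>+\<omega>. ennreal (st (tr (- Z (N j) \<omega>) h) * (1 - st (tr (- Z (N j) \<omega>) h))) \<partial>\<Omega>) \<le> ennreal ((1 / 2) ^ j)" .
  qed (use v01 in auto)
  moreover have "AE \<omega> in \<Omega>. (\<lambda>j. (st (tr (- Z (N (Suc j)) \<omega>) h) - st (tr (- Z (N j) \<omega>) h))\<^sup>2) \<longlonglongrightarrow> 0"
  proof (rule AE_tendsto_0[where i = i])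
    fix j assume "i \<le> j"
    then show "(\<integral>\<^sup>+\<omega>. ennreal ((st (tr (- Z (N (Suc j)) \<omega>) h) - st (tr (- Z (N j) \<omega>) h))\<^sup>2) \<partial>\<Omega>) \<le> ennreal ((1 / 2) ^ j)"
      by (rule inc) (rule monoD[OF monoN], simp)
  qed auto
  moreover have "AE \<omega> in \<Omega>. (\<lambda>j. (st (tr (- Z (N j + 1) \<omega>) h) - st (tr (- Z (N j) \<omega>) h))\<^sup>2) \<longlonglongrightarrow> 0"
  proof (rule AE_tendsto_0[where i = i])
    fix j assume "i \<le> j"
    then show "(\<integral>\<^sup>+\<omega>. ennreal ((st (tr (- Z (N j + 1) \<omega>) h) - st (tr (- Z (N j) \<omega>) h))\<^sup>2) \<partial>\<Omega>) \<le> ennreal ((1 / 2) ^ j)"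
      by (rule inc) simp
  qed auto
  ultimately show "AE \<omega> in \<Omega>. good \<omega> h" unfolding good_def by eventually_elim blast
qed

lemma good_limit:
  assumes "good \<omega> h" "h \<in> H"
  shows "(\<lambda>j. st (tr (- Z (N j) \<omega>) h)) \<longlonglongrightarrow> (if prebnd (walk \<omega>) h then 1 else 0)"
proof -
  let ?a = "\<lambda>j. st (tr (- Z (N j) \<omega>) h)"
  have "?a \<longlonglongrightarrow> 1 \<or> ?a \<longlonglongrightarrow> 0"
    using zero_one_dichotomy[of ?a] st01 assms(1) unfolding good_def by blast
  then obtain P where P: "?a \<longlonglongrightarrow> (if P then 1 else 0)" by (elim disjE) (rule that[of True], simp, rule that[of False], simp)
  then show ?thesis using eventually_half_iff[OF P] assms(2) by (simp add: prebnd_def walk_def)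
qed

lemma good_shift:
  assumes "\<forall>h\<in>H. good \<omega> h"
  shows "prebnd (path_shift (walk \<omega>)) = prebnd (walk \<omega>)"
proof (rule extensionalityI[of _ H])
  fix h assume h: "h \<in> H"
  let ?a = "\<lambda>j. st (tr (- Z (N j) \<omega>) h)" and ?c = "\<lambda>j. st (tr (- Z (N j + 1) \<omega>) h)"
  have "(\<lambda>j. (?c j - ?a j)\<^sup>2) \<longlonglongrightarrow> 0" using assms h by (auto simp: good_def)
  then have "(\<lambda>j. ?c j - ?a j) \<longlonglongrightarrow> 0" by simp
  moreover have "?a \<longlonglongrightarrow> (if prebnd (walk \<omega>) h then 1 else 0)" using assms h good_limit by blast
  ultimately have "(\<lambda>j. (?c j - ?a j) + ?a j) \<longlonglongrightarrow> 0 + (if prebnd (walk \<omega>) h then 1 else 0)" by (rule tendsto_add)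
  then have "?c \<longlonglongrightarrow> (if prebnd (walk \<omega>) h then 1 else 0)" by simp
  from eventually_half_iff[OF this] show "prebnd (path_shift (walk \<omega>)) h = prebnd (walk \<omega>) h"
    using h by (simp add: prebnd_def walk_def path_shift_def)
qed (simp_all add: prebnd_ext)

text \<open>The rules of \<open>st\<close> for complements and for disjoint pairs pass to the 0-1
  limit and become the consistency conditions of \<open>roller_closure_iff\<close>.\<close>

lemma good_closure:
  assumes "\<forall>h\<in>H. good \<omega> h"
  shows "prebnd (walk \<omega>) \<in> roller_top E closure_of range (Uv E)"
proof -
  let ?a = "\<lambda>h j. st (tr (- Z (N j) \<omega>) h)" and ?p = "prebnd (walk \<omega>)"
  have lim: "?a h \<longlonglongrightarrow> (if ?p h then 1 else 0)" if "h \<in> H" for h using assms that good_limit by blast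
  show ?thesis
    unfolding roller_closure_iff
  proof (intro conjI ballI impI)
    fix h assume h: "h \<in> H"
    have "?a (- h) j = 1 - ?a h j" for j using h by (simp add: tr_compl st_compl)
    then have "?a (- h) \<longlonglongrightarrow> 1 - (if ?p h then 1 else 0)" using tendsto_diff[OF tendsto_const lim[OF h], of 1] by simp
    from LIMSEQ_unique[OF this lim[OF H_compl[OF h]]] show "?p (- h) \<longleftrightarrow> \<not> ?p h" by (auto split: if_splits)
  next
    fix h k assume hk: "h \<in> H" "k \<in> H" "?p h" "?p k"
    show "h \<inter> k \<noteq> {}"
    proof
      assume "h \<inter> k = {}"
      then have "?a h j + ?a k j \<le> 1" for j using hk by (intro st_disj2) (simp_all add: tr_empty_Int)
      moreover have "(\<lambda>j. ?a h j + ?a k j) \<longlonglongrightarrow> 1 + 1" using tendsto_add[OF lim[OF hk(1)] lim[OF hk(2)]] hk by simp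
      ultimately have "1 + 1 \<le> (1::real)" by (intro LIMSEQ_le_const2) auto
      then show False by simp
    qed
  qed (rule prebnd_ext)
qed

lemma meas_prebnd: "h \<in> H \<Longrightarrow> Measurable.pred path_space (\<lambda>p. prebnd p h)"
proof -
  assume h: "h \<in> H"
  have [measurable]: "Measurable.pred path_space (\<lambda>p. 1 / 2 < st (tr (- p (N j)) h))" for j
    by (rule measurable_compose[OF meas_path]) simp
  have "Measurable.pred path_space (\<lambda>p. \<exists>J. \<forall>j\<ge>J. 1 / 2 < st (tr (- p (N j)) h))" by measurable
  then show ?thesis using h by (simp add: prebnd_def)
qed

lemma meas_prebnd_walk: "h \<in> H \<Longrightarrow> Measurable.pred \<Omega> (\<lambda>\<omega>. prebnd (walk \<omega>) h)"
  by (rule measurable_compose[OF meas_walk]) (rule meas_prebnd)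

text \<open>By stationarity the weight has mean \<open>st h\<close> at every time, and bounded
  convergence passes to the indicator of the limit.\<close>

lemma prebnd_law:
  assumes h: "h \<in> H"
  shows "measure \<Omega> {\<omega> \<in> space \<Omega>. prebnd (walk \<omega>) h} = st h"
proof -
  note [measurable] = meas_prebnd_walk[OF h]
  have 1: "(\<lambda>j. \<integral>\<omega>. st (tr (- Z (N j) \<omega>) h) \<partial>\<Omega>) \<longlonglongrightarrow> (\<integral>\<omega>. (if prebnd (walk \<omega>) h then 1 else 0) \<partial>\<Omega>)"
  proof (rule integral_dominated_convergence[where w = "\<lambda>_. 1"])
    show "AE \<omega> in \<Omega>. (\<lambda>j. st (tr (- Z (N j) \<omega>) h)) \<longlonglongrightarrow> (if prebnd (walk \<omega>) h then 1 else 0)"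
      using AE_good by eventually_elim (use h good_limit in blast)
  qed (use st01 in auto)
  have "(\<integral>\<omega>. st (tr (- Z (N j) \<omega>) h) \<partial>\<Omega>) = st h" for j
  proof -
    have "ennreal (\<integral>\<omega>. st (tr (- Z (N j) \<omega>) h) \<partial>\<Omega>) = (\<integral>\<^sup>+\<omega>. ennreal (st (tr (- Z (N j) \<omega>) h)) \<partial>\<Omega>)"
      by (rule nn_integral_eq_integral[symmetric])
         (use st01 in \<open>auto intro!: seq.P.integrable_const_bound[where B = 1]\<close>)
    also have "\<dots> = (\<integral>\<^sup>+z. ennreal (st (tr (- z) h)) \<partial>m (N j))" by (rule nn_Z[of "\<lambda>z. ennreal (st (tr (- z) h))"])
    also have "\<dots> = ennreal (st h)" by (simp only: nn_unit[OF st01] st_stat[OF h, symmetric])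
    finally show ?thesis using st01[of h] st01 by (subst (asm) ennreal_inj) (auto intro: Bochner_Integration.integral_nonneg)
  qed
  then have "(\<lambda>j :: nat. st h) \<longlonglongrightarrow> (\<integral>\<omega>. (if prebnd (walk \<omega>) h then 1 else 0) \<partial>\<Omega>)" using 1 by simp
  from LIMSEQ_unique[OF this tendsto_const] have "(\<integral>\<omega>. (if prebnd (walk \<omega>) h then 1 else 0) \<partial>\<Omega>) = st h" by simp
  moreover have "(\<integral>\<omega>. (if prebnd (walk \<omega>) h then 1 else 0 :: real) \<partial>\<Omega>) = (\<integral>\<omega>. indicator {\<omega> \<in> space \<Omega>. prebnd (walk \<omega>) h} \<omega> \<partial>\<Omega>)"
    by (intro Bochner_Integration.integral_cong) (auto simp: indicator_def)
  moreover have "\<dots> = measure \<Omega> {\<omega> \<in> space \<Omega>. prebnd (walk \<omega>) h}"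
    by (subst Bochner_Integration.integral_indicator) (auto intro!: arg_cong[where f = "measure \<Omega>"])
  ultimately show ?thesis by linarith
qed

lemma prebnd_equivariant: "AE \<omega> in \<Omega>. prebnd (walk \<omega>) = ra (\<omega> 0) (prebnd (walk (shift \<omega>)))"
  using AE_good
proof eventually_elim
  case (elim \<omega>)
  from good_shift[OF this] show ?case by (simp only: path_shift_walk prebnd_translate)
qed

lemma Uv_inj: "Uv E q = Uv E w \<Longrightarrow> q = w"
proof (rule ccontr)
  assume e: "Uv E q = Uv E w" and n: "q \<noteq> w"
  obtain h where "h \<in> H" "q \<in> h" "w \<notin> h" by (rule H_separates[OF n])
  then show False using fun_cong[OF e, of h] by (simp add: Uv_def)
qed

lemma vertex_event: "{\<omega> \<in> space \<Omega>. prebnd (walk \<omega>) = Uv E q} \<in> sets \<Omega>"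
proof -
  have "{\<omega> \<in> space \<Omega>. prebnd (walk \<omega>) = Uv E q} = {\<omega> \<in> space \<Omega>. \<forall>h\<in>H. prebnd (walk \<omega>) h \<longleftrightarrow> q \<in> h}"
  proof (intro Collect_cong conj_cong refl)
    fix \<omega>
    show "prebnd (walk \<omega>) = Uv E q \<longleftrightarrow> (\<forall>h\<in>H. prebnd (walk \<omega>) h \<longleftrightarrow> q \<in> h)"
    proof
      assume "\<forall>h\<in>H. prebnd (walk \<omega>) h \<longleftrightarrow> q \<in> h"
      then show "prebnd (walk \<omega>) = Uv E q"
        by (intro extensionalityI[of _ H]) (simp_all add: prebnd_ext Uv_def)
    qed (simp add: Uv_def)
  qed
  also have "\<dots> \<in> sets \<Omega>"
    unfolding pred_def[symmetric]
  proof (rule measurable_pred_countable(1)[OF countable_H])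
    fix h assume h: "h \<in> H"
    note [measurable] = meas_prebnd_walk[OF h]
    show "Measurable.pred \<Omega> (\<lambda>\<omega>. prebnd (walk \<omega>) h \<longleftrightarrow> q \<in> h)" by measurable
  qed
  finally show ?thesis .
qed

text \<open>The vertices of maximal mass form a finite set invariant under the support of the
  reflected walk.\<close>

lemma not_vertex: "measure \<Omega> {\<omega> \<in> space \<Omega>. prebnd (walk \<omega>) = Uv E q} = 0"
proof (rule ccontr)
  define T where "T q = measure \<Omega> {\<omega> \<in> space \<Omega>. prebnd (walk \<omega>) = Uv E q}" for q
  assume "measure \<Omega> {\<omega> \<in> space \<Omega>. prebnd (walk \<omega>) = Uv E q} \<noteq> 0"
  then have v0: "0 < T q" by (simp add: T_def less_le)
  have T01: "0 \<le> T w \<and> T w \<le> 1" for w by (simp add: T_def)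
  have sum: "sum T F \<le> 1" if F: "finite F" for F
  proof -
    have "sum T F = measure \<Omega> (\<Union>w\<in>F. {\<omega> \<in> space \<Omega>. prebnd (walk \<omega>) = Uv E w})"
      unfolding T_def
    proof (rule seq.P.finite_measure_finite_Union[symmetric, OF F])
      show "disjoint_family_on (\<lambda>w. {\<omega> \<in> space \<Omega>. prebnd (walk \<omega>) = Uv E w}) F"
        unfolding disjoint_family_on_def using Uv_inj by auto
    qed (use vertex_event in auto)
    then show ?thesis by simp
  qed
  have "finite {w. T q \<le> T w}"
  proof (rule ccontr)
    assume inf: "infinite {w. T q \<le> T w}"
    obtain M :: nat where M: "1 < real M * T q" using reals_Archimedean3[OF v0] by blast
    obtain F where F: "F \<subseteq> {w. T q \<le> T w}" "finite F" "card F = M" using infinite_arbitrarily_large[OF inf] by blast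
    have "real M * T q \<le> sum T F" using sum_mono[of F "\<lambda>_. T q" T] F by auto
    then show False using sum[OF F(2)] M by linarith
  qed note fin = this
  define c where "c = Max (T ` {w. T q \<le> T w})"
  have le_c: "T w \<le> c" for w
  proof (cases "T q \<le> T w")
    case True
    then show ?thesis unfolding c_def using fin by (intro Max_ge) auto
  next
    case False
    moreover have "T q \<le> c" unfolding c_def using fin by (intro Max_ge) auto
    ultimately show ?thesis by simp
  qed
  define F where "F = {w. T w = c}"
  have "F \<subseteq> {w. T q \<le> T w}" unfolding F_def using le_c[of q] by auto
  then have finF: "finite F" using fin finite_subset by blast
  have "c \<in> T ` {w. T q \<le> T w}" unfolding c_def by (rule Max_in) (use fin in auto)
  then obtain w0 where w0: "w0 \<in> F" by (auto simp: F_def)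
  \<comment> \<open>By equivariance the masses of vertices form a stationary function; at a maximum,
    its values one step away in the support must be maximal as well.\<close>
  have stat: "T w = (\<integral>x. T (act (- x) w) \<partial>\<mu>)" for w
  proof -
    let ?f = "\<lambda>\<omega>. indicator {\<omega> \<in> space \<Omega>. prebnd (walk \<omega>) = Uv E w} \<omega> :: ennreal"
    have "ennreal (T w) = (\<integral>\<^sup>+\<omega>. ?f \<omega> \<partial>\<Omega>)"
      using vertex_event[of w] by (simp add: T_def seq.P.emeasure_eq_measure)
    also have "\<dots> = (\<integral>\<^sup>+x. \<integral>\<^sup>+\<omega>. ?f (case_nat x \<omega>) \<partial>\<Omega> \<partial>\<mu>)"
      by (rule nn_iter) (use vertex_event in auto)
    also have "\<dots> = (\<integral>\<^sup>+x. ennreal (T (act (- x) w)) \<partial>\<mu>)"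
    proof (rule nn_integral_cong_AE)
      show "AE x in \<mu>. (\<integral>\<^sup>+\<omega>. ?f (case_nat x \<omega>) \<partial>\<Omega>) = ennreal (T (act (- x) w))"
        using AE_iter[OF prebnd_equivariant]
      proof eventually_elim
        case (elim x)
        have "(\<integral>\<^sup>+\<omega>. ?f (case_nat x \<omega>) \<partial>\<Omega>) = (\<integral>\<^sup>+\<omega>. indicator {\<omega> \<in> space \<Omega>. prebnd (walk \<omega>) = Uv E (act (- x) w)} \<omega> \<partial>\<Omega>)"
        proof (rule nn_integral_cong_AE)
          show "AE \<omega> in \<Omega>. ?f (case_nat x \<omega>) = indicator {\<omega> \<in> space \<Omega>. prebnd (walk \<omega>) = Uv E (act (- x) w)} \<omega>"
            using elim
          proof eventually_elim
            case (elim \<omega>)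
            then have e: "prebnd (walk (case_nat x \<omega>)) = ra x (prebnd (walk \<omega>))" by simp
            have "ra x (prebnd (walk \<omega>)) = Uv E w \<longleftrightarrow> prebnd (walk \<omega>) = Uv E (act (- x) w)"
            proof
              assume "ra x (prebnd (walk \<omega>)) = Uv E w"
              then have "ra (- x + x) (prebnd (walk \<omega>)) = Uv E (act (- x) w)" by (simp only: ra_add ra_Uv)
              then show "prebnd (walk \<omega>) = Uv E (act (- x) w)" by (simp add: ra_0 prebnd_ext)
            qed (simp add: ra_Uv)
            then show ?case using e by (simp add: indicator_def space_PiM)
          qed
        qed
        also have "\<dots> = ennreal (T (act (- x) w))"
          using vertex_event[of "act (- x) w"] by (simp add: T_def seq.P.emeasure_eq_measure)
        finally show ?case .
      qed
    qed
    also have "\<dots> = ennreal (\<integral>x. T (act (- x) w) \<partial>\<mu>)" by (rule nn_unit) (rule T01)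
    finally show ?thesis using T01 by (subst (asm) ennreal_inj) (auto intro: Bochner_Integration.integral_nonneg)
  qed
  have inv: "act (- x) w \<in> F" if "w \<in> F" "x \<in> set_pmf \<mu>" for w x
  proof -
    have iT: "integrable \<mu> (\<lambda>x. T (act (- x) w))" by (rule integrable_unit) (rule T01)
    have "(\<integral>x. c - T (act (- x) w) \<partial>\<mu>) = c - (\<integral>x. T (act (- x) w) \<partial>\<mu>)" using iT by simp
    also have "\<dots> = 0" using stat[of w] that(1) by (simp add: F_def)
    finally have "AE x in \<mu>. c - T (act (- x) w) = 0"
      using iT le_c by (subst (asm) integral_nonneg_eq_0_iff_AE) auto
    then have "c - T (act (- x) w) = 0" using that(2) by (simp add: AE_measure_pmf_iff)
    then show ?thesis by (simp add: F_def)
  qed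
  have inv_list: "act (- sum_list xs) w \<in> F" if "w \<in> F" "set xs \<subseteq> set_pmf \<mu>" for w xs
    using that
  proof (induction xs arbitrary: w)
    case (Cons x xs)
    have "act (- sum_list xs) (act (- x) w) \<in> F" using Cons.prems by (intro Cons.IH inv) auto
    then show ?case by (simp only: sum_list.Cons minus_add act_add)
  qed simp
  have "act g w0 \<in> F" for g
  proof -
    obtain xs where xs: "set xs \<subseteq> set_pmf \<mu>" "- g = sum_list xs" using gen unfolding generating_def by blast
    have "act (- sum_list xs) w0 \<in> F" by (rule inv_list[OF w0 xs(1)])
    then show ?thesis by (simp only: xs(2)[symmetric] minus_minus)
  qed
  then have "range (\<lambda>g. act g w0) \<subseteq> F" by (simp add: image_subset_iff)
  then show False using finite_subset[OF _ finF] inforb[of w0] by simp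
qed

lemma AE_boundary: "AE \<omega> in \<Omega>. prebnd (walk \<omega>) \<in> roller_boundary E"
proof -
  have "AE \<omega> in \<Omega>. prebnd (walk \<omega>) \<noteq> Uv E q" for q
    by (rule AE_I[of _ _ "{\<omega> \<in> space \<Omega>. prebnd (walk \<omega>) = Uv E q}"])
       (auto simp: seq.P.emeasure_eq_measure not_vertex vertex_event)
  then have "AE \<omega> in \<Omega>. \<forall>q. prebnd (walk \<omega>) \<noteq> Uv E q" by (simp add: AE_all_countable)
  with AE_good show ?thesis
    by eventually_elim (use good_closure in \<open>auto simp: roller_boundary_def\<close>)
qed

text \<open>Off the almost sure event any boundary point serves as default, so that every path is
  mapped into the boundary.\<close>

definition bnd :: "(nat \<Rightarrow> 'b) \<Rightarrow> 'a set \<Rightarrow> bool" where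
  "bnd p = (if prebnd p \<in> roller_boundary E then prebnd p else (SOME \<xi>. \<xi> \<in> roller_boundary E))"

text \<open>The boundary is nonempty because the limit point lies in it almost surely.\<close>

lemma boundary_ne: "\<exists>\<xi>. \<xi> \<in> roller_boundary E"
proof (rule ccontr)
  assume "\<not> ?thesis"
  then have "AE \<omega> in \<Omega>. False" using AE_boundary by simp
  then show False by (simp add: seq.P.AE_False)
qed

lemma bnd_in: "bnd p \<in> roller_boundary E"
  unfolding bnd_def using someI_ex[OF boundary_ne] by simp

lemma meas_boundary_event: "Measurable.pred path_space (\<lambda>p. prebnd p \<in> roller_boundary E)"
proof -
  have c: "Measurable.pred path_space (\<lambda>p. prebnd p h)" if "h \<in> H" for h using that by (rule meas_prebnd)
  have "prebnd p \<in> roller_boundary E \<longleftrightarrow> (\<forall>h\<in>H. prebnd p (- h) \<longleftrightarrow> \<not> prebnd p h) \<and>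
      (\<forall>h\<in>H. \<forall>k\<in>H. prebnd p h \<and> prebnd p k \<longrightarrow> h \<inter> k \<noteq> {}) \<and> (\<forall>q. \<exists>h\<in>H. prebnd p h \<longleftrightarrow> q \<notin> h)" for p
  proof -
    have "prebnd p = Uv E q \<longleftrightarrow> (\<forall>h\<in>H. prebnd p h \<longleftrightarrow> q \<in> h)" for q
    proof
      assume "\<forall>h\<in>H. prebnd p h \<longleftrightarrow> q \<in> h"
      then show "prebnd p = Uv E q"
        by (intro extensionalityI[of _ H]) (simp_all add: prebnd_ext Uv_def)
    qed (simp add: Uv_def)
    then have "prebnd p \<notin> range (Uv E) \<longleftrightarrow> (\<forall>q. \<exists>h\<in>H. prebnd p h \<longleftrightarrow> q \<notin> h)" by blast
    then show ?thesis unfolding roller_boundary_def Diff_iff roller_closure_iff using prebnd_ext by auto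
  qed
  moreover have "Measurable.pred path_space (\<lambda>p. (\<forall>h\<in>H. prebnd p (- h) \<longleftrightarrow> \<not> prebnd p h))"
    by (intro measurable_pred_countable(1)[OF countable_H] pred_intros_logic c H_compl)
  moreover have "Measurable.pred path_space (\<lambda>p. (\<forall>h\<in>H. \<forall>k\<in>H. prebnd p h \<and> prebnd p k \<longrightarrow> h \<inter> k \<noteq> {}))"
    by (intro measurable_pred_countable(1)[OF countable_H] pred_intros_logic c) simp_all
  moreover have "Measurable.pred path_space (\<lambda>p. \<forall>q. \<exists>h\<in>H. prebnd p h \<longleftrightarrow> q \<notin> h)"
    by (intro pred_intros_countable measurable_pred_countable(2)[OF countable_H] pred_intros_logic c) simp_all
  ultimately show ?thesis by simp
qed

lemma meas_bnd: "bnd \<in> path_space \<rightarrow>\<^sub>M boundary_borel E"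
proof (rule measurable_boundary[OF countable_H])
  fix h assume h: "h \<in> H"
  note [measurable] = meas_prebnd[OF h] meas_boundary_event
  have "(\<lambda>p. bnd p h) = (\<lambda>p. if prebnd p \<in> roller_boundary E then prebnd p h else (SOME \<xi>. \<xi> \<in> roller_boundary E) h)"
    by (auto simp: bnd_def)
  then show "Measurable.pred path_space (\<lambda>p. bnd p h)" by simp
qed (rule bnd_in)

lemma AE_bnd_shift: "AE \<omega> in \<Omega>. bnd (path_shift (walk \<omega>)) = bnd (walk \<omega>)"
  using AE_good by eventually_elim (simp add: bnd_def good_shift)

lemma AE_bnd_translate: "AE \<omega> in \<Omega>. bnd (\<lambda>n. g + walk \<omega> n) = ra g (bnd (walk \<omega>))"
  using AE_boundary by eventually_elim (simp add: bnd_def prebnd_translate ra_boundary)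

lemma AE_bnd_equivariant: "AE \<omega> in \<Omega>. bnd (walk \<omega>) = ra (\<omega> 0) (bnd (walk (shift \<omega>)))"
  using prebnd_equivariant AE_shift[OF AE_boundary]
  by eventually_elim (simp add: bnd_def ra_boundary)

lemma bnd_law:
  assumes h: "h \<in> H"
  shows "measure \<Omega> {\<omega> \<in> space \<Omega>. bnd (walk \<omega>) h} = st h"
proof -
  note [measurable] = meas_prebnd_walk[OF h] measurable_compose[OF meas_walk measurable_compose[OF meas_bnd boundary_coordinate[OF h]]]
  have "measure \<Omega> {\<omega> \<in> space \<Omega>. bnd (walk \<omega>) h} = measure \<Omega> {\<omega> \<in> space \<Omega>. prebnd (walk \<omega>) h}"
  proof (rule measure_eq_AE)
    show "AE \<omega> in \<Omega>. (\<omega> \<in> {\<omega> \<in> space \<Omega>. bnd (walk \<omega>) h}) = (\<omega> \<in> {\<omega> \<in> space \<Omega>. prebnd (walk \<omega>) h})"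
      using AE_boundary by eventually_elim (simp add: bnd_def)
  qed measurable
  then show ?thesis by (simp only: prebnd_law[OF h])
qed

end

section \<open>Strips\<close>

text \<open>Expresses a size bound by finite sets of one fixed size. Over countably many half-spaces
  there are only countably many of these, which makes strips measurable.\<close>

lemma finite_card_le_iff: "finite J \<and> card J \<le> R \<longleftrightarrow> (\<forall>F. finite F \<and> card F = Suc R \<longrightarrow> \<not> F \<subseteq> J)"
proof
  assume J: "finite J \<and> card J \<le> R"
  show "\<forall>F. finite F \<and> card F = Suc R \<longrightarrow> \<not> F \<subseteq> J"
  proof (intro allI impI notI)
    fix F assume F: "finite F \<and> card F = Suc R" "F \<subseteq> J"
    then have "card F \<le> card J" using J by (intro card_mono) auto
    then show False using F J by simp
  qed
next
  assume n: "\<forall>F. finite F \<and> card F = Suc R \<longrightarrow> \<not> F \<subseteq> J"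
  show "finite J \<and> card J \<le> R"
  proof (rule ccontr)
    assume "\<not> ?thesis"
    then consider "infinite J" | "Suc R \<le> card J" by linarith
    then have "\<exists>F\<subseteq>J. finite F \<and> card F = Suc R"
    proof cases
      case 1
      then show ?thesis using infinite_arbitrarily_large[of J "Suc R"] by blast
    next
      case 2
      then show ?thesis using obtain_subset_with_card_n[of "Suc R" J] by (metis card_ge_0_finite zero_less_Suc)
    qed
    then show False using n by blast
  qed
qed

lemma card_fibers:
  assumes "finite B" "\<And>a. a \<in> A \<Longrightarrow> f a \<in> B" "\<And>y. y \<in> B \<Longrightarrow> finite {a \<in> A. f a = y} \<and> card {a \<in> A. f a = y} \<le> N"
  shows "finite A \<and> card A \<le> card B * N"
proof -
  have A: "A = (\<Union>y\<in>B. {a \<in> A. f a = y})" using assms(2) by auto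
  have "card (\<Union>y\<in>B. {a \<in> A. f a = y}) \<le> (\<Sum>y\<in>B. card {a \<in> A. f a = y})" by (rule card_UN_le[OF assms(1)])
  also have "\<dots> \<le> (\<Sum>y\<in>B. N)" using assms(3) by (intro sum_mono) auto
  finally have "card A \<le> card B * N" using A by simp
  moreover have "finite (\<Union>y\<in>B. {a \<in> A. f a = y})" using assms(1,3) by auto
  then have "finite A" using A by simp
  ultimately show ?thesis by simp
qed

text \<open>A subset of at most \<open>n + 1\<close> elements arises from one of at most
  \<open>n\<close> by inserting one of \<open>card Q\<close> elements or nothing.\<close>

lemma card_small_subsets:
  assumes Q: "finite Q"
  shows "finite {M. M \<subseteq> Q \<and> card M \<le> n} \<and> card {M. M \<subseteq> Q \<and> card M \<le> n} \<le> (card Q + 1) ^ n"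
proof (induction n)
  case 0
  have "{M. M \<subseteq> Q \<and> card M \<le> 0} = {{}}"
  proof (intro equalityI subsetI)
    fix M assume "M \<in> {M. M \<subseteq> Q \<and> card M \<le> 0}"
    then show "M \<in> {{}}" using finite_subset[OF _ Q, of M] by simp
  qed simp
  then show ?case by simp
next
  case (Suc n)
  let ?F = "\<lambda>n. {M. M \<subseteq> Q \<and> card M \<le> n}"
  let ?f = "\<lambda>(M, q). case q of None \<Rightarrow> M | Some q \<Rightarrow> insert q M"
  let ?P = "?F n \<times> insert None (Some ` Q)"
  have P: "finite ?P" using Suc Q by simp
  have "?F (Suc n) \<subseteq> ?f ` ?P"
  proof
    fix M assume M: "M \<in> ?F (Suc n)"
    show "M \<in> ?f ` ?P"
    proof (cases "M = {}")
      case True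
      then have "(M, None) \<in> ?P" by simp
      then show ?thesis by (rule rev_image_eqI) simp
    next
      case False
      then obtain q where q: "q \<in> M" by blast
      then have "card (M - {q}) \<le> n" using M Q finite_subset by (auto simp: card_Diff_singleton)
      then have "(M - {q}, Some q) \<in> ?P" using M q by auto
      then show ?thesis by (rule rev_image_eqI) (use q in auto)
    qed
  qed
  then have "card (?F (Suc n)) \<le> card ?P" using P surj_card_le by (metis (no_types, lifting) card_image_le card_mono finite_imageI le_trans)
  also have "card ?P = card (?F n) * (card Q + 1)" using Q by (simp add: card_cartesian_product card_image)
  also have "\<dots> \<le> (card Q + 1) ^ n * (card Q + 1)" using Suc by (intro mult_right_mono) auto
  finally have "card (?F (Suc n)) \<le> (card Q + 1) ^ Suc n" by (simp add: algebra_simps)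
  moreover have "finite (?F (Suc n))" using Q by simp
  ultimately show ?case by blast
qed

locale cc_strip = cc_act E act for E :: "'x::countable \<Rightarrow> 'x \<Rightarrow> bool"
    and act :: "'g::{group_add,countable} \<Rightarrow> 'x \<Rightarrow> 'x" +
  fixes b :: 'x
  assumes proper: "proper_action E act"
begin

abbreviation X where "X \<equiv> roller_boundary E"

definition len :: "'g \<Rightarrow> nat" where "len z = d (act z b) b"

lemma len_0: "len 0 = 0"
  by (simp add: len_def)

lemma len_add: "len (x + y) \<le> len x + len y"
proof -
  have "len (x + y) \<le> d (act x (act y b)) (act x b) + d (act x b) b" unfolding len_def act_add by (rule d_tri)
  also have "d (act x (act y b)) (act x b) = d (act y b) b" by (rule act_d)
  finally show ?thesis by (simp add: len_def)
qed

text \<open>The half-spaces separating \<open>act g b\<close> from the interval spanned by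
  \<open>y\<close> and \<open>y'\<close>; their number measures the distance of this orbit point
  from the interval.\<close>

definition common :: "('x set \<Rightarrow> bool) \<Rightarrow> ('x set \<Rightarrow> bool) \<Rightarrow> 'g \<Rightarrow> 'x set set" where
  "common y y' g = {h \<in> H. act g b \<notin> h \<and> y h \<and> y' h}"

definition strip :: "nat \<Rightarrow> ('x set \<Rightarrow> bool) \<Rightarrow> ('x set \<Rightarrow> bool) \<Rightarrow> 'g set" where
  "strip t y y' = {g. finite (common y y' g) \<and> card (common y y' g) \<le> t}"

lemma strip_mono: "strip t y y' \<subseteq> strip (Suc t) y y'"
  by (auto simp: strip_def)

lemma strip_equivariant: "g + z \<in> strip t (ra g y) (ra g y') \<longleftrightarrow> z \<in> strip t y y'"
proof -
  have "common (ra g y) (ra g y') (g + z) = tr g ` common y y' z"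
  proof
    show "common (ra g y) (ra g y') (g + z) \<subseteq> tr g ` common y y' z"
    proof
      fix h assume h: "h \<in> common (ra g y) (ra g y') (g + z)"
      then have "act (- g) (act g (act z b)) \<notin> tr (- g) h" by (simp add: common_def act_add tr_iff)
      moreover have "y (tr (- g) h)" "y' (tr (- g) h)" using h ra_apply[of h g] by (simp_all add: common_def)
      ultimately have "tr (- g) h \<in> common y y' z" using h by (simp add: common_def)
      then show "h \<in> tr g ` common y y' z" by (rule rev_image_eqI) simp
    qed
    show "tr g ` common y y' z \<subseteq> common (ra g y) (ra g y') (g + z)"
      by (auto simp: common_def ra_apply act_add)
  qed
  moreover have "inj_on (tr g) (common y y' z)" using tr_inj by (rule inj_on_subset) simp
  ultimately show ?thesis by (simp add: strip_def finite_image_iff card_image)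
qed

lemma strip_measurable: "Measurable.pred (boundary_borel E \<Otimes>\<^sub>M boundary_borel E) (\<lambda>p. z \<in> strip t (fst p) (snd p))"
proof -
  let ?N = "boundary_borel E"
  let ?Fs = "{F. finite F \<and> F \<subseteq> H} \<inter> {F. card F = Suc t}"
  have eq: "z \<in> strip t (fst p) (snd p) \<longleftrightarrow> (\<forall>F\<in>?Fs. \<exists>h\<in>F. \<not> (act z b \<notin> h \<and> fst p h \<and> snd p h))" for p
  proof -
    have "z \<in> strip t (fst p) (snd p) \<longleftrightarrow> (\<forall>F. finite F \<and> card F = Suc t \<longrightarrow> \<not> F \<subseteq> common (fst p) (snd p) z)"
      unfolding strip_def mem_Collect_eq by (rule finite_card_le_iff)
    also have "\<dots> \<longleftrightarrow> (\<forall>F\<in>?Fs. \<exists>h\<in>F. \<not> (act z b \<notin> h \<and> fst p h \<and> snd p h))"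
      unfolding common_def by blast
    finally show ?thesis .
  qed
  have c: "countable ?Fs" by (rule countable_subset[OF _ countable_Collect_finite_subset[OF countable_H]]) auto
  have "Measurable.pred (?N \<Otimes>\<^sub>M ?N) (\<lambda>p. \<forall>F\<in>?Fs. \<exists>h\<in>F. \<not> (act z b \<notin> h \<and> fst p h \<and> snd p h))"
  proof (intro measurable_pred_countable(1)[OF c] pred_intros_finite(4))
    fix F h assume F: "F \<in> ?Fs" and h: "h \<in> F"
    then have "h \<in> H" by blast
    note [measurable] = measurable_compose[OF measurable_fst boundary_coordinate[OF this]]
      measurable_compose[OF measurable_snd boundary_coordinate[OF this]]
    show "Measurable.pred (?N \<Otimes>\<^sub>M ?N) (\<lambda>p. \<not> (act z b \<notin> h \<and> fst p h \<and> snd p h))" by measurable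
  qed auto
  then show ?thesis by (simp only: eq)
qed

definition away :: "('x set \<Rightarrow> bool) \<Rightarrow> ('x set \<Rightarrow> bool) \<Rightarrow> 'g \<Rightarrow> 'x set set" where
  "away y y' g = {h \<in> H. y h \<and> \<not> y' h \<and> b \<notin> h \<and> act g b \<in> h}"

text \<open>A half-space between the two orbit points that does not distinguish \<open>y\<close>
  from \<open>y'\<close> is counted, up to complement, by \<open>common\<close> for one of them. One
  that does distinguish them would, up to complement, lie in only one of two \<open>away\<close>
  sets assumed equal.\<close>

lemma away_determines:
  assumes y: "y \<in> X" "y' \<in> X" and g: "g \<in> strip t y y'" "g' \<in> strip t y y'"
    and eq: "away y y' g = away y y' g'" "away y' y g = away y' y g'"
  shows "d (act g b) (act g' b) \<le> 2 * t"
proof -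
  note c = boundaryD(2)[OF y(1)] boundaryD(2)[OF y(2)]
  have "sep (act g b) (act g' b) \<subseteq> common y y' g' \<union> uminus ` common y y' g"
  proof
    fix h assume "h \<in> sep (act g b) (act g' b)"
    then have h: "h \<in> H" "act g b \<in> h" "act g' b \<notin> h" by (auto simp: sep_def)
    consider "y h" "y' h" | "\<not> y h" "\<not> y' h" | "y h" "\<not> y' h" | "\<not> y h" "y' h" by blast
    then show "h \<in> common y y' g' \<union> uminus ` common y y' g"
    proof cases
      case 1
      then show ?thesis using h by (simp add: common_def)
    next
      case 2
      then have "- h \<in> common y y' g" using h c H_compl by (simp add: common_def)
      then have "- (- h) \<in> uminus ` common y y' g" by (rule imageI)
      then show ?thesis by simp
    next
      case 3
      show ?thesis
      proof (cases "b \<in> h")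
        case True
        then have "- h \<in> away y' y g'" using 3 h c H_compl by (simp add: away_def)
        then have "- h \<in> away y' y g" using eq by simp
        then show ?thesis using h by (simp add: away_def)
      next
        case False
        then have "h \<in> away y y' g" using 3 h by (simp add: away_def)
        then have "h \<in> away y y' g'" using eq by simp
        then show ?thesis using h by (simp add: away_def)
      qed
    next
      case 4
      show ?thesis
      proof (cases "b \<in> h")
        case True
        then have "- h \<in> away y y' g'" using 4 h c H_compl by (simp add: away_def)
        then have "- h \<in> away y y' g" using eq by simp
        then show ?thesis using h by (simp add: away_def)
      next
        case False
        then have "h \<in> away y' y g" using 4 h by (simp add: away_def)
        then have "h \<in> away y' y g'" using eq by simp
        then show ?thesis using h by (simp add: away_def)
      qed
    qed
  qed
  moreover have f: "finite (common y y' g)" "card (common y y' g) \<le> t" "finite (common y y' g')" "card (common y y' g') \<le> t"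
    using g by (simp_all add: strip_def)
  ultimately have "card (sep (act g b) (act g' b)) \<le> card (common y y' g' \<union> uminus ` common y y' g)"
    by (intro card_mono) auto
  also have "\<dots> \<le> card (common y y' g') + card (uminus ` common y y' g)" by (rule card_Un_le)
  also have "\<dots> \<le> t + t" using f card_image_le[OF f(1), of uminus] by (intro add_mono) auto
  finally show ?thesis by (simp add: card_sep)
qed

text \<open>A finite up-set of a poset of width \<open>D\<close> is determined by its minimal elements; if it has at
  most \<open>L\<close> elements, these lie on the first \<open>L\<close> levels.\<close>

lemma away_count:
  assumes y: "y \<in> X"
  shows "finite {away y y' g |g. len g \<le> L} \<and> card {away y y' g |g. len g \<le> L} \<le> (D * L + 1) ^ D"
proof -
  define U where "U = {h \<in> H. y h \<and> \<not> y' h \<and> b \<notin> h}"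
  have U: "sided b U" unfolding sided_def U_def using boundaryD(3)[OF y] by auto
  define ab where "ab h = {k \<in> U. h \<subseteq> k}" for h
  have ab_fin: "finite (ab h)" if "h \<in> U" for h
    by (rule finite_subset[OF _ finite_above[of h b]]) (use that in \<open>auto simp: ab_def U_def\<close>)
  define Q where "Q = {h \<in> U. card (ab h) \<le> L}"
  have lev: "finite {h \<in> U. card (ab h) = r} \<and> card {h \<in> U. card (ab h) = r} \<le> D" for r
  proof (rule antichain_card)
    show "sided b {h \<in> U. card (ab h) = r}" by (rule sided_mono[OF U]) auto
    fix h k assume h: "h \<in> {h \<in> U. card (ab h) = r}" "k \<in> {h \<in> U. card (ab h) = r}" "h \<subseteq> k"
    then have "ab k \<subseteq> ab h" by (auto simp: ab_def)
    then have "ab k = ab h" using h by (intro card_subset_eq ab_fin) auto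
    then have "h \<in> ab k" using h by (simp add: ab_def)
    then show "h = k" using h(3) by (auto simp: ab_def)
  qed
  have Q: "finite Q \<and> card Q \<le> card {1..L} * D"
  proof (rule card_fibers[where f = "\<lambda>h. card (ab h)"])
    fix h assume h: "h \<in> Q"
    then have "h \<in> ab h" by (simp add: ab_def Q_def)
    then have "0 < card (ab h)" using h ab_fin[of h] by (auto simp: Q_def card_gt_0_iff)
    then show "card (ab h) \<in> {1..L}" using h by (simp add: Q_def)
  next
    fix r assume "r \<in> {1..L}"
    have "{a \<in> Q. card (ab a) = r} \<subseteq> {h \<in> U. card (ab h) = r}" by (auto simp: Q_def)
    then show "finite {a \<in> Q. card (ab a) = r} \<and> card {a \<in> Q. card (ab a) = r} \<le> D"
      using lev[of r] by (meson card_mono finite_subset order_trans)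
  qed simp
  define up where "up M = {h \<in> U. \<exists>k\<in>M. k \<subseteq> h}" for M
  have "{away y y' g |g. len g \<le> L} \<subseteq> up ` {M. M \<subseteq> Q \<and> card M \<le> D}"
  proof
    fix Y assume "Y \<in> {away y y' g |g. len g \<le> L}"
    then obtain g where g: "Y = away y y' g" "len g \<le> L" by blast
    have YU: "Y = {h \<in> U. act g b \<in> h}" using g(1) by (auto simp: away_def U_def)
    have Ys: "Y \<subseteq> sep (act g b) b" using g(1) by (auto simp: away_def sep_def)
    have Yf: "finite Y" by (rule finite_subset[OF Ys finite_sep])
    have Yc: "card Y \<le> L" using card_mono[OF finite_sep Ys] g(2) by (simp add: card_sep len_def)
    define M where "M = {h \<in> Y. \<forall>k\<in>Y. k \<subseteq> h \<longrightarrow> k = h}"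
    have MY: "M \<subseteq> Y" by (auto simp: M_def)
    have "M \<subseteq> Q"
    proof
      fix h assume "h \<in> M"
      then have h: "h \<in> Y" using MY by blast
      have "ab h \<subseteq> Y" using h unfolding YU ab_def by auto
      then have "card (ab h) \<le> L" using card_mono[OF Yf] Yc by (meson order_trans)
      then show "h \<in> Q" using h by (simp add: Q_def YU)
    qed
    moreover have "card M \<le> D"
    proof -
      have "finite M \<and> card M \<le> D"
      proof (rule antichain_card)
        show "sided b M" by (rule sided_mono[OF U]) (use MY YU in auto)
      qed (auto simp: M_def)
      then show ?thesis ..
    qed
    moreover have "Y = up M"
    proof
      show "up M \<subseteq> Y" using MY unfolding YU up_def by auto
      show "Y \<subseteq> up M"
      proof
        fix h assume h: "h \<in> Y"
        have "finite {k \<in> Y. k \<subseteq> h}" "{k \<in> Y. k \<subseteq> h} \<noteq> {}" using Yf h by auto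
        then obtain k where k: "k \<in> {k \<in> Y. k \<subseteq> h}" "\<forall>l\<in>{k \<in> Y. k \<subseteq> h}. l \<subseteq> k \<longrightarrow> k = l"
          using finite_has_minimal[of "{k \<in> Y. k \<subseteq> h}"] by blast
        then have "k \<in> M" by (auto simp: M_def)
        then show "h \<in> up M" using k h by (auto simp: up_def YU)
      qed
    qed
    ultimately show "Y \<in> up ` {M. M \<subseteq> Q \<and> card M \<le> D}" by blast
  qed note sub = this
  note C = card_small_subsets[OF conjunct1[OF Q], of D]
  have "card {away y y' g |g. len g \<le> L} \<le> card (up ` {M. M \<subseteq> Q \<and> card M \<le> D})"
    using C by (intro card_mono[OF _ sub]) simp
  also have "\<dots> \<le> card {M. M \<subseteq> Q \<and> card M \<le> D}" using C by (intro card_image_le) simp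
  also have "\<dots> \<le> (card Q + 1) ^ D" using C by simp
  also have "\<dots> \<le> (D * L + 1) ^ D" using Q by (intro power_mono) (auto simp: mult.commute)
  finally show ?thesis using finite_subset[OF sub] C by simp
qed

text \<open>The pair of \<open>away\<close> sets takes polynomially many values by
  \<open>away_count\<close>. Elements with the same pair have orbit points within
  \<open>2 * t\<close> of each other, so they lie in one translate of \<open>P\<close>, which is
  finite by properness.\<close>

lemma strip_growth: "\<exists>C k. \<forall>L. \<forall>y\<in>X. \<forall>y'\<in>X.
    finite {z \<in> strip t y y'. len z \<le> L} \<and> card {z \<in> strip t y y'. len z \<le> L} \<le> C * (L + 1) ^ k"
proof -
  define P where "P = {g. d (act g b) b \<le> 2 * t}"
  have "finite {g. real (d (act g b) b) \<le> real (2 * t)}" using proper unfolding proper_action_def by blast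
  then have P: "finite P" unfolding P_def of_nat_le_iff .
  show ?thesis
  proof (intro exI allI ballI)
    fix L y y' assume y: "y \<in> X" "y' \<in> X"
    let ?A = "{z \<in> strip t y y'. len z \<le> L}"
    let ?B = "{away y y' g |g. len g \<le> L} \<times> {away y' y g |g. len g \<le> L}"
    note c = away_count[OF y(1), of y' L] away_count[OF y(2), of y L]
    have "finite ?A \<and> card ?A \<le> card ?B * card P"
    proof (rule card_fibers[where f = "\<lambda>g. (away y y' g, away y' y g)"])
      show "finite ?B" using c by (intro finite_cartesian_product) simp_all
      show "(away y y' g, away y' y g) \<in> ?B" if "g \<in> ?A" for g using that by blast
      fix p assume "p \<in> ?B"
      let ?F = "{g \<in> ?A. (away y y' g, away y' y g) = p}"
      show "finite ?F \<and> card ?F \<le> card P"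
      proof (cases "?F = {}")
        case True
        then show ?thesis by (simp only: finite.emptyI card.empty) simp
      next
        case False
        then obtain g0 where g0: "g0 \<in> ?F" by blast
        have "?F \<subseteq> (+) g0 ` P"
        proof
          fix g assume g: "g \<in> ?F"
          have "d (act g b) (act g0 b) \<le> 2 * t" by (rule away_determines[OF y]) (use g g0 in auto)
          then have "d (act (- g0) (act g b)) (act (- g0) (act g0 b)) \<le> 2 * t" by (simp only: act_d)
          then have "- g0 + g \<in> P" by (simp add: P_def act_add)
          then show "g \<in> (+) g0 ` P" by (rule rev_image_eqI) (simp add: add.assoc[symmetric])
        qed
        then show ?thesis using P by (meson card_image_le card_mono finite_imageI finite_subset order_trans)
      qed
    qed
    moreover have "card ?B \<le> (D * L + 1) ^ D * (D * L + 1) ^ D"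
      unfolding card_cartesian_product using c by (intro mult_mono) auto
    moreover have "(D * L + 1) ^ D * (D * L + 1) ^ D = (D * L + 1) ^ (2 * D)"
      by (simp add: power_add[symmetric] mult_2)
    moreover have "(D * L + 1) ^ (2 * D) \<le> ((D + 1) * (L + 1)) ^ (2 * D)" by (intro power_mono) auto
    moreover have "((D + 1) * (L + 1)) ^ (2 * D) = (D + 1) ^ (2 * D) * (L + 1) ^ (2 * D)" by (rule power_mult_distrib)
    ultimately have "finite ?A" "card ?A \<le> ((D + 1) ^ (2 * D) * (L + 1) ^ (2 * D)) * card P"
      by (auto intro: order_trans mult_right_mono)
    then show "finite ?A \<and> card ?A \<le> (card P * (D + 1) ^ (2 * D)) * (L + 1) ^ (2 * D)"
      by (simp add: mult_ac)
  qed
qed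

end

section \<open>Common half-spaces of two limit points\<close>

context cc_bnd begin

text \<open>An infinite common set contains half-spaces of weight below \<open>1 / (n + 1)\<close>,
  because the heavy ones are finite in number. The limit point then lies in one of the at most
  \<open>D\<close> maximal half-spaces of this kind, an event of probability at most
  \<open>D / (n + 1)\<close>.\<close>

lemma few_common:
  assumes y: "y \<in> roller_boundary E"
  shows "AE \<omega> in \<Omega>. finite {h \<in> H. b \<notin> h \<and> y h \<and> bnd (walk \<omega>) h}"
proof -
  define U where "U = {h \<in> H. b \<notin> h \<and> y h}"
  have U: "sided b U" unfolding sided_def U_def using boundaryD(3)[OF y] by auto
  define Ue where "Ue n = {h \<in> U. st h < inverse (real (Suc n))}" for n
  have Ue: "sided b (Ue n)" for n by (rule sided_mono[OF U]) (auto simp: Ue_def)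
  define B where "B n = (\<Union>h\<in>maxels (Ue n). {\<omega> \<in> space \<Omega>. bnd (walk \<omega>) h})" for n
  have ev: "{\<omega> \<in> space \<Omega>. bnd (walk \<omega>) h} \<in> sets \<Omega>" if "h \<in> H" for h
    using measurable_compose[OF meas_walk measurable_compose[OF meas_bnd boundary_coordinate[OF that]]] by (simp add: pred_def)
  have mx: "h \<in> H" "st h < inverse (real (Suc n))" if "h \<in> maxels (Ue n)" for h n
    using that by (auto simp: maxels_def Ue_def U_def)
  have B: "B n \<in> sets \<Omega>" for n
    unfolding B_def using maxels_card[OF Ue] mx(1) ev by (intro sets.finite_UN) auto
  have mB: "measure \<Omega> (B n) \<le> real D * inverse (real (Suc n))" for n
  proof -
    have "measure \<Omega> (B n) \<le> (\<Sum>h\<in>maxels (Ue n). measure \<Omega> {\<omega> \<in> space \<Omega>. bnd (walk \<omega>) h})"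
      unfolding B_def using maxels_card[OF Ue] mx(1) ev by (intro seq.P.finite_measure_subadditive_finite) auto
    also have "\<dots> \<le> (\<Sum>h\<in>maxels (Ue n). inverse (real (Suc n)))"
      by (intro sum_mono) (simp only: bnd_law mx(1) less_imp_le[OF mx(2)])
    also have "\<dots> \<le> real D * inverse (real (Suc n))" using maxels_card[OF Ue, of n] by (simp only: sum_constant) (intro mult_right_mono, auto)
    finally show ?thesis .
  qed
  have sub: "{\<omega> \<in> space \<Omega>. \<not> finite {h \<in> H. b \<notin> h \<and> y h \<and> bnd (walk \<omega>) h}} \<subseteq> (\<Inter>n. B n)"
  proof (intro subsetI INT_I)
    fix \<omega> n assume w: "\<omega> \<in> {\<omega> \<in> space \<Omega>. \<not> finite {h \<in> H. b \<notin> h \<and> y h \<and> bnd (walk \<omega>) h}}"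
    let ?I = "{h \<in> H. b \<notin> h \<and> y h \<and> bnd (walk \<omega>) h}"
    have "finite {k \<in> H. b \<notin> k \<and> inverse (real (Suc n)) \<le> st k}" by (rule finite_heavy) simp
    then have "\<not> ?I \<subseteq> {k \<in> H. b \<notin> k \<and> inverse (real (Suc n)) \<le> st k}" using w finite_subset by blast
    then obtain h where h: "h \<in> H" "b \<notin> h" "y h" "bnd (walk \<omega>) h" "\<not> inverse (real (Suc n)) \<le> st h" by blast
    then have "h \<in> Ue n" by (simp add: Ue_def U_def)
    then obtain k where k: "k \<in> maxels (Ue n)" "h \<subseteq> k" by (rule below_maxel[OF Ue])
    have "\<not> bnd (walk \<omega>) (- k)" using boundaryD(3)[OF bnd_in[of "walk \<omega>"], of h "- k"] h k mx(1)[OF k(1)] H_compl by blast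
    then have "bnd (walk \<omega>) k" using boundaryD(2)[OF bnd_in mx(1)[OF k(1)]] by blast
    then show "\<omega> \<in> B n" using k(1) w by (auto simp: B_def)
  qed
  have "measure \<Omega> (\<Inter>n. B n) \<le> real D * inverse (real (Suc n))" for n
    using seq.P.finite_measure_mono[of "\<Inter>n. B n" "B n"] B mB[of n] by (intro order_trans[OF _ mB[of n]]) auto
  moreover have "(\<lambda>n. real D * inverse (real (Suc n))) \<longlonglongrightarrow> real D * 0"
    by (intro tendsto_mult tendsto_const LIMSEQ_inverse_real_of_nat)
  ultimately have "measure \<Omega> (\<Inter>n. B n) \<le> real D * 0" by (intro LIMSEQ_le_const) auto
  then have "measure \<Omega> (\<Inter>n. B n) = 0" by (simp only: mult_zero_right measure_le_0_iff)
  then show ?thesis using B by (intro AE_I[OF sub]) (auto simp: seq.P.emeasure_eq_measure)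
qed

end

section \<open>Identification of the Poisson boundary\<close>

lemma generating_reflect:
  fixes \<mu> :: "'g::group_add pmf"
  assumes "generating \<mu>"
  shows "generating (reflect_pmf \<mu>)"
  unfolding generating_def
proof
  fix g :: 'g
  obtain xs where xs: "xs \<noteq> []" "set xs \<subseteq> set_pmf \<mu>" "- g = sum_list xs"
    using assms unfolding generating_def by blast
  have "sum_list (map uminus (rev ys)) = - sum_list ys" for ys :: "'g list"
    by (induction ys) (simp_all only: rev.simps map_append sum_list_append list.map sum_list.Nil sum_list.Cons minus_add minus_zero add_0_right)
  then have "g = sum_list (map uminus (rev xs))" using xs(3) by (metis minus_minus)
  then show "\<exists>xs. xs \<noteq> [] \<and> set xs \<subseteq> set_pmf (reflect_pmf \<mu>) \<and> g = sum_list xs"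
    using xs(1,2) by (intro exI[of _ "map uminus (rev xs)"]) (auto simp: reflect_pmf_def)
qed

lemma pmf_reflect: "pmf (reflect_pmf \<mu>) x = pmf \<mu> (- x :: 'g::group_add)"
proof -
  have "pmf (map_pmf uminus \<mu>) (- (- x)) = pmf \<mu> (- x)" by (rule pmf_map_inj') (simp add: inj_def)
  then show ?thesis by (simp add: reflect_pmf_def)
qed

lemma nn_reflect: "(\<integral>\<^sup>+x. f x \<partial>reflect_pmf \<mu>) = (\<integral>\<^sup>+x. f (- x :: 'g::group_add) \<partial>\<mu>)"
  by (simp add: reflect_pmf_def)

text \<open>Turns the unordered sums of the hypotheses into integrals. For the logarithmic moment,
  \<open>A\<close> is the set of elements of nonzero length; outside it
  \<open>ln 0 = 0\<close>.\<close>

lemma summable_nn_finite: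
  fixes f :: "'a \<Rightarrow> real"
  assumes s: "(\<lambda>x. pmf p x * f x) summable_on A" and nn: "\<And>x. 0 \<le> f x" and z: "\<And>x. x \<notin> A \<Longrightarrow> f x = 0"
  shows "(\<integral>\<^sup>+x. ennreal (f x) \<partial>measure_pmf p) < \<top>"
proof -
  let ?g = "\<lambda>x. pmf p x * f x"
  have g0: "0 \<le> ?g x" for x using nn by simp
  have "(\<lambda>x. norm (?g x)) summable_on A" using s g0 by simp
  then have "integrable (count_space A) ?g" by (simp only: abs_summable_equivalent abs_summable_on_def)
  then have fin: "(\<integral>\<^sup>+x. ennreal (norm (?g x)) \<partial>count_space A) < \<infinity>" by (simp add: integrable_iff_bounded)
  have "(\<integral>\<^sup>+x. ennreal (f x) \<partial>measure_pmf p) = (\<integral>\<^sup>+x. ennreal (pmf p x) * ennreal (f x) \<partial>count_space UNIV)"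
    by (rule nn_integral_measure_pmf)
  also have "\<dots> = (\<integral>\<^sup>+x. ennreal (?g x) * indicator A x \<partial>count_space UNIV)"
    by (intro nn_integral_cong) (auto simp: indicator_def z ennreal_mult nn)
  also have "\<dots> = (\<integral>\<^sup>+x. ennreal (?g x) \<partial>count_space A)"
    by (subst nn_integral_count_space_indicator) simp_all
  finally show ?thesis using fin g0 by (simp add: top_unique less_top[symmetric])
qed

context rw_factor begin

text \<open>An invariant event \<open>S\<close> enlarges the factor by the function \<open>g \<mapsto> [- g + Z \<in> S]\<close>, so maximality
  of the given factor among all larger ones recovers \<open>S\<close>.\<close>

lemma poisson_criterion:
  assumes bnd: "bnd \<in> path_space \<rightarrow>\<^sub>M N" and \<beta>: "\<beta> = (\<lambda>\<omega>. bnd (walk \<omega>))"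
    and inv: "AE p in rw_measure \<mu>. bnd (path_shift p) = bnd p"
    and equi: "\<And>g. AE p in rw_measure \<mu>. bnd (\<lambda>n. g + p n) = A g (bnd p)"
    and ent: "(\<integral>\<^sup>+x. ennreal (v x) \<partial>\<mu>) < \<top>"
    and small: "\<And>\<epsilon>. \<epsilon> > 0 \<Longrightarrow> \<exists>n. (\<integral>\<^sup>+\<omega>. ennreal (u (Suc n) \<omega>) \<partial>\<Omega>) \<le> ennreal (\<epsilon> * real (Suc n))"
  shows "poisson_boundary \<mu> A lam"
  unfolding poisson_boundary_def
proof (intro conjI allI bexI[of _ bnd] ballI impI)
  show "prob_space lam" by (rule L.prob_space_axioms)
  show "A g \<in> lam \<rightarrow>\<^sub>M lam" for g by measurable
  have bnd': "bnd \<in> path_space \<rightarrow>\<^sub>M lam" using bnd by (simp cong: measurable_cong_sets)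
  then show "bnd \<in> path_space \<rightarrow>\<^sub>M lam" .
  have "distr (rw_measure \<mu>) lam bnd = distr \<Omega> lam (bnd \<circ> walk)"
    unfolding rw_measure_eq by (rule distr_distr[OF bnd' meas_walk])
  also have "\<dots> = lam" unfolding lam_def by (simp add: \<beta> comp_def cong: distr_cong)
  finally show "distr (rw_measure \<mu>) lam bnd = lam" .
  show "AE p in rw_measure \<mu>. bnd (path_shift p) = bnd p" by (rule inv)
  show "AE p in rw_measure \<mu>. bnd (\<lambda>n. g + p n) = A g (bnd p)" for g by (rule equi)
next
  fix S :: "(nat \<Rightarrow> 'g) set" assume S: "S \<in> sets path_space" "path_shift -` S = S"
  define N' where "N' = N \<Otimes>\<^sub>M PiM UNIV (\<lambda>_::'g. count_space (UNIV :: bool set))"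
  define A' where "A' z p = (A z (fst p), \<lambda>k. snd p (- z + k))" for z and p :: "'b \<times> ('g \<Rightarrow> bool)"
  define \<beta>' where "\<beta>' \<omega> = (\<beta> \<omega>, \<lambda>g. (\<lambda>n. - g + walk \<omega> n) \<in> S)" for \<omega>
  have meas_tr: "(\<lambda>\<omega> n. g + walk \<omega> n) \<in> \<Omega> \<rightarrow>\<^sub>M path_space" for g
    unfolding path_space_def walk_def
    by (rule measurable_abs_UNIV, rule measurable_compose[OF meas_Z]) simp
  have meas_A': "A' z \<in> N' \<rightarrow>\<^sub>M N'" for z
    unfolding A'_def N'_def
  proof (rule measurable_Pair)
    show "(\<lambda>p. A z (fst p)) \<in> N \<Otimes>\<^sub>M PiM UNIV (\<lambda>_. count_space UNIV) \<rightarrow>\<^sub>M N" by measurable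
    show "(\<lambda>p k. snd p (- z + k)) \<in> N \<Otimes>\<^sub>M PiM UNIV (\<lambda>_::'g. count_space (UNIV :: bool set)) \<rightarrow>\<^sub>M PiM UNIV (\<lambda>_. count_space UNIV)"
      by (rule measurable_abs_UNIV, rule measurable_compose[OF measurable_snd], rule measurable_component_singleton) simp
  qed
  have meas_\<beta>': "\<beta>' \<in> \<Omega> \<rightarrow>\<^sub>M N'"
    unfolding \<beta>'_def N'_def
  proof (rule measurable_Pair[OF meas_\<beta>], rule measurable_abs_UNIV)
    fix g
    show "(\<lambda>\<omega>. (\<lambda>n. - g + walk \<omega> n) \<in> S) \<in> \<Omega> \<rightarrow>\<^sub>M count_space UNIV"
      by (rule measurable_compose[OF meas_tr]) (use S(1) in \<open>simp add: pred_def sets.sets_into_space\<close>)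
  qed
  \<comment> \<open>Invariance of \<open>S\<close> under the path shift lets the first increment be
    absorbed into the translating element, which is the equivariance of the second
    coordinate.\<close>
  have shift_S: "(\<lambda>n. - g + walk \<omega> n) \<in> S \<longleftrightarrow> (\<lambda>n. - (- \<omega> 0 + g) + walk (shift \<omega>) n) \<in> S" for g \<omega>
  proof -
    have "(\<lambda>n. - g + walk \<omega> n) \<in> S \<longleftrightarrow> path_shift (\<lambda>n. - g + walk \<omega> n) \<in> S" using S(2) by blast
    also have "path_shift (\<lambda>n. - g + walk \<omega> n) = (\<lambda>n. - g + path_shift (walk \<omega>) n)" by (simp add: path_shift_def)
    also have "\<dots> = (\<lambda>n. - (- \<omega> 0 + g) + walk (shift \<omega>) n)"
      unfolding path_shift_walk by (simp only: minus_add minus_minus add.assoc)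
    finally show ?thesis .
  qed
  have space_N': "fst p \<in> space N" if "p \<in> space N'" for p using that by (auto simp: N'_def space_pair_measure)
  interpret P: rw_factor_pair \<mu> N A \<beta> N' A' \<beta>' fst
  proof unfold_locales
    show "A' z \<in> N' \<rightarrow>\<^sub>M N'" for z by (rule meas_A')
    show "A' (z + w) y = A' z (A' w y)" if "y \<in> space N'" for z w y
      using A_add[OF space_N'[OF that]] by (simp only: A'_def fst_conv snd_conv minus_add add.assoc)
    show "A' 0 y = y" if "y \<in> space N'" for y using A_0[OF space_N'[OF that]] by (simp add: A'_def)
    show "\<beta>' \<in> \<Omega> \<rightarrow>\<^sub>M N'" by (rule meas_\<beta>')
    show "AE \<omega> in \<Omega>. \<beta>' \<omega> = A' (\<omega> 0) (\<beta>' (shift \<omega>))"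
      using equivar
    proof eventually_elim
      case (elim \<omega>)
      show ?case unfolding \<beta>'_def A'_def by (simp only: fst_conv snd_conv elim[symmetric] shift_S[symmetric])
    qed
    show "fst \<in> N' \<rightarrow>\<^sub>M N" by (simp add: N'_def)
    show "\<beta> \<omega> = fst (\<beta>' \<omega>)" for \<omega> by (simp add: \<beta>'_def)
    show "\<exists>n. (\<integral>\<^sup>+\<omega>. ennreal (u (Suc n) \<omega>) \<partial>\<Omega>) \<le> ennreal (\<epsilon> * real (Suc n))" if "\<epsilon> > 0" for \<epsilon> by (rule small[OF that])
  qed (rule generating ent)+
  \<comment> \<open>Evaluation at the neutral element recovers \<open>S\<close>.\<close>
  define B' where "B' = {p \<in> space N'. snd p 0}"
  have "Measurable.pred N' (\<lambda>p. snd p 0)"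
    unfolding N'_def by (rule measurable_compose[OF measurable_snd]) (rule measurable_component_singleton, simp)
  then have "B' \<in> sets N'" by (simp add: B'_def pred_def)
  from P.factor_maximal[OF this] obtain B where B: "B \<in> sets N"
    and null: "emeasure \<Omega> ((\<beta>' -` B' - \<beta> -` B) \<union> (\<beta> -` B - \<beta>' -` B')) = 0" by blast
  have "\<beta>' \<omega> \<in> B' \<longleftrightarrow> walk \<omega> \<in> S" for \<omega>
  proof -
    have "\<beta>' \<omega> \<in> space N'" using measurable_space[OF meas_\<beta>', of \<omega>] by (simp add: space_PiM)
    then show ?thesis by (simp add: B'_def \<beta>'_def)
  qed
  then have e: "(\<beta>' -` B' - \<beta> -` B) \<union> (\<beta> -` B - \<beta>' -` B') = walk -` ((S - bnd -` B) \<union> (bnd -` B - S)) \<inter> space \<Omega>"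
    unfolding set_eq_iff by (simp add: \<beta> space_PiM)
  have "bnd -` B \<in> sets path_space" using measurable_sets[OF bnd B] by (simp add: path_space_def space_PiM)
  then have "emeasure (rw_measure \<mu>) ((S - bnd -` B) \<union> (bnd -` B - S)) = 0"
    unfolding rw_measure_eq using S(1) null by (subst emeasure_distr[OF meas_walk]) (simp_all only: e sets.Un sets.Diff)
  then show "\<exists>B\<in>sets lam. emeasure (rw_measure \<mu>) ((S - bnd -` B) \<union> (bnd -` B - S)) = 0" using B by auto
qed

end

context cc_bnd begin

lemma boundary_factor: "rw_factor \<mu> (boundary_borel E) (ract E act) (\<lambda>\<omega>. bnd (walk \<omega>))"
proof
  show "generating \<mu>" by (rule gen)
  show "ra z \<in> boundary_borel E \<rightarrow>\<^sub>M boundary_borel E" for z by (rule ra_measurable)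
  show "ra (z + w) y = ra z (ra w y)" for z w y by (rule ra_add)
  show "ra 0 y = y" if "y \<in> space (boundary_borel E)" for y
    using that by (intro ra_0) (simp add: space_boundary boundaryD(1))
  show "(\<lambda>\<omega>. bnd (walk \<omega>)) \<in> \<Omega> \<rightarrow>\<^sub>M boundary_borel E" by (rule measurable_compose[OF meas_walk meas_bnd])
  show "AE \<omega> in \<Omega>. bnd (walk \<omega>) = ra (\<omega> 0) (bnd (walk (shift \<omega>)))" by (rule AE_bnd_equivariant)
qed

text \<open>Equality of boundary points is a measurable event, being equality of countably many
  coordinates, so it can be transported from increments to paths.\<close>

lemma AE_rw_measure_eq:
  assumes f: "f \<in> path_space \<rightarrow>\<^sub>M boundary_borel E" "g \<in> path_space \<rightarrow>\<^sub>M boundary_borel E"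
    and ae: "AE \<omega> in \<Omega>. f (walk \<omega>) = g (walk \<omega>)"
  shows "AE p in rw_measure \<mu>. f p = g p"
proof -
  have "f p \<in> extensional H" "g p \<in> extensional H" for p
    using measurable_space[OF f(1), of p] measurable_space[OF f(2), of p]
    by (auto simp: space_boundary path_space_def space_PiM dest: boundaryD(1))
  then have e: "f p = g p \<longleftrightarrow> (\<forall>h\<in>H. f p h \<longleftrightarrow> g p h)" for p
    using extensionalityI[of "f p" H "g p"] by auto
  have "Measurable.pred path_space (\<lambda>p. \<forall>h\<in>H. f p h \<longleftrightarrow> g p h)"
    by (intro measurable_pred_countable(1)[OF countable_H] pred_intros_logic
        measurable_compose[OF f(1) boundary_coordinate] measurable_compose[OF f(2) boundary_coordinate])
  then have "{p \<in> space path_space. f p = g p} \<in> sets path_space" by (simp only: pred_def e)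
  then show ?thesis unfolding rw_measure_eq using ae by (subst AE_distr_iff[OF meas_walk])
qed

lemma meas_path_shift: "path_shift \<in> path_space \<rightarrow>\<^sub>M (path_space :: (nat \<Rightarrow> 'b) measure)"
  unfolding path_space_def path_shift_def by (rule measurable_abs_UNIV) (rule measurable_component_singleton, simp)

lemma meas_path_translate: "(\<lambda>p n. g + p n) \<in> path_space \<rightarrow>\<^sub>M (path_space :: (nat \<Rightarrow> 'b) measure)"
proof -
  have "(\<lambda>p n. g + p n) \<in> path_space \<rightarrow>\<^sub>M PiM UNIV (\<lambda>_. count_space (UNIV :: 'b set))"
    by (rule measurable_abs_UNIV, rule measurable_compose[OF meas_path]) simp
  then show ?thesis by (simp only: path_space_def)
qed

lemma bnd_invariant: "AE p in rw_measure \<mu>. bnd (path_shift p) = bnd p"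
  by (rule AE_rw_measure_eq[OF measurable_compose[OF meas_path_shift meas_bnd] meas_bnd AE_bnd_shift])

lemma bnd_equivariant: "AE p in rw_measure \<mu>. bnd (\<lambda>n. g + p n) = ra g (bnd p)"
  by (rule AE_rw_measure_eq[OF measurable_compose[OF meas_path_translate meas_bnd] measurable_compose[OF meas_bnd ra_measurable] AE_bnd_translate])

end

context cc_walk begin

lemma cc_bnd_exists: "\<exists>st N. cc_bnd E act \<mu> st N"
proof -
  obtain st where st: "stationary_weight st" using stationary_weight_exists by blast
  interpret cc_state E act \<mu> b st by unfold_locales (rule st)
  obtain N where N: "\<And>h. h \<in> H \<Longrightarrow> \<exists>i. \<forall>j\<ge>i. \<forall>n\<ge>N j. st h - V n h \<le> (1 / 2) ^ j" "mono N"
    by (rule decision_times) (rule that)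
  have "cc_bnd E act \<mu> st N" by unfold_locales (rule N, assumption, rule N)
  then show ?thesis by blast
qed

end

context cc_strip begin

text \<open>The reflected walk has its own stationary weight and decision times; its limit point
  enters only through the strips.\<close>

lemma poisson_boundary_walk:
  fixes \<mu> :: "'g pmf"
  assumes ne: "nonelementary E act" and es: "essential E act" and gen: "generating \<mu>"
    and ent: "(\<integral>\<^sup>+x. ennreal (- ln (pmf \<mu> x)) \<partial>\<mu>) < \<top>"
    and lm: "(\<integral>\<^sup>+x. ennreal (ln (real (len x))) \<partial>\<mu>) < \<top>"
  shows "\<exists>lam. sets lam = sets (boundary_borel E) \<and> poisson_boundary \<mu> (ract E act) lam"
proof -
  have walk: "cc_walk E act \<nu>" if "generating \<nu>" for \<nu> :: "'g pmf"
  proof unfold_locales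
    show "generating \<nu>" by (rule that)
    show "facing h M" if "h \<in> H" for h M using ne es that by (rule facing_translates)
    show "infinite (range (\<lambda>g. act g x))" for x using ne by (simp add: nonelementary_def)
  qed
  obtain st N where F: "cc_bnd E act \<mu> st N" using cc_walk.cc_bnd_exists[OF walk[OF gen]] by (elim exE)
  obtain st' N' where B: "cc_bnd E act (reflect_pmf \<mu>) st' N'"
    using cc_walk.cc_bnd_exists[OF walk[OF generating_reflect[OF gen]]] by (elim exE)
  interpret F: cc_bnd E act \<mu> b st N by (rule F)
  interpret B: cc_bnd E act "reflect_pmf \<mu>" b st' N' by (rule B)
  let ?\<beta> = "\<lambda>\<omega>. F.bnd (F.walk \<omega>)" and ?\<beta>' = "\<lambda>\<omega>. B.bnd (B.walk \<omega>)"
  interpret FF: rw_factor \<mu> "boundary_borel E" "ract E act" ?\<beta> by (rule F.boundary_factor)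
  interpret BF: rw_factor "reflect_pmf \<mu>" "boundary_borel E" "ract E act" ?\<beta>' by (rule B.boundary_factor)
  have ent': "(\<integral>\<^sup>+x. ennreal (F.v x) \<partial>\<mu>) < \<top>" using ent by (simp add: F.v_def)
  interpret S: rw_strip \<mu> "boundary_borel E" "ract E act" ?\<beta> ?\<beta>' strip len
  proof (unfold_locales, goal_cases)
    case 1
    show ?case by (rule ent')
  next
    case 2
    show ?case by (rule lm)
  next
    case 3
    show ?case by (rule len_0)
  next
    case (4 x y)
    show ?case by (rule len_add)
  next
    case (5 r z)
    show ?case by (rule strip_measurable)
  next
    case (6 r h z y y')
    show ?case by (rule strip_equivariant)
  next
    case (7 r y y')
    show ?case by (rule strip_mono)
  next
    case 8
    \<comment> \<open>\<open>few_common\<close> holds for every fixed boundary point, so no backward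
      path has to be excluded; the required width is the number of common half-spaces missing the
      base point.\<close>
    have "AE \<omega> in F.\<Omega>. \<exists>r. 0 \<in> strip r (?\<beta>' \<omega>') (?\<beta> \<omega>)" for \<omega>'
      using F.few_common[OF B.bnd_in, of "B.walk \<omega>'"]
    proof eventually_elim
      case (elim \<omega>)
      then show ?case by (auto simp: strip_def common_def)
    qed
    then show ?case by simp
  next
    case (9 r)
    show ?case unfolding space_boundary by (rule strip_growth)
  qed
  have "poisson_boundary \<mu> (ract E act) FF.lam"
    by (rule FF.poisson_criterion[OF F.meas_bnd refl F.bnd_invariant F.bnd_equivariant ent' S.entropy_small])
  then show ?thesis by (intro exI[of _ FF.lam]) simp
qed

lemma len_minus: "len (- x) = len x"
proof -
  have "d (act (- x) b) b = d (act x (act (- x) b)) (act x b)" by (rule act_d[symmetric])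
  then show ?thesis by (simp add: len_def d_sym[of b])
qed

end

theorem theorem8p3:
  fixes E :: "'x::countable \<Rightarrow> 'x \<Rightarrow> bool"
    and act :: "'g::{group_add,countable} \<Rightarrow> 'x \<Rightarrow> 'x"
    and \<mu> :: "'g pmf"
    and x0 :: 'x
  assumes "median_graph E"
    and "finite_dim E"
    and "cc_action E act"
    and "nonelementary E act"
    and "essential E act"
    and "proper_action E act"
    and "generating \<mu>"
    and "finite_entropy \<mu>"
    and "(\<lambda>g. pmf \<mu> g * ln (real (gdist E (act g x0) x0))) summable_on {g. gdist E (act g x0) x0 \<noteq> 0}"
  shows "\<exists>lam_minus lam_plus.
           sets lam_minus = sets (boundary_borel E) \<and> sets lam_plus = sets (boundary_borel E) \<and>
           poisson_boundary (reflect_pmf \<mu>) (ract E act) lam_minus \<and>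
           poisson_boundary \<mu> (ract E act) lam_plus"
proof -
  interpret cc_strip E act x0 by unfold_locales (rule assms)+
  have len: "0 \<le> ln (real (len x))" for x by (cases "len x = 0") simp_all
  have "(\<lambda>g. pmf \<mu> g * - ln (pmf \<mu> g)) summable_on UNIV" using assms(8) by (simp add: finite_entropy_def)
  then have ent: "(\<integral>\<^sup>+x. ennreal (- ln (pmf \<mu> x)) \<partial>\<mu>) < \<top>"
    by (rule summable_nn_finite) (use rw.v_nonneg[of \<mu>] in \<open>simp_all add: rw.v_def\<close>)
  have lm: "(\<integral>\<^sup>+x. ennreal (ln (real (len x))) \<partial>\<mu>) < \<top>"
    by (rule summable_nn_finite[OF assms(9)[folded len_def] len]) simp
  have "\<exists>lam. sets lam = sets (boundary_borel E) \<and> poisson_boundary \<mu> (ract E act) lam"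
    by (rule poisson_boundary_walk[OF assms(4,5,7) ent lm])
  moreover have "\<exists>lam. sets lam = sets (boundary_borel E) \<and> poisson_boundary (reflect_pmf \<mu>) (ract E act) lam"
  \<comment> \<open>Inversion preserves entropy, and \<open>len\<close> is symmetric, so the
    reflected measure satisfies the same integrability conditions.\<close>
  proof (rule poisson_boundary_walk[OF assms(4,5) generating_reflect[OF assms(7)]])
    show "(\<integral>\<^sup>+x. ennreal (- ln (pmf (reflect_pmf \<mu>) x)) \<partial>reflect_pmf \<mu>) < \<top>"
      using ent by (simp add: nn_reflect pmf_reflect)
    show "(\<integral>\<^sup>+x. ennreal (ln (real (len x))) \<partial>reflect_pmf \<mu>) < \<top>"
      using lm by (simp add: nn_reflect len_minus)
  qed
  ultimately show ?thesis by blast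
qed

end
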